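(* Set $1<p<\infty$, $\sigma>0$, $S_p^{(\sigma)}:=[\mathsf W_p^{(\sigma)}]^p$, and let $\mu,\nu\in\mathcal P(\mathcal X)$ be such that $\mathrm{int}(\mathrm{spt}(\mu*\eta_\sigma))$ is connected. Let $\varphi$ be an OT potential from $\mu*\eta_\sigma$ to $\nu*\eta_\sigma$ for $\mathsf W_p$, which is unique on $\mathrm{int}(\mathrm{spt}(\mu*\eta_\sigma))$ up to additive constants. (i) We have $$\sqrt n\big(S_p^{(\sigma)}(\hat\mu_n,\nu)-S_p^{(\sigma)}(\mu,\nu)\big)\stackrel{d}{\to}N(0,v_p^2),$$ where $v_p^2:=\mathrm{Var}_\mu(\varphi*\chi_\sigma)$. The asymptotic variance $v_p^2$ coincides with the semiparametric efficiency bound for estimating $S_p^{(\sigma)}(\cdot,\nu)$ at $\mu$. Also, provided that $v_p^2>0$, we have $$\sup_{t\in\mathbb R}\Big|\mathbb P^B\Big(\sqrt n\big(S_p^{(\sigma)}(\hat\mu_n^B,\nu)-S_p^{(\sigma)}(\hat\mu_n,\nu)\big)\le t\Big)-\mathbb P(N(0,v_p^2)\le t)\Big|\stackrel{\mathbb P}{\to}0.$$ (ii) If in addition $\nu*\eta_\sigma$ has connected support, then $$\sqrt n\big(S_p^{(\sigma)}(\hat\mu_n,\hat\nu_n)-S_p^{(\sigma)}(\mu,\nu)\big)\stackrel{d}{\to}N(0,v_p^2+w_p^2),$$ where $v_p^2$ is as in (i) and $w_p^2:=\mathrm{Var}_\nu(\varphi^c*\chi_\sigma)$. The asymptotic variance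 $v_p^2+w_p^2$ coincides with the semiparametric efficiency bound for estimating $S_p^{(\sigma)}$ at $(\mu,\nu)$. Also, provided that $v_p^2+w_p^2>0$, we have $$\sup_{t\in\mathbb R}\Big|\mathbb P^B\Big(\sqrt n\big(S_p^{(\sigma)}(\hat\mu_n^B,\hat\nu_n^B)-S_p^{(\sigma)}(\hat\mu_n,\hat\nu_n)\big)\le t\Big)-\mathbb P(N(0,v_p^2+w_p^2)\le t)\Big|\stackrel{\mathbb P}{\to}0.$$
   Context: Smoothing kernel: $\chi\in C^\infty(\mathbb R^d)$ is any non-negative, compactly supported function with $\int_{\mathbb R^d}\chi(x)\,dx=1$ (so that $\int\|x\|^p\chi(x)\,dx<\infty$ for all $1\le p<\infty$); for $\sigma>0$, $\chi_\sigma=\sigma^{-d}\chi(\cdot/\sigma)$, and $\eta_\sigma$ is the probability measure with Lebesgue density $\chi_\sigma$. It is assumed that $\chi_\sigma$ is identically zero on $\mathbb R^d\setminus B(0,\sigma)$, where $B(0,\sigma)$ is the open ball. $\mathcal X\subset\mathbb R^d$ is a fixed compact set; $\mathcal P(\mathcal X)$ is identified with the Borel probability measures on $\mathbb R^d$ with support in $\mathcal X$. $\mathsf W_p(\mu,\nu)=\inf_{\pi\in\Pi(\mu,\nu)}[\int\|x-y\|^p\,d\pi]^{1/p}$ ($\Pi$ = couplings) and $\mathsf W_p^{(\sigma)}(\mu,\nu)=\mathsf W_p(\mu*\eta_\sigma,\nu*\eta_\sigma)$. $\mathrm{spt}$ is topological support and $\mathrm{int}$ is interior. $\varphi^c(y)=\inf_{x\in\mathbb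 R^d}[\|x-y\|^p-\varphi(x)]$. A function $f:\mathbb R^d\to[-\infty,\infty)$ is $c$-concave if $f=g^c$ for some $g:\mathbb R^d\to[-\infty,\infty)$. An OT potential from $\alpha$ to $\beta$ for $\mathsf W_p$ is a $c$-concave $\varphi\in L^1(\alpha)$ attaining the supremum in $\mathsf W_p^p(\alpha,\beta)=\sup_{\varphi\in L^1(\alpha)}[\int\varphi\,d\alpha+\int\varphi^c\,d\beta]$. $(f*\chi_\sigma)(x)=\int f(y)\chi_\sigma(x-y)\,dy$. $X_1,X_2,\dots\sim\mu$ and $Y_1,Y_2,\dots\sim\nu$ are independent i.i.d. sequences; $\hat\mu_n=n^{-1}\sum_{i=1}^n\delta_{X_i}$, $\hat\nu_n=n^{-1}\sum_{i=1}^n\delta_{Y_i}$. Given the data, $X_1^B,\dots,X_n^B$ are i.i.d. from $\hat\mu_n$, and $\hat\mu_n^B=n^{-1}\sum_{i=1}^n\delta_{X_i^B}$; $\hat\nu_n^B$ is defined analogously (independently, given the data); $\mathbb P^B$ is conditional probability given the data. Semiparametric efficiency bound. Let $T_\mu$ be the set of bounded measurable $h:\mathbb R^d\to\mathbb R$ with $\mu(h)=\int h\,d\mu=0$. For a functional $\kappa$ of $\mu$, if there is a continuous linear functional $\dot\kappa_\mu$ on $L^2(\mu)$ with $t^{-1}\{\kappa((1+th)\mu)-\kappa(\mu)\}\to\dot\kappa_\mu h$ as $t\downarrow0$ for every $h\in T_\mu$, the bound at $\mu$ is $\sup_{h\in T_\mu,h\ne0}(\dot\kappa_\mu h)^2/\|h\|^2_{L^2(\mu)}$.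 In the two-sample case it is relative to the tangent space $\{h_1\oplus h_2:h_1\in T_\mu,h_2\in T_\nu\}$, $(h_1\oplus h_2)(x,y)=h_1(x)+h_2(y)$: with $\dot\kappa$ a continuous linear functional on $L^2(\mu\otimes\nu)$ such that $t^{-1}\{\kappa((1+th_1)\mu,(1+th_2)\nu)-\kappa(\mu,\nu)\}\to\dot\kappa(h_1\oplus h_2)$ as $t\downarrow0$, the bound is $\sup(\dot\kappa(h_1\oplus h_2))^2/\|h_1\oplus h_2\|^2_{L^2(\mu\otimes\nu)}$ over nonzero $h_1\oplus h_2$. Suprema over the empty set are $0$.
   Formalization: In the variances v_p² and w_p², φ∗χ_σ and φ^c∗χ_σ are taken with the reflected kernel, x ↦ ∫φ(y)χ_σ(y−x)dy; this is the stated convolution when χ is even, and for non-even χ the stated formula is false. *)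

theory Defs
  imports "HOL-Probability.Probability"
begin

text \<open>All iterated partial derivatives up to order \<open>k\<close> exist and are continuous (for \<open>k \<ge> 1\<close>
  the total derivative is required as well, which is automatic once the partial derivatives are
  continuous).\<close>

primrec C_k :: "nat \<Rightarrow> ('a::euclidean_space \<Rightarrow> real) \<Rightarrow> bool" where
  "C_k 0 f \<longleftrightarrow> continuous_on UNIV f"
| "C_k (Suc k) f \<longleftrightarrow> f differentiable_on UNIV \<and>
     (\<forall>b\<in>Basis. C_k k (\<lambda>x. frechet_derivative f (at x) b))"

definition C_infinity :: "('a::euclidean_space \<Rightarrow> real) \<Rightarrow> bool" where
  "C_infinity f \<longleftrightarrow> (\<forall>k. C_k k f)"

definition smoothing_kernel :: "('a::euclidean_space \<Rightarrow> real) \<Rightarrow> bool" where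
  "smoothing_kernel K \<longleftrightarrow>
     C_infinity K \<and> (\<forall>x. 0 \<le> K x) \<and> compact (closure {x. K x \<noteq> 0}) \<and>
     (LINT x|lborel. K x) = 1"

definition scaled_kernel :: "('a::euclidean_space \<Rightarrow> real) \<Rightarrow> real \<Rightarrow> 'a \<Rightarrow> real" where
  "scaled_kernel K \<sigma> x = K (x /\<^sub>R \<sigma>) / \<sigma> ^ DIM('a)"

definition kernel_measure :: "('a::euclidean_space \<Rightarrow> real) \<Rightarrow> real \<Rightarrow> 'a measure" where
  "kernel_measure K \<sigma> = density lborel (\<lambda>x. ennreal (scaled_kernel K \<sigma> x))"

definition fun_convolution ::
    "('a::euclidean_space \<Rightarrow> real) \<Rightarrow> ('a \<Rightarrow> real) \<Rightarrow> 'a \<Rightarrow> real" where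
  "fun_convolution f k x = (LINT y|lborel. f y * k (x - y))"

definition reflect :: "('a::uminus \<Rightarrow> real) \<Rightarrow> 'a \<Rightarrow> real" where
  "reflect k x = k (- x)"

lemma reflect_even: "(\<And>x. k (- x) = k x) \<Longrightarrow> reflect k = k"
  by (simp add: reflect_def fun_eq_iff)

definition msupport :: "'a::topological_space measure \<Rightarrow> 'a set" where
  "msupport M = {x. \<forall>U. open U \<longrightarrow> x \<in> U \<longrightarrow> 0 < emeasure M U}"

definition prob_measures_on :: "'a::topological_space set \<Rightarrow> 'a measure set" where
  "prob_measures_on \<X> = {M. prob_space M \<and> sets M = sets borel \<and> msupport M \<subseteq> \<X>}"

definition couplings ::
    "'a::topological_space measure \<Rightarrow> 'a measure \<Rightarrow> ('a \<times> 'a) measure set" where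
  "couplings M N = {P. sets P = sets (borel \<Otimes>\<^sub>M borel) \<and> distr P borel fst = M \<and> distr P borel snd = N}"

text \<open>Only used for exponents \<open>a > 0\<close>.\<close>

definition ennreal_powr :: "ennreal \<Rightarrow> real \<Rightarrow> ennreal" where
  "ennreal_powr x a = (if x = \<top> then \<top> else ennreal (enn2real x powr a))"

definition wasserstein ::
    "real \<Rightarrow> 'a::euclidean_space measure \<Rightarrow> 'a measure \<Rightarrow> ennreal" where
  "wasserstein p M N =
     (INF P\<in>couplings M N. ennreal_powr (\<integral>\<^sup>+ (x, y). ennreal (norm (x - y) powr p) \<partial>P) (1 / p))"

definition smooth_wasserstein ::
    "(real^'d \<Rightarrow> real) \<Rightarrow> real \<Rightarrow> real \<Rightarrow> (real^'d) measure \<Rightarrow> (real^'d) measure \<Rightarrow> ennreal" where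
  "smooth_wasserstein K \<sigma> p M N =
     wasserstein p (M \<star> kernel_measure K \<sigma>) (N \<star> kernel_measure K \<sigma>)"

text \<open>The distance is finite for the compactly supported probability measures to which this is
  applied, so that passing to the reals loses nothing.\<close>

definition smooth_cost ::
    "(real^'d \<Rightarrow> real) \<Rightarrow> real \<Rightarrow> real \<Rightarrow> (real^'d) measure \<Rightarrow> (real^'d) measure \<Rightarrow> real" where
  "smooth_cost K \<sigma> p M N = enn2real (smooth_wasserstein K \<sigma> p M N) powr p"

text \<open>In \<^typ>\<open>ereal\<close>, \<open>c - (-\<infinity>) = \<infinity>\<close>, so points where \<open>\<phi>\<close> is \<open>-\<infinity>\<close> do not
  contribute to the infimum.\<close>

definition c_transform :: "real \<Rightarrow> ('a::euclidean_space \<Rightarrow> ereal) \<Rightarrow> 'a \<Rightarrow> ereal" where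
  "c_transform p \<phi> y = (INF x. ereal (norm (x - y) powr p) - \<phi> x)"

definition c_concave :: "real \<Rightarrow> ('a::euclidean_space \<Rightarrow> ereal) \<Rightarrow> bool" where
  "c_concave p f \<longleftrightarrow> (\<forall>x. f x \<noteq> \<infinity>) \<and> (\<exists>g. (\<forall>x. g x \<noteq> \<infinity>) \<and> f = c_transform p g)"

text \<open>Integral with values in the extended reals. It is the usual one as soon as the positive or
  the negative part has finite integral. In \<open>dual_value\<close> below, with compactly supported \<open>N\<close> and
  \<open>\<phi> \<in> L1_ereal M\<close>, the integral of the positive part of \<open>c_transform p \<phi>\<close> is finite, so the value
  is never of the form \<open>\<infinity> - \<infinity>\<close>.\<close>

definition ereal_integral :: "'a measure \<Rightarrow> ('a \<Rightarrow> ereal) \<Rightarrow> ereal" where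
  "ereal_integral M f =
     enn2ereal (\<integral>\<^sup>+ x. e2ennreal (f x) \<partial>M) - enn2ereal (\<integral>\<^sup>+ x. e2ennreal (- f x) \<partial>M)"

definition L1_ereal :: "'a measure \<Rightarrow> ('a \<Rightarrow> ereal) set" where
  "L1_ereal M = {f. f \<in> borel_measurable M \<and> (\<forall>x. f x \<noteq> \<infinity>) \<and> (\<integral>\<^sup>+ x. e2ennreal \<bar>f x\<bar> \<partial>M) < \<top>}"

definition dual_value ::
    "real \<Rightarrow> 'a::euclidean_space measure \<Rightarrow> 'a measure \<Rightarrow> ('a \<Rightarrow> ereal) \<Rightarrow> ereal" where
  "dual_value p M N \<phi> = ereal_integral M \<phi> + ereal_integral N (c_transform p \<phi>)"

definition OT_potential ::
    "real \<Rightarrow> 'a::euclidean_space measure \<Rightarrow> 'a measure \<Rightarrow> ('a \<Rightarrow> ereal) \<Rightarrow> bool" where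
  "OT_potential p M N \<phi> \<longleftrightarrow>
     c_concave p \<phi> \<and> \<phi> \<in> L1_ereal M \<and>
     dual_value p M N \<phi> = (SUP \<psi>\<in>L1_ereal M. dual_value p M N \<psi>)"

text \<open>The variance under \<open>M\<close> of the smoothed potential. The smoothed potential has to be the adjoint
  of \<open>M \<mapsto> M \<star> kernel_measure K \<sigma>\<close>, i.e. \<open>x \<mapsto> \<integral> \<phi> y * K\<^sub>\<sigma> (y - x) dy\<close>, whence the reflected kernel.
  For even \<open>K\<close> this is \<open>\<phi> * K\<^sub>\<sigma>\<close> literally (see \<open>reflect_even\<close>). For non-even \<open>K\<close> the unreflected
  convolution evaluates \<open>\<phi>\<close> outside the support of \<open>M \<star> kernel_measure K \<sigma>\<close>, where potentials
  are not unique, and cannot be the asymptotic variance. The value of \<open>real_of_ereal\<close> at \<open>-\<infinity>\<close> is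
  irrelevant, since for \<open>M\<close>-almost every \<open>x\<close> a potential is finite almost everywhere on the set
  where \<open>y \<mapsto> K\<^sub>\<sigma> (y - x)\<close> does not vanish.\<close>

definition smoothed_variance ::
    "('a::euclidean_space \<Rightarrow> real) \<Rightarrow> real \<Rightarrow> 'a measure \<Rightarrow> ('a \<Rightarrow> ereal) \<Rightarrow> real" where
  "smoothed_variance K \<sigma> M \<phi> =
     prob_space.variance M
       (fun_convolution (\<lambda>y. real_of_ereal (\<phi> y)) (reflect (scaled_kernel K \<sigma>)))"

text \<open>The normal law with mean \<open>0\<close> and variance \<open>v\<close>, which is a point mass for \<open>v = 0\<close>.\<close>

definition centered_normal :: "real \<Rightarrow> real measure" where
  "centered_normal v = (if v = 0 then return borel 0 else density lborel (normal_density 0 (sqrt v)))"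

definition converges_in_distribution ::
    "'w measure \<Rightarrow> (nat \<Rightarrow> 'w \<Rightarrow> real) \<Rightarrow> real measure \<Rightarrow> bool" where
  "converges_in_distribution \<Omega> Z L \<longleftrightarrow>
     (\<forall>n. Z n \<in> borel_measurable \<Omega>) \<and> weak_conv_m (\<lambda>n. distr \<Omega> borel (Z n)) L"

definition converges_in_probability ::
    "'w measure \<Rightarrow> (nat \<Rightarrow> 'w \<Rightarrow> real) \<Rightarrow> real \<Rightarrow> bool" where
  "converges_in_probability \<Omega> Z c \<longleftrightarrow>
     (\<forall>n. Z n \<in> borel_measurable \<Omega>) \<and>
     (\<forall>\<epsilon>>0. (\<lambda>n. measure \<Omega> {\<omega> \<in> space \<Omega>. \<bar>Z n \<omega> - c\<bar> > \<epsilon>}) \<longlonglongrightarrow> 0)"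

definition empirical :: "nat \<Rightarrow> (nat \<Rightarrow> 'a::topological_space) \<Rightarrow> 'a measure" where
  "empirical n x = distr (uniform_count_measure {..<n}) borel x"

lemma emeasure_empirical:
  assumes "0 < n" "A \<in> sets borel"
  shows "emeasure (empirical n x) A = ennreal ((\<Sum>i<n. indicator A (x i)) / real n)"
proof -
  have "emeasure (empirical n x) A = emeasure (uniform_count_measure {..<n}) {i\<in>{..<n}. x i \<in> A}"
    using assms unfolding empirical_def
    by (subst emeasure_distr)
      (auto simp: space_uniform_count_measure intro!: arg_cong2[where f=emeasure]
        measurableI[where M="uniform_count_measure {..<n}"] simp: sets_uniform_count_measure)
  also have "\<dots> = ennreal (real (card {i\<in>{..<n}. x i \<in> A}) / real n)"
    using assms by (subst emeasure_uniform_count_measure) auto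
  also have "real (card {i\<in>{..<n}. x i \<in> A}) = (\<Sum>i<n. indicator A (x i))"
    by (simp add: indicator_def sum.If_cases Int_def)
  finally show ?thesis .
qed

text \<open>Conditionally on the data \<open>x\<close>, the bootstrap sample is distributed according to the \<open>n\<close>-fold
  product of the empirical measure. The functions below are the resulting conditional
  distribution functions of the bootstrap statistic at \<open>t\<close>; in the two-sample case the two
  bootstrap samples are conditionally independent.\<close>

definition bootstrap_cdf ::
    "('a::topological_space measure \<Rightarrow> real) \<Rightarrow> nat \<Rightarrow> (nat \<Rightarrow> 'a) \<Rightarrow> real \<Rightarrow> real" where
  "bootstrap_cdf \<kappa> n x t =
     (let P = PiM {..<n} (\<lambda>_. empirical n x)
      in measure P {xB \<in> space P. sqrt (real n) * (\<kappa> (empirical n xB) - \<kappa> (empirical n x)) \<le> t})"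

definition bootstrap_cdf2 ::
    "('a::topological_space measure \<Rightarrow> 'a measure \<Rightarrow> real) \<Rightarrow> nat \<Rightarrow> (nat \<Rightarrow> 'a) \<Rightarrow> (nat \<Rightarrow> 'a) \<Rightarrow> real \<Rightarrow> real" where
  "bootstrap_cdf2 \<kappa> n x y t =
     (let P = PiM {..<n} (\<lambda>_. empirical n x) \<Otimes>\<^sub>M PiM {..<n} (\<lambda>_. empirical n y)
      in measure P {(xB, yB) \<in> space P.
           sqrt (real n) * (\<kappa> (empirical n xB) (empirical n yB) - \<kappa> (empirical n x) (empirical n y)) \<le> t})"

definition L2_functions :: "'a measure \<Rightarrow> ('a \<Rightarrow> real) set" where
  "L2_functions M = {f. f \<in> borel_measurable M \<and> integrable M (\<lambda>x. (f x)\<^sup>2)}"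

definition L2_norm :: "'a measure \<Rightarrow> ('a \<Rightarrow> real) \<Rightarrow> real" where
  "L2_norm M f = sqrt (LINT x|M. (f x)\<^sup>2)"

text \<open>Functionals are defined on functions rather than on classes; boundedness and linearity force
  them to respect equality almost everywhere.\<close>

definition L2_continuous_linear :: "'a measure \<Rightarrow> (('a \<Rightarrow> real) \<Rightarrow> real) \<Rightarrow> bool" where
  "L2_continuous_linear M D \<longleftrightarrow>
     (\<forall>f\<in>L2_functions M. \<forall>g\<in>L2_functions M. D (\<lambda>x. f x + g x) = D f + D g) \<and>
     (\<forall>c. \<forall>f\<in>L2_functions M. D (\<lambda>x. c * f x) = c * D f) \<and>
     (\<exists>C. \<forall>f\<in>L2_functions M. \<bar>D f\<bar> \<le> C * L2_norm M f)"

definition tangent_set :: "'a::topological_space measure \<Rightarrow> ('a \<Rightarrow> real) set" where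
  "tangent_set M = {h. h \<in> borel_measurable borel \<and> bounded (range h) \<and> (LINT x|M. h x) = 0}"

definition tilt :: "'a measure \<Rightarrow> ('a \<Rightarrow> real) \<Rightarrow> real \<Rightarrow> 'a measure" where
  "tilt M h t = density M (\<lambda>x. ennreal (1 + t * h x))"

definition osum :: "('a \<Rightarrow> real) \<Rightarrow> ('b \<Rightarrow> real) \<Rightarrow> 'a \<times> 'b \<Rightarrow> real" (infixl \<open>\<oplus>\<^sub>o\<close> 65) where
  "(h \<oplus>\<^sub>o k) = (\<lambda>(x, y). h x + k y)"

definition sup_quotient :: "'a measure \<Rightarrow> (('a \<Rightarrow> real) \<Rightarrow> real) \<Rightarrow> ('a \<Rightarrow> real) set \<Rightarrow> real" where
  "sup_quotient M D H =
     (let H' = {h \<in> H. L2_norm M h \<noteq> 0}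
      in if H' = {} then 0 else (SUP h\<in>H'. (D h)\<^sup>2 / (L2_norm M h)\<^sup>2))"

definition efficiency_bound ::
    "('a::topological_space measure \<Rightarrow> real) \<Rightarrow> 'a measure \<Rightarrow> real \<Rightarrow> bool" where
  "efficiency_bound \<kappa> M b \<longleftrightarrow>
     (\<exists>D. L2_continuous_linear M D \<and>
          (\<forall>h\<in>tangent_set M. ((\<lambda>t. (\<kappa> (tilt M h t) - \<kappa> M) / t) \<longlongrightarrow> D h) (at_right 0)) \<and>
          b = sup_quotient M D (tangent_set M))"

definition efficiency_bound2 ::
    "('a::topological_space measure \<Rightarrow> 'a measure \<Rightarrow> real) \<Rightarrow> 'a measure \<Rightarrow> 'a measure \<Rightarrow> real \<Rightarrow> bool" where
  "efficiency_bound2 \<kappa> M N b \<longleftrightarrow>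
     (\<exists>D. L2_continuous_linear (M \<Otimes>\<^sub>M N) D \<and>
          (\<forall>h\<in>tangent_set M. \<forall>k\<in>tangent_set N.
             ((\<lambda>t. (\<kappa> (tilt M h t) (tilt N k t) - \<kappa> M N) / t) \<longlongrightarrow> D (h \<oplus>\<^sub>o k)) (at_right 0)) \<and>
          b = sup_quotient (M \<Otimes>\<^sub>M N) D {h \<oplus>\<^sub>o k |h k. h \<in> tangent_set M \<and> k \<in> tangent_set N})"

end

theory Submission
  imports Defs "HOL-Complex_Analysis.Great_Picard" "HOL-Real_Asymp.Real_Asymp"
begin

text \<open>
  The transport cost itself is a very nonsmooth functional of a measure, but after convolution
  with a fixed kernel of bounded support it has an honest first-order expansion along empirical
  measures, and everything else follows from that expansion. Two facts meet. First, the density of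
  \<open>empirical n x \<star> \<eta>\<close> at a point \<open>y\<close> is an average of
  \<open>n\<close> independent bounded terms, so its mean distance to the density of
  \<open>\<mu> \<star> \<eta>\<close> is of order
  \<open>1 / sqrt n\<close>; all densities live in a common ball, hence the
  \<open>L\<^sup>1\<close> distance \<open>tv\<close> of the densities is of that order too
  (\<open>tv_sampling\<close>). Second, the cost is differentiable for this distance: under
  perturbations of a pair of measures that do not enlarge the supports, its increment is the sum
  of the integrals of the two optimal potentials against the perturbations, up to
  \<open>\<epsilon>\<close> times the total variation
  (\<open>transport_cost_differentiable\<close>).

  The differentiability is a compactness argument. The optimal pair is admissible in the perturbed
  dual problem, which bounds the increment of the cost from below. From above, take almost optimal
  pairs of the perturbed problems. They can be chosen equi-Lipschitz and bounded, so a subsequence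
  converges uniformly on the supports, and the limit is an optimal pair of the unperturbed
  problem. If that pair is unique up to an additive constant, the almost optimal pairs are
  uniformly close to the potentials up to constants, and constants integrate to nothing against a
  difference of probability measures; the error is therefore a small factor times the total
  variation.

  Two classical ingredients are proved by elementary routes. Kantorovich duality is obtained by
  entropic regularization (\<open>kantorovich_duality\<close>): the entropic dual has an exact
  maximizer by Arzela--Ascoli, its optimality conditions say that a Gibbs density has the right
  marginals, and replacing the soft transform by the hard one costs as little as desired, because
  balls around points of the support have uniformly positive mass. For uniqueness
  (\<open>dual_optimal_unique\<close>) two optimal pairs are compared on a segment: at each point
  they share a contact point, so their increments are dominated by the increments of the same
  differentiable function, and adding up over a fine partition telescopes
  (\<open>common_subgradient_increment_le\<close>). This makes the difference of two potentials
  locally constant in the interior of the support, which is connected and, for a smoothed measure,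
  dense in the support.

  Integrals of a potential \<open>\<phi>\<close> against \<open>\<rho> \<star> \<eta>\<close> are
  integrals of the smoothed potential \<open>adj \<phi>\<close> against \<open>\<rho>\<close>, so
  the expansion makes the normalized error a normalized sum of bounded independent variables plus
  a vanishing remainder. For the bootstrap the data are frozen and the sampled measures are
  themselves empirical measures, which change with \<open>n\<close>. For this reason the limit
  theorem \<open>statistic_weak_convergence\<close> is a statement on arbitrary triangular arrays
  whose row laws stay within \<open>C / sqrt n\<close> of \<open>(\<mu>, \<nu>)\<close>: the
  expansion is always taken at \<open>(\<mu>, \<nu>)\<close>, once for the resampled and once for
  the sampled measures, and subtracted. With the constant array it is the central limit theorem;
  with the empirical measures as rows, and with Polya's theorem for the uniformity in
  \<open>t\<close>, it is the consistency of the bootstrap. Differentiating along a tilt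
  \<open>(1 + t h) \<mu>\<close> gives the functional
  \<open>h \<mapsto> \<integral> adj \<phi> h d\<mu>\<close>, whose norm on mean zero functions is
  the standard deviation of \<open>adj \<phi>\<close>; that is the efficiency bound. The
  one-sample assertions are the two-sample ones for a functional that ignores its second argument.
\<close>

section \<open>Entropic transport and Kantorovich duality\<close>

text \<open>The entropic counterpart of \<open>x \<mapsto> INF y. k x y - g y\<close>: the infimum
  is replaced by the logarithm of an average of exponentials, with integrals in place of pointwise
  optimization.\<close>

definition soft_transform :: "'b measure \<Rightarrow> ('a \<Rightarrow> 'b \<Rightarrow> real) \<Rightarrow> ('b \<Rightarrow> real) \<Rightarrow> 'a \<Rightarrow> real" where
  "soft_transform M k g x = - ln (LINT y|M. exp (g y - k x y))"

lemma integrable_exp_bounded: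
  fixes g k :: "'b \<Rightarrow> real"
  assumes "prob_space M" and [measurable]: "g \<in> borel_measurable M" "k \<in> borel_measurable M"
    and "\<And>y. \<bar>g y\<bar> \<le> B" "\<And>y. 0 \<le> k y"
  shows "integrable M (\<lambda>y. exp (g y - k y))"
proof -
  interpret prob_space M by fact
  show ?thesis
  proof (rule integrable_const_bound[where B="exp B"])
    show "AE y in M. norm (exp (g y - k y)) \<le> exp B"
    proof (rule AE_I2)
      show "norm (exp (g y - k y)) \<le> exp B" for y using assms(4)[of y] assms(5)[of y] by simp
    qed
  qed measurable
qed

lemma soft_transform_exp_bounds:
  fixes g :: "'b \<Rightarrow> real" and k :: "'a \<Rightarrow> 'b \<Rightarrow> real"
  assumes M: "prob_space M" and [measurable]: "g \<in> borel_measurable M" "k x \<in> borel_measurable M"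
    and g: "\<And>y. \<bar>g y\<bar> \<le> B" and k: "\<And>y. 0 \<le> k x y" "\<And>y. k x y \<le> C"
  shows "exp (- B - C) \<le> (LINT y|M. exp (g y - k x y))"
    and "(LINT y|M. exp (g y - k x y)) \<le> exp B"
    and "0 < (LINT y|M. exp (g y - k x y))"
    and "exp (- soft_transform M k g x) = (LINT y|M. exp (g y - k x y))"
    and "\<bar>soft_transform M k g x\<bar> \<le> B + C"
proof -
  interpret prob_space M by fact
  have int: "integrable M (\<lambda>y. exp (g y - k x y))"
    by (rule integrable_exp_bounded[where B=B]) (use assms in auto)
  have "(LINT y|M. exp (- B - C)) \<le> (LINT y|M. exp (g y - k x y))"
  proof (rule integral_mono[OF _ int])
    show "exp (- B - C) \<le> exp (g y - k x y)" for y
      using g[of y] k(2)[of y] by simp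
  qed simp
  then show 1: "exp (- B - C) \<le> (LINT y|M. exp (g y - k x y))" by (simp add: prob_space)
  have "(LINT y|M. exp (g y - k x y)) \<le> (LINT y|M. exp B)"
  proof (rule integral_mono[OF int])
    show "exp (g y - k x y) \<le> exp B" for y
      using g[of y] k(1)[of y] by simp
  qed simp
  then show 2: "(LINT y|M. exp (g y - k x y)) \<le> exp B" by (simp add: prob_space)
  show 3: "0 < (LINT y|M. exp (g y - k x y))"
    using 1 exp_gt_zero less_le_trans by blast
  then show "exp (- soft_transform M k g x) = (LINT y|M. exp (g y - k x y))"
    by (simp add: soft_transform_def)
  have "- B - C \<le> ln (LINT y|M. exp (g y - k x y))" using 1 3 by (simp add: ln_ge_iff)
  moreover have "ln (LINT y|M. exp (g y - k x y)) \<le> B" using 2 3 by (metis ln_exp ln_le_cancel_iff exp_gt_zero)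
  moreover have "0 \<le> C" using k order_trans by blast
  ultimately show "\<bar>soft_transform M k g x\<bar> \<le> B + C" by (simp add: soft_transform_def)
qed

text \<open>Like the infimum, the soft transform commutes with adding constants and is monotone.
  Whatever Lipschitz or oscillation bound the cost has in \<open>x\<close> is therefore inherited,
  independently of \<open>g\<close>.\<close>

lemma soft_transform_shift:
  fixes g :: "'b \<Rightarrow> real" and k :: "'a \<Rightarrow> 'b \<Rightarrow> real"
  assumes M: "prob_space M" and [measurable]: "g \<in> borel_measurable M" "\<And>x. k x \<in> borel_measurable M"
    and g: "\<And>y. \<bar>g y\<bar> \<le> B" and k: "\<And>x y. 0 \<le> k x y" "\<And>x y. k x y \<le> C"
    and le: "\<And>y. k x y \<le> k x' y + d"
  shows "soft_transform M k g x \<le> soft_transform M k g x' + d"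
proof -
  interpret prob_space M by fact
  have int: "integrable M (\<lambda>y. exp (g y - k x y))" for x
    by (rule integrable_exp_bounded[where B=B]) (use assms in auto)
  have pos: "0 < (LINT y|M. exp (g y - k x y))" for x
    by (rule soft_transform_exp_bounds(3)[where B=B and C=C]) (use assms in auto)
  have "exp (- d) * (LINT y|M. exp (g y - k x' y)) = (LINT y|M. exp (- d) * exp (g y - k x' y))" by simp
  also have "\<dots> \<le> (LINT y|M. exp (g y - k x y))"
  proof (rule integral_mono[OF _ int])
    show "exp (- d) * exp (g y - k x' y) \<le> exp (g y - k x y)" for y
      using le[of y] by (simp add: mult_exp_exp)
  qed (use int in simp)
  finally have "ln (exp (- d) * (LINT y|M. exp (g y - k x' y))) \<le> ln (LINT y|M. exp (g y - k x y))"
    using pos by (subst ln_le_cancel_iff) auto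
  moreover have "ln (exp (- d) * (LINT y|M. exp (g y - k x' y))) = - d + ln (LINT y|M. exp (g y - k x' y))"
    using pos by (subst ln_mult) (auto simp: less_imp_neq[symmetric])
  ultimately show ?thesis by (simp add: soft_transform_def)
qed

lemma soft_transform_lipschitz:
  fixes g :: "'b \<Rightarrow> real" and k :: "'a::metric_space \<Rightarrow> 'b \<Rightarrow> real"
  assumes M: "prob_space M" and [measurable]: "g \<in> borel_measurable M" "\<And>x. k x \<in> borel_measurable M"
    and g: "\<And>y. \<bar>g y\<bar> \<le> B" and k: "\<And>x y. 0 \<le> k x y" "\<And>x y. k x y \<le> C"
    and lip: "\<And>y. L-lipschitz_on UNIV (\<lambda>x. k x y)"
  shows "L-lipschitz_on UNIV (soft_transform M k g)"
proof (rule lipschitz_onI)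
  show "0 \<le> L" using lip lipschitz_on_nonneg by blast
  have "soft_transform M k g x \<le> soft_transform M k g x' + L * dist x x'" for x x'
  proof (rule soft_transform_shift[OF assms(1-3) g k])
    show "k x y \<le> k x' y + L * dist x x'" for y
      using lipschitz_onD[OF lip, of x x' y] by (simp add: dist_real_def)
  qed
  note le = this
  show "dist (soft_transform M k g x) (soft_transform M k g x') \<le> L * dist x x'" for x x'
    using le[of x x'] le[of x' x] unfolding dist_real_def dist_commute[of x' x] by linarith
qed

lemma lipschitz_measurable:
  fixes f :: "'a::euclidean_space \<Rightarrow> real"
  shows "L-lipschitz_on UNIV f \<Longrightarrow> f \<in> borel_measurable borel"
  by (intro borel_measurable_continuous_onI lipschitz_on_continuous_on)

text \<open>Arzela--Ascoli in the form in which it produces limits of potentials.\<close>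

lemma lipschitz_uniform_subsequence:
  fixes F :: "nat \<Rightarrow> 'a::euclidean_space \<Rightarrow> real"
  assumes "compact A" and lip: "\<And>n. L-lipschitz_on UNIV (F n)" and bd: "\<And>n x. \<bar>F n x\<bar> \<le> M"
  obtains g k where "continuous_on A g" "strict_mono (k :: nat \<Rightarrow> nat)"
    "\<And>e. 0 < e \<Longrightarrow> \<exists>N. \<forall>n\<ge>N. \<forall>x\<in>A. \<bar>F (k n) x - g x\<bar> < e"
proof -
  have L_nonneg: "0 \<le> L" using lip lipschitz_on_nonneg by blast
  show ?thesis
  proof (rule Arzela_Ascoli[OF assms(1), of F M])
    show "norm (F n x) \<le> M" for n x using bd by simp
    show "\<exists>d>0. \<forall>n y. y \<in> A \<and> norm (x - y) < d \<longrightarrow> norm (F n x - F n y) < e" if "0 < e" for x e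
    proof (intro exI conjI allI impI)
      show "0 < e / (L + 1)" using that L_nonneg by simp
      fix n y assume y: "y \<in> A \<and> norm (x - y) < e / (L + 1)"
      have "norm (F n x - F n y) \<le> L * norm (x - y)"
        using lipschitz_onD[OF lip, of x y n] by (simp add: dist_norm)
      also have "\<dots> \<le> (L + 1) * norm (x - y)" by (simp add: distrib_right)
      also have "\<dots> < e" using y L_nonneg by (auto simp: field_simps)
      finally show "norm (F n x - F n y) < e" .
    qed
    fix g and k :: "nat \<Rightarrow> nat"
    assume *: "continuous_on A g" "strict_mono k" "\<And>e. 0 < e \<Longrightarrow> \<exists>N. \<forall>n x. n \<ge> N \<and> x \<in> A \<longrightarrow> norm (F (k n) x - g x) < e"
    show thesis
      by (rule that[OF *(1,2)]) (use *(3) in force)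
  qed
qed

text \<open>Bounded Lipschitz costs suffice: on compact sets the power cost agrees with a cost of
  this kind. The sets \<open>A\<close> and \<open>B\<close> carry the two measures but may be
  larger than their supports, so that perturbed measures can be treated within the same
  sets.\<close>

locale transport_problem =
  fixes c :: "'a::euclidean_space \<Rightarrow> 'a \<Rightarrow> real" and C L :: real and \<alpha> \<beta> :: "'a measure" and A B :: "'a set"
  assumes c_nonneg: "\<And>x y. 0 \<le> c x y" and c_le: "\<And>x y. c x y \<le> C"
    and c_lip1: "\<And>y. L-lipschitz_on UNIV (\<lambda>x. c x y)"
    and c_lip2: "\<And>x. L-lipschitz_on UNIV (\<lambda>y. c x y)"
    and prob: "prob_space \<alpha>" "prob_space \<beta>"
    and sets [measurable_cong]: "sets \<alpha> = sets borel" "sets \<beta> = sets borel"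
    and compact: "compact A" "compact B"
    and conc: "AE x in \<alpha>. x \<in> A" "AE y in \<beta>. y \<in> B"
begin

sublocale \<alpha>: prob_space \<alpha> by (fact prob)
sublocale \<beta>: prob_space \<beta> by (fact prob)
sublocale pair_prob_space \<alpha> \<beta> ..

lemma C_nonneg: "0 \<le> C" using c_nonneg c_le order_trans by blast
lemma L_nonneg: "0 \<le> L" using c_lip1 lipschitz_on_nonneg by blast

lemma c_measurable [measurable]: "(\<lambda>z. c (fst z) (snd z)) \<in> borel_measurable (borel \<Otimes>\<^sub>M borel)"
proof -
  have "(2 * L)-lipschitz_on UNIV (\<lambda>z. c (fst z) (snd z))"
  proof (rule lipschitz_onI)
    fix z z' :: "'a \<times> 'a"
    have "\<bar>c (fst z) (snd z) - c (fst z') (snd z)\<bar> \<le> L * dist (fst z) (fst z')"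
      using lipschitz_onD[OF c_lip1, of "fst z" "fst z'"] by (simp add: dist_real_def)
    also have "\<dots> \<le> L * dist z z'" by (simp add: L_nonneg mult_left_mono dist_fst_le)
    moreover have "\<bar>c (fst z') (snd z) - c (fst z') (snd z')\<bar> \<le> L * dist (snd z) (snd z')"
      using lipschitz_onD[OF c_lip2, of "snd z" "snd z'"] by (simp add: dist_real_def)
    moreover have "L * dist (snd z) (snd z') \<le> L * dist z z'" by (simp add: L_nonneg mult_left_mono dist_snd_le)
    ultimately show "dist (c (fst z) (snd z)) (c (fst z') (snd z')) \<le> 2 * L * dist z z'"
      by (simp add: dist_real_def)
  qed (use L_nonneg in simp)
  then have "(\<lambda>z. c (fst z) (snd z)) \<in> borel_measurable (borel :: ('a \<times> 'a) measure)"
    by (intro borel_measurable_continuous_onI lipschitz_on_continuous_on)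
  then show ?thesis by (simp add: borel_prod)
qed

lemma c_measurable1 [measurable]: "(\<lambda>x. c x y) \<in> borel_measurable borel"
  using c_lip1 by (rule lipschitz_measurable)
lemma c_measurable2 [measurable]: "c x \<in> borel_measurable borel"
  using c_lip2 by (rule lipschitz_measurable)

definition soft1 where "soft1 = soft_transform \<beta> c"
definition soft2 where "soft2 = soft_transform \<alpha> (\<lambda>y x. c x y)"

context
  fixes f :: "'a \<Rightarrow> real" and b :: real
  assumes f [measurable]: "f \<in> borel_measurable borel" and b: "\<And>x. \<bar>f x\<bar> \<le> b"
begin

lemma soft1_exp: "exp (- soft1 f x) = (LINT y|\<beta>. exp (f y - c x y))"
  unfolding soft1_def by (rule soft_transform_exp_bounds(4)[where B=b and C=C]) (use prob b c_nonneg c_le in auto)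
lemma soft2_exp: "exp (- soft2 f y) = (LINT x|\<alpha>. exp (f x - c x y))"
  unfolding soft2_def by (rule soft_transform_exp_bounds(4)[where B=b and C=C]) (use prob b c_nonneg c_le in auto)
lemma soft1_bound: "\<bar>soft1 f x\<bar> \<le> b + C"
  unfolding soft1_def by (rule soft_transform_exp_bounds(5)[where B=b and C=C]) (use prob b c_nonneg c_le in auto)
lemma soft2_bound: "\<bar>soft2 f x\<bar> \<le> b + C"
  unfolding soft2_def by (rule soft_transform_exp_bounds(5)[where B=b and C=C]) (use prob b c_nonneg c_le in auto)
lemma soft1_lip: "L-lipschitz_on UNIV (soft1 f)"
  unfolding soft1_def by (rule soft_transform_lipschitz[where B=b and C=C]) (use prob b c_nonneg c_le c_lip1 in auto)
lemma soft2_lip: "L-lipschitz_on UNIV (soft2 f)"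
  unfolding soft2_def by (rule soft_transform_lipschitz[where B=b and C=C]) (use prob b c_nonneg c_le c_lip2 in auto)
lemma soft1_osc: "\<bar>soft1 f x - soft1 f x'\<bar> \<le> C"
proof -
  have "soft1 f x \<le> soft1 f x' + C" for x x'
    unfolding soft1_def
    by (rule soft_transform_shift[where B=b and C=C])
       (use prob b c_nonneg c_le in \<open>auto simp: add_increasing\<close>)
  from this[of x x'] this[of x' x] show ?thesis by simp
qed
lemma soft2_add: "soft2 (\<lambda>x. f x + t) y = soft2 f y - t"
proof -
  have "exp (- soft2 f y) > 0" by simp
  then have "0 < (LINT x|\<alpha>. exp (f x - c x y))" by (simp only: soft2_exp)
  moreover have "(LINT x|\<alpha>. exp (f x + t - c x y)) = exp t * (LINT x|\<alpha>. exp (f x - c x y))"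
    by (subst integral_mult_right_zero[symmetric]) (simp add: mult_exp_exp algebra_simps)
  ultimately show ?thesis unfolding soft2_def soft_transform_def
    by (simp add: ln_mult less_imp_neq[symmetric])
qed
lemma bounded_integrable1: "integrable \<alpha> f"
  by (rule \<alpha>.integrable_const_bound[where B=b]) (use b in auto)
lemma bounded_integrable2: "integrable \<beta> f"
  by (rule \<beta>.integrable_const_bound[where B=b]) (use b in auto)

end

lemma soft_coupling_integrable:
  assumes [measurable]: "f \<in> borel_measurable borel" "g \<in> borel_measurable borel"
    and b: "\<And>x. \<bar>f x\<bar> \<le> b" "\<And>x. \<bar>g x\<bar> \<le> b'"
  shows "integrable (\<alpha> \<Otimes>\<^sub>M \<beta>) (\<lambda>(x, y). exp (f x + g y - c x y))"
proof (rule P.integrable_const_bound[where B="exp (b + b')"])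
  show "AE z in \<alpha> \<Otimes>\<^sub>M \<beta>. norm (case z of (x, y) \<Rightarrow> exp (f x + g y - c x y)) \<le> exp (b + b')"
  proof (intro AE_I2, clarify)
    fix x y
    show "norm (exp (f x + g y - c x y)) \<le> exp (b + b')"
      using b(1)[of x] b(2)[of y] c_nonneg[of x y] by simp
  qed
qed (simp add: split_beta' cong: measurable_cong_sets[OF sets_pair_measure_cong[OF sets(1) sets(2)] refl])

text \<open>A maximizer of the entropic dual
  \<open>\<integral> f d\<alpha> + \<integral> soft2 f d\<beta>\<close> exists by compactness,
  since composing the two transforms turns any function into a Lipschitz function with oscillation
  at most \<open>C\<close> without decreasing the functional. At a maximum the two transforms must
  reproduce each other; this fixed point property is exactly the pair of marginal equations in the
  conclusion.\<close>

lemma entropic_potentials_exist: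
  obtains f g b where "L-lipschitz_on UNIV f" "L-lipschitz_on UNIV g"
    "\<And>x. \<bar>f x\<bar> \<le> b" "\<And>x. \<bar>g x\<bar> \<le> b"
    "\<And>x. exp (- f x) = (LINT y|\<beta>. exp (g y - c x y))"
    "\<And>y. exp (- g y) = (LINT x|\<alpha>. exp (f x - c x y))"
proof -
  define G where "G f = (LINT x|\<alpha>. f x) + (LINT y|\<beta>. soft2 f y)" for f
  \<comment> \<open>The functional does not change when a constant is added to \<open>f\<close>,
    hence the normalization.\<close>
  define \<K> where "\<K> = {f::'a \<Rightarrow> real. L-lipschitz_on UNIV f \<and> (\<forall>x. \<bar>f x\<bar> \<le> C)}"
  have meas: "f \<in> borel_measurable borel" and bd: "\<bar>f x\<bar> \<le> C" if "f \<in> \<K>" for f x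
    using that lipschitz_measurable by (auto simp: \<K>_def)
  have zero: "(\<lambda>_. 0) \<in> \<K>" using L_nonneg C_nonneg by (auto simp: \<K>_def intro!: lipschitz_onI)
  have G_le: "G f \<le> 3 * C" if f: "f \<in> \<K>" for f
  proof -
    note m = meas[OF f] and b = bd[OF f]
    note s2 = soft2_bound[OF m b] lipschitz_measurable[OF soft2_lip[OF m b]]
    have "(LINT x|\<alpha>. f x) \<le> C" using bounded_integrable1[OF m b] b
      by (intro \<alpha>.integral_le_const) (auto intro!: AE_I2 simp: abs_le_iff)
    moreover have "(LINT x|\<beta>. soft2 f x) \<le> C + C" using bounded_integrable2[OF s2(2,1)] s2(1)
      by (intro \<beta>.integral_le_const) (auto intro!: AE_I2 simp: abs_le_iff)
    ultimately show ?thesis by (simp add: G_def)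
  qed
  define s where "s = (SUP f\<in>\<K>. G f)"
  have bdd: "bdd_above (G ` \<K>)" using G_le by (auto intro!: bdd_aboveI)
  have "\<exists>f\<in>\<K>. s - 1 / real (Suc n) < G f" for n
    using less_cSUP_iff[OF _ bdd, of "s - 1 / real (Suc n)"] zero unfolding s_def by auto
  then obtain F where F: "\<And>n. F n \<in> \<K>" "\<And>n. s - 1 / real (Suc n) < G (F n)" by metis
  obtain g0 k where g0: "continuous_on A g0" and k: "strict_mono (k :: nat \<Rightarrow> nat)"
    and lim: "\<And>e. 0 < e \<Longrightarrow> \<exists>N. \<forall>n\<ge>N. \<forall>x\<in>A. \<bar>F (k n) x - g0 x\<bar> < e"
    by (rule lipschitz_uniform_subsequence[OF compact(1), of L F C]) (use F(1) in \<open>auto simp: \<K>_def\<close>)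
  \<comment> \<open>The uniform limit is only controlled on \<open>A\<close>, which carries
    \<open>\<alpha>\<close>; outside it is set to \<open>0\<close>.\<close>
  define f where "f x = (if x \<in> A then g0 x else 0)" for x
  have ptw: "(\<lambda>n. F (k n) x) \<longlonglongrightarrow> f x" if "x \<in> A" for x
  proof (rule LIMSEQ_I)
    fix r :: real assume "0 < r"
    from lim[OF this] that show "\<exists>no. \<forall>n\<ge>no. norm (F (k n) x - f x) < r" by (auto simp: f_def)
  qed
  have f_bd: "\<bar>f x\<bar> \<le> C" for x
  proof (cases "x \<in> A")
    case True
    have "norm (f x) \<le> C" by (rule Lim_norm_ubound[OF _ ptw[OF True]]) (auto simp: bd[OF F(1)])
    then show ?thesis by simp
  qed (simp add: f_def C_nonneg)
  have f_meas [measurable]: "f \<in> borel_measurable borel"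
    unfolding f_def using g0 compact_imp_closed[OF compact(1)]
    by (intro borel_measurable_continuous_on_if) auto
  have Fm [measurable]: "F n \<in> borel_measurable borel" for n using meas[OF F(1)] .
  have soft_lim: "(\<lambda>n. soft2 (F (k n)) y) \<longlonglongrightarrow> soft2 f y" for y
  proof -
    have "(\<lambda>n. LINT x|\<alpha>. exp (F (k n) x - c x y)) \<longlonglongrightarrow> (LINT x|\<alpha>. exp (f x - c x y))"
    proof (rule integral_dominated_convergence[where w="\<lambda>_. exp C"])
      show "AE x in \<alpha>. (\<lambda>n. exp (F (k n) x - c x y)) \<longlonglongrightarrow> exp (f x - c x y)"
        using conc(1) by eventually_elim (intro tendsto_intros ptw)
      have "F (k n) x - c x y \<le> C" for n x using bd[OF F(1), of "k n" x] c_nonneg[of x y] by simp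
      then show "AE x in \<alpha>. norm (exp (F (k n) x - c x y)) \<le> exp C" for n by auto
    qed auto
    moreover have "(LINT x|\<alpha>. exp (f x - c x y)) > 0"
      using soft2_exp[OF f_meas f_bd, of y] by (metis exp_gt_zero)
    ultimately show ?thesis unfolding soft2_def soft_transform_def by (intro tendsto_intros) auto
  qed
  have "(\<lambda>n. LINT x|\<alpha>. F (k n) x) \<longlonglongrightarrow> (LINT x|\<alpha>. f x)"
  proof (rule integral_dominated_convergence[where w="\<lambda>_. C"])
    show "AE x in \<alpha>. (\<lambda>n. F (k n) x) \<longlonglongrightarrow> f x" using conc(1) by eventually_elim (rule ptw)
  qed (auto simp: bd[OF F(1)])
  moreover have "(\<lambda>n. LINT y|\<beta>. soft2 (F (k n)) y) \<longlonglongrightarrow> (LINT y|\<beta>. soft2 f y)"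
  proof (rule integral_dominated_convergence[where w="\<lambda>_. C + C"])
    show "AE y in \<beta>. (\<lambda>n. soft2 (F (k n)) y) \<longlonglongrightarrow> soft2 f y" by (simp add: soft_lim)
    show "soft2 f \<in> borel_measurable \<beta>" using lipschitz_measurable[OF soft2_lip[OF f_meas f_bd]] by measurable
    show "soft2 (F (k n)) \<in> borel_measurable \<beta>" for n
      using lipschitz_measurable[OF soft2_lip[OF Fm bd[OF F(1)]]] by measurable
    show "AE x in \<beta>. norm (soft2 (F (k n)) x) \<le> C + C" for n
      using soft2_bound[OF Fm bd[OF F(1)]] by auto
  qed auto
  ultimately have "(\<lambda>n. G (F (k n))) \<longlonglongrightarrow> G f"
    unfolding G_def by (rule tendsto_add)
  moreover have "(\<lambda>n. s - 1 / real (Suc n)) \<longlonglongrightarrow> s - 0"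
    by (intro tendsto_intros LIMSEQ_Suc[OF lim_1_over_n])
  moreover have "s - 1 / real (Suc n) \<le> G (F (k n))" for n
  proof -
    have "s - 1 / real (Suc n) \<le> s - 1 / real (Suc (k n))"
      using seq_suble[OF k, of n] by (intro diff_left_mono divide_left_mono) auto
    then show ?thesis using F(2)[of "k n"] by linarith
  qed
  ultimately have Gf: "s \<le> G f"
    using LIMSEQ_le by fastforce
  define g where "g = soft2 f"
  define f' where "f' = soft1 g"
  have g_bd: "\<bar>g x\<bar> \<le> C + C" for x unfolding g_def by (rule soft2_bound[OF f_meas f_bd])
  have g_lip: "L-lipschitz_on UNIV g" unfolding g_def by (rule soft2_lip[OF f_meas f_bd])
  have g_meas [measurable]: "g \<in> borel_measurable borel" using g_lip lipschitz_measurable by blast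
  have f'_bd: "\<bar>f' x\<bar> \<le> 3 * C" for x using soft1_bound[OF g_meas g_bd, of x] unfolding f'_def by linarith
  have f'_lip: "L-lipschitz_on UNIV f'" unfolding f'_def by (rule soft1_lip[OF g_meas g_bd])
  have f'_meas [measurable]: "f' \<in> borel_measurable borel" using f'_lip lipschitz_measurable by blast
  have f'_exp: "exp (- f' x) = (LINT y|\<beta>. exp (g y - c x y))" for x
    unfolding f'_def by (rule soft1_exp[OF g_meas g_bd])
  have g_exp: "exp (- g y) = (LINT x|\<alpha>. exp (f x - c x y))" for y
    unfolding g_def by (rule soft2_exp[OF f_meas f_bd])
  define g' where "g' = soft2 f'"
  have g'_bd: "\<bar>g' x\<bar> \<le> 3 * C + C" for x unfolding g'_def by (rule soft2_bound[OF f'_meas f'_bd])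
  have g'_lip: "L-lipschitz_on UNIV g'" unfolding g'_def by (rule soft2_lip[OF f'_meas f'_bd])
  have g'_meas [measurable]: "g' \<in> borel_measurable borel" using g'_lip lipschitz_measurable by blast
  have g'_exp: "exp (- g' y) = (LINT x|\<alpha>. exp (f' x - c x y))" for y
    unfolding g'_def by (rule soft2_exp[OF f'_meas f'_bd])
  have Gf': "G f' \<le> s"
  proof -
    define f'' where "f'' x = f' x + (- f' 0)" for x
    have "f'' \<in> \<K>" using f'_lip soft1_osc[OF g_meas g_bd]
      by (auto simp: \<K>_def f''_def f'_def lipschitz_on_def dist_real_def)
    then have "G f'' \<le> s" unfolding s_def using bdd by (rule cSUP_upper)
    moreover have "(LINT x|\<alpha>. f'' x) = (LINT x|\<alpha>. f' x) - f' 0"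
      using bounded_integrable1[OF f'_meas f'_bd] by (simp add: f''_def \<alpha>.prob_space)
    moreover have "soft2 f'' y = g' y + f' 0" for y
      unfolding f''_def g'_def by (subst soft2_add[OF f'_meas f'_bd]) simp
    then have "(LINT y|\<beta>. soft2 f'' y) = (LINT y|\<beta>. g' y) + f' 0"
      using bounded_integrable2[OF g'_meas g'_bd] by (simp add: \<beta>.prob_space)
    ultimately show ?thesis by (simp add: G_def g'_def)
  qed
  \<comment> \<open>One round of transforms \<open>f \<mapsto> f'\<close>,
    \<open>g \<mapsto> g'\<close> can only increase the functional. Both integrals below equal
    \<open>1\<close>, so by \<open>1 + x \<le> exp x\<close> each of the two updates is an
    improvement on average; maximality leaves room for neither, and equality in
    \<open>1 + x \<le> exp x\<close> forces \<open>f = f'\<close> almost everywhere.\<close>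
  have "(LINT y|\<beta>. exp (g y - g' y)) = (LINT y|\<beta>. (LINT x|\<alpha>. exp (f' x + g y - c x y)))"
  proof (rule Bochner_Integration.integral_cong[OF refl])
    fix y
    have "(LINT x|\<alpha>. exp (f' x + g y - c x y)) = (LINT x|\<alpha>. exp (g y) * exp (f' x - c x y))"
      by (simp add: mult_exp_exp algebra_simps)
    also have "\<dots> = exp (g y) * exp (- g' y)" by (simp add: g'_exp)
    finally show "exp (g y - g' y) = (LINT x|\<alpha>. exp (f' x + g y - c x y))" by (simp add: mult_exp_exp)
  qed
  also have "\<dots> = (LINT x|\<alpha>. (LINT y|\<beta>. exp (f' x + g y - c x y)))"
    using soft_coupling_integrable[OF f'_meas g_meas f'_bd g_bd] by (rule Fubini_integral)
  also have "\<dots> = (LINT x|\<alpha>. 1)"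
  proof (rule Bochner_Integration.integral_cong[OF refl])
    fix x
    have "(LINT y|\<beta>. exp (f' x + g y - c x y)) = (LINT y|\<beta>. exp (f' x) * exp (g y - c x y))"
      by (simp add: mult_exp_exp algebra_simps)
    also have "\<dots> = exp (f' x) * exp (- f' x)" by (simp add: f'_exp)
    finally show "(LINT y|\<beta>. exp (f' x + g y - c x y)) = 1" by (simp add: mult_exp_exp)
  qed
  finally have one_g: "(LINT y|\<beta>. exp (g y - g' y)) = 1" by (simp add: \<alpha>.prob_space)
  have "(LINT x|\<alpha>. exp (f x - f' x)) = (LINT x|\<alpha>. (LINT y|\<beta>. exp (f x + g y - c x y)))"
  proof (rule Bochner_Integration.integral_cong[OF refl])
    fix x
    have "(LINT y|\<beta>. exp (f x + g y - c x y)) = (LINT y|\<beta>. exp (f x) * exp (g y - c x y))"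
      by (simp add: mult_exp_exp algebra_simps)
    also have "\<dots> = exp (f x) * exp (- f' x)" by (simp add: f'_exp)
    finally show "exp (f x - f' x) = (LINT y|\<beta>. exp (f x + g y - c x y))" by (simp add: mult_exp_exp)
  qed
  also have "\<dots> = (LINT y|\<beta>. (LINT x|\<alpha>. exp (f x + g y - c x y)))"
    using soft_coupling_integrable[OF f_meas g_meas f_bd g_bd] by (rule Fubini_integral[symmetric])
  also have "\<dots> = (LINT y|\<beta>. 1)"
  proof (rule Bochner_Integration.integral_cong[OF refl])
    fix y
    have "(LINT x|\<alpha>. exp (f x + g y - c x y)) = (LINT x|\<alpha>. exp (g y) * exp (f x - c x y))"
      by (simp add: mult_exp_exp algebra_simps)
    also have "\<dots> = exp (g y) * exp (- g y)" by (simp add: g_exp)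
    finally show "(LINT x|\<alpha>. exp (f x + g y - c x y)) = 1" by (simp add: mult_exp_exp)
  qed
  finally have one_f: "(LINT x|\<alpha>. exp (f x - f' x)) = 1" by (simp add: \<beta>.prob_space)
  have int_f: "integrable \<alpha> (\<lambda>x. exp (f x - f' x))"
  proof (rule \<alpha>.integrable_const_bound[where B="exp (C + 3 * C)"])
    have "f x - f' x \<le> C + 3 * C" for x using f_bd[of x] f'_bd[of x] by linarith
    then show "AE x in \<alpha>. norm (exp (f x - f' x)) \<le> exp (C + 3 * C)" by simp
  qed simp
  have int_g: "integrable \<beta> (\<lambda>x. exp (g x - g' x))"
  proof (rule \<beta>.integrable_const_bound[where B="exp ((C + C) + (3 * C + C))"])
    have "g x - g' x \<le> (C + C) + (3 * C + C)" for x using g_bd[of x] g'_bd[of x] by linarith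
    then show "AE x in \<beta>. norm (exp (g x - g' x)) \<le> exp ((C + C) + (3 * C + C))" by simp
  qed simp
  have ig: "integrable \<beta> g" "integrable \<beta> g'" "integrable \<alpha> f" "integrable \<alpha> f'"
    using bounded_integrable1[OF f_meas f_bd] bounded_integrable1[OF f'_meas f'_bd]
      bounded_integrable2[OF g_meas g_bd] bounded_integrable2[OF g'_meas g'_bd] by auto
  have "(LINT y|\<beta>. g y - g' y) \<le> (LINT y|\<beta>. exp (g y - g' y) - 1)"
    using int_g ig by (intro integral_mono) (auto intro: order_trans[OF _ exp_ge_add_one_self] simp: le_diff_eq add.commute)
  also have "\<dots> = 0" using int_g one_g by (simp add: \<beta>.prob_space)
  finally have "(LINT y|\<beta>. g y) \<le> (LINT y|\<beta>. g' y)" using ig by simp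
  with Gf Gf' have "(LINT x|\<alpha>. f' x) \<le> (LINT x|\<alpha>. f x)" by (simp add: G_def g_def[symmetric] g'_def[symmetric])
  then have "(LINT x|\<alpha>. exp (f x - f' x) - 1 - (f x - f' x)) \<le> 0"
    using int_f ig one_f by (simp add: \<alpha>.prob_space)
  moreover have nn: "0 \<le> exp (f x - f' x) - 1 - (f x - f' x)" for x
    using exp_ge_add_one_self[of "f x - f' x"] by linarith
  ultimately have "(LINT x|\<alpha>. exp (f x - f' x) - 1 - (f x - f' x)) = 0"
    by (simp add: order_antisym Bochner_Integration.integral_nonneg)
  then have "AE x in \<alpha>. exp (f x - f' x) - 1 - (f x - f' x) = 0"
    using int_f ig nn by (subst (asm) integral_nonneg_eq_0_iff_AE) auto
  then have ae: "AE x in \<alpha>. f x = f' x"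
  proof eventually_elim
    case (elim x)
    then have "ln (exp (f x - f' x)) = exp (f x - f' x) - 1" by simp
    from ln_eq_minus_one[OF _ this] show ?case by simp
  qed
  show ?thesis
  proof (rule that[of f' g "3 * C"])
    show "exp (- g y) = (LINT x|\<alpha>. exp (f' x - c x y))" for y
      unfolding g_exp by (rule integral_cong_AE) (use ae in auto)
    show "\<bar>g x\<bar> \<le> 3 * C" for x using g_bd[of x] C_nonneg by linarith
  qed (use f'_lip g_lip f'_bd f'_exp in auto)
qed

end

text \<open>Couplings enter through their marginals only: integrals and null sets in one
  coordinate are those of the marginal.\<close>

lemma coupling_prob_space:
  assumes "\<pi> \<in> couplings \<alpha> \<beta>" "prob_space \<alpha>"
  shows "prob_space \<pi>"
proof -
  have "distr \<pi> borel fst = \<alpha>" "sets \<pi> = sets (borel \<Otimes>\<^sub>M borel)" using assms by (auto simp: couplings_def)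
  moreover from this(2) have m: "fst \<in> measurable \<pi> borel" by (simp cong: measurable_cong_sets)
  ultimately show ?thesis using assms(2) prob_space_distrD[OF m] by simp
qed

lemma coupling_integral:
  fixes f :: "'a::topological_space \<Rightarrow> real"
  assumes \<pi>: "\<pi> \<in> couplings \<alpha> \<beta>" and [measurable]: "f \<in> borel_measurable borel"
  shows "integrable \<pi> (\<lambda>z. f (fst z)) \<longleftrightarrow> integrable \<alpha> f" "(LINT z|\<pi>. f (fst z)) = (LINT x|\<alpha>. f x)"
    and "integrable \<pi> (\<lambda>z. f (snd z)) \<longleftrightarrow> integrable \<beta> f" "(LINT z|\<pi>. f (snd z)) = (LINT y|\<beta>. f y)"
proof -
  have d: "distr \<pi> borel fst = \<alpha>" "distr \<pi> borel snd = \<beta>" and s: "sets \<pi> = sets (borel \<Otimes>\<^sub>M borel)"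
    using \<pi> by (auto simp: couplings_def)
  have m [measurable]: "fst \<in> measurable \<pi> borel" "snd \<in> measurable \<pi> borel"
    by (simp_all cong: measurable_cong_sets[OF s refl])
  show "integrable \<pi> (\<lambda>z. f (fst z)) \<longleftrightarrow> integrable \<alpha> f" "(LINT z|\<pi>. f (fst z)) = (LINT x|\<alpha>. f x)"
    using integrable_distr_eq[OF m(1), of f] integral_distr[OF m(1), of f] d by auto
  show "integrable \<pi> (\<lambda>z. f (snd z)) \<longleftrightarrow> integrable \<beta> f" "(LINT z|\<pi>. f (snd z)) = (LINT y|\<beta>. f y)"
    using integrable_distr_eq[OF m(2), of f] integral_distr[OF m(2), of f] d by auto
qed

lemma coupling_AE:
  assumes \<pi>: "\<pi> \<in> couplings \<alpha> \<beta>" and [measurable]: "Measurable.pred borel P"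
  shows "(AE z in \<pi>. P (fst z)) \<longleftrightarrow> (AE x in \<alpha>. P x)" "(AE z in \<pi>. P (snd z)) \<longleftrightarrow> (AE y in \<beta>. P y)"
proof -
  have d: "distr \<pi> borel fst = \<alpha>" "distr \<pi> borel snd = \<beta>" and s: "sets \<pi> = sets (borel \<Otimes>\<^sub>M borel)"
    using \<pi> by (auto simp: couplings_def)
  have m [measurable]: "fst \<in> measurable \<pi> borel" "snd \<in> measurable \<pi> borel"
    by (simp_all cong: measurable_cong_sets[OF s refl])
  show "(AE z in \<pi>. P (fst z)) \<longleftrightarrow> (AE x in \<alpha>. P x)" "(AE z in \<pi>. P (snd z)) \<longleftrightarrow> (AE y in \<beta>. P y)"
    using AE_distr_iff[OF m(1), of P] AE_distr_iff[OF m(2), of P] d by auto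
qed

lemma closed_msupport: "closed (msupport M)"
proof -
  have "- msupport M = \<Union>{U. open U \<and> emeasure M U = 0}"
    by (auto simp: msupport_def zero_less_iff_neq_zero)
  then have "open (- msupport M)" by auto
  then show ?thesis by (simp add: closed_def)
qed

text \<open>In a second countable space the complement of the support is a countable union of null
  sets.\<close>

lemma AE_msupport:
  fixes M :: "'a::second_countable_topology measure"
  assumes "sets M = sets borel"
  shows "AE x in M. x \<in> msupport M"
proof -
  obtain \<B> :: "'a set set" where \<B>: "countable \<B>" "topological_basis \<B>" using ex_countable_basis by blast
  define N where "N = \<Union>{U \<in> \<B>. emeasure M U = 0}"
  have sub: "- msupport M \<subseteq> N"
  proof
    fix x assume "x \<in> - msupport M"
    then obtain U where U: "open U" "x \<in> U" "emeasure M U = 0"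
      by (auto simp: msupport_def zero_less_iff_neq_zero)
    from topological_basisE[OF \<B>(2) U(1,2)] obtain V where V: "V \<in> \<B>" "x \<in> V" "V \<subseteq> U" .
    have "emeasure M V \<le> emeasure M U" using V U assms by (intro emeasure_mono) auto
    then show "x \<in> N" using V U by (auto simp: N_def)
  qed
  have "N \<in> null_sets M" unfolding N_def
    using \<B> assms topological_basis_open[OF \<B>(2)]
    by (intro null_sets_UN' [where N="\<lambda>x. x", unfolded image_ident]) (auto simp: null_sets_def)
  then show ?thesis by (rule AE_I') (use sub in auto)
qed

lemma msupport_subset_closed:
  assumes "sets M = sets borel" "closed B" "AE x in M. x \<in> B"
  shows "msupport M \<subseteq> B"
proof
  fix x assume x: "x \<in> msupport M"
  show "x \<in> B"
  proof (rule ccontr)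
    assume "x \<notin> B"
    then have "0 < emeasure M (- B)" using x assms(2) by (auto simp: msupport_def)
    moreover have "emeasure M (- B) = 0" using assms by (subst (asm) AE_iff_measurable[of "- B"]) (auto simp: sets_eq_imp_space_eq[OF assms(1)])
    ultimately show False by simp
  qed
qed

text \<open>Every ball around a point of the support has positive mass; a finite cover by balls of
  half the radius makes the lower bound uniform.\<close>

lemma msupport_ball_mass:
  fixes M :: "'a::metric_space measure"
  assumes M: "finite_measure M" "sets M = sets borel" and "compact (msupport M)" "0 < r"
  obtains m where "0 < m" "\<And>x. x \<in> msupport M \<Longrightarrow> m \<le> measure M (ball x r)"
proof -
  interpret finite_measure M by fact
  obtain F where F: "F \<subseteq> msupport M" "finite F" "msupport M \<subseteq> (\<Union>x\<in>F. ball x (r/2))"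
  proof (rule compactE_image[OF assms(3), of "msupport M" "\<lambda>x. ball x (r/2)"])
    show "msupport M \<subseteq> (\<Union>x\<in>msupport M. ball x (r/2))"
      using assms(4) by (intro subsetI UN_I) auto
  qed auto
  define m where "m = Min (insert 1 ((\<lambda>x. measure M (ball x (r/2))) ` F))"
  have pos: "0 < measure M (ball x (r/2))" if "x \<in> F" for x
    using that F(1) assms(4) by (auto simp: msupport_def emeasure_eq_measure)
  show ?thesis
  proof (rule that[of m])
    show "0 < m" unfolding m_def using F(2) pos by (subst Min_gr_iff) auto
    fix x assume "x \<in> msupport M"
    then obtain z where z: "z \<in> F" "x \<in> ball z (r/2)" using F(3) by blast
    have "m \<le> measure M (ball z (r/2))" unfolding m_def using F(2) z(1) by (intro Min_le) auto
    also have "\<dots> \<le> measure M (ball x r)"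
    proof (rule finite_measure_mono)
      show "ball z (r/2) \<subseteq> ball x r"
      proof
        fix y assume "y \<in> ball z (r/2)"
        then show "y \<in> ball x r" using z(2) dist_triangle[of x y z] by (auto simp: dist_commute)
      qed
    qed (use M(2) in auto)
    finally show "m \<le> measure M (ball x r)" .
  qed
qed

lemma INF_shift:
  fixes k :: "'a \<Rightarrow> 'b \<Rightarrow> real"
  assumes "S \<noteq> {}" and bdd: "\<And>y. y \<in> S \<Longrightarrow> b \<le> k x y - v y" and le: "\<And>y. y \<in> S \<Longrightarrow> k x y \<le> k x' y + d"
  shows "(INF y\<in>S. k x y - v y) \<le> (INF y\<in>S. k x' y - v y) + d"
proof -
  have "(INF y\<in>S. k x y - v y) - d \<le> (INF y\<in>S. k x' y - v y)"
  proof (rule cINF_greatest[OF assms(1)])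
    fix y assume y: "y \<in> S"
    have "(INF y\<in>S. k x y - v y) \<le> k x y - v y" using bdd y by (intro cINF_lower) (auto intro!: bdd_belowI)
    also have "\<dots> \<le> k x' y + d - v y" using le[OF y] by simp
    finally show "(INF y\<in>S. k x y - v y) - d \<le> k x' y - v y" by simp
  qed
  then show ?thesis by simp
qed

lemma INF_lipschitz:
  fixes k :: "'a::metric_space \<Rightarrow> 'b \<Rightarrow> real"
  assumes "S \<noteq> {}" and bdd: "\<And>x y. y \<in> S \<Longrightarrow> b \<le> k x y - v y" and lip: "\<And>y. L-lipschitz_on UNIV (\<lambda>x. k x y)"
  shows "L-lipschitz_on UNIV (\<lambda>x. INF y\<in>S. k x y - v y)"
proof (rule lipschitz_onI)
  show "0 \<le> L" using lip lipschitz_on_nonneg by blast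
  have le: "(INF y\<in>S. k x y - v y) \<le> (INF y\<in>S. k x' y - v y) + L * dist x x'" for x x'
  proof (rule INF_shift[OF assms(1), where b=b])
    show "k x y \<le> k x' y + L * dist x x'" for y
      using lipschitz_onD[OF lip, of x x' y] by (simp add: dist_real_def)
  qed (use bdd in auto)
  show "dist (INF y\<in>S. k x y - v y) (INF y\<in>S. k x' y - v y) \<le> L * dist x x'" for x x'
    using le[of x x'] le[of x' x] unfolding dist_real_def dist_commute[of x' x] by linarith
qed

context transport_problem begin

lemma cost_integrable_coupling:
  assumes "\<pi> \<in> couplings \<alpha> \<beta>"
  shows "integrable \<pi> (\<lambda>z. c (fst z) (snd z))"
proof -
  interpret \<pi>: prob_space \<pi> using coupling_prob_space[OF assms prob(1)] .
  have s: "sets \<pi> = sets (borel \<Otimes>\<^sub>M borel)" using assms by (auto simp: couplings_def)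
  show ?thesis
    by (rule \<pi>.integrable_const_bound[where B=C])
      (auto simp: c_nonneg c_le abs_of_nonneg cong: measurable_cong_sets[OF s refl])
qed

text \<open>The density \<open>exp (f + g - c)\<close> with respect to
  \<open>\<alpha> \<otimes> \<beta>\<close> has marginals \<open>\<alpha>\<close> and
  \<open>\<beta>\<close> by the equations for the entropic potentials. Its relative entropy is
  nonnegative and equals
  \<open>\<integral> f d\<alpha> + \<integral> g d\<beta> - \<integral> c d\<pi>\<close>, which is
  the asserted inequality.\<close>

lemma entropic_coupling:
  obtains \<pi> f g b where "\<pi> \<in> couplings \<alpha> \<beta>" "L-lipschitz_on UNIV f" "L-lipschitz_on UNIV g"
    "\<And>x. \<bar>f x\<bar> \<le> b" "\<And>x. \<bar>g x\<bar> \<le> b"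
    "\<And>x. exp (- f x) = (LINT y|\<beta>. exp (g y - c x y))"
    "(LINT z|\<pi>. c (fst z) (snd z)) \<le> (LINT x|\<alpha>. f x) + (LINT y|\<beta>. g y)"
proof -
  obtain f g b where f: "L-lipschitz_on UNIV f" and g: "L-lipschitz_on UNIV g"
    and fb: "\<And>x. \<bar>f x\<bar> \<le> b" and gb: "\<And>x. \<bar>g x\<bar> \<le> b"
    and fe: "\<And>x. exp (- f x) = (LINT y|\<beta>. exp (g y - c x y))"
    and ge: "\<And>y. exp (- g y) = (LINT x|\<alpha>. exp (f x - c x y))"
    using entropic_potentials_exist by blast
  have [measurable]: "f \<in> borel_measurable borel" "g \<in> borel_measurable borel"
    using f g lipschitz_measurable by auto
  note pc = sets_pair_measure_cong[OF sets(1) sets(2)]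
  define D where "D z = exp (f (fst z) + g (snd z) - c (fst z) (snd z))" for z
  have Dm [measurable]: "D \<in> borel_measurable (borel \<Otimes>\<^sub>M borel)" unfolding D_def by measurable
  have Dm' [measurable]: "D \<in> borel_measurable (\<alpha> \<Otimes>\<^sub>M \<beta>)" by (simp cong: measurable_cong_sets[OF pc refl])
  have Dpos: "0 < D z" for z by (simp add: D_def)
  define \<pi> where "\<pi> = density (\<alpha> \<Otimes>\<^sub>M \<beta>) (\<lambda>z. ennreal (D z))"
  have s\<pi>: "sets \<pi> = sets (borel \<Otimes>\<^sub>M borel)" by (simp add: \<pi>_def pc)
  have up: "f x + g y - c x y \<le> b + b" for x y
    using abs_le_D1[OF fb[of x]] abs_le_D1[OF gb[of y]] c_nonneg[of x y] by linarith
  have int2: "integrable \<beta> (\<lambda>y. exp (f x + g y - c x y))" for x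
    by (rule \<beta>.integrable_const_bound[where B="exp (b + b)"]) (use up in \<open>auto simp del: mult_2\<close>)
  have int1: "integrable \<alpha> (\<lambda>x. exp (f x + g y - c x y))" for y
    by (rule \<alpha>.integrable_const_bound[where B="exp (b + b)"]) (use up in \<open>auto simp del: mult_2\<close>)
  have one2: "(\<integral>\<^sup>+ y. ennreal (D (x, y)) \<partial>\<beta>) = 1" for x
  proof -
    have "(\<integral>\<^sup>+ y. ennreal (D (x, y)) \<partial>\<beta>) = ennreal (LINT y|\<beta>. exp (f x + g y - c x y))"
      unfolding D_def using int2 by (subst nn_integral_eq_integral) auto
    also have "(LINT y|\<beta>. exp (f x + g y - c x y)) = (LINT y|\<beta>. exp (f x) * exp (g y - c x y))"
      by (simp add: mult_exp_exp algebra_simps)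
    also have "\<dots> = exp (f x) * exp (- f x)" by (simp add: fe)
    also have "\<dots> = 1" by (simp add: mult_exp_exp)
    finally show ?thesis by simp
  qed
  have one1: "(\<integral>\<^sup>+ x. ennreal (D (x, y)) \<partial>\<alpha>) = 1" for y
  proof -
    have "(\<integral>\<^sup>+ x. ennreal (D (x, y)) \<partial>\<alpha>) = ennreal (LINT x|\<alpha>. exp (f x + g y - c x y))"
      unfolding D_def using int1 by (subst nn_integral_eq_integral) auto
    also have "(LINT x|\<alpha>. exp (f x + g y - c x y)) = (LINT x|\<alpha>. exp (g y) * exp (f x - c x y))"
      by (simp add: mult_exp_exp algebra_simps)
    also have "\<dots> = exp (g y) * exp (- g y)" by (simp add: ge)
    also have "\<dots> = 1" by (simp add: mult_exp_exp)
    finally show ?thesis by simp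
  qed
  have "distr \<pi> borel fst = \<alpha>"
  proof (rule measure_eqI)
    fix E assume "E \<in> sets (distr \<pi> borel fst)"
    then have E [measurable]: "E \<in> sets borel" by simp
    have mf: "fst \<in> measurable \<pi> borel" by (simp cong: measurable_cong_sets[OF s\<pi> refl])
    have "emeasure (distr \<pi> borel fst) E = (\<integral>\<^sup>+ z. indicator E z \<partial>distr \<pi> borel fst)" by simp
    also have "\<dots> = (\<integral>\<^sup>+ z. indicator E (fst z) \<partial>\<pi>)" using mf by (subst nn_integral_distr) auto
    also have "\<dots> = (\<integral>\<^sup>+ z. ennreal (D z) * indicator E (fst z) \<partial>(\<alpha> \<Otimes>\<^sub>M \<beta>))"
      unfolding \<pi>_def by (subst nn_integral_density) auto
    also have "\<dots> = (\<integral>\<^sup>+ x. \<integral>\<^sup>+ y. ennreal (D (x, y)) * indicator E x \<partial>\<beta> \<partial>\<alpha>)"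
      by (subst \<beta>.nn_integral_fst[symmetric]) auto
    also have "\<dots> = (\<integral>\<^sup>+ x. (\<integral>\<^sup>+ y. ennreal (D (x, y)) \<partial>\<beta>) * indicator E x \<partial>\<alpha>)"
      by (intro nn_integral_cong nn_integral_multc) auto
    also have "\<dots> = emeasure \<alpha> E" by (simp add: one2 sets)
    finally show "emeasure (distr \<pi> borel fst) E = emeasure \<alpha> E" .
  qed (simp add: sets)
  moreover have "distr \<pi> borel snd = \<beta>"
  proof (rule measure_eqI)
    fix E assume "E \<in> sets (distr \<pi> borel snd)"
    then have E [measurable]: "E \<in> sets borel" by simp
    have mf: "snd \<in> measurable \<pi> borel" by (simp cong: measurable_cong_sets[OF s\<pi> refl])
    have "emeasure (distr \<pi> borel snd) E = (\<integral>\<^sup>+ z. indicator E z \<partial>distr \<pi> borel snd)" by simp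
    also have "\<dots> = (\<integral>\<^sup>+ z. indicator E (snd z) \<partial>\<pi>)" using mf by (subst nn_integral_distr) auto
    also have "\<dots> = (\<integral>\<^sup>+ z. ennreal (D z) * indicator E (snd z) \<partial>(\<alpha> \<Otimes>\<^sub>M \<beta>))"
      unfolding \<pi>_def by (subst nn_integral_density) auto
    also have "\<dots> = (\<integral>\<^sup>+ y. \<integral>\<^sup>+ x. ennreal (D (x, y)) * indicator E y \<partial>\<alpha> \<partial>\<beta>)"
      by (subst nn_integral_snd[symmetric]) auto
    also have "\<dots> = (\<integral>\<^sup>+ y. (\<integral>\<^sup>+ x. ennreal (D (x, y)) \<partial>\<alpha>) * indicator E y \<partial>\<beta>)"
      by (intro nn_integral_cong nn_integral_multc) auto
    also have "\<dots> = emeasure \<beta> E" by (simp add: one1 sets)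
    finally show "emeasure (distr \<pi> borel snd) E = emeasure \<beta> E" .
  qed (simp add: sets)
  ultimately have \<pi>: "\<pi> \<in> couplings \<alpha> \<beta>" by (simp add: couplings_def s\<pi>)
  define h where "h z = f (fst z) + g (snd z) - c (fst z) (snd z)" for z
  have hm [measurable]: "h \<in> borel_measurable (\<alpha> \<Otimes>\<^sub>M \<beta>)"
    unfolding h_def by (simp cong: measurable_cong_sets[OF pc refl])
  have hD: "D z = exp (h z)" for z by (simp add: D_def h_def)
  have h_up: "h z \<le> b + b" for z
    unfolding h_def using abs_le_D1[OF fb[of "fst z"]] abs_le_D1[OF gb[of "snd z"]] c_nonneg[of "fst z" "snd z"] by linarith
  have h_lo: "- (b + b + C) \<le> h z" for z
    unfolding h_def using fb[of "fst z"] gb[of "snd z"] c_le[of "fst z" "snd z"] by linarith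
  have intD: "integrable (\<alpha> \<Otimes>\<^sub>M \<beta>) D"
    by (rule P.integrable_const_bound[where B="exp (b + b)"]) (use h_up in \<open>auto simp: hD\<close>)
  have inthD: "integrable (\<alpha> \<Otimes>\<^sub>M \<beta>) (\<lambda>z. D z * h z)"
  proof (rule P.integrable_const_bound[where B="exp (b + b) * (b + b + C)"])
    show "AE z in \<alpha> \<Otimes>\<^sub>M \<beta>. norm (D z * h z) \<le> exp (b + b) * (b + b + C)"
    proof (rule AE_I2)
      fix z
      have "\<bar>h z\<bar> \<le> b + b + C" using h_up[of z] h_lo[of z] C_nonneg by linarith
      then show "norm (D z * h z) \<le> exp (b + b) * (b + b + C)"
        using h_up[of z] unfolding real_norm_def abs_mult by (intro mult_mono) (simp_all add: hD del: mult_2)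
    qed
  qed simp
  have "(\<integral>\<^sup>+ z. ennreal (D z) \<partial>(\<alpha> \<Otimes>\<^sub>M \<beta>)) = 1"
    by (subst \<beta>.nn_integral_fst[symmetric]) (auto simp: one2 \<alpha>.emeasure_space_1)
  then have D1: "(LINT z|(\<alpha> \<Otimes>\<^sub>M \<beta>). D z) = 1"
    using Dpos by (subst integral_eq_nn_integral) (auto simp: less_imp_le)
  \<comment> \<open>Nonnegativity of the relative entropy: \<open>D - 1 \<le> D ln D\<close>
    pointwise.\<close>
  have "0 = (LINT z|(\<alpha> \<Otimes>\<^sub>M \<beta>). D z - 1)" using intD D1 by (simp add: P.prob_space)
  also have "\<dots> \<le> (LINT z|(\<alpha> \<Otimes>\<^sub>M \<beta>). D z * h z)"
  proof (rule integral_mono)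
    fix z
    have "D z * (1 - exp (- h z)) \<le> D z * h z"
      using exp_ge_add_one_self[of "- h z"] Dpos[of z] by (intro mult_left_mono) auto
    then show "D z - 1 \<le> D z * h z" by (simp add: hD right_diff_distrib mult_exp_exp)
  qed (use intD inthD in auto)
  also have "\<dots> = (LINT z|\<pi>. h z)"
    unfolding \<pi>_def using Dpos by (subst integral_density) (auto simp: less_imp_le)
  also have "\<dots> = (LINT z|\<pi>. f (fst z)) + (LINT z|\<pi>. g (snd z)) - (LINT z|\<pi>. c (fst z) (snd z))"
  proof -
    have "integrable \<alpha> f" by (rule bounded_integrable1[OF _ fb]) simp
    then have 1: "integrable \<pi> (\<lambda>z. f (fst z))" by (subst coupling_integral(1)[OF \<pi>]) simp
    have "integrable \<beta> g" by (rule bounded_integrable2[OF _ gb]) simp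
    then have 2: "integrable \<pi> (\<lambda>z. g (snd z))" by (subst coupling_integral(3)[OF \<pi>]) simp
    show ?thesis unfolding h_def
      using Bochner_Integration.integral_diff[OF Bochner_Integration.integrable_add[OF 1 2] cost_integrable_coupling[OF \<pi>]]
        Bochner_Integration.integral_add[OF 1 2] by simp
  qed
  also have "\<dots> = (LINT x|\<alpha>. f x) + (LINT y|\<beta>. g y) - (LINT z|\<pi>. c (fst z) (snd z))"
    using coupling_integral[OF \<pi>] by simp
  finally have "(LINT z|\<pi>. c (fst z) (snd z)) \<le> (LINT x|\<alpha>. f x) + (LINT y|\<beta>. g y)" by simp
  then show ?thesis by (rule that[OF \<pi> f g fb gb fe])
qed

text \<open>Duality for the cost \<open>c\<close> up to an error \<open>\<eta>\<close>, from the
  entropic problem for \<open>c / \<epsilon>\<close>. Scaling back by \<open>\<epsilon>\<close>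
  gives a coupling and a pair \<open>(u, v)\<close> that nearly satisfies
  \<open>u + v \<le> c\<close>; the violation is at most
  \<open>\<epsilon> \<bar>ln m\<bar>\<close> plus a Lipschitz error, where \<open>m\<close> bounds
  the mass of small balls from below. Hard transforms then restore the constraint everywhere. The
  bounds on \<open>\<phi>\<close> and \<open>\<psi>\<close> and the normalization at
  \<open>x0\<close> do not depend on the measures, which is what the compactness arguments below
  rely on.\<close>

theorem kantorovich_duality:
  assumes "0 < \<eta>"
  obtains \<pi> \<phi> \<psi> where "\<pi> \<in> couplings \<alpha> \<beta>" "L-lipschitz_on UNIV \<phi>" "L-lipschitz_on UNIV \<psi>"
    "\<And>x. \<bar>\<phi> x\<bar> \<le> C" "\<And>x. \<bar>\<psi> x\<bar> \<le> 2 * C" "\<phi> x0 = 0"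
    "\<And>x y. \<phi> x + \<psi> y \<le> c x y"
    "(LINT z|\<pi>. c (fst z) (snd z)) \<le> (LINT x|\<alpha>. \<phi> x) + (LINT y|\<beta>. \<psi> y) + \<eta>"
proof -
  let ?S = "msupport \<beta>"
  have S: "AE y in \<beta>. y \<in> ?S" by (rule AE_msupport) (rule sets)
  have "?S \<subseteq> B" by (rule msupport_subset_closed) (use sets compact conc compact_imp_closed in auto)
  then have S_compact: "compact ?S"
    using compact_Int_closed[OF compact(2) closed_msupport[of \<beta>]] by (simp add: Int_absorb1)
  have S_ne: "?S \<noteq> {}" using S \<beta>.AE_False by auto
  \<comment> \<open>The ball radius \<open>r\<close> and then \<open>\<epsilon>\<close> are chosen
    so that each of the two errors is at most \<open>\<eta> / 2\<close>.\<close>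
  define r where "r = \<eta> / (4 * L + 4)"
  have r: "0 < r" "2 * L * r \<le> \<eta> / 2"
    using assms L_nonneg unfolding r_def by (simp, simp add: field_simps)
  obtain m where m: "0 < m" "\<And>y. y \<in> ?S \<Longrightarrow> m \<le> measure \<beta> (ball y r)"
    using msupport_ball_mass[OF \<beta>.finite_measure_axioms sets(2) S_compact r(1)] by blast
  define \<epsilon> where "\<epsilon> = \<eta> / (2 * (\<bar>ln m\<bar> + 1))"
  have \<epsilon>: "0 < \<epsilon>" "\<epsilon> * (- ln m) \<le> \<eta> / 2"
  proof -
    show "0 < \<epsilon>" using assms by (simp add: \<epsilon>_def add_nonneg_pos)
    have "\<epsilon> * (- ln m) \<le> \<epsilon> * (\<bar>ln m\<bar> + 1)" using \<open>0 < \<epsilon>\<close> by (intro mult_left_mono) auto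
    also have "\<dots> = \<eta> / 2" by (simp add: \<epsilon>_def divide_simps add_nonneg_eq_0_iff)
    finally show "\<epsilon> * (- ln m) \<le> \<eta> / 2" .
  qed
  interpret E: transport_problem "\<lambda>x y. c x y / \<epsilon>" "C / \<epsilon>" "L / \<epsilon>" \<alpha> \<beta> A B
  proof
    show "(L / \<epsilon>)-lipschitz_on UNIV (\<lambda>x. c x y / \<epsilon>)" for y
      using c_lip1[of y] \<epsilon>(1) by (auto simp: lipschitz_on_def dist_real_def diff_divide_distrib[symmetric] divide_right_mono)
    show "(L / \<epsilon>)-lipschitz_on UNIV (\<lambda>y. c x y / \<epsilon>)" for x
      using c_lip2[of x] \<epsilon>(1) by (auto simp: lipschitz_on_def dist_real_def diff_divide_distrib[symmetric] divide_right_mono)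
  qed (use c_nonneg c_le \<epsilon> prob sets compact conc in \<open>auto simp: divide_right_mono\<close>)
  obtain \<pi> f g b where \<pi>: "\<pi> \<in> couplings \<alpha> \<beta>" and f: "(L/\<epsilon>)-lipschitz_on UNIV f" and g: "(L/\<epsilon>)-lipschitz_on UNIV g"
    and fb: "\<And>x. \<bar>f x\<bar> \<le> b" and gb: "\<And>x. \<bar>g x\<bar> \<le> b"
    and fe: "\<And>x. exp (- f x) = (LINT y|\<beta>. exp (g y - c x y / \<epsilon>))"
    and le: "(LINT z|\<pi>. c (fst z) (snd z) / \<epsilon>) \<le> (LINT x|\<alpha>. f x) + (LINT y|\<beta>. g y)"
    by (rule E.entropic_coupling) blast
  have [measurable]: "f \<in> borel_measurable borel" "g \<in> borel_measurable borel"
    using f g lipschitz_measurable by auto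
  define u where "u x = \<epsilon> * f x" for x
  define v where "v x = \<epsilon> * g x" for x
  have v_lip: "\<bar>v y - v y'\<bar> \<le> L * dist y y'" for y y'
  proof -
    have "\<bar>g y - g y'\<bar> \<le> L / \<epsilon> * dist y y'" using lipschitz_onD[OF g] by (simp add: dist_real_def)
    then have "\<epsilon> * \<bar>g y - g y'\<bar> \<le> \<epsilon> * (L / \<epsilon> * dist y y')" using \<epsilon>(1) by (intro mult_left_mono) auto
    then show ?thesis using \<epsilon>(1) by (simp add: v_def abs_mult flip: right_diff_distrib)
  qed
  have v_bd: "\<bar>v y\<bar> \<le> \<epsilon> * b" for y using gb[of y] \<epsilon>(1) by (simp add: v_def abs_mult)
  have c_v_lower: "- (\<epsilon> * b) \<le> c x y - v y" for x y
    using v_bd[of y] c_nonneg[of x y] by linarith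
  define \<phi>0 where "\<phi>0 x = (INF y\<in>?S. c x y - v y)" for x
  have \<phi>0_lip: "L-lipschitz_on UNIV \<phi>0"
    unfolding \<phi>0_def by (rule INF_lipschitz[where k=c and v=v, OF S_ne c_v_lower c_lip1])
  have \<phi>0_osc: "\<phi>0 x \<le> \<phi>0 x' + C" for x x'
    unfolding \<phi>0_def
  proof (rule INF_shift[where k=c and v=v, OF S_ne c_v_lower])
    show "c x y \<le> c x' y + C" for y using c_le[of x y] c_nonneg[of x' y] by linarith
  qed
  \<comment> \<open>Restricting the integral in the definition of \<open>f\<close> to a ball
    around \<open>y\<close> compares the soft transform with the value of
    \<open>c x y - v y\<close> at a single point.\<close>
  have u_le: "u x \<le> \<phi>0 x + \<eta>" for x
  proof -
    have "u x - \<eta> \<le> \<phi>0 x"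
      unfolding \<phi>0_def
    proof (rule cINF_greatest[OF S_ne])
      fix y assume y: "y \<in> ?S"
      define d where "d = (v y - c x y - 2 * L * r) / \<epsilon>"
      have "m * exp d \<le> measure \<beta> (ball y r) * exp d" using m(2)[OF y] by simp
      also have "\<dots> = (LINT y'|\<beta>. indicator (ball y r) y' * exp d)" by (simp add: sets)
      also have "\<dots> \<le> (LINT y'|\<beta>. exp (g y' - c x y' / \<epsilon>))"
      proof (rule integral_mono)
        show "integrable \<beta> (\<lambda>y'. indicator (ball y r) y' * exp d)"
          by (intro integrable_mult_left integrable_real_indicator) (auto simp: sets \<beta>.emeasure_eq_measure)
        show "integrable \<beta> (\<lambda>y'. exp (g y' - c x y' / \<epsilon>))"
          by (rule integrable_exp_bounded[where B=b]) (use prob gb c_nonneg \<epsilon> in auto)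
        fix y'
        show "indicator (ball y r) y' * exp d \<le> exp (g y' - c x y' / \<epsilon>)"
        proof (cases "y' \<in> ball y r")
          case True
          then have "dist y y' \<le> r" by simp
          then have "L * dist y y' \<le> L * r" using L_nonneg by (rule mult_left_mono)
          moreover have "\<bar>c x y - c x y'\<bar> \<le> L * dist y y'"
            using lipschitz_onD[OF c_lip2, of y y'] by (simp add: dist_real_def)
          ultimately have "v y - c x y - 2 * L * r \<le> v y' - c x y'" using v_lip[of y y'] by linarith
          then have "d \<le> (v y' - c x y') / \<epsilon>" unfolding d_def using \<epsilon>(1) by (intro divide_right_mono) auto
          also have "\<dots> = g y' - c x y' / \<epsilon>" using \<epsilon>(1) by (simp add: v_def diff_divide_distrib)
          finally show ?thesis using True by simp
        qed simp
      qed
      also have "\<dots> = exp (- f x)" by (simp add: fe)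
      finally have "ln (m * exp d) \<le> ln (exp (- f x))" using m(1) by (subst ln_le_cancel_iff) auto
      then have "ln m + d \<le> - f x" using m(1) by (simp add: ln_mult)
      then have "\<epsilon> * (ln m + d) \<le> \<epsilon> * (- f x)" using \<epsilon>(1) by (intro mult_left_mono) auto
      moreover have "\<epsilon> * d = v y - c x y - 2 * L * r" using \<epsilon>(1) by (simp add: d_def)
      ultimately have "u x \<le> c x y - v y + 2 * L * r + \<epsilon> * (- ln m)" by (simp add: u_def algebra_simps)
      then show "u x - \<eta> \<le> c x y - v y" using r(2) \<epsilon>(2) by linarith
    qed
    then show ?thesis by simp
  qed
  define t where "t = \<phi>0 x0"
  define \<phi> where "\<phi> x = \<phi>0 x - t" for x
  define \<psi> where "\<psi> y = (INF x\<in>UNIV. c x y - \<phi> x)" for y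
  have \<phi>_lip: "L-lipschitz_on UNIV \<phi>" using \<phi>0_lip by (auto simp: \<phi>_def lipschitz_on_def dist_real_def)
  have \<phi>_bd: "\<bar>\<phi> x\<bar> \<le> C" for x using \<phi>0_osc[of x x0] \<phi>0_osc[of x0 x] by (auto simp: \<phi>_def t_def)
  have lower: "- C \<le> c x y - \<phi> x" for x y using \<phi>_bd[of x] c_nonneg[of x y] by linarith
  have \<psi>_lip: "L-lipschitz_on UNIV \<psi>"
    unfolding \<psi>_def by (rule INF_lipschitz[where k="\<lambda>y x. c x y" and v=\<phi>, OF _ lower c_lip2]) auto
  have feas: "\<phi> x + \<psi> y \<le> c x y" for x y
  proof -
    have "\<psi> y \<le> c x y - \<phi> x" unfolding \<psi>_def using lower by (intro cINF_lower) (auto intro!: bdd_belowI)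
    then show ?thesis by simp
  qed
  have \<psi>_bd: "\<bar>\<psi> y\<bar> \<le> 2 * C" for y
  proof -
    have "- C \<le> \<psi> y" unfolding \<psi>_def using lower by (intro cINF_greatest) auto
    moreover have "\<psi> y \<le> c x0 y - \<phi> x0" using feas[of x0 y] by simp
    ultimately show ?thesis using \<phi>_bd[of x0] c_le[of x0 y] C_nonneg by linarith
  qed
  have v_le: "v y + t \<le> \<psi> y" if y: "y \<in> ?S" for y
    unfolding \<psi>_def
  proof (rule cINF_greatest)
    fix x
    have "\<phi>0 x \<le> c x y - v y" unfolding \<phi>0_def using c_v_lower y by (intro cINF_lower) (auto intro!: bdd_belowI)
    then show "v y + t \<le> c x y - \<phi> x" by (simp add: \<phi>_def)
  qed simp
  have [measurable]: "\<phi> \<in> borel_measurable borel" "\<psi> \<in> borel_measurable borel"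
    using \<phi>_lip \<psi>_lip lipschitz_measurable by auto
  have i: "integrable \<alpha> f" "integrable \<beta> g" "integrable \<alpha> \<phi>" "integrable \<beta> \<psi>"
    by (rule bounded_integrable1[OF _ fb] bounded_integrable2[OF _ gb] bounded_integrable1[OF _ \<phi>_bd]
          bounded_integrable2[OF _ \<psi>_bd], simp)+
  have "(LINT z|\<pi>. c (fst z) (snd z)) = \<epsilon> * (LINT z|\<pi>. c (fst z) (snd z) / \<epsilon>)" using \<epsilon>(1) by simp
  also have "\<dots> \<le> \<epsilon> * ((LINT x|\<alpha>. f x) + (LINT y|\<beta>. g y))" using le \<epsilon>(1) by (intro mult_left_mono) auto
  also have "\<dots> = (LINT x|\<alpha>. u x) + (LINT y|\<beta>. v y)" by (simp add: u_def[abs_def] v_def[abs_def] distrib_left)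
  also have "\<dots> \<le> (LINT x|\<alpha>. \<phi> x + t + \<eta>) + (LINT y|\<beta>. \<psi> y - t)"
  proof (rule add_mono)
  show "(LINT x|\<alpha>. u x) \<le> (LINT x|\<alpha>. \<phi> x + t + \<eta>)"
  proof (rule integral_mono)
    show "u x \<le> \<phi> x + t + \<eta>" for x using u_le[of x] by (simp add: \<phi>_def)
  qed (use i in \<open>auto simp: u_def[abs_def]\<close>)
  show "(LINT y|\<beta>. v y) \<le> (LINT y|\<beta>. \<psi> y - t)"
  proof (rule integral_mono_AE)
    show "AE y in \<beta>. v y \<le> \<psi> y - t" using S by eventually_elim (use v_le in force)
  qed (use i in \<open>auto simp: v_def[abs_def]\<close>)
  qed
  also have "\<dots> = (LINT x|\<alpha>. \<phi> x) + (LINT y|\<beta>. \<psi> y) + \<eta>"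
    using i by (simp add: \<alpha>.prob_space \<beta>.prob_space)
  finally have "(LINT z|\<pi>. c (fst z) (snd z)) \<le> (LINT x|\<alpha>. \<phi> x) + (LINT y|\<beta>. \<psi> y) + \<eta>" .
  moreover have "\<phi> x0 = 0" by (simp add: \<phi>_def t_def)
  ultimately show ?thesis by (intro that[OF \<pi> \<phi>_lip \<psi>_lip \<phi>_bd \<psi>_bd _ feas])
qed

end

section \<open>The power cost\<close>

lemma powr_diff_le:
  fixes a b R p :: real
  assumes "1 \<le> p" "0 \<le> a" "a \<le> b" "b \<le> R"
  shows "b powr p - a powr p \<le> p * R powr (p - 1) * (b - a)"
proof (cases "a = b")
  case False
  then have ab: "a < b" and R: "0 < R" using assms by auto
  have "continuous_on {a..b} (\<lambda>t. t powr p)" using assms by (intro continuous_on_powr' continuous_intros) auto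
  moreover have "((\<lambda>t. t powr p) has_real_derivative p * t powr (p - 1)) (at t)" if "a < t" "t < b" for t
    using that assms by (intro has_real_derivative_powr) auto
  ultimately obtain l z where z: "a < z" "z < b" "((\<lambda>t. t powr p) has_real_derivative l) (at z)" "b powr p - a powr p = (b - a) * l"
    using MVT[OF ab, of "\<lambda>t. t powr p"] real_differentiable_def by blast
  have "((\<lambda>t. t powr p) has_real_derivative p * z powr (p - 1)) (at z)"
    using z assms by (intro has_real_derivative_powr) auto
  then have "l = p * z powr (p - 1)" using z(3) DERIV_unique by blast
  also have "\<dots> \<le> p * R powr (p - 1)" using z assms by (intro mult_left_mono powr_mono2) auto
  finally have "(b - a) * l \<le> (b - a) * (p * R powr (p - 1))" using ab by (intro mult_left_mono) auto
  then show ?thesis using z(4) by (simp add: mult.commute)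
qed simp

text \<open>Cutting the distance off at \<open>R\<close> makes the cost globally Lipschitz and
  bounded without changing it on sets of pairs at distance at most \<open>R\<close>.\<close>

definition truncated_cost :: "real \<Rightarrow> real \<Rightarrow> 'a::euclidean_space \<Rightarrow> 'a \<Rightarrow> real" where
  "truncated_cost p R x y = min (norm (x - y)) R powr p"

lemma truncated_cost_lipschitz:
  fixes x y :: "'a::euclidean_space"
  assumes "1 \<le> p" "0 \<le> R"
  shows "(p * R powr (p - 1))-lipschitz_on UNIV (\<lambda>x. truncated_cost p R x y)"
    and "(p * R powr (p - 1))-lipschitz_on UNIV (\<lambda>y. truncated_cost p R x y)"
proof -
  have *: "\<bar>min s R powr p - min t R powr p\<bar> \<le> p * R powr (p - 1) * \<bar>s - t\<bar>" if "0 \<le> s" "0 \<le> t" for s t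
  proof -
    have le: "min t R powr p - min s R powr p \<le> p * R powr (p - 1) * \<bar>s - t\<bar>" if st: "0 \<le> s" "s \<le> t" for s t
    proof -
      have "min t R powr p - min s R powr p \<le> p * R powr (p - 1) * (min t R - min s R)"
        using st assms by (intro powr_diff_le) auto
      also have "\<dots> \<le> p * R powr (p - 1) * \<bar>s - t\<bar>" using st assms by (intro mult_left_mono) auto
      finally show ?thesis .
    qed
    have mono: "min s R powr p \<le> min t R powr p" if "0 \<le> s" "s \<le> t" for s t
      using that assms by (intro powr_mono2) auto
    show ?thesis
    proof (cases "s \<le> t")
      case True
      then show ?thesis using le[of s t] mono[of s t] that by simp
    next
      case False
      then show ?thesis using le[of t s] mono[of t s] that by (simp add: abs_minus_commute)
    qed
  qed
  have L: "0 \<le> p * R powr (p - 1)" using assms by simp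
  show "(p * R powr (p - 1))-lipschitz_on UNIV (\<lambda>x. truncated_cost p R x y)"
  proof (rule lipschitz_onI[OF _ L])
    fix x x' :: 'a
    have "\<bar>norm (x - y) - norm (x' - y)\<bar> \<le> dist x x'"
      using norm_triangle_ineq3[of "x - y" "x' - y"] by (simp add: dist_norm)
    then show "dist (truncated_cost p R x y) (truncated_cost p R x' y) \<le> p * R powr (p - 1) * dist x x'"
      unfolding truncated_cost_def dist_real_def
      by (intro order_trans[OF * mult_left_mono[OF _ L]]) auto
  qed
  show "(p * R powr (p - 1))-lipschitz_on UNIV (\<lambda>y. truncated_cost p R x y)"
  proof (rule lipschitz_onI[OF _ L])
    fix y y' :: 'a
    have "\<bar>norm (x - y) - norm (x - y')\<bar> \<le> dist y y'"
      using norm_triangle_ineq3[of "x - y" "x - y'"] by (simp add: dist_norm norm_minus_commute)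
    then show "dist (truncated_cost p R x y) (truncated_cost p R x y') \<le> p * R powr (p - 1) * dist y y'"
      unfolding truncated_cost_def dist_real_def
      by (intro order_trans[OF * mult_left_mono[OF _ L]]) auto
  qed
qed

text \<open>The gradient of \<open>x \<mapsto> norm x powr p\<close>. At \<open>0\<close> the
  formula gives \<open>0\<close>, also for \<open>p < 2\<close>, where the scalar factor alone
  would blow up.\<close>

definition norm_powr_gradient :: "real \<Rightarrow> 'a::euclidean_space \<Rightarrow> 'a" where
  "norm_powr_gradient p x = (p * norm x powr (p - 2)) *\<^sub>R x"

lemma norm_norm_powr_gradient:
  assumes "1 < p" shows "norm (norm_powr_gradient p x) = p * norm x powr (p - 1)"
proof (cases "x = 0")
  case False
  then have "norm x powr (p - 2) * norm x = norm x powr (p - 1)"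
    using powr_add[of "norm x" "p - 2" 1] by simp
  then show ?thesis using assms by (simp add: norm_powr_gradient_def abs_mult)
qed (simp add: norm_powr_gradient_def)

lemma isCont_norm_powr_gradient:
  fixes x :: "'a::euclidean_space"
  assumes "1 < p" shows "isCont (norm_powr_gradient p) x"
proof (cases "x = 0")
  case True
  have "((\<lambda>y. p * norm y powr (p - 1)) \<longlongrightarrow> p * norm (0::'a) powr (p - 1)) (at (0::'a))"
    using assms by (intro tendsto_intros) auto
  then have "((\<lambda>y. norm (norm_powr_gradient p y)) \<longlongrightarrow> 0) (at (0::'a))"
    using assms by (simp add: norm_norm_powr_gradient)
  then have "(norm_powr_gradient p \<longlongrightarrow> (0::'a)) (at 0)" by (rule tendsto_norm_zero_cancel)
  then show ?thesis using True by (simp add: isCont_def norm_powr_gradient_def)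
next
  case False
  then show ?thesis unfolding norm_powr_gradient_def[abs_def] by (intro continuous_intros) auto
qed

lemma has_derivative_norm_powr:
  fixes x :: "'a::euclidean_space"
  assumes "1 < p"
  shows "((\<lambda>x. norm x powr p) has_derivative (\<lambda>h. norm_powr_gradient p x \<bullet> h)) (at x)"
proof (cases "x = 0")
  case True
  have "((\<lambda>y. norm y powr (p - 1)) \<longlongrightarrow> norm (0::'a) powr (p - 1)) (at (0::'a))"
    using assms by (intro tendsto_intros) auto
  then have "((\<lambda>y. norm y powr (p - 1)) \<longlongrightarrow> 0) (at (0::'a))" using assms by simp
  moreover have "eventually (\<lambda>y::'a. norm y powr (p - 1) = norm (norm y powr p) / norm y) (at 0)"
  proof -
    have "norm y powr (p - 1) = norm (norm y powr p) / norm y" if "y \<noteq> 0" for y :: 'a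
      using that powr_diff[of "norm y" p 1] by simp
    then show ?thesis by (auto simp: eventually_at_filter)
  qed
  ultimately have "((\<lambda>y::'a. norm (norm y powr p) / norm y) \<longlongrightarrow> 0) (at 0)"
    by (rule Lim_transform_eventually)
  then show ?thesis using True by (simp add: has_derivative_at norm_powr_gradient_def)
next
  case False
  have "((\<lambda>x. norm x powr p) has_derivative (\<lambda>h. (p * norm x powr (p - 1)) * (sgn x \<bullet> h))) (at x)"
    using False by (auto intro!: derivative_eq_intros has_derivative_norm simp: powr_diff inner_commute field_simps)
  moreover have "(p * norm x powr (p - 1)) * (sgn x \<bullet> h) = norm_powr_gradient p x \<bullet> h" for h
  proof -
    have "norm x powr (p - 2) = norm x powr (p - 1) / norm x"
      using powr_diff[of "norm x" "p - 1" 1] False by simp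
    then show ?thesis by (simp add: norm_powr_gradient_def sgn_div_norm divide_inverse)
  qed
  ultimately show ?thesis by simp
qed

lemma norm_powr_increment:
  fixes a b :: "'a::euclidean_space"
  assumes "1 < p"
  obtains \<theta> where "0 \<le> \<theta>" "\<theta> \<le> 1" "norm (a + b) powr p - norm a powr p = norm_powr_gradient p (a + \<theta> *\<^sub>R b) \<bullet> b"
proof -
  have d: "((\<lambda>t. norm (a + t *\<^sub>R b) powr p) has_real_derivative (norm_powr_gradient p (a + t *\<^sub>R b) \<bullet> b)) (at t)" for t
  proof -
    have "((\<lambda>t. norm (a + t *\<^sub>R b) powr p) has_derivative (\<lambda>h. norm_powr_gradient p (a + t *\<^sub>R b) \<bullet> (h *\<^sub>R b))) (at t)"
      by (rule has_derivative_compose[OF _ has_derivative_norm_powr[OF assms]]) (auto intro!: derivative_eq_intros)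
    moreover have "(\<lambda>h. norm_powr_gradient p (a + t *\<^sub>R b) \<bullet> (h *\<^sub>R b)) = (*) (norm_powr_gradient p (a + t *\<^sub>R b) \<bullet> b)"
      by (simp add: fun_eq_iff)
    ultimately show ?thesis by (simp only: has_field_derivative_def)
  qed
  obtain z where "0 < z" "z < 1" "norm (a + 1 *\<^sub>R b) powr p - norm (a + 0 *\<^sub>R b) powr p = (1 - 0) * (norm_powr_gradient p (a + z *\<^sub>R b) \<bullet> b)"
    using MVT2[of 0 1 "\<lambda>t. norm (a + t *\<^sub>R b) powr p" "\<lambda>t. norm_powr_gradient p (a + t *\<^sub>R b) \<bullet> b"] d by auto
  then show ?thesis by (intro that[of z]) auto
qed

lemma norm_powr_locally_lipschitz:
  assumes "1 < p"
  obtains K where "0 \<le> K" "\<And>a b :: 'a::euclidean_space. norm a \<le> M \<Longrightarrow> norm b \<le> 1 \<Longrightarrow>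
     \<bar>norm (a + b) powr p - norm a powr p\<bar> \<le> K * norm b"
proof -
  show ?thesis
  proof (rule that[of "p * \<bar>M + 1\<bar> powr (p - 1)"])
    fix a b :: 'a assume ab: "norm a \<le> M" "norm b \<le> 1"
    obtain \<theta> where \<theta>: "0 \<le> \<theta>" "\<theta> \<le> 1" "norm (a + b) powr p - norm a powr p = norm_powr_gradient p (a + \<theta> *\<^sub>R b) \<bullet> b"
      using norm_powr_increment[OF assms] by blast
    have "norm (a + \<theta> *\<^sub>R b) \<le> norm a + \<theta> * norm b" using norm_triangle_ineq[of a "\<theta> *\<^sub>R b"] \<theta> by simp
    also have "\<dots> \<le> M + 1" using ab \<theta> by (intro add_mono mult_le_one) auto
    finally have "norm (norm_powr_gradient p (a + \<theta> *\<^sub>R b)) \<le> p * \<bar>M + 1\<bar> powr (p - 1)"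
      unfolding norm_norm_powr_gradient[OF assms] using assms by (intro mult_left_mono powr_mono2) auto
    then have "norm (norm_powr_gradient p (a + \<theta> *\<^sub>R b)) * norm b \<le> p * \<bar>M + 1\<bar> powr (p - 1) * norm b"
      by (rule mult_right_mono) simp
    then show "\<bar>norm (a + b) powr p - norm a powr p\<bar> \<le> p * \<bar>M + 1\<bar> powr (p - 1) * norm b"
      unfolding \<theta>(3) using Cauchy_Schwarz_ineq2 order_trans by blast
  qed (use assms in simp)
qed

text \<open>Continuous differentiability is all that holds at the origin when
  \<open>p < 2\<close>, so second differences are only of order \<open>o (norm b)\<close>,
  uniformly on bounded sets; for \<open>p = 1\<close> even this fails, the norm having a
  kink.\<close>

lemma norm_powr_second_difference:
  assumes "1 < p" "0 < \<epsilon>"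
  obtains \<delta> where "0 < \<delta>" "\<And>a b :: 'a::euclidean_space. norm a \<le> M \<Longrightarrow> norm b < \<delta> \<Longrightarrow>
     norm (a + b) powr p - 2 * norm a powr p + norm (a - b) powr p \<le> \<epsilon> * norm b"
proof -
  have "uniformly_continuous_on (cball 0 (M + 1)) (norm_powr_gradient p :: 'a \<Rightarrow> 'a)"
    using isCont_norm_powr_gradient[OF assms(1)]
    by (intro compact_uniformly_continuous continuous_at_imp_continuous_on) auto
  then obtain d where d: "0 < d" "\<And>x y :: 'a. x \<in> cball 0 (M + 1) \<Longrightarrow> y \<in> cball 0 (M + 1) \<Longrightarrow> dist y x < d \<Longrightarrow>
      dist (norm_powr_gradient p y) (norm_powr_gradient p x) < \<epsilon>"
    using assms(2) unfolding uniformly_continuous_on_def by metis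
  show ?thesis
  proof (rule that[of "min 1 (d / 2)"])
    fix a b :: 'a assume ab: "norm a \<le> M" "norm b < min 1 (d / 2)"
    obtain \<theta> where \<theta>: "0 \<le> \<theta>" "\<theta> \<le> 1" "norm (a + b) powr p - norm a powr p = norm_powr_gradient p (a + \<theta> *\<^sub>R b) \<bullet> b"
      using norm_powr_increment[OF assms(1)] by blast
    obtain \<theta>' where \<theta>': "0 \<le> \<theta>'" "\<theta>' \<le> 1" "norm (a - b + b) powr p - norm (a - b) powr p = norm_powr_gradient p (a - b + \<theta>' *\<^sub>R b) \<bullet> b"
      using norm_powr_increment[OF assms(1)] by blast
    let ?y = "a + \<theta> *\<^sub>R b" and ?x = "a - b + \<theta>' *\<^sub>R b"
    have small: "t * norm b \<le> norm b" if "0 \<le> t" "t \<le> 1" for t using that by (simp add: mult_left_le_one_le)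
    have "norm ?y \<le> M + 1"
      using norm_triangle_ineq[of a "\<theta> *\<^sub>R b"] small[OF \<theta>(1,2)] \<theta> ab by simp
    moreover have x': "?x = a - (1 - \<theta>') *\<^sub>R b" by (simp add: algebra_simps)
    have "norm ?x \<le> M + 1"
      unfolding x' using norm_triangle_ineq4[of a "(1 - \<theta>') *\<^sub>R b"] small[of "1 - \<theta>'"] \<theta>' ab by simp
    moreover have "dist ?y ?x < d"
    proof -
      have "?y - ?x = (\<theta> + (1 - \<theta>')) *\<^sub>R b" by (simp add: algebra_simps)
      then have "dist ?y ?x = (\<theta> + (1 - \<theta>')) * norm b" using \<theta> \<theta>' by (simp add: dist_norm)
      also have "\<dots> \<le> 2 * norm b" using \<theta> \<theta>' by (intro mult_right_mono) auto
      finally show ?thesis using ab by simp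
    qed
    ultimately have "dist (norm_powr_gradient p ?y) (norm_powr_gradient p ?x) < \<epsilon>"
      by (intro d(2)) (simp_all add: mem_cball dist_0_norm)
    then have "norm (norm_powr_gradient p ?y - norm_powr_gradient p ?x) \<le> \<epsilon>"
      by (simp only: dist_norm less_imp_le)
    then have "(norm_powr_gradient p ?y - norm_powr_gradient p ?x) \<bullet> b \<le> \<epsilon> * norm b"
      using norm_cauchy_schwarz[of "norm_powr_gradient p ?y - norm_powr_gradient p ?x" b]
        mult_right_mono[of _ \<epsilon> "norm b"] order_trans by (metis norm_ge_zero)
    then show "norm (a + b) powr p - 2 * norm a powr p + norm (a - b) powr p \<le> \<epsilon> * norm b"
      using \<theta>(3) \<theta>'(3) by (simp add: inner_diff_left)
  qed (use d in auto)
qed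

text \<open>Two functions on a segment are touched from above, at every point \<open>t\<close>, by
  vertical translates of the same function \<open>s \<mapsto> norm (x + s z - y t) powr p\<close>;
  then their increments agree, and the statement is one of the two inequalities. Where the two
  functions are differentiable, their derivatives are that of the touching function. The discrete
  form of this argument: the increment of \<open>f1\<close> over a step is bounded by the touching
  function at its left end, that of \<open>- f2\<close> by the one at its right end, the two
  differ by a second difference, and the rest telescopes.\<close>

lemma common_subgradient_increment_le:
  fixes x z :: "'a::euclidean_space" and f1 f2 :: "real \<Rightarrow> real"
  assumes p: "1 < p" and bdd: "bounded Y"
    and y: "\<And>t. t \<in> {0..1} \<Longrightarrow> y t \<in> Y"
    and f1: "\<And>s t. s \<in> {0..1} \<Longrightarrow> t \<in> {0..1} \<Longrightarrow>
      f1 s - f1 t \<le> norm (x + s *\<^sub>R z - y t) powr p - norm (x + t *\<^sub>R z - y t) powr p"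
    and f2: "\<And>s t. s \<in> {0..1} \<Longrightarrow> t \<in> {0..1} \<Longrightarrow>
      f2 s - f2 t \<le> norm (x + s *\<^sub>R z - y t) powr p - norm (x + t *\<^sub>R z - y t) powr p"
  shows "f1 1 - f1 0 \<le> f2 1 - f2 0"
proof (rule field_le_epsilon)
  fix e :: real assume e: "0 < e"
  obtain Yb where Yb: "\<And>y. y \<in> Y \<Longrightarrow> norm y \<le> Yb" using bdd bounded_iff by blast
  define M where "M = norm x + norm z + Yb"
  define q where "q t s = norm (x + s *\<^sub>R z - y t) powr p" for t s
  have M: "norm (x + t *\<^sub>R z - y t) \<le> M" if "t \<in> {0..1}" for t
  proof -
    have "norm (x + t *\<^sub>R z - y t) \<le> norm (x + t *\<^sub>R z) + norm (y t)" by (rule norm_triangle_ineq4)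
    also have "norm (x + t *\<^sub>R z) \<le> norm x + norm (t *\<^sub>R z)" by (rule norm_triangle_ineq)
    also have "norm (t *\<^sub>R z) \<le> norm z" using that by (simp add: mult_left_le_one_le)
    finally show ?thesis using Yb[OF y[OF that]] by (simp add: M_def)
  qed
  obtain K where K: "0 \<le> K" "\<And>a b :: 'a. norm a \<le> M \<Longrightarrow> norm b \<le> 1 \<Longrightarrow>
     \<bar>norm (a + b) powr p - norm a powr p\<bar> \<le> K * norm b"
    using norm_powr_locally_lipschitz[OF p] by blast
  define \<epsilon> where "\<epsilon> = e / (2 * (norm z + 1))"
  have z1: "0 < norm z + 1" by (simp add: add_nonneg_pos)
  have \<epsilon>: "0 < \<epsilon>" "\<epsilon> * norm z \<le> e / 2"
  proof -
    show "0 < \<epsilon>" using e z1 by (simp add: \<epsilon>_def)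
    then have "\<epsilon> * norm z \<le> \<epsilon> * (norm z + 1)" by simp
    also have "\<dots> = e / 2"
      unfolding \<epsilon>_def using z1 by (simp del: distrib_left_numeral)
    finally show "\<epsilon> * norm z \<le> e / 2" .
  qed
  obtain \<delta> where \<delta>: "0 < \<delta>" "\<And>a b :: 'a. norm a \<le> M \<Longrightarrow> norm b < \<delta> \<Longrightarrow>
     norm (a + b) powr p - 2 * norm a powr p + norm (a - b) powr p \<le> \<epsilon> * norm b"
    using norm_powr_second_difference[OF p \<epsilon>(1)] by blast
  \<comment> \<open>\<open>N\<close> steps of length \<open>norm b = norm z / N\<close>: small
    enough for the second difference bound and for the two boundary terms of the telescoping
    sum.\<close>
  obtain N :: nat where N: "N > norm z / min 1 \<delta> + 4 * K * norm z / e"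
    using reals_Archimedean2 by blast
  moreover have "0 \<le> norm z / min 1 \<delta>" "0 \<le> 4 * K * norm z / e" using \<delta>(1) K(1) e by simp_all
  ultimately have N1: "norm z / min 1 \<delta> < N" and N2: "4 * K * norm z / e < N" and N0: "0 < real N" by linarith+
  define h where "h = 1 / real N"
  define b where "b = h *\<^sub>R z"
  have b: "norm b < \<delta>" "norm b \<le> 1" "2 * K * norm b \<le> e / 2" "real N * norm b = norm z"
  proof -
    have nb: "norm b = norm z / real N" by (simp add: b_def h_def)
    have "norm z < real N * min 1 \<delta>" using N1 \<delta>(1) by (simp add: divide_less_eq)
    then have "norm b < min 1 \<delta>" unfolding nb using N0 by (subst divide_less_eq) (simp only: mult.commute if_True)
    then show "norm b < \<delta>" "norm b \<le> 1" by auto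
    have "4 * K * norm z < N * e" using N2 e by (simp add: divide_less_eq)
    then show "2 * K * norm b \<le> e / 2" using N0 by (simp add: nb field_simps)
    show "real N * norm b = norm z" using N0 by (simp add: nb)
  qed
  define \<tau> where "\<tau> i = real i * h" for i
  have \<tau>: "\<tau> i \<in> {0..1}" if "i \<le> N" for i using that N0 by (simp add: \<tau>_def h_def divide_le_eq)
  have \<tau>Suc: "\<tau> (Suc i) = \<tau> i + h" for i by (simp add: \<tau>_def algebra_simps)
  define G where "G i = q (\<tau> i) (\<tau> i + h) - q (\<tau> i) (\<tau> i)" for i
  have shift: "x + (t + h) *\<^sub>R z - w = (x + t *\<^sub>R z - w) + b" "x + (t - h) *\<^sub>R z - w = (x + t *\<^sub>R z - w) - b" for t w
    by (simp_all add: b_def algebra_simps)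
  have G: "\<bar>G i\<bar> \<le> K * norm b" if "i \<le> N" for i
    unfolding G_def q_def shift by (intro K(2) M b \<tau> that)
  \<comment> \<open>\<open>G i\<close> is the forward increment of the touching function at
    \<open>\<tau> i\<close>.\<close>
  have step: "(f1 (\<tau> (Suc i)) - f2 (\<tau> (Suc i))) - (f1 (\<tau> i) - f2 (\<tau> i)) \<le> G i - G (Suc i) + \<epsilon> * norm b" if i: "i < N" for i
  proof -
    have ti: "\<tau> i \<in> {0..1}" "\<tau> (Suc i) \<in> {0..1}" using \<tau> i by auto
    have "f1 (\<tau> (Suc i)) - f1 (\<tau> i) \<le> G i"
      using f1[OF ti(2,1)] by (simp add: G_def q_def \<tau>Suc)
    moreover have "f2 (\<tau> i) - f2 (\<tau> (Suc i)) \<le> q (\<tau> (Suc i)) (\<tau> (Suc i) - h) - q (\<tau> (Suc i)) (\<tau> (Suc i))"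
      using f2[OF ti(1,2)] by (simp add: q_def \<tau>Suc)
    moreover have "q (\<tau> (Suc i)) (\<tau> (Suc i) + h) - 2 * q (\<tau> (Suc i)) (\<tau> (Suc i)) + q (\<tau> (Suc i)) (\<tau> (Suc i) - h) \<le> \<epsilon> * norm b"
      unfolding q_def shift by (intro \<delta>(2) M ti b)
    ultimately show ?thesis by (simp add: G_def)
  qed
  have "(\<Sum>i<N. (f1 (\<tau> (Suc i)) - f2 (\<tau> (Suc i))) - (f1 (\<tau> i) - f2 (\<tau> i))) \<le> (\<Sum>i<N. G i - G (Suc i) + \<epsilon> * norm b)"
    using step by (intro sum_mono) auto
  also have "\<dots> = G 0 - G N + \<epsilon> * norm z"
    by (subst sum.distrib, subst sum_lessThan_telescope') (use b(4) in \<open>simp add: mult.left_commute\<close>)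
  also have "\<dots> \<le> 2 * K * norm b + e / 2" using G[of 0] G[of N] \<epsilon>(2) by (simp add: abs_le_iff)
  also have "\<dots> \<le> e" using b(3) by simp
  finally have "(f1 (\<tau> N) - f2 (\<tau> N)) - (f1 (\<tau> 0) - f2 (\<tau> 0)) \<le> e"
    by (subst (asm) sum_lessThan_telescope) simp
  moreover have "\<tau> N = 1" "\<tau> 0 = 0" using N0 by (auto simp: \<tau>_def h_def)
  ultimately show "f1 1 - f1 0 \<le> f2 1 - f2 0 + e" by simp
qed


section \<open>Optimal transport between compactly supported measures\<close>

text \<open>Passing to the reals loses nothing for measures on compact sets, where the distance is
  finite.\<close>

definition transport_cost :: "real \<Rightarrow> 'a::euclidean_space measure \<Rightarrow> 'a measure \<Rightarrow> real" where
  "transport_cost p \<alpha> \<beta> = enn2real (wasserstein p \<alpha> \<beta>) powr p"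

text \<open>The bound \<open>R\<close> on distances fixes the Lipschitz constant and the bounds of
  all dual pairs used below; they are common to all measures carried by \<open>A\<close> and
  \<open>B\<close>.\<close>

locale power_transport =
  fixes p R :: real and \<alpha> \<beta> :: "'a::euclidean_space measure" and A B :: "'a set"
  assumes p: "1 < p" and R: "0 \<le> R" "\<And>x y. x \<in> A \<Longrightarrow> y \<in> B \<Longrightarrow> norm (x - y) \<le> R"
    and prob': "prob_space \<alpha>" "prob_space \<beta>"
    and sets' [measurable_cong]: "sets \<alpha> = sets borel" "sets \<beta> = sets borel"
    and compact': "compact A" "compact B"
    and conc': "AE x in \<alpha>. x \<in> A" "AE y in \<beta>. y \<in> B"
begin

sublocale transport_problem "truncated_cost p R" "R powr p" "p * R powr (p - 1)" \<alpha> \<beta> A B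
proof (rule transport_problem.intro)
  show "truncated_cost p R x y \<le> R powr p" for x y :: 'a
    unfolding truncated_cost_def using p R(1) by (intro powr_mono2) auto
qed (rule truncated_cost_lipschitz[OF less_imp_le[OF p] R(1)] prob' sets' compact' conc'
    | simp add: truncated_cost_def)+

lemma truncated_cost_eq: "x \<in> A \<Longrightarrow> y \<in> B \<Longrightarrow> truncated_cost p R x y = norm (x - y) powr p"
  using R by (simp add: truncated_cost_def)

lemma truncated_cost_le: "truncated_cost p R x y \<le> norm (x - y) powr p"
  unfolding truncated_cost_def using p R(1) by (intro powr_mono2) auto

lemma coupling_in: "\<pi> \<in> couplings \<alpha> \<beta> \<Longrightarrow> AE z in \<pi>. fst z \<in> A \<and> snd z \<in> B"
proof -
  assume \<pi>: "\<pi> \<in> couplings \<alpha> \<beta>"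
  have [measurable]: "A \<in> sets borel" "B \<in> sets borel"
    using compact_imp_closed[OF compact(1)] compact_imp_closed[OF compact(2)] by simp_all
  show ?thesis using coupling_AE(1)[OF \<pi>, of "\<lambda>x. x \<in> A"] coupling_AE(2)[OF \<pi>, of "\<lambda>x. x \<in> B"] conc by auto
qed

lemma power_cost_measurable [measurable]:
  "(\<lambda>z. norm (fst z - snd z) powr p) \<in> borel_measurable (borel \<Otimes>\<^sub>M borel :: ('a \<times> 'a) measure)"
  by measurable

lemma power_cost_coupling:
  assumes \<pi>: "\<pi> \<in> couplings \<alpha> \<beta>"
  shows "integrable \<pi> (\<lambda>z. norm (fst z - snd z) powr p)"
    and "(LINT z|\<pi>. norm (fst z - snd z) powr p) = (LINT z|\<pi>. truncated_cost p R (fst z) (snd z))"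
    and "(\<integral>\<^sup>+ (x, y). ennreal (norm (x - y) powr p) \<partial>\<pi>) = ennreal (LINT z|\<pi>. norm (fst z - snd z) powr p)"
proof -
  have s: "sets \<pi> = sets (borel \<Otimes>\<^sub>M borel)" using \<pi> by (auto simp: couplings_def)
  have m: "(\<lambda>z. norm (fst z - snd z) powr p) \<in> borel_measurable \<pi>"
    "(\<lambda>z. truncated_cost p R (fst z) (snd z)) \<in> borel_measurable \<pi>"
    by (simp_all cong: measurable_cong_sets[OF s refl])
  have ae: "AE z in \<pi>. norm (fst z - snd z) powr p = truncated_cost p R (fst z) (snd z)"
    using coupling_in[OF \<pi>] by eventually_elim (simp add: truncated_cost_eq)
  show 1: "integrable \<pi> (\<lambda>z. norm (fst z - snd z) powr p)"
    using integrable_cong_AE[OF m ae] cost_integrable_coupling[OF \<pi>] by simp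
  show "(LINT z|\<pi>. norm (fst z - snd z) powr p) = (LINT z|\<pi>. truncated_cost p R (fst z) (snd z))"
    using ae m by (intro integral_cong_AE) auto
  show "(\<integral>\<^sup>+ (x, y). ennreal (norm (x - y) powr p) \<partial>\<pi>) = ennreal (LINT z|\<pi>. norm (fst z - snd z) powr p)"
    using nn_integral_eq_integral[OF 1] by (simp add: split_beta')
qed

lemma wasserstein_coupling:
  "wasserstein p \<alpha> \<beta> = (INF \<pi>\<in>couplings \<alpha> \<beta>. ennreal ((LINT z|\<pi>. norm (fst z - snd z) powr p) powr (1 / p)))"
  unfolding wasserstein_def
  by (intro INF_cong refl) (simp add: power_cost_coupling(3) ennreal_powr_def Bochner_Integration.integral_nonneg)

lemma transport_cost_le:
  assumes "\<pi> \<in> couplings \<alpha> \<beta>"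
  shows "transport_cost p \<alpha> \<beta> \<le> (LINT z|\<pi>. norm (fst z - snd z) powr p)" (is "_ \<le> ?J")
proof -
  have J: "0 \<le> ?J" by (simp add: Bochner_Integration.integral_nonneg)
  have "wasserstein p \<alpha> \<beta> \<le> ennreal (?J powr (1 / p))"
    unfolding wasserstein_coupling by (rule INF_lower[OF assms])
  then have "enn2real (wasserstein p \<alpha> \<beta>) \<le> ?J powr (1 / p)" by (intro enn2real_leI) auto
  then have "enn2real (wasserstein p \<alpha> \<beta>) powr p \<le> (?J powr (1 / p)) powr p" using p by (intro powr_mono2) auto
  also have "\<dots> = ?J" using p J by (simp add: powr_powr)
  finally show ?thesis by (simp add: transport_cost_def)
qed

text \<open>The infimum in the Wasserstein distance is over \<open>p\<close>-th roots; it is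
  turned into a statement on \<open>p\<close>-th powers by monotonicity, and the existence of a
  coupling makes the infimum finite.\<close>

lemma transport_cost_greatest:
  assumes "\<And>\<pi>. \<pi> \<in> couplings \<alpha> \<beta> \<Longrightarrow> m \<le> (LINT z|\<pi>. norm (fst z - snd z) powr p)"
  shows "m \<le> transport_cost p \<alpha> \<beta>"
proof -
  let ?J = "\<lambda>\<pi>. LINT z|\<pi>. norm (fst z - snd z) powr p"
  define m' where "m' = max 0 m"
  have m': "m' \<le> ?J \<pi>" if "\<pi> \<in> couplings \<alpha> \<beta>" for \<pi>
    using assms[OF that] by (simp add: m'_def Bochner_Integration.integral_nonneg)
  obtain \<pi> where \<pi>: "\<pi> \<in> couplings \<alpha> \<beta>" using kantorovich_duality[of 1] by (metis zero_less_one)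
  have "wasserstein p \<alpha> \<beta> \<le> ennreal (?J \<pi> powr (1 / p))"
    unfolding wasserstein_coupling by (rule INF_lower[OF \<pi>])
  then have fin: "wasserstein p \<alpha> \<beta> < \<top>" using ennreal_less_top le_less_trans by blast
  have "ennreal (m' powr (1 / p)) \<le> wasserstein p \<alpha> \<beta>"
    unfolding wasserstein_coupling
    using p m' by (intro INF_greatest ennreal_leI powr_mono2) (auto simp: m'_def)
  then have "m' powr (1 / p) \<le> enn2real (wasserstein p \<alpha> \<beta>)"
    using fin by (metis enn2real_ennreal enn2real_mono powr_ge_zero)
  then have "(m' powr (1 / p)) powr p \<le> transport_cost p \<alpha> \<beta>"
    unfolding transport_cost_def using p by (intro powr_mono2) auto
  then have "m' \<le> transport_cost p \<alpha> \<beta>" using p by (simp add: powr_powr m'_def)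
  then show ?thesis by (simp add: m'_def)
qed

lemma dual_le_coupling:
  assumes \<pi>: "\<pi> \<in> couplings \<alpha> \<beta>" and [measurable]: "\<phi> \<in> borel_measurable borel" "\<psi> \<in> borel_measurable borel"
    and int: "integrable \<alpha> \<phi>" "integrable \<beta> \<psi>"
    and feas: "\<And>x y. x \<in> A \<Longrightarrow> y \<in> B \<Longrightarrow> \<phi> x + \<psi> y \<le> norm (x - y) powr p"
  shows "(LINT x|\<alpha>. \<phi> x) + (LINT y|\<beta>. \<psi> y) \<le> (LINT z|\<pi>. norm (fst z - snd z) powr p)"
proof -
  have i: "integrable \<pi> (\<lambda>z. \<phi> (fst z))" "integrable \<pi> (\<lambda>z. \<psi> (snd z))"
    using int coupling_integral(1,3)[OF \<pi>] assms(2,3) by auto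
  have "(LINT x|\<alpha>. \<phi> x) + (LINT y|\<beta>. \<psi> y) = (LINT z|\<pi>. \<phi> (fst z) + \<psi> (snd z))"
    using Bochner_Integration.integral_add[OF i] coupling_integral(2,4)[OF \<pi>] assms(2,3) by simp
  also have "\<dots> \<le> (LINT z|\<pi>. norm (fst z - snd z) powr p)"
  proof (rule integral_mono_AE)
    show "AE z in \<pi>. \<phi> (fst z) + \<psi> (snd z) \<le> norm (fst z - snd z) powr p"
      using coupling_in[OF \<pi>] by eventually_elim (simp add: feas)
  qed (use i power_cost_coupling(1)[OF \<pi>] in auto)
  finally show ?thesis .
qed

lemma dual_le_transport_cost:
  assumes "\<phi> \<in> borel_measurable borel" "\<psi> \<in> borel_measurable borel" "integrable \<alpha> \<phi>" "integrable \<beta> \<psi>"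
    and "\<And>x y. x \<in> A \<Longrightarrow> y \<in> B \<Longrightarrow> \<phi> x + \<psi> y \<le> norm (x - y) powr p"
  shows "(LINT x|\<alpha>. \<phi> x) + (LINT y|\<beta>. \<psi> y) \<le> transport_cost p \<alpha> \<beta>"
  by (intro transport_cost_greatest dual_le_coupling assms)

text \<open>Both approximate optimizers at once, with bounds that depend on \<open>p\<close> and
  \<open>R\<close> only.\<close>

lemma transport_duality:
  assumes "0 < \<eta>"
  obtains \<pi> \<phi> \<psi> where "\<pi> \<in> couplings \<alpha> \<beta>" "(p * R powr (p - 1))-lipschitz_on UNIV \<phi>" "(p * R powr (p - 1))-lipschitz_on UNIV \<psi>"
    "\<And>x. \<bar>\<phi> x\<bar> \<le> R powr p" "\<And>x. \<bar>\<psi> x\<bar> \<le> 2 * R powr p" "\<phi> x0 = 0"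
    "\<And>x y. \<phi> x + \<psi> y \<le> norm (x - y) powr p"
    "(LINT z|\<pi>. norm (fst z - snd z) powr p) \<le> transport_cost p \<alpha> \<beta> + \<eta>"
    "transport_cost p \<alpha> \<beta> \<le> (LINT x|\<alpha>. \<phi> x) + (LINT y|\<beta>. \<psi> y) + \<eta>"
proof -
  obtain \<pi> \<phi> \<psi> where \<pi>: "\<pi> \<in> couplings \<alpha> \<beta>" and \<phi>: "(p * R powr (p - 1))-lipschitz_on UNIV \<phi>"
    and \<psi>: "(p * R powr (p - 1))-lipschitz_on UNIV \<psi>"
    and b: "\<And>x. \<bar>\<phi> x\<bar> \<le> R powr p" "\<And>x. \<bar>\<psi> x\<bar> \<le> 2 * R powr p" "\<phi> x0 = 0"
    and feas: "\<And>x y. \<phi> x + \<psi> y \<le> truncated_cost p R x y"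
    and le: "(LINT z|\<pi>. truncated_cost p R (fst z) (snd z)) \<le> (LINT x|\<alpha>. \<phi> x) + (LINT y|\<beta>. \<psi> y) + \<eta>"
    by (rule kantorovich_duality[OF assms, where ?x0.0 = x0]) blast
  have feas': "\<phi> x + \<psi> y \<le> norm (x - y) powr p" for x y
    using feas[of x y] truncated_cost_le[of x y] by linarith
  have m: "\<phi> \<in> borel_measurable borel" "\<psi> \<in> borel_measurable borel"
    using \<phi> \<psi> lipschitz_measurable by auto
  have "(LINT x|\<alpha>. \<phi> x) + (LINT y|\<beta>. \<psi> y) \<le> transport_cost p \<alpha> \<beta>"
    by (rule dual_le_transport_cost[OF m bounded_integrable1[OF m(1) b(1)] bounded_integrable2[OF m(2) b(2)] feas'])
  then show ?thesis
    using le transport_cost_le[OF \<pi>] power_cost_coupling(2)[OF \<pi>]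
    by (intro that[OF \<pi> \<phi> \<psi> b feas']) auto
qed

end

section \<open>Uniqueness of optimal potentials\<close>

text \<open>Infima of continuous functions, such as \<open>c\<close>-transforms, have this
  property, and it is what is needed to pass to the limit in an inequality
  \<open>c\<^sub>n \<le> u (x\<^sub>n) + v (y\<^sub>n)\<close>.\<close>

definition upper_semicontinuous :: "('a::topological_space \<Rightarrow> ereal) \<Rightarrow> bool" where
  "upper_semicontinuous u \<longleftrightarrow> (\<forall>r::real. open {x. u x < ereal r})"

lemma upper_semicontinuous_measurable:
  assumes "upper_semicontinuous u" shows "u \<in> borel_measurable borel"
proof (rule borel_measurableI_less)
  fix y :: ereal
  show "{x \<in> space borel. u x < y} \<in> sets borel"
  proof (cases y)
    case PInf
    have "{x. u x < \<infinity>} = (\<Union>n::nat. {x. u x < ereal (real n)})"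
    proof (intro set_eqI iffI; clarsimp)
      fix x assume "u x \<noteq> \<infinity>"
      then show "\<exists>n::nat. u x < ereal (real n)"
        by (cases "u x") (auto intro: reals_Archimedean2)
    qed
    then show ?thesis using PInf assms by (auto simp: upper_semicontinuous_def)
  qed (use assms in \<open>auto simp: upper_semicontinuous_def\<close>)
qed

lemma upper_semicontinuous_sum_limit:
  fixes u v :: "'a::euclidean_space \<Rightarrow> ereal"
  assumes u: "upper_semicontinuous u" and v: "upper_semicontinuous v"
    and fin: "\<And>x. u x \<noteq> \<infinity>" "\<And>y. v y \<noteq> \<infinity>"
    and lim: "xs \<longlonglongrightarrow> x" "ys \<longlonglongrightarrow> y" "cs \<longlonglongrightarrow> (c::real)"
    and le: "\<And>n. ereal (cs n) \<le> u (xs n) + v (ys n)"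
  shows "ereal c \<le> u x + v y"
proof (rule ccontr)
  assume "\<not> ereal c \<le> u x + v y"
  then have less: "u x + v y < ereal c" by simp
  obtain r s where rs: "u x < ereal r" "v y < ereal s" "r + s < c"
  proof (cases "u x")
    case (real a)
    show ?thesis
    proof (cases "v y")
      case (real b)
      with \<open>u x = ereal a\<close> less have "a + b < c" by simp
      then show ?thesis
        by (intro that[of "a + (c - a - b) / 3" "b + (c - a - b) / 3"]) (auto simp: \<open>u x = ereal a\<close> real field_simps)
    next
      case MInf
      then show ?thesis by (intro that[of "a + 1" "c - a - 2"]) (auto simp: real)
    qed (use fin in auto)
  next
    case MInf
    show ?thesis
    proof (cases "v y")
      case (real b)
      then show ?thesis by (intro that[of "c - b - 2" "b + 1"]) (auto simp: MInf)
    next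
      case MInf
      then show ?thesis by (intro that[of "c - 1" 0]) (auto simp: \<open>u x = - \<infinity>\<close>)
    qed (use fin in auto)
  qed (use fin in auto)
  have "eventually (\<lambda>n. u (xs n) < ereal r) sequentially"
    using topological_tendstoD[OF lim(1), of "{x. u x < ereal r}"] u rs by (auto simp: upper_semicontinuous_def)
  moreover have "eventually (\<lambda>n. v (ys n) < ereal s) sequentially"
    using topological_tendstoD[OF lim(2), of "{x. v x < ereal s}"] v rs by (auto simp: upper_semicontinuous_def)
  moreover have "eventually (\<lambda>n. r + s < cs n) sequentially"
    using order_tendstoD(1)[OF lim(3) rs(3)] .
  ultimately have "eventually (\<lambda>n. False) sequentially"
  proof eventually_elim
    case (elim n)
    then have "u (xs n) + v (ys n) \<le> ereal r + ereal s" by (intro add_mono) auto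
    also have "\<dots> < ereal (cs n)" using elim by simp
    finally show False using le[of n] by simp
  qed
  then show False by simp
qed

context power_transport begin

definition dual_optimal :: "('a \<Rightarrow> ereal) \<Rightarrow> ('a \<Rightarrow> ereal) \<Rightarrow> bool" where
  "dual_optimal u v \<longleftrightarrow> upper_semicontinuous u \<and> upper_semicontinuous v \<and>
     (\<forall>x. u x \<noteq> \<infinity>) \<and> (\<forall>y. v y \<noteq> \<infinity>) \<and>
     (\<forall>x y. u x + v y \<le> ereal (norm (x - y) powr p)) \<and>
     (AE x in \<alpha>. u x \<noteq> - \<infinity>) \<and> (AE y in \<beta>. v y \<noteq> - \<infinity>) \<and>
     integrable \<alpha> (\<lambda>x. real_of_ereal (u x)) \<and> integrable \<beta> (\<lambda>y. real_of_ereal (v y)) \<and>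
     transport_cost p \<alpha> \<beta> \<le> (LINT x|\<alpha>. real_of_ereal (u x)) + (LINT y|\<beta>. real_of_ereal (v y))"

text \<open>For an optimal pair the slack \<open>norm (x - y) powr p - u x - v y\<close> is
  nonnegative and has integral at most \<open>\<eta>\<close> under an
  \<open>\<eta>\<close>-optimal coupling. A set to which every coupling gives mass at least
  \<open>m\<close> therefore contains points at which the slacks of two optimal pairs are small
  simultaneously.\<close>

lemma near_contact:
  assumes uv: "dual_optimal u v" and uv': "dual_optimal u' v'"
    and [measurable]: "E \<in> sets (borel \<Otimes>\<^sub>M borel)"
    and m: "0 < m" "\<And>\<pi>. \<pi> \<in> couplings \<alpha> \<beta> \<Longrightarrow> m \<le> measure \<pi> E" and e: "0 < e"
  obtains x y where "(x, y) \<in> E" "x \<in> A" "y \<in> B"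
    "ereal (norm (x - y) powr p - e) \<le> u x + v y" "ereal (norm (x - y) powr p - e) \<le> u' x + v' y"
proof -
  \<comment> \<open>The factor \<open>1 / 4\<close> leaves the sum of the two slacks, at most
    \<open>2 * \<eta>\<close> in the mean, strictly below \<open>m * e\<close>.\<close>
  define \<eta> where "\<eta> = m * e / 4"
  have \<eta>: "0 < \<eta>" using m(1) e by (simp add: \<eta>_def)
  obtain \<pi> where \<pi>: "\<pi> \<in> couplings \<alpha> \<beta>" and J: "(LINT z|\<pi>. norm (fst z - snd z) powr p) \<le> transport_cost p \<alpha> \<beta> + \<eta>"
    by (rule transport_duality[OF \<eta>]) blast
  interpret \<pi>: prob_space \<pi> using coupling_prob_space[OF \<pi> prob(1)] .
  have s: "sets \<pi> = sets (borel \<Otimes>\<^sub>M borel)" using \<pi> by (auto simp: couplings_def)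
  have slack: "integrable \<pi> (\<lambda>z. norm (fst z - snd z) powr p - real_of_ereal (u (fst z)) - real_of_ereal (v (snd z))) \<and>
      (LINT z|\<pi>. norm (fst z - snd z) powr p - real_of_ereal (u (fst z)) - real_of_ereal (v (snd z))) \<le> \<eta> \<and>
      (AE z in \<pi>. u (fst z) + v (snd z) = ereal (real_of_ereal (u (fst z)) + real_of_ereal (v (snd z)))) \<and>
      (AE z in \<pi>. real_of_ereal (u (fst z)) + real_of_ereal (v (snd z)) \<le> norm (fst z - snd z) powr p)"
    if uv: "dual_optimal u v" for u v
  proof -
    have [measurable]: "u \<in> borel_measurable borel" "v \<in> borel_measurable borel"
      using uv upper_semicontinuous_measurable by (auto simp: dual_optimal_def)
    have i: "integrable \<pi> (\<lambda>z. real_of_ereal (u (fst z)))" "integrable \<pi> (\<lambda>z. real_of_ereal (v (snd z)))"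
      using uv coupling_integral(1)[OF \<pi>, of "\<lambda>x. real_of_ereal (u x)"] coupling_integral(3)[OF \<pi>, of "\<lambda>x. real_of_ereal (v x)"]
      by (auto simp: dual_optimal_def)
    have "(LINT z|\<pi>. norm (fst z - snd z) powr p - real_of_ereal (u (fst z)) - real_of_ereal (v (snd z))) =
      (LINT z|\<pi>. norm (fst z - snd z) powr p) - (LINT x|\<alpha>. real_of_ereal (u x)) - (LINT y|\<beta>. real_of_ereal (v y))"
      using Bochner_Integration.integral_diff[OF Bochner_Integration.integrable_diff[OF power_cost_coupling(1)[OF \<pi>] i(1)] i(2)]
        Bochner_Integration.integral_diff[OF power_cost_coupling(1)[OF \<pi>] i(1)]
        coupling_integral(2)[OF \<pi>, of "\<lambda>x. real_of_ereal (u x)"] coupling_integral(4)[OF \<pi>, of "\<lambda>x. real_of_ereal (v x)"]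
      by simp
    also have "\<dots> \<le> \<eta>" using J uv by (simp add: dual_optimal_def)
    finally have 1: "(LINT z|\<pi>. norm (fst z - snd z) powr p - real_of_ereal (u (fst z)) - real_of_ereal (v (snd z))) \<le> \<eta>" .
    have "AE z in \<pi>. u (fst z) \<noteq> - \<infinity>" "AE z in \<pi>. v (snd z) \<noteq> - \<infinity>"
      using uv coupling_AE(1)[OF \<pi>, of "\<lambda>x. u x \<noteq> - \<infinity>"] coupling_AE(2)[OF \<pi>, of "\<lambda>x. v x \<noteq> - \<infinity>"]
      by (auto simp: dual_optimal_def)
    then have 2: "AE z in \<pi>. u (fst z) + v (snd z) = ereal (real_of_ereal (u (fst z)) + real_of_ereal (v (snd z)))"
    proof eventually_elim
      case (elim z)
      then show ?case using uv by (cases "u (fst z)"; cases "v (snd z)") (auto simp: dual_optimal_def)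
    qed
    then have 3: "AE z in \<pi>. real_of_ereal (u (fst z)) + real_of_ereal (v (snd z)) \<le> norm (fst z - snd z) powr p"
    proof eventually_elim
      case (elim z)
      have "u (fst z) + v (snd z) \<le> ereal (norm (fst z - snd z) powr p)" using uv by (auto simp: dual_optimal_def)
      then show ?case unfolding elim by simp
    qed
    show ?thesis using 1 2 3 i power_cost_coupling(1)[OF \<pi>] by simp
  qed
  note s1 = slack[OF uv] and s2 = slack[OF uv']
  define s where "s u v z = norm (fst z - snd z) powr p - real_of_ereal (u (fst z)) - real_of_ereal (v (snd z))" for u v and z :: "'a \<times> 'a"
  have int: "integrable \<pi> (s u v)" "integrable \<pi> (s u' v')"
    and le: "(LINT z|\<pi>. s u v z) \<le> \<eta>" "(LINT z|\<pi>. s u' v' z) \<le> \<eta>"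
    unfolding s_def[abs_def] using s1 s2 by blast+
  have sum_le: "(LINT z|\<pi>. s u v z + s u' v' z) \<le> 2 * \<eta>"
    using Bochner_Integration.integral_add[OF int] le by simp
  have E: "E \<in> sets \<pi>" by (simp add: \<open>sets \<pi> = _\<close>)
  show ?thesis
  proof (rule ccontr)
    assume neg: "\<not> thesis"
    have "AE z in \<pi>. indicator E z * e \<le> s u v z + s u' v' z"
      using coupling_in[OF \<pi>] s1[THEN conjunct2, THEN conjunct2, THEN conjunct1] s1[THEN conjunct2, THEN conjunct2, THEN conjunct2]
        s2[THEN conjunct2, THEN conjunct2, THEN conjunct1] s2[THEN conjunct2, THEN conjunct2, THEN conjunct2]
    proof eventually_elim
      case (elim z)
      have nn: "0 \<le> s u v z" "0 \<le> s u' v' z" using elim by (auto simp: s_def)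
      show ?case
      proof (rule ccontr)
        assume "\<not> ?case"
        then have z: "z \<in> E" and less: "s u v z + s u' v' z < e" using nn by (cases "z \<in> E"; simp)+
        have "thesis"
        proof (rule that[of "fst z" "snd z"])
          show "ereal (norm (fst z - snd z) powr p - e) \<le> u (fst z) + v (snd z)"
            using elim(2) less nn by (simp add: s_def)
          show "ereal (norm (fst z - snd z) powr p - e) \<le> u' (fst z) + v' (snd z)"
            using elim(4) less nn by (simp add: s_def)
        qed (use elim z in auto)
        then show False using neg by simp
      qed
    qed
    then have "(LINT z|\<pi>. indicator E z * e) \<le> (LINT z|\<pi>. s u v z + s u' v' z)"
      using E int by (intro integral_mono_AE) (auto intro!: integrable_mult_left integrable_real_indicator simp: \<pi>.emeasure_eq_measure)
    then have "measure \<pi> E * e \<le> 2 * \<eta>" using sum_le E by simp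
    moreover have "m * e \<le> measure \<pi> E * e" using m(2)[OF \<pi>] e by (intro mult_right_mono) auto
    moreover have "0 < m * e" using m(1) e by simp
    moreover have "2 * \<eta> = m * e / 2" by (simp add: \<eta>_def)
    ultimately show False by linarith
  qed
qed

text \<open>Near contact points accumulate by compactness, and upper semicontinuity turns the
  limit into a common contact point of both pairs.\<close>

lemma contact_limit:
  assumes uv: "dual_optimal u v" and uv': "dual_optimal u' v'"
    and E: "\<And>e. 0 < e \<Longrightarrow> E e \<in> sets (borel \<Otimes>\<^sub>M borel)"
    and m: "\<And>e. 0 < e \<Longrightarrow> \<exists>m>0. \<forall>\<pi>\<in>couplings \<alpha> \<beta>. m \<le> measure \<pi> (E e)"
  obtains x y xs ys where "x \<in> A" "y \<in> B" "u x + v y = ereal (norm (x - y) powr p)" "u' x + v' y = ereal (norm (x - y) powr p)"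
    "xs \<longlonglongrightarrow> x" "ys \<longlonglongrightarrow> y" "\<And>n::nat. \<exists>k\<ge>n. (xs n, ys n) \<in> E (1 / real (Suc k))"
proof -
  have "\<exists>z. z \<in> E (1 / real (Suc n)) \<and> fst z \<in> A \<and> snd z \<in> B \<and>
    ereal (norm (fst z - snd z) powr p - 1 / real (Suc n)) \<le> u (fst z) + v (snd z) \<and>
    ereal (norm (fst z - snd z) powr p - 1 / real (Suc n)) \<le> u' (fst z) + v' (snd z)" for n
  proof -
    have pos: "0 < 1 / real (Suc n)" by simp
    obtain m0 where m0: "0 < m0" "\<And>\<pi>. \<pi> \<in> couplings \<alpha> \<beta> \<Longrightarrow> m0 \<le> measure \<pi> (E (1 / real (Suc n)))"
      using m[OF pos] by blast
    show ?thesis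
      by (rule near_contact[OF uv uv' E[OF pos] m0 pos]) force+
  qed
  then obtain z where z: "\<And>n. z n \<in> E (1 / real (Suc n))" "\<And>n. fst (z n) \<in> A" "\<And>n. snd (z n) \<in> B"
    "\<And>n. ereal (norm (fst (z n) - snd (z n)) powr p - 1 / real (Suc n)) \<le> u (fst (z n)) + v (snd (z n))"
    "\<And>n. ereal (norm (fst (z n) - snd (z n)) powr p - 1 / real (Suc n)) \<le> u' (fst (z n)) + v' (snd (z n))"
    by metis
  have "compact (A \<times> B)" using compact by (intro compact_Times)
  moreover have "\<forall>n. z n \<in> A \<times> B" using z(2,3) by (simp add: mem_Times_iff)
  ultimately obtain l r where l: "l \<in> A \<times> B" "strict_mono (r :: nat \<Rightarrow> nat)" "(z \<circ> r) \<longlonglongrightarrow> l"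
    unfolding compact_def by blast
  have lx: "(\<lambda>n. fst (z (r n))) \<longlonglongrightarrow> fst l" and ly: "(\<lambda>n. snd (z (r n))) \<longlonglongrightarrow> snd l"
    using tendsto_fst[OF l(3)] tendsto_snd[OF l(3)] by (auto simp: o_def)
  have "(\<lambda>n. 1 / real (Suc n)) \<longlonglongrightarrow> 0" by (rule LIMSEQ_Suc[OF lim_1_over_n])
  from LIMSEQ_subseq_LIMSEQ[OF this l(2)] have "(\<lambda>n. 1 / real (Suc (r n))) \<longlonglongrightarrow> 0" by (simp only: o_def)
  then have lc: "(\<lambda>n. norm (fst (z (r n)) - snd (z (r n))) powr p - 1 / real (Suc (r n))) \<longlonglongrightarrow> norm (fst l - snd l) powr p - 0"
    using p by (intro tendsto_intros tendsto_powr' lx ly) auto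
  have fin: "\<And>x. u x \<noteq> \<infinity>" "\<And>y. v y \<noteq> \<infinity>" "\<And>x. u' x \<noteq> \<infinity>" "\<And>y. v' y \<noteq> \<infinity>"
    and usc: "upper_semicontinuous u" "upper_semicontinuous v" "upper_semicontinuous u'" "upper_semicontinuous v'"
    using uv uv' by (auto simp: dual_optimal_def)
  have 1: "ereal (norm (fst l - snd l) powr p - 0) \<le> u (fst l) + v (snd l)"
    by (rule upper_semicontinuous_sum_limit[OF usc(1,2) fin(1,2) lx ly lc]) (rule z(4))
  have 2: "ereal (norm (fst l - snd l) powr p - 0) \<le> u' (fst l) + v' (snd l)"
    by (rule upper_semicontinuous_sum_limit[OF usc(3,4) fin(3,4) lx ly lc]) (rule z(5))
  have 3: "u (fst l) + v (snd l) \<le> ereal (norm (fst l - snd l) powr p)" "u' (fst l) + v' (snd l) \<le> ereal (norm (fst l - snd l) powr p)"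
    using uv uv' by (auto simp: dual_optimal_def)
  show ?thesis
  proof (rule that[OF _ _ _ _ lx ly])
    show "\<exists>k\<ge>n. (fst (z (r n)), snd (z (r n))) \<in> E (1 / real (Suc k))" for n
      using z(1)[of "r n"] seq_suble[OF l(2), of n] by (intro exI[of _ "r n"]) auto
  qed (use l(1) 1 2 3 in \<open>auto simp: mem_Times_iff intro!: antisym\<close>)
qed

text \<open>Shrinking balls around a support point of \<open>\<alpha>\<close> have mass that is
  the same under every coupling, so every such point belongs to a common contact pair.\<close>

lemma contact_fst:
  assumes uv: "dual_optimal u v" "dual_optimal u' v'" and x: "x \<in> msupport \<alpha>"
  obtains y where "y \<in> B" "u x + v y = ereal (norm (x - y) powr p)" "u' x + v' y = ereal (norm (x - y) powr p)"
proof -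
  obtain x' y xs ys where *: "x' \<in> A" "y \<in> B" "u x' + v y = ereal (norm (x' - y) powr p)" "u' x' + v' y = ereal (norm (x' - y) powr p)"
    "xs \<longlonglongrightarrow> x'" "ys \<longlonglongrightarrow> y" "\<And>n::nat. \<exists>k\<ge>n. (xs n, ys n) \<in> ball x (1 / real (Suc k)) \<times> (UNIV :: 'a set)"
  proof (rule contact_limit[OF uv, of "\<lambda>e. ball x e \<times> UNIV"])
    fix e :: real assume e: "0 < e"
    have "0 < measure \<alpha> (ball x e)"
      using x e by (auto simp: msupport_def \<alpha>.emeasure_eq_measure)
    moreover have "measure \<pi> (ball x e \<times> UNIV) = measure \<alpha> (ball x e)" if \<pi>: "\<pi> \<in> couplings \<alpha> \<beta>" for \<pi>
    proof -
      have s: "sets \<pi> = sets (borel \<Otimes>\<^sub>M borel)" and d: "distr \<pi> borel fst = \<alpha>" using \<pi> by (auto simp: couplings_def)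
      have "measure (distr \<pi> borel fst) (ball x e) = measure \<pi> (fst -` ball x e \<inter> space \<pi>)"
        by (rule measure_distr) (auto cong: measurable_cong_sets[OF s refl])
      moreover have "fst -` ball x e \<inter> space \<pi> = ball x e \<times> UNIV"
        using sets_eq_imp_space_eq[OF s] by (auto simp: space_pair_measure)
      ultimately show ?thesis by (simp add: d)
    qed
    ultimately show "\<exists>m>0. \<forall>\<pi>\<in>couplings \<alpha> \<beta>. m \<le> measure \<pi> (ball x e \<times> UNIV)" by auto
  qed (auto intro!: pair_measureI)
  have "xs \<longlonglongrightarrow> x"
  proof (rule metric_LIMSEQ_I)
    fix r :: real assume "0 < r"
    then obtain N where N: "1 / real (Suc N) < r" using nat_approx_posE by blast
    have "dist (xs n) x < r" if n: "n \<ge> N" for n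
    proof -
      obtain k where "k \<ge> n" "dist x (xs n) < 1 / real (Suc k)" using *(7)[of n] by auto
      moreover have "1 / real (Suc k) \<le> 1 / real (Suc N)" using \<open>k \<ge> n\<close> n by (intro divide_left_mono) auto
      ultimately show ?thesis using N by (simp add: dist_commute)
    qed
    then show "\<exists>no. \<forall>n\<ge>no. dist (xs n) x < r" by blast
  qed
  then have "x' = x" using *(5) LIMSEQ_unique by blast
  then show ?thesis using * that by blast
qed

lemma contact_snd:
  assumes uv: "dual_optimal u v" "dual_optimal u' v'" and y: "y \<in> msupport \<beta>"
  obtains x where "x \<in> A" "u x + v y = ereal (norm (x - y) powr p)" "u' x + v' y = ereal (norm (x - y) powr p)"
proof -
  obtain x y' xs ys where *: "x \<in> A" "y' \<in> B" "u x + v y' = ereal (norm (x - y') powr p)" "u' x + v' y' = ereal (norm (x - y') powr p)"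
    "xs \<longlonglongrightarrow> x" "ys \<longlonglongrightarrow> y'" "\<And>n::nat. \<exists>k\<ge>n. (xs n, ys n) \<in> (UNIV :: 'a set) \<times> ball y (1 / real (Suc k))"
  proof (rule contact_limit[OF uv, of "\<lambda>e. UNIV \<times> ball y e"])
    fix e :: real assume e: "0 < e"
    have "0 < measure \<beta> (ball y e)"
      using y e by (auto simp: msupport_def \<beta>.emeasure_eq_measure)
    moreover have "measure \<pi> (UNIV \<times> ball y e) = measure \<beta> (ball y e)" if \<pi>: "\<pi> \<in> couplings \<alpha> \<beta>" for \<pi>
    proof -
      have s: "sets \<pi> = sets (borel \<Otimes>\<^sub>M borel)" and d: "distr \<pi> borel snd = \<beta>" using \<pi> by (auto simp: couplings_def)
      have "measure (distr \<pi> borel snd) (ball y e) = measure \<pi> (snd -` ball y e \<inter> space \<pi>)"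
        by (rule measure_distr) (auto cong: measurable_cong_sets[OF s refl])
      moreover have "snd -` ball y e \<inter> space \<pi> = UNIV \<times> ball y e"
        using sets_eq_imp_space_eq[OF s] by (auto simp: space_pair_measure)
      ultimately show ?thesis by (simp add: d)
    qed
    ultimately show "\<exists>m>0. \<forall>\<pi>\<in>couplings \<alpha> \<beta>. m \<le> measure \<pi> (UNIV \<times> ball y e)" by auto
  qed (auto intro!: pair_measureI)
  have "ys \<longlonglongrightarrow> y"
  proof (rule metric_LIMSEQ_I)
    fix r :: real assume "0 < r"
    then obtain N where N: "1 / real (Suc N) < r" using nat_approx_posE by blast
    have "dist (ys n) y < r" if n: "n \<ge> N" for n
    proof -
      obtain k where "k \<ge> n" "dist y (ys n) < 1 / real (Suc k)" using *(7)[of n] by auto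
      moreover have "1 / real (Suc k) \<le> 1 / real (Suc N)" using \<open>k \<ge> n\<close> n by (intro divide_left_mono) auto
      ultimately show ?thesis using N by (simp add: dist_commute)
    qed
    then show "\<exists>no. \<forall>n\<ge>no. dist (ys n) y < r" by blast
  qed
  then have "y' = y" using *(6) LIMSEQ_unique by blast
  then show ?thesis using * that by blast
qed

text \<open>Let \<open>a, a'\<close> be the first components of two optimal pairs and
  \<open>Y x\<close> a common contact point of \<open>x\<close>. Then both \<open>a\<close> and
  \<open>a'\<close> are touched from above at \<open>x\<close> by
  \<open>x' \<mapsto> norm (x' - Y x) powr p\<close> up to a constant, so their increments agree
  along every segment in \<open>A\<close>. Hence \<open>a' - a\<close> is locally constant on the
  interior, constant by connectedness, and constant on \<open>A\<close> by continuity and density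
  of the interior. The second components follow at contact points. The second pair equal to the
  first already yields that potentials are finite and continuous on the support.\<close>

theorem dual_optimal_unique:
  assumes uv: "dual_optimal u v" "dual_optimal u' v'"
    and supp: "A = msupport \<alpha>" "B = msupport \<beta>"
    and conn: "connected (interior A)" "A \<subseteq> closure (interior A)"
  obtains k :: real where "\<And>x. x \<in> A \<Longrightarrow> \<bar>u x\<bar> \<noteq> \<infinity>" "\<And>y. y \<in> B \<Longrightarrow> \<bar>v y\<bar> \<noteq> \<infinity>"
    "\<And>x. x \<in> A \<Longrightarrow> u' x = u x + ereal k" "\<And>y. y \<in> B \<Longrightarrow> v' y = v y - ereal k"
    "continuous_on A (\<lambda>x. real_of_ereal (u x))"
proof -
  have fin: "u x \<noteq> \<infinity>" "v y \<noteq> \<infinity>" "u' x \<noteq> \<infinity>" "v' y \<noteq> \<infinity>"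
    and feas: "u x + v y \<le> ereal (norm (x - y) powr p)" "u' x + v' y \<le> ereal (norm (x - y) powr p)" for x y
    using uv by (auto simp: dual_optimal_def)
  define a where "a x = real_of_ereal (u x)" for x
  define a' where "a' x = real_of_ereal (u' x)" for x
  define b where "b x = real_of_ereal (v x)" for x
  define b' where "b' x = real_of_ereal (v' x)" for x
  have real: "u x = ereal (a x) \<and> v y = ereal (b y)" if "u x + v y = ereal r" for x y r
    using that fin(1)[of x] fin(2)[of y] unfolding a_def b_def by (cases "u x"; cases "v y") auto
  have real': "u' x = ereal (a' x) \<and> v' y = ereal (b' y)" if "u' x + v' y = ereal r" for x y r
    using that fin(3)[of x] fin(4)[of y] unfolding a'_def b'_def by (cases "u' x"; cases "v' y") auto
  define P where "P x y \<longleftrightarrow> y \<in> B \<and> u x = ereal (a x) \<and> u' x = ereal (a' x) \<and> v y = ereal (b y) \<and> v' y = ereal (b' y) \<and>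
      a x + b y = norm (x - y) powr p \<and> a' x + b' y = norm (x - y) powr p" for x y
  define Y where "Y x = (SOME y. P x y)" for x
  have PY: "P x (Y x)" if x: "x \<in> A" for x
  proof -
    have "x \<in> msupport \<alpha>" using x supp by simp
    from contact_fst[OF uv this]
    obtain y where y: "y \<in> B" "u x + v y = ereal (norm (x - y) powr p)" "u' x + v' y = ereal (norm (x - y) powr p)" .
    have "P x y" using real[OF y(2)] real'[OF y(3)] y by (simp add: P_def)
    then show ?thesis unfolding Y_def by (rule someI)
  qed
  have Y: "Y x \<in> B" "u x = ereal (a x)" "u' x = ereal (a' x)" "v (Y x) = ereal (b (Y x))" "v' (Y x) = ereal (b' (Y x))"
    "a x + b (Y x) = norm (x - Y x) powr p" "a' x + b' (Y x) = norm (x - Y x) powr p" if "x \<in> A" for x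
    using PY[OF that] by (auto simp: P_def)
  have inc: "a x' - a x \<le> norm (x' - Y x) powr p - norm (x - Y x) powr p"
            "a' x' - a' x \<le> norm (x' - Y x) powr p - norm (x - Y x) powr p" if "x \<in> A" "x' \<in> A" for x x'
    using feas[of x' "Y x"] Y(2,3)[OF that(2)] Y(4-7)[OF that(1)] by auto
  have seg: "a z - a x = a' z - a' x" if xz: "closed_segment x z \<subseteq> A" for x z
  proof -
    have mem: "x + t *\<^sub>R (z - x) \<in> A" if "t \<in> {0..1}" for t
    proof -
      have "x + t *\<^sub>R (z - x) = (1 - t) *\<^sub>R x + t *\<^sub>R z" by (simp add: algebra_simps)
      then have "x + t *\<^sub>R (z - x) \<in> closed_segment x z" using that by (auto simp: closed_segment_def)
      then show ?thesis using xz by blast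
    qed
    have "a (x + 1 *\<^sub>R (z - x)) - a (x + 0 *\<^sub>R (z - x)) \<le> a' (x + 1 *\<^sub>R (z - x)) - a' (x + 0 *\<^sub>R (z - x))"
      by (rule common_subgradient_increment_le[OF p compact_imp_bounded[OF compact(2)], where x=x and z="z - x" and y="\<lambda>t. Y (x + t *\<^sub>R (z - x))"])
        (intro Y(1) mem inc; assumption)+
    moreover have "a' (x + 1 *\<^sub>R (z - x)) - a' (x + 0 *\<^sub>R (z - x)) \<le> a (x + 1 *\<^sub>R (z - x)) - a (x + 0 *\<^sub>R (z - x))"
      by (rule common_subgradient_increment_le[OF p compact_imp_bounded[OF compact(2)], where x=x and z="z - x" and y="\<lambda>t. Y (x + t *\<^sub>R (z - x))"])
        (intro Y(1) mem inc; assumption)+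
    ultimately show ?thesis by simp
  qed
  have "AE x in \<alpha>. x \<in> A" by (rule conc)
  then have "A \<noteq> {}" using \<alpha>.AE_False by auto
  then have "interior A \<noteq> {}" using conn(2) by auto
  then obtain x0 where x0: "x0 \<in> interior A" by blast
  define k where "k = a' x0 - a x0"
  have int: "a' x - a x = k" if x: "x \<in> interior A" for x
    unfolding k_def
  proof (rule connected_local_const[OF conn(1) x x0], rule ballI)
    fix y assume "y \<in> interior A"
    then obtain e where e: "0 < e" "ball y e \<subseteq> A" by (auto simp: mem_interior)
    have "a' y - a y = a' w - a w" if w: "dist w y < e" for w
    proof -
      have "closed_segment y w \<subseteq> ball y e" using w e(1) by (intro closed_segment_subset) (auto simp: dist_commute)
      then have "closed_segment y w \<subseteq> A" using e(2) by (rule subset_trans)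
      from seg[OF this] show ?thesis by linarith
    qed
    then show "\<forall>\<^sub>F w in at y within interior A. a' y - a y = a' w - a w"
      using e(1) by (auto simp: eventually_at)
  qed
  \<comment> \<open>Functions touched in this way inherit the Lipschitz constant of the
    cost.\<close>
  have lip: "L'-lipschitz_on A f"
    if f: "\<And>x x'. x \<in> A \<Longrightarrow> x' \<in> A \<Longrightarrow> f x' - f x \<le> norm (x' - Y x) powr p - norm (x - Y x) powr p"
      and L': "L' = p * R powr (p - 1)" for f :: "'a \<Rightarrow> real" and L'
  proof (rule lipschitz_onI)
    show "0 \<le> L'" using p by (simp add: L')
    have le: "f x' - f x \<le> L' * dist x x'" if "x \<in> A" "x' \<in> A" for x x'
    proof -
      have "f x' - f x \<le> truncated_cost p R x' (Y x) - truncated_cost p R x (Y x)"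
        using f[OF that] truncated_cost_eq that Y(1) by simp
      also have "\<dots> \<le> L' * dist x x'"
        using lipschitz_onD[OF c_lip1, of x' x "Y x"] by (simp add: dist_real_def L' dist_commute)
      finally show ?thesis .
    qed
    show "dist (f x) (f x') \<le> L' * dist x x'" if "x \<in> A" "x' \<in> A" for x x'
      using le[OF that] le[OF that(2,1)] unfolding dist_real_def dist_commute[of x' x] by linarith
  qed
  have ca: "continuous_on A a'" "continuous_on A a"
    using lip[OF inc(2) refl] lip[OF inc(1) refl] lipschitz_on_continuous_on by auto
  then have cont: "continuous_on A (\<lambda>x. a' x - a x)" by (intro continuous_intros)
  have clos: "closure (interior A) \<subseteq> A" using compact_imp_closed[OF compact(1)] interior_subset closure_minimal by blast
  have all: "a' x - a x = k" if "x \<in> A" for x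
    by (rule continuous_constant_on_closure[OF continuous_on_subset[OF cont clos] int]) (use conn(2) that in auto)
  have vb: "v y = ereal (b y) \<and> v' y = ereal (b' y) \<and> b' y = b y - k" if "y \<in> B" for y
  proof -
    have "y \<in> msupport \<beta>" using that supp by simp
    from contact_snd[OF uv this]
    obtain x where x: "x \<in> A" "u x + v y = ereal (norm (x - y) powr p)" "u' x + v' y = ereal (norm (x - y) powr p)" .
    show ?thesis using real[OF x(2)] real'[OF x(3)] x all[OF x(1)] by auto
  qed
  show ?thesis
  proof (rule that[of k])
    show "u' x = u x + ereal k" if "x \<in> A" for x using Y(2,3)[OF that] all[OF that] by simp
    show "v' y = v y - ereal k" if "y \<in> B" for y using vb[OF that] by simp
    show "continuous_on A (\<lambda>x. real_of_ereal (u x))" using ca(2) by (simp add: a_def[abs_def])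
  qed (use Y(2) vb in auto)
qed

end

section \<open>Potentials as dual optimal pairs\<close>

lemma open_ereal_diff_less:
  fixes h :: "'a::topological_space \<Rightarrow> real"
  assumes "continuous_on UNIV h"
  shows "open {y. ereal (h y) - a < ereal r}"
proof (cases a)
  case (real t)
  then have "{y. ereal (h y) - a < ereal r} = {y. h y < r + t}" by auto
  then show ?thesis using open_Collect_less[OF assms continuous_on_const, of "r + t"] by simp
qed auto

text \<open>An infimum of continuous functions; points with \<open>f x = - \<infinity>\<close>
  contribute \<open>\<infinity>\<close> and drop out.\<close>

lemma upper_semicontinuous_c_transform:
  assumes "1 < p" shows "upper_semicontinuous (c_transform p f)"
  unfolding upper_semicontinuous_def
proof
  fix r :: real
  have "{y. c_transform p f y < ereal r} = (\<Union>x. {y. ereal (norm (x - y) powr p) - f x < ereal r})"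
    by (auto simp: c_transform_def INF_less_iff)
  moreover have "open {y. ereal (norm (x - y) powr p) - f x < ereal r}" for x
    using assms by (intro open_ereal_diff_less continuous_on_powr' continuous_intros) auto
  ultimately show "open {y. c_transform p f y < ereal r}" by auto
qed

lemma c_transform_feasible:
  assumes "f x \<noteq> \<infinity>" "c_transform p f y \<noteq> \<infinity>"
  shows "f x + c_transform p f y \<le> ereal (norm (x - y) powr p)"
proof -
  have "c_transform p f y \<le> ereal (norm (x - y) powr p) - f x"
    unfolding c_transform_def by (rule INF_lower) simp
  then show ?thesis using assms by (cases "f x"; cases "c_transform p f y") auto
qed

lemma ereal_integral_mono:
  assumes "\<And>x. f x \<le> g x" shows "ereal_integral M f \<le> ereal_integral M g"
  unfolding ereal_integral_def
  using assms by (intro ereal_minus_mono) (auto simp flip: less_eq_ennreal.rep_eq intro!: nn_integral_mono e2ennreal_mono)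

text \<open>When both parts are finite the extended integral is the Bochner integral of the real
  version; the convention for \<open>real_of_ereal\<close> at infinite values only matters on a
  null set.\<close>

lemma ereal_integral_finite:
  assumes m [measurable]: "g \<in> borel_measurable M"
    and fin: "(\<integral>\<^sup>+ x. e2ennreal (g x) \<partial>M) < \<top>" "(\<integral>\<^sup>+ x. e2ennreal (- g x) \<partial>M) < \<top>"
  shows "AE x in M. \<bar>g x\<bar> \<noteq> \<infinity>" "integrable M (\<lambda>x. real_of_ereal (g x))"
    "ereal_integral M g = ereal (LINT x|M. real_of_ereal (g x))"
proof -
  have mm: "(\<lambda>x. e2ennreal (g x)) \<in> borel_measurable M" "(\<lambda>x. e2ennreal (- g x)) \<in> borel_measurable M" by measurable
  have "AE x in M. e2ennreal (g x) \<noteq> \<infinity>" "AE x in M. e2ennreal (- g x) \<noteq> \<infinity>"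
    using nn_integral_PInf_AE[OF mm(1)] nn_integral_PInf_AE[OF mm(2)] fin by (auto simp: less_top)
  then show ae: "AE x in M. \<bar>g x\<bar> \<noteq> \<infinity>"
  proof eventually_elim
    case (elim x)
    then show ?case by (cases "g x") (auto simp: e2ennreal_infty)
  qed
  have eq: "(\<integral>\<^sup>+ x. ennreal (real_of_ereal (g x)) \<partial>M) = (\<integral>\<^sup>+ x. e2ennreal (g x) \<partial>M)"
    "(\<integral>\<^sup>+ x. ennreal (- real_of_ereal (g x)) \<partial>M) = (\<integral>\<^sup>+ x. e2ennreal (- g x) \<partial>M)"
  proof -
    have "AE x in M. ennreal (real_of_ereal (g x)) = e2ennreal (g x)"
      using ae by eventually_elim (auto simp: ennreal.abs_eq e2ennreal_def ennreal_def max_def split: if_splits)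
    then show "(\<integral>\<^sup>+ x. ennreal (real_of_ereal (g x)) \<partial>M) = (\<integral>\<^sup>+ x. e2ennreal (g x) \<partial>M)" by (rule nn_integral_cong_AE)
    have "AE x in M. ennreal (- real_of_ereal (g x)) = e2ennreal (- g x)"
    using ae proof eventually_elim
      case (elim x) then show ?case by (cases "g x") (auto simp: e2ennreal_ereal)
    qed
    then show "(\<integral>\<^sup>+ x. ennreal (- real_of_ereal (g x)) \<partial>M) = (\<integral>\<^sup>+ x. e2ennreal (- g x) \<partial>M)" by (rule nn_integral_cong_AE)
  qed
  show int: "integrable M (\<lambda>x. real_of_ereal (g x))"
    unfolding real_integrable_def eq using fin by auto
  have "ereal_integral M g = ereal (enn2real (\<integral>\<^sup>+ x. e2ennreal (g x) \<partial>M)) - ereal (enn2real (\<integral>\<^sup>+ x. e2ennreal (- g x) \<partial>M))"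
    unfolding ereal_integral_def using fin
    by (metis enn2ereal_ennreal enn2real_nonneg ennreal_enn2real)
  then show "ereal_integral M g = ereal (LINT x|M. real_of_ereal (g x))"
    by (simp add: real_lebesgue_integral_def[OF int] eq)
qed

lemma L1_erealD:
  assumes "f \<in> L1_ereal M"
  shows "AE x in M. \<bar>f x\<bar> \<noteq> \<infinity>" "integrable M (\<lambda>x. real_of_ereal (f x))"
    "ereal_integral M f = ereal (LINT x|M. real_of_ereal (f x))"
proof -
  have m: "f \<in> borel_measurable M" and i: "(\<integral>\<^sup>+ x. e2ennreal \<bar>f x\<bar> \<partial>M) < \<top>" using assms by (auto simp: L1_ereal_def)
  have "(\<integral>\<^sup>+ x. e2ennreal (f x) \<partial>M) \<le> (\<integral>\<^sup>+ x. e2ennreal \<bar>f x\<bar> \<partial>M)"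
  proof (intro nn_integral_mono e2ennreal_mono)
    show "f x \<le> \<bar>f x\<bar>" for x by (cases "f x") auto
  qed
  moreover have "(\<integral>\<^sup>+ x. e2ennreal (- f x) \<partial>M) \<le> (\<integral>\<^sup>+ x. e2ennreal \<bar>f x\<bar> \<partial>M)"
  proof (intro nn_integral_mono e2ennreal_mono)
    show "- f x \<le> \<bar>f x\<bar>" for x by (cases "f x") auto
  qed
  ultimately have "(\<integral>\<^sup>+ x. e2ennreal (f x) \<partial>M) < \<top>" "(\<integral>\<^sup>+ x. e2ennreal (- f x) \<partial>M) < \<top>" using i by auto
  from ereal_integral_finite[OF m this] show "AE x in M. \<bar>f x\<bar> \<noteq> \<infinity>" "integrable M (\<lambda>x. real_of_ereal (f x))"
    "ereal_integral M f = ereal (LINT x|M. real_of_ereal (f x))" by auto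
qed

lemma integrable_L1_ereal:
  assumes "integrable M f" shows "(\<lambda>x. ereal (f x)) \<in> L1_ereal M"
proof -
  have "(\<integral>\<^sup>+ x. e2ennreal \<bar>ereal (f x)\<bar> \<partial>M) = (\<integral>\<^sup>+ x. ennreal (norm (f x)) \<partial>M)"
    by (simp add: e2ennreal_ereal)
  also have "\<dots> < \<top>" using assms by (simp add: integrable_iff_bounded)
  finally show ?thesis using borel_measurable_integrable[OF assms] by (auto simp: L1_ereal_def)
qed

context power_transport begin

text \<open>A Lipschitz dual pair \<open>(\<phi>, \<psi>)\<close> is dominated by the pair of
  \<open>\<phi>\<close> and its \<open>c\<close>-transform.\<close>

lemma transport_cost_le_dual_sup: "ereal (transport_cost p \<alpha> \<beta>) \<le> (SUP \<psi>\<in>L1_ereal \<alpha>. dual_value p \<alpha> \<beta> \<psi>)"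
proof (rule ereal_le_epsilon2)
    fix \<eta> :: real assume \<eta>: "0 < \<eta>"
    obtain \<phi> \<psi> where \<phi>: "(p * R powr (p - 1))-lipschitz_on UNIV \<phi>" and \<psi>: "(p * R powr (p - 1))-lipschitz_on UNIV \<psi>"
      and b: "\<And>x. \<bar>\<phi> x\<bar> \<le> R powr p" "\<And>x. \<bar>\<psi> x\<bar> \<le> 2 * R powr p"
      and feas: "\<And>x y. \<phi> x + \<psi> y \<le> norm (x - y) powr p"
      and le: "transport_cost p \<alpha> \<beta> \<le> (LINT x|\<alpha>. \<phi> x) + (LINT y|\<beta>. \<psi> y) + \<eta>"
      by (rule transport_duality[OF \<eta>]) blast
    note m = lipschitz_measurable[OF \<phi>] lipschitz_measurable[OF \<psi>]
    have i: "integrable \<alpha> \<phi>" "integrable \<beta> \<psi>"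
      using bounded_integrable1[OF m(1) b(1)] bounded_integrable2[OF m(2) b(2)] by auto
    note L = integrable_L1_ereal[OF i(1)] integrable_L1_ereal[OF i(2)]
    have "ereal (\<psi> y) \<le> c_transform p (\<lambda>x. ereal (\<phi> x)) y" for y
      unfolding c_transform_def using feas by (intro INF_greatest) (simp add: le_diff_eq add.commute)
    then have "ereal_integral \<beta> (\<lambda>y. ereal (\<psi> y)) \<le> ereal_integral \<beta> (c_transform p (\<lambda>x. ereal (\<phi> x)))"
      by (rule ereal_integral_mono)
    from add_left_mono[OF this, of "ereal (LINT x|\<alpha>. \<phi> x)"]
    have "ereal ((LINT x|\<alpha>. \<phi> x) + (LINT y|\<beta>. \<psi> y)) \<le> dual_value p \<alpha> \<beta> (\<lambda>x. ereal (\<phi> x))"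
      by (simp add: dual_value_def L1_erealD(3)[OF L(1)] L1_erealD(3)[OF L(2)])
    also have "\<dots> \<le> (SUP \<psi>\<in>L1_ereal \<alpha>. dual_value p \<alpha> \<beta> \<psi>)" using L(1) by (rule SUP_upper)
    finally have "ereal ((LINT x|\<alpha>. \<phi> x) + (LINT y|\<beta>. \<psi> y)) + ereal \<eta> \<le> (SUP \<psi>\<in>L1_ereal \<alpha>. dual_value p \<alpha> \<beta> \<psi>) + ereal \<eta>"
      by (rule add_right_mono)
    then show "ereal (transport_cost p \<alpha> \<beta>) \<le> (SUP \<psi>\<in>L1_ereal \<alpha>. dual_value p \<alpha> \<beta> \<psi>) + ereal \<eta>"
      using le order_trans by (metis ereal_less_eq(3) plus_ereal.simps(1))
qed

text \<open>The defining property of a potential refers to integrals with values in the extended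
  reals. At the maximum the value is at least the finite transport cost, and the transform is
  bounded above on the compact set \<open>B\<close>, so its negative part must be integrable as
  well; then both integrals are ordinary ones.\<close>

theorem OT_potential_dual_optimal:
  assumes "OT_potential p \<alpha> \<beta> \<phi>"
  shows "dual_optimal \<phi> (c_transform p \<phi>)"
proof -
  let ?\<psi> = "c_transform p \<phi>"
  obtain g where g: "\<phi> = c_transform p g" using assms by (auto simp: OT_potential_def c_concave_def)
  have usc: "upper_semicontinuous \<phi>" "upper_semicontinuous ?\<psi>"
    using upper_semicontinuous_c_transform[OF p] g by auto
  have L: "\<phi> \<in> L1_ereal \<alpha>" using assms by (auto simp: OT_potential_def)
  have \<phi>: "\<phi> x \<noteq> \<infinity>" for x using L by (auto simp: L1_ereal_def)
  have ae: "AE x in \<alpha>. \<phi> x \<noteq> - \<infinity>" using L1_erealD(1)[OF L] by eventually_elim auto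
  have "\<exists>x. \<phi> x \<noteq> - \<infinity>"
  proof (rule ccontr)
    assume "\<not> ?thesis"
    then have "AE x in \<alpha>. False" using ae by auto
    then show False using \<alpha>.AE_False by simp
  qed
  then obtain x1 where "\<phi> x1 \<noteq> - \<infinity>" by blast
  then obtain t where t: "\<phi> x1 = ereal t" using \<phi>[of x1] by (cases "\<phi> x1") auto
  have up: "?\<psi> y \<le> ereal (norm (x1 - y) powr p - t)" for y
    unfolding c_transform_def by (rule INF_lower2[of x1]) (auto simp: t)
  have \<psi>: "?\<psi> y \<noteq> \<infinity>" for y using up[of y] by auto
  have m [measurable]: "?\<psi> \<in> borel_measurable \<beta>" using upper_semicontinuous_measurable[OF usc(2)] by measurable
  have le: "ereal (transport_cost p \<alpha> \<beta>) \<le> ereal_integral \<alpha> \<phi> + ereal_integral \<beta> ?\<psi>"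
    using assms transport_cost_le_dual_sup by (simp add: OT_potential_def dual_value_def)
  obtain Bb where Bb: "\<And>y. y \<in> B \<Longrightarrow> norm y \<le> Bb" using compact_imp_bounded[OF compact(2)] by (auto simp: bounded_iff)
  have "AE y in \<beta>. e2ennreal (?\<psi> y) \<le> ennreal ((norm x1 + \<bar>Bb\<bar>) powr p + \<bar>t\<bar>)"
    using conc(2)
  proof eventually_elim
    case (elim y)
    have "norm (x1 - y) \<le> norm x1 + \<bar>Bb\<bar>" using norm_triangle_ineq4[of x1 y] Bb[OF elim] by linarith
    then have "norm (x1 - y) powr p \<le> (norm x1 + \<bar>Bb\<bar>) powr p" using p by (intro powr_mono2) auto
    then have "?\<psi> y \<le> ereal ((norm x1 + \<bar>Bb\<bar>) powr p + \<bar>t\<bar>)"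
      using up[of y] by (intro order_trans[OF up]) simp
    then have "e2ennreal (?\<psi> y) \<le> e2ennreal (ereal ((norm x1 + \<bar>Bb\<bar>) powr p + \<bar>t\<bar>))" by (rule e2ennreal_mono)
    then show ?case by (simp add: e2ennreal_ereal)
  qed
  then have "(\<integral>\<^sup>+ y. e2ennreal (?\<psi> y) \<partial>\<beta>) \<le> (\<integral>\<^sup>+ y. ennreal ((norm x1 + \<bar>Bb\<bar>) powr p + \<bar>t\<bar>) \<partial>\<beta>)"
    by (rule nn_integral_mono_AE)
  also have "\<dots> < \<top>" by (simp add: \<beta>.emeasure_space_1)
  finally have pos: "(\<integral>\<^sup>+ y. e2ennreal (?\<psi> y) \<partial>\<beta>) < \<top>" .
  have neg: "(\<integral>\<^sup>+ y. e2ennreal (- ?\<psi> y) \<partial>\<beta>) < \<top>"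
  proof (rule ccontr)
    assume "\<not> ?thesis"
    then have "(\<integral>\<^sup>+ y. e2ennreal (- ?\<psi> y) \<partial>\<beta>) = \<top>" by (metis top.not_eq_extremum)
    moreover obtain r where "(\<integral>\<^sup>+ y. e2ennreal (?\<psi> y) \<partial>\<beta>) = ennreal r" "0 \<le> r" using pos by (cases "(\<integral>\<^sup>+ y. e2ennreal (?\<psi> y) \<partial>\<beta>)") auto
    ultimately have "ereal_integral \<beta> ?\<psi> = - \<infinity>"
      by (simp add: ereal_integral_def enn2ereal_ennreal)
    then show False using le L1_erealD(3)[OF L] by simp
  qed
  note fin = ereal_integral_finite[OF m pos neg]
  show ?thesis
    unfolding dual_optimal_def
  proof (intro conjI allI)
    show "\<phi> x + ?\<psi> y \<le> ereal (norm (x - y) powr p)" for x y using \<phi> \<psi> by (rule c_transform_feasible)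
    show "AE x in \<alpha>. \<phi> x \<noteq> - \<infinity>" by fact
    show "AE y in \<beta>. ?\<psi> y \<noteq> - \<infinity>" using fin(1) by eventually_elim auto
    show "transport_cost p \<alpha> \<beta> \<le> (LINT x|\<alpha>. real_of_ereal (\<phi> x)) + (LINT y|\<beta>. real_of_ereal (?\<psi> y))"
      using le unfolding fin(3) L1_erealD(3)[OF L] by simp
  qed (use usc \<phi> \<psi> fin(2) L1_erealD(2)[OF L] in auto)
qed

text \<open>Uniform limits of potentials are only known on the supports. Extending them by
  \<open>- \<infinity>\<close> keeps the constraint and upper semicontinuity, the sets being
  closed.\<close>

lemma dual_optimal_on:
  assumes f: "continuous_on A f" and g: "continuous_on B g"
    and feas: "\<And>x y. x \<in> A \<Longrightarrow> y \<in> B \<Longrightarrow> f x + g y \<le> norm (x - y) powr p"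
    and le: "transport_cost p \<alpha> \<beta> \<le> (LINT x|\<alpha>. indicator A x * f x) + (LINT y|\<beta>. indicator B y * g y)"
  shows "dual_optimal (\<lambda>x. if x \<in> A then ereal (f x) else - \<infinity>) (\<lambda>y. if y \<in> B then ereal (g y) else - \<infinity>)"
proof -
  have usc: "upper_semicontinuous (\<lambda>x. if x \<in> S then ereal (h x) else - \<infinity>)"
    if S: "compact S" and h: "continuous_on S h" for S :: "'a set" and h
    unfolding upper_semicontinuous_def
  proof
    fix r :: real
    have "closed (S \<inter> h -` {r..})" using h compact_imp_closed[OF S] by (intro continuous_closed_preimage) auto
    then have "open (- (S \<inter> h -` {r..}))" by (rule open_Compl)
    moreover have "{x. (if x \<in> S then ereal (h x) else - \<infinity>) < ereal r} = - (S \<inter> h -` {r..})" by auto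
    ultimately show "open {x. (if x \<in> S then ereal (h x) else - \<infinity>) < ereal r}" by (simp only:)
  qed
  have ri: "real_of_ereal (if x \<in> S then ereal (h x) else - \<infinity>) = indicator S x * h x" for S :: "'a set" and h x
    by simp
  have int: "integrable M (\<lambda>x. indicator S x * h x)" if S: "compact S" and h: "continuous_on S h"
     and M: "finite_measure M" "sets M = sets borel" for S :: "'a set" and h :: "'a \<Rightarrow> real" and M
  proof -
    interpret M: finite_measure M by fact
    obtain K where "\<And>x. x \<in> S \<Longrightarrow> norm (h x) \<le> K"
      using compact_imp_bounded[OF compact_continuous_image[OF h S]] by (auto simp: bounded_iff)
    then have "\<And>x. x \<in> S \<Longrightarrow> \<bar>h x\<bar> \<le> \<bar>K\<bar>" by force
    moreover have "(\<lambda>x. indicator S x *\<^sub>R h x) \<in> borel_measurable borel"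
      using h compact_imp_closed[OF S] by (intro borel_measurable_continuous_on_indicator) auto
    then have "(\<lambda>x. indicator S x * h x) \<in> borel_measurable M" using M(2) by (simp cong: measurable_cong_sets)
    ultimately show ?thesis
      by (intro M.integrable_const_bound[where B="\<bar>K\<bar>"]) (auto simp: indicator_def intro!: AE_I2 intro: order_trans)
  qed
  show ?thesis
    unfolding dual_optimal_def ri
  proof (intro conjI)
    show "AE x in \<alpha>. (if x \<in> A then ereal (f x) else - \<infinity>) \<noteq> - \<infinity>" using conc(1) by eventually_elim auto
    show "AE x in \<beta>. (if x \<in> B then ereal (g x) else - \<infinity>) \<noteq> - \<infinity>" using conc(2) by eventually_elim auto
    show "integrable \<alpha> (\<lambda>x. indicator A x * f x)" using compact f \<alpha>.finite_measure_axioms sets by (intro int) auto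
    show "integrable \<beta> (\<lambda>x. indicator B x * g x)" using compact g \<beta>.finite_measure_axioms sets by (intro int) auto
  qed (use usc[OF compact(1) f] usc[OF compact(2) g] feas le in auto)
qed

lemma dual_optimal_integral:
  assumes "dual_optimal u v"
  shows "transport_cost p \<alpha> \<beta> = (LINT x|\<alpha>. real_of_ereal (u x)) + (LINT y|\<beta>. real_of_ereal (v y))"
proof (rule antisym)
  have m [measurable]: "u \<in> borel_measurable borel" "v \<in> borel_measurable borel"
    using assms upper_semicontinuous_measurable by (auto simp: dual_optimal_def)
  show "(LINT x|\<alpha>. real_of_ereal (u x)) + (LINT y|\<beta>. real_of_ereal (v y)) \<le> transport_cost p \<alpha> \<beta>"
  proof (rule transport_cost_greatest)
    fix \<pi> assume \<pi>: "\<pi> \<in> couplings \<alpha> \<beta>"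
    have i: "integrable \<pi> (\<lambda>z. real_of_ereal (u (fst z)))" "integrable \<pi> (\<lambda>z. real_of_ereal (v (snd z)))"
      using assms coupling_integral(1)[OF \<pi>, of "\<lambda>x. real_of_ereal (u x)"] coupling_integral(3)[OF \<pi>, of "\<lambda>x. real_of_ereal (v x)"]
      by (auto simp: dual_optimal_def)
    have ae: "AE z in \<pi>. u (fst z) \<noteq> - \<infinity>" "AE z in \<pi>. v (snd z) \<noteq> - \<infinity>"
      using assms coupling_AE(1)[OF \<pi>, of "\<lambda>x. u x \<noteq> - \<infinity>"] coupling_AE(2)[OF \<pi>, of "\<lambda>x. v x \<noteq> - \<infinity>"]
      by (auto simp: dual_optimal_def)
    have "(LINT x|\<alpha>. real_of_ereal (u x)) + (LINT y|\<beta>. real_of_ereal (v y)) =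
        (LINT z|\<pi>. real_of_ereal (u (fst z)) + real_of_ereal (v (snd z)))"
      using Bochner_Integration.integral_add[OF i]
        coupling_integral(2)[OF \<pi>, of "\<lambda>x. real_of_ereal (u x)"] coupling_integral(4)[OF \<pi>, of "\<lambda>x. real_of_ereal (v x)"]
      by simp
    also have "\<dots> \<le> (LINT z|\<pi>. norm (fst z - snd z) powr p)"
    proof (rule integral_mono_AE)
      show "AE z in \<pi>. real_of_ereal (u (fst z)) + real_of_ereal (v (snd z)) \<le> norm (fst z - snd z) powr p"
        using ae
      proof eventually_elim
        case (elim z)
        have "u (fst z) + v (snd z) \<le> ereal (norm (fst z - snd z) powr p)" "u (fst z) \<noteq> \<infinity>" "v (snd z) \<noteq> \<infinity>"
          using assms by (auto simp: dual_optimal_def)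
        then show ?case using elim by (cases "u (fst z)"; cases "v (snd z)") auto
      qed
    qed (use i power_cost_coupling(1)[OF \<pi>] in auto)
    finally show "(LINT x|\<alpha>. real_of_ereal (u x)) + (LINT y|\<beta>. real_of_ereal (v y)) \<le> (LINT z|\<pi>. norm (fst z - snd z) powr p)" .
  qed
qed (use assms in \<open>simp add: dual_optimal_def\<close>)

end

section \<open>Differentiability of the transport cost\<close>

text \<open>Total variation distance at most \<open>\<delta>\<close> (up to the usual factor),
  tested against bounded measurable functions.\<close>

definition variation_close :: "real \<Rightarrow> 'a::topological_space measure \<Rightarrow> 'a measure \<Rightarrow> bool" where
  "variation_close \<delta> M N \<longleftrightarrow> (\<forall>f::'a \<Rightarrow> real. f \<in> borel_measurable borel \<longrightarrow> (\<forall>x. \<bar>f x\<bar> \<le> 1) \<longrightarrow>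
     \<bar>(LINT x|M. f x) - (LINT x|N. f x)\<bar> \<le> \<delta>)"

lemma variation_close_nonneg: "variation_close \<delta> M N \<Longrightarrow> 0 \<le> \<delta>"
  unfolding variation_close_def by (drule spec[of _ "\<lambda>_. 0"]) auto

lemma variation_closeD:
  assumes "variation_close \<delta> M N" and f: "f \<in> borel_measurable borel" "\<And>x. \<bar>f x\<bar> \<le> c"
  shows "\<bar>(LINT x|M. f x) - (LINT x|N. f x)\<bar> \<le> c * \<delta>"
proof -
  have c: "0 \<le> c" using f(2) abs_ge_zero order_trans by blast
  show ?thesis
  proof (cases "c = 0")
    case True
    then have "f = (\<lambda>_. 0)" using f(2) by auto
    then show ?thesis using True by simp
  next
    case False
    with c have c: "0 < c" by simp
    have "\<bar>f x / c\<bar> \<le> 1" for x using f(2)[of x] c by (simp add: abs_divide)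
    moreover have "(\<lambda>x. f x / c) \<in> borel_measurable borel" using f(1) by simp
    ultimately have "\<bar>(LINT x|M. f x / c) - (LINT x|N. f x / c)\<bar> \<le> \<delta>" using assms(1) unfolding variation_close_def by blast
    then have "\<bar>(LINT x|M. f x) - (LINT x|N. f x)\<bar> / c \<le> \<delta>"
      using c by (simp add: diff_divide_distrib[symmetric] abs_divide)
    then show ?thesis using c by (simp add: divide_le_eq mult.commute)
  qed
qed

lemma integral_indicator_AE:
  fixes f :: "'a \<Rightarrow> real"
  assumes "AE x in M. x \<in> A" "A \<in> sets M" "f \<in> borel_measurable M"
  shows "(LINT x|M. indicator A x * f x) = (LINT x|M. f x)"
proof (rule integral_cong_AE)
  show "AE x in M. indicator A x * f x = f x" using assms(1) by eventually_elim simp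
qed (use assms in auto)

text \<open>The standing situation of the uniqueness theorem; \<open>A\<close> and
  \<open>B\<close> are now the supports. The real versions of the potentials are cut off outside
  the supports, where \<open>u\<close> and \<open>v\<close> may be infinite and are not
  determined.\<close>

locale unique_transport = power_transport +
  fixes u v :: "'a \<Rightarrow> ereal"
  assumes supp: "A = msupport \<alpha>" "B = msupport \<beta>"
    and conn: "connected (interior A)" "A \<subseteq> closure (interior A)"
    and uv: "dual_optimal u v"
begin

definition "fst_potential x = indicator A x * real_of_ereal (u x)"
definition "snd_potential y = indicator B y * real_of_ereal (v y)"

lemma A_borel [measurable]: "A \<in> sets borel" and B_borel [measurable]: "B \<in> sets borel"
  using compact_imp_closed[OF compact(1)] compact_imp_closed[OF compact(2)] by simp_all

lemma potentials_real:
  shows "x \<in> A \<Longrightarrow> u x = ereal (fst_potential x)" "y \<in> B \<Longrightarrow> v y = ereal (snd_potential y)"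
    and "continuous_on A fst_potential"
proof -
  obtain k where *: "\<And>x. x \<in> A \<Longrightarrow> \<bar>u x\<bar> \<noteq> \<infinity>" "\<And>y. y \<in> B \<Longrightarrow> \<bar>v y\<bar> \<noteq> \<infinity>"
    "continuous_on A (\<lambda>x. real_of_ereal (u x))"
    by (rule dual_optimal_unique[OF uv uv supp conn]) blast
  show "x \<in> A \<Longrightarrow> u x = ereal (fst_potential x)" using *(1)[of x] by (simp add: fst_potential_def ereal_real)
  show "y \<in> B \<Longrightarrow> v y = ereal (snd_potential y)" using *(2)[of y] by (simp add: snd_potential_def ereal_real)
  show "continuous_on A fst_potential"
    using *(3) by (rule continuous_on_eq) (simp add: fst_potential_def)
qed

lemma potentials_measurable [measurable]: "fst_potential \<in> borel_measurable borel" "snd_potential \<in> borel_measurable borel"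
proof -
  have [measurable]: "u \<in> borel_measurable borel" "v \<in> borel_measurable borel"
    using uv upper_semicontinuous_measurable by (auto simp: dual_optimal_def)
  show "fst_potential \<in> borel_measurable borel" "snd_potential \<in> borel_measurable borel"
    unfolding fst_potential_def[abs_def] snd_potential_def[abs_def] by measurable
qed

lemma potentials_feasible: "x \<in> A \<Longrightarrow> y \<in> B \<Longrightarrow> fst_potential x + snd_potential y \<le> norm (x - y) powr p"
proof -
  assume xy: "x \<in> A" "y \<in> B"
  have "u x + v y \<le> ereal (norm (x - y) powr p)" using uv by (simp add: dual_optimal_def)
  then show ?thesis using potentials_real(1)[OF xy(1)] potentials_real(2)[OF xy(2)] by simp
qed

lemma potentials_bounded: obtains K where "0 \<le> K" "\<And>x. \<bar>fst_potential x\<bar> \<le> K" "\<And>y. \<bar>snd_potential y\<bar> \<le> K"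
proof -
  obtain K0 where K0: "\<And>x. x \<in> A \<Longrightarrow> \<bar>fst_potential x\<bar> \<le> K0"
    using compact_imp_bounded[OF compact_continuous_image[OF potentials_real(3) compact(1)]] by (auto simp: bounded_iff)
  have K1: "\<bar>snd_potential y\<bar> \<le> R powr p + \<bar>K0\<bar>" if y: "y \<in> B" for y
  proof -
    have "y \<in> msupport \<beta>" using y supp by simp
    from contact_snd[OF uv uv this] obtain x where x: "x \<in> A" "u x + v y = ereal (norm (x - y) powr p)" by blast
    then have "fst_potential x + snd_potential y = norm (x - y) powr p"
      using potentials_real(1)[OF x(1)] potentials_real(2)[OF y] by simp
    moreover have "norm (x - y) powr p \<le> R powr p" using R x(1) y p by (intro powr_mono2) auto
    moreover have "0 \<le> norm (x - y) powr p" by simp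
    ultimately show ?thesis using K0[OF x(1)] unfolding abs_le_iff by linarith
  qed
  show ?thesis
  proof (rule that[of "R powr p + \<bar>K0\<bar>"])
    show "\<bar>fst_potential x\<bar> \<le> R powr p + \<bar>K0\<bar>" for x
    proof (cases "x \<in> A")
      case True then show ?thesis using K0[OF True] powr_ge_zero[of R p] by linarith
    qed (simp add: fst_potential_def)
    show "\<bar>snd_potential y\<bar> \<le> R powr p + \<bar>K0\<bar>" for y
    proof (cases "y \<in> B")
      case True then show ?thesis using K1 by blast
    qed (simp add: snd_potential_def)
  qed simp
qed

lemma potentials_value: "transport_cost p \<alpha> \<beta> = (LINT x|\<alpha>. fst_potential x) + (LINT y|\<beta>. snd_potential y)"
proof -
  have [measurable]: "u \<in> borel_measurable borel" "v \<in> borel_measurable borel"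
    using uv upper_semicontinuous_measurable by (auto simp: dual_optimal_def)
  have "(LINT x|\<alpha>. fst_potential x) = (LINT x|\<alpha>. real_of_ereal (u x))"
    unfolding fst_potential_def by (rule integral_indicator_AE) (use conc in auto)
  moreover have "(LINT x|\<beta>. snd_potential x) = (LINT x|\<beta>. real_of_ereal (v x))"
    unfolding snd_potential_def by (rule integral_indicator_AE) (use conc in auto)
  ultimately show ?thesis using dual_optimal_integral[OF uv] by simp
qed

text \<open>Perturbed measures are not allowed to leave the supports of the original ones: outside
  of them the potentials are not determined, and different choices would give different linear
  terms.\<close>

definition admissible :: "'a measure \<Rightarrow> 'a measure \<Rightarrow> bool" where
  "admissible \<alpha>' \<beta>' \<longleftrightarrow> prob_space \<alpha>' \<and> prob_space \<beta>' \<and> sets \<alpha>' = sets borel \<and> sets \<beta>' = sets borel \<and>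
     (AE x in \<alpha>'. x \<in> A) \<and> (AE y in \<beta>'. y \<in> B)"

lemma admissible_power_transport: "admissible \<alpha>' \<beta>' \<Longrightarrow> power_transport p R \<alpha>' \<beta>' A B"
  unfolding admissible_def by (elim conjE, rule power_transport.intro) (rule p R(1) compact | assumption | (rule R(2), assumption, assumption))+

definition remainder where
  "remainder \<alpha>' \<beta>' = transport_cost p \<alpha>' \<beta>' - transport_cost p \<alpha> \<beta>
     - ((LINT x|\<alpha>'. fst_potential x) - (LINT x|\<alpha>. fst_potential x))
     - ((LINT y|\<beta>'. snd_potential y) - (LINT y|\<beta>. snd_potential y))"

text \<open>The unperturbed potentials are a competitor in the perturbed dual problem.\<close>

lemma remainder_nonneg:
  assumes "admissible \<alpha>' \<beta>'" shows "0 \<le> remainder \<alpha>' \<beta>'"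
proof -
  interpret P: power_transport p R \<alpha>' \<beta>' A B using admissible_power_transport[OF assms] .
  obtain K where "0 \<le> K" and K: "\<And>x. \<bar>fst_potential x\<bar> \<le> K" "\<And>y. \<bar>snd_potential y\<bar> \<le> K" using potentials_bounded by blast
  have "(LINT x|\<alpha>'. fst_potential x) + (LINT y|\<beta>'. snd_potential y) \<le> transport_cost p \<alpha>' \<beta>'"
    by (rule P.dual_le_transport_cost[OF potentials_measurable P.bounded_integrable1[OF potentials_measurable(1) K(1)]
          P.bounded_integrable2[OF potentials_measurable(2) K(2)] potentials_feasible])
  then show ?thesis using potentials_value by (simp add: remainder_def)
qed

text \<open>By contradiction: take perturbations of size tending to \<open>0\<close> that violate
  the bound, and almost optimal dual pairs for them. A subsequence converges uniformly to an
  optimal pair of the unperturbed problem, that is, to the potentials shifted by a constant.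
  Testing both measures with the difference, which is uniformly at most
  \<open>\<epsilon> / 2\<close>, contradicts the violation.\<close>

theorem transport_cost_differentiable:
  assumes \<epsilon>: "0 < \<epsilon>"
  obtains \<delta> where "0 < \<delta>" "\<And>\<alpha>' \<beta>' \<delta>1 \<delta>2. admissible \<alpha>' \<beta>' \<Longrightarrow> variation_close \<delta>1 \<alpha>' \<alpha> \<Longrightarrow> variation_close \<delta>2 \<beta>' \<beta> \<Longrightarrow>
     \<delta>1 \<le> \<delta> \<Longrightarrow> \<delta>2 \<le> \<delta> \<Longrightarrow> \<bar>remainder \<alpha>' \<beta>'\<bar> \<le> \<epsilon> * (\<delta>1 + \<delta>2)"
proof (rule ccontr)
  assume neg: "\<not> thesis"
  have "\<exists>\<alpha>' \<beta>' \<delta>1 \<delta>2. admissible \<alpha>' \<beta>' \<and> variation_close \<delta>1 \<alpha>' \<alpha> \<and> variation_close \<delta>2 \<beta>' \<beta> \<and>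
     \<delta>1 \<le> 1 / real (Suc n) \<and> \<delta>2 \<le> 1 / real (Suc n) \<and> \<epsilon> * (\<delta>1 + \<delta>2) < remainder \<alpha>' \<beta>'" for n
  proof (rule ccontr)
    assume none: "\<not> ?thesis"
    have thesis
    proof (rule that[of "1 / real (Suc n)"])
      fix \<alpha>' \<beta>' \<delta>1 \<delta>2
      assume *: "admissible \<alpha>' \<beta>'" "variation_close \<delta>1 \<alpha>' \<alpha>" "variation_close \<delta>2 \<beta>' \<beta>"
        "\<delta>1 \<le> 1 / real (Suc n)" "\<delta>2 \<le> 1 / real (Suc n)"
      then have "remainder \<alpha>' \<beta>' \<le> \<epsilon> * (\<delta>1 + \<delta>2)" using none not_less by blast
      then show "\<bar>remainder \<alpha>' \<beta>'\<bar> \<le> \<epsilon> * (\<delta>1 + \<delta>2)" using remainder_nonneg[OF *(1)] by simp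
    qed simp
    then show False using neg by blast
  qed
  then obtain \<alpha>' \<beta>' \<delta>1 \<delta>2 where adm: "\<And>n. admissible (\<alpha>' n) (\<beta>' n)"
    and cl1: "\<And>n. variation_close (\<delta>1 n) (\<alpha>' n) \<alpha>" and cl2: "\<And>n. variation_close (\<delta>2 n) (\<beta>' n) \<beta>"
    and d: "\<And>n. \<delta>1 n \<le> 1 / real (Suc n)" "\<And>n. \<delta>2 n \<le> 1 / real (Suc n)"
    and viol: "\<And>n. \<epsilon> * (\<delta>1 n + \<delta>2 n) < remainder (\<alpha>' n) (\<beta>' n)" by metis
  define r where "r n = remainder (\<alpha>' n) (\<beta>' n)" for n
  have d_nn: "0 \<le> \<delta>1 n" "0 \<le> \<delta>2 n" for n using variation_close_nonneg cl1 cl2 by blast+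
  have r_pos: "0 < r n" for n
  proof -
    have "0 \<le> \<epsilon> * (\<delta>1 n + \<delta>2 n)" using \<epsilon> d_nn by simp
    then show ?thesis using viol[of n] by (simp add: r_def)
  qed
  define L where "L = p * R powr (p - 1)"
  define C where "C = R powr p"
  have C: "0 \<le> C" by (simp add: C_def)
  \<comment> \<open>The accuracy of the dual pairs has to be small compared with the remainder
    \<open>r n\<close> itself, which is positive by the assumed violation; losing half of it is
    harmless.\<close>
  define \<eta> where "\<eta> n = min (r n / 2) (1 / real (Suc n))" for n
  have \<eta>: "0 < \<eta> n" "\<eta> n \<le> r n / 2" "\<eta> n \<le> 1 / real (Suc n)" for n using r_pos[of n] by (auto simp: \<eta>_def)
  have "\<exists>\<phi> \<psi>. L-lipschitz_on UNIV \<phi> \<and> L-lipschitz_on UNIV \<psi> \<and> (\<forall>x. \<bar>\<phi> x\<bar> \<le> C) \<and> (\<forall>x. \<bar>\<psi> x\<bar> \<le> 2 * C) \<and>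
    (\<forall>x y. \<phi> x + \<psi> y \<le> norm (x - y) powr p) \<and>
    transport_cost p (\<alpha>' n) (\<beta>' n) \<le> (LINT x|\<alpha>' n. \<phi> x) + (LINT y|\<beta>' n. \<psi> y) + \<eta> n" for n
  proof -
    interpret P: power_transport p R "\<alpha>' n" "\<beta>' n" A B using admissible_power_transport[OF adm] .
    show ?thesis unfolding L_def C_def by (rule P.transport_duality[OF \<eta>(1)[of n]]) blast
  qed
  then obtain \<phi> \<psi> where \<phi>: "\<And>n. L-lipschitz_on UNIV (\<phi> n)" "\<And>n x. \<bar>\<phi> n x\<bar> \<le> C"
    and \<psi>: "\<And>n. L-lipschitz_on UNIV (\<psi> n)" "\<And>n x. \<bar>\<psi> n x\<bar> \<le> 2 * C"
    and feas: "\<And>n x y. \<phi> n x + \<psi> n y \<le> norm (x - y) powr p"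
    and near: "\<And>n. transport_cost p (\<alpha>' n) (\<beta>' n) \<le> (LINT x|\<alpha>' n. \<phi> n x) + (LINT y|\<beta>' n. \<psi> n y) + \<eta> n"
    by metis
  have [measurable]: "\<phi> n \<in> borel_measurable borel" "\<psi> n \<in> borel_measurable borel" for n
    using \<phi> \<psi> lipschitz_measurable by blast+
  obtain f k1 where f: "continuous_on A f" and k1: "strict_mono (k1 :: nat \<Rightarrow> nat)"
    and f_lim: "\<And>e. 0 < e \<Longrightarrow> \<exists>N. \<forall>n\<ge>N. \<forall>x\<in>A. \<bar>\<phi> (k1 n) x - f x\<bar> < e"
    by (rule lipschitz_uniform_subsequence[OF compact(1), of L \<phi> C]) (use \<phi> in auto)
  obtain g k2 where g: "continuous_on B g" and k2: "strict_mono (k2 :: nat \<Rightarrow> nat)"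
    and g_lim: "\<And>e. 0 < e \<Longrightarrow> \<exists>N. \<forall>n\<ge>N. \<forall>y\<in>B. \<bar>\<psi> (k1 (k2 n)) y - g y\<bar> < e"
    by (rule lipschitz_uniform_subsequence[OF compact(2), of L "\<lambda>n. \<psi> (k1 n)" "2 * C"]) (use \<psi> in auto)
  define k where "k n = k1 (k2 n)" for n
  have k_ge: "n \<le> k n" for n
    unfolding k_def using seq_suble[OF k1, of "k2 n"] seq_suble[OF k2, of n] by linarith
  have f_lim': "\<exists>N. \<forall>n\<ge>N. \<forall>x\<in>A. \<bar>\<phi> (k n) x - f x\<bar> < e" if e: "0 < e" for e
  proof -
    obtain N where N: "\<And>n x. n \<ge> N \<Longrightarrow> x \<in> A \<Longrightarrow> \<bar>\<phi> (k1 n) x - f x\<bar> < e" using f_lim[OF e] by blast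
    have "k2 n \<ge> N" if "n \<ge> N" for n using seq_suble[OF k2, of n] that by linarith
    then show ?thesis using N by (intro exI[of _ N]) (auto simp: k_def)
  qed
  have f_ptw: "(\<lambda>n. \<phi> (k n) x) \<longlonglongrightarrow> f x" if "x \<in> A" for x
    using f_lim' that by (intro LIMSEQ_I) (auto simp: dist_real_def, metis)
  have g_ptw: "(\<lambda>n. \<psi> (k n) y) \<longlonglongrightarrow> g y" if "y \<in> B" for y
    using g_lim that by (intro LIMSEQ_I) (auto simp: k_def dist_real_def, metis)
  have feas': "f x + g y \<le> norm (x - y) powr p" if "x \<in> A" "y \<in> B" for x y
    by (rule LIMSEQ_le_const2[OF tendsto_add[OF f_ptw[OF that(1)] g_ptw[OF that(2)]]]) (use feas in auto)
  obtain K where K0: "0 \<le> K" and K: "\<And>x. \<bar>fst_potential x\<bar> \<le> K" "\<And>y. \<bar>snd_potential y\<bar> \<le> K" using potentials_bounded by blast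
  \<comment> \<open>Optimality of the limit: costs and integrals of equibounded functions converge
    along the perturbations, with explicit rates in \<open>1 / Suc n\<close>.\<close>
  have limit_opt: "transport_cost p \<alpha> \<beta> \<le> (LINT x|\<alpha>. indicator A x * f x) + (LINT y|\<beta>. indicator B y * g y)"
  proof (rule LIMSEQ_le)
    show "(\<lambda>n. transport_cost p \<alpha> \<beta> - (2 * K + 3 * C + 1) * (1 / real (Suc n))) \<longlonglongrightarrow> transport_cost p \<alpha> \<beta>"
      using tendsto_diff[OF tendsto_const tendsto_mult_right_zero[OF LIMSEQ_Suc[OF lim_1_over_n]], of "transport_cost p \<alpha> \<beta>" "2 * K + 3 * C + 1"]
      by simp
    show "(\<lambda>n. (LINT x|\<alpha>. \<phi> (k n) x) + (LINT y|\<beta>. \<psi> (k n) y)) \<longlonglongrightarrow> (LINT x|\<alpha>. indicator A x * f x) + (LINT y|\<beta>. indicator B y * g y)"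
    proof (rule tendsto_add)
      have fm: "(\<lambda>x. indicator A x *\<^sub>R f x) \<in> borel_measurable borel" "(\<lambda>x. indicator B x *\<^sub>R g x) \<in> borel_measurable borel"
        by (rule borel_measurable_continuous_on_indicator[OF A_borel f] borel_measurable_continuous_on_indicator[OF B_borel g])+
      show "(\<lambda>n. LINT x|\<alpha>. \<phi> (k n) x) \<longlonglongrightarrow> (LINT x|\<alpha>. indicator A x * f x)"
      proof (rule integral_dominated_convergence[where w="\<lambda>_. C"])
        show "AE x in \<alpha>. (\<lambda>n. \<phi> (k n) x) \<longlonglongrightarrow> indicator A x * f x"
          using conc(1) by eventually_elim (simp add: f_ptw)
      qed (use \<phi> fm in auto)
      show "(\<lambda>n. LINT x|\<beta>. \<psi> (k n) x) \<longlonglongrightarrow> (LINT x|\<beta>. indicator B x * g x)"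
      proof (rule integral_dominated_convergence[where w="\<lambda>_. 2 * C"])
        show "AE x in \<beta>. (\<lambda>n. \<psi> (k n) x) \<longlonglongrightarrow> indicator B x * g x"
          using conc(2) by eventually_elim (simp add: g_ptw)
      qed (use \<psi> fm in auto)
    qed
    have "transport_cost p \<alpha> \<beta> - (2 * K + 3 * C + 1) * (1 / real (Suc n)) \<le> (LINT x|\<alpha>. \<phi> (k n) x) + (LINT y|\<beta>. \<psi> (k n) y)" for n
    proof -
      define e where "e = 1 / real (Suc n)"
      have "1 / real (Suc (k n)) \<le> e" unfolding e_def using k_ge[of n] by (intro divide_left_mono) auto
      then have small: "\<delta>1 (k n) \<le> e" "\<delta>2 (k n) \<le> e" "\<eta> (k n) \<le> e" using d[of "k n"] \<eta>(3)[of "k n"] by linarith+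
      have "\<bar>(LINT x|\<alpha>' (k n). \<phi> (k n) x) - (LINT x|\<alpha>. \<phi> (k n) x)\<bar> \<le> C * \<delta>1 (k n)"
        by (rule variation_closeD[OF cl1]) (use \<phi> in auto)
      moreover have "\<bar>(LINT x|\<beta>' (k n). \<psi> (k n) x) - (LINT x|\<beta>. \<psi> (k n) x)\<bar> \<le> 2 * C * \<delta>2 (k n)"
        by (rule variation_closeD[OF cl2]) (use \<psi> in auto)
      moreover have "\<bar>(LINT x|\<alpha>' (k n). fst_potential x) - (LINT x|\<alpha>. fst_potential x)\<bar> \<le> K * \<delta>1 (k n)"
        by (rule variation_closeD[OF cl1]) (use K in auto)
      moreover have "\<bar>(LINT x|\<beta>' (k n). snd_potential x) - (LINT x|\<beta>. snd_potential x)\<bar> \<le> K * \<delta>2 (k n)"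
        by (rule variation_closeD[OF cl2]) (use K in auto)
      moreover have "C * \<delta>1 (k n) \<le> C * e" "2 * C * \<delta>2 (k n) \<le> 2 * C * e" "K * \<delta>1 (k n) \<le> K * e" "K * \<delta>2 (k n) \<le> K * e"
        using small C K0 by (auto intro!: mult_left_mono)
      moreover have "0 \<le> remainder (\<alpha>' (k n)) (\<beta>' (k n))" by (rule remainder_nonneg[OF adm])
      moreover have "(2 * K + 3 * C + 1) * e = 2 * (K * e) + (C * e) + 2 * C * e + e" by (simp add: algebra_simps)
      ultimately show ?thesis
        using near[of "k n"] small(3) unfolding e_def[symmetric] remainder_def by (simp only: abs_le_iff) linarith
    qed
    then show "\<exists>N. \<forall>n\<ge>N. transport_cost p \<alpha> \<beta> - (2 * K + 3 * C + 1) * (1 / real (Suc n)) \<le> (LINT x|\<alpha>. \<phi> (k n) x) + (LINT y|\<beta>. \<psi> (k n) y)"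
      by blast
  qed
  define u' where "u' x = (if x \<in> A then ereal (f x) else - \<infinity>)" for x
  define v' where "v' y = (if y \<in> B then ereal (g y) else - \<infinity>)" for y
  have opt: "dual_optimal u' v'" unfolding u'_def v'_def by (rule dual_optimal_on[OF f g feas' limit_opt])
  obtain c where c: "\<And>x. x \<in> A \<Longrightarrow> u' x = u x + ereal c" "\<And>y. y \<in> B \<Longrightarrow> v' y = v y - ereal c"
    by (rule dual_optimal_unique[OF uv opt supp conn]) blast
  have fa: "f x = fst_potential x + c" if "x \<in> A" for x using c(1)[OF that] potentials_real(1)[OF that] that by (simp add: u'_def)
  have gb: "g y = snd_potential y - c" if "y \<in> B" for y using c(2)[OF that] potentials_real(2)[OF that] that by (simp add: v'_def)
  obtain N1 where N1: "\<And>n x. n \<ge> N1 \<Longrightarrow> x \<in> A \<Longrightarrow> \<bar>\<phi> (k n) x - f x\<bar> < \<epsilon> / 2" using f_lim'[of "\<epsilon> / 2"] \<epsilon> by auto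
  obtain N2 where N2: "\<And>n y. n \<ge> N2 \<Longrightarrow> y \<in> B \<Longrightarrow> \<bar>\<psi> (k n) y - g y\<bar> < \<epsilon> / 2" using g_lim[of "\<epsilon> / 2"] \<epsilon> by (auto simp: k_def)
  define n where "n = k (max N1 N2)"
  interpret P: power_transport p R "\<alpha>' n" "\<beta>' n" A B using admissible_power_transport[OF adm] .
  have diff1: "\<bar>(LINT x|\<alpha>' n. indicator A x * (\<phi> n x - fst_potential x - c)) - (LINT x|\<alpha>. indicator A x * (\<phi> n x - fst_potential x - c))\<bar> \<le> \<epsilon> / 2 * \<delta>1 n"
  proof (rule variation_closeD[OF cl1])
    show "\<bar>indicator A x * (\<phi> n x - fst_potential x - c)\<bar> \<le> \<epsilon> / 2" for x
    proof (cases "x \<in> A")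
      case True
      have eq: "\<phi> n x - fst_potential x - c = \<phi> n x - f x" using fa[OF True] by simp
      have "\<bar>\<phi> n x - f x\<bar> < \<epsilon> / 2" unfolding n_def by (rule N1[OF _ True]) simp
      then show ?thesis unfolding eq by (simp add: True)
    qed (use \<epsilon> in simp)
  qed measurable
  have diff2: "\<bar>(LINT x|\<beta>' n. indicator B x * (\<psi> n x - snd_potential x + c)) - (LINT x|\<beta>. indicator B x * (\<psi> n x - snd_potential x + c))\<bar> \<le> \<epsilon> / 2 * \<delta>2 n"
  proof (rule variation_closeD[OF cl2])
    show "\<bar>indicator B x * (\<psi> n x - snd_potential x + c)\<bar> \<le> \<epsilon> / 2" for x
    proof (cases "x \<in> B")
      case True
      have eq: "\<psi> n x - snd_potential x + c = \<psi> n x - g x" using gb[OF True] by simp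
      have "\<bar>\<psi> n x - g x\<bar> < \<epsilon> / 2" unfolding n_def by (rule N2[OF _ True]) simp
      then show ?thesis unfolding eq by (simp add: True)
    qed (use \<epsilon> in simp)
  qed measurable
  have split1: "(LINT x|M. indicator A x * (\<phi> n x - fst_potential x - c)) = (LINT x|M. \<phi> n x) - (LINT x|M. fst_potential x) - c"
    if M: "prob_space M" "sets M = sets borel" "AE x in M. x \<in> A" for M
  proof -
    interpret M: prob_space M by fact
    note [measurable_cong] = M(2)
    have "integrable M (\<phi> n)" "integrable M fst_potential"
      using \<phi> K by (auto intro: M.integrable_const_bound[where B=C]) (auto intro: M.integrable_const_bound[where B=K])
    moreover have "(LINT x|M. indicator A x * (\<phi> n x - fst_potential x - c)) = (LINT x|M. \<phi> n x - fst_potential x - c)"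
      by (rule integral_indicator_AE) (use M in auto)
    ultimately show ?thesis by (simp add: M.prob_space)
  qed
  have split2: "(LINT x|M. indicator B x * (\<psi> n x - snd_potential x + c)) = (LINT x|M. \<psi> n x) - (LINT x|M. snd_potential x) + c"
    if M: "prob_space M" "sets M = sets borel" "AE x in M. x \<in> B" for M
  proof -
    interpret M: prob_space M by fact
    note [measurable_cong] = M(2)
    have "integrable M (\<psi> n)" "integrable M snd_potential"
      using \<psi> K by (auto intro: M.integrable_const_bound[where B="2 * C"]) (auto intro: M.integrable_const_bound[where B=K])
    moreover have "(LINT x|M. indicator B x * (\<psi> n x - snd_potential x + c)) = (LINT x|M. \<psi> n x - snd_potential x + c)"
      by (rule integral_indicator_AE) (use M in auto)
    ultimately show ?thesis by (simp add: M.prob_space)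
  qed
  have m\<phi>: "\<phi> n \<in> borel_measurable borel" "\<psi> n \<in> borel_measurable borel" by measurable
  \<comment> \<open>The perturbed pair is in turn a competitor in the unperturbed dual
    problem.\<close>
  have "(LINT x|\<alpha>. \<phi> n x) + (LINT y|\<beta>. \<psi> n y) \<le> transport_cost p \<alpha> \<beta>"
    by (rule dual_le_transport_cost[OF m\<phi> bounded_integrable1[OF m\<phi>(1) \<phi>(2)] bounded_integrable2[OF m\<phi>(2) \<psi>(2)] feas])
  then have "r n \<le> \<epsilon> / 2 * \<delta>1 n + \<epsilon> / 2 * \<delta>2 n + r n / 2"
    using near[of n] \<eta>(2)[of n] diff1 diff2
    unfolding split1[OF P.prob(1) P.sets(1) P.conc(1)] split1[OF prob(1) sets(1) conc(1)]
      split2[OF P.prob(2) P.sets(2) P.conc(2)] split2[OF prob(2) sets(2) conc(2)] r_def remainder_def abs_le_iff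
    by linarith
  moreover have "\<epsilon> * (\<delta>1 n + \<delta>2 n) < r n" using viol[of n] by (simp add: r_def)
  moreover have "\<epsilon> / 2 * \<delta>1 n + \<epsilon> / 2 * \<delta>2 n = \<epsilon> * (\<delta>1 n + \<delta>2 n) / 2" by (simp add: algebra_simps)
  ultimately show False by linarith
qed

end

text \<open>Continuity of the cost in a weaker distance, with only Lipschitz test functions. It
  applies to arbitrary measures carried by \<open>A\<close> and \<open>B\<close> and serves to
  show that the cost of empirical measures is a continuous, hence measurable, function of the
  sample points.\<close>

lemma (in power_transport) transport_cost_lipschitz_perturbation:
  assumes "power_transport p R \<alpha>' \<beta>' A B"
    and d1: "\<And>f b. (p * R powr (p - 1))-lipschitz_on UNIV f \<Longrightarrow> (\<And>x. \<bar>f x\<bar> \<le> b) \<Longrightarrow> \<bar>(LINT x|\<alpha>'. f x) - (LINT x|\<alpha>. f x)\<bar> \<le> d1"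
    and d2: "\<And>f b. (p * R powr (p - 1))-lipschitz_on UNIV f \<Longrightarrow> (\<And>x. \<bar>f x\<bar> \<le> b) \<Longrightarrow> \<bar>(LINT x|\<beta>'. f x) - (LINT x|\<beta>. f x)\<bar> \<le> d2"
  shows "\<bar>transport_cost p \<alpha>' \<beta>' - transport_cost p \<alpha> \<beta>\<bar> \<le> d1 + d2"
proof -
  interpret P: power_transport p R \<alpha>' \<beta>' A B by fact
  have "transport_cost p \<alpha> \<beta> \<le> transport_cost p \<alpha>' \<beta>' + (d1 + d2) + \<eta>" if \<eta>: "0 < \<eta>" for \<eta>
  proof -
    obtain \<phi> \<psi> where \<phi>: "(p * R powr (p - 1))-lipschitz_on UNIV \<phi>" and \<psi>: "(p * R powr (p - 1))-lipschitz_on UNIV \<psi>"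
      and b: "\<And>x. \<bar>\<phi> x\<bar> \<le> R powr p" "\<And>x. \<bar>\<psi> x\<bar> \<le> 2 * R powr p"
      and feas: "\<And>x y. \<phi> x + \<psi> y \<le> norm (x - y) powr p"
      and le: "transport_cost p \<alpha> \<beta> \<le> (LINT x|\<alpha>. \<phi> x) + (LINT y|\<beta>. \<psi> y) + \<eta>"
      by (rule transport_duality[OF \<eta>]) blast
    note m = lipschitz_measurable[OF \<phi>] lipschitz_measurable[OF \<psi>]
    have "(LINT x|\<alpha>'. \<phi> x) + (LINT y|\<beta>'. \<psi> y) \<le> transport_cost p \<alpha>' \<beta>'"
      by (rule P.dual_le_transport_cost[OF m P.bounded_integrable1[OF m(1) b(1)] P.bounded_integrable2[OF m(2) b(2)] feas])
    then show ?thesis using le d1[OF \<phi> b(1)] d2[OF \<psi> b(2)] unfolding abs_le_iff by linarith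
  qed
  then have 1: "transport_cost p \<alpha> \<beta> \<le> transport_cost p \<alpha>' \<beta>' + (d1 + d2)" by (rule field_le_epsilon)
  have "transport_cost p \<alpha>' \<beta>' \<le> transport_cost p \<alpha> \<beta> + (d1 + d2) + \<eta>" if \<eta>: "0 < \<eta>" for \<eta>
  proof -
    obtain \<phi> \<psi> where \<phi>: "(p * R powr (p - 1))-lipschitz_on UNIV \<phi>" and \<psi>: "(p * R powr (p - 1))-lipschitz_on UNIV \<psi>"
      and b: "\<And>x. \<bar>\<phi> x\<bar> \<le> R powr p" "\<And>x. \<bar>\<psi> x\<bar> \<le> 2 * R powr p"
      and feas: "\<And>x y. \<phi> x + \<psi> y \<le> norm (x - y) powr p"
      and le: "transport_cost p \<alpha>' \<beta>' \<le> (LINT x|\<alpha>'. \<phi> x) + (LINT y|\<beta>'. \<psi> y) + \<eta>"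
      by (rule P.transport_duality[OF \<eta>]) blast
    note m = lipschitz_measurable[OF \<phi>] lipschitz_measurable[OF \<psi>]
    have "(LINT x|\<alpha>. \<phi> x) + (LINT y|\<beta>. \<psi> y) \<le> transport_cost p \<alpha> \<beta>"
      by (rule dual_le_transport_cost[OF m bounded_integrable1[OF m(1) b(1)] bounded_integrable2[OF m(2) b(2)] feas])
    then show ?thesis using le d1[OF \<phi> b(1)] d2[OF \<psi> b(2)] unfolding abs_le_iff by linarith
  qed
  then have "transport_cost p \<alpha>' \<beta>' \<le> transport_cost p \<alpha> \<beta> + (d1 + d2)" by (rule field_le_epsilon)
  with 1 show ?thesis by (simp add: abs_le_iff)
qed

section \<open>Smoothing by a kernel\<close>

lemma lborel_integral_translation:
  fixes f :: "'a::euclidean_space \<Rightarrow> real"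
  assumes [measurable]: "f \<in> borel_measurable borel"
  shows "(LINT z|lborel. f (c + z)) = (LINT y|lborel. f y)"
    and "integrable lborel (\<lambda>z. f (c + z)) \<longleftrightarrow> integrable lborel f"
  using integral_distr[of "(+) c" lborel borel f] integrable_distr_eq[of "(+) c" lborel borel f]
  by (simp_all add: lborel_distr_plus)

lemma open_null_lborel:
  fixes S :: "'a::euclidean_space set"
  assumes "open S" "AE x in lborel. x \<notin> S" shows "S = {}"
proof (rule ccontr)
  assume "S \<noteq> {}"
  with assms(1) have "\<not> negligible S" by (rule open_not_negligible)
  moreover have "emeasure lborel S = 0"
    using assms by (subst (asm) AE_iff_measurable[of S]) auto
  then have "emeasure lebesgue S = 0" using assms(1) by simp
  then have "negligible S" using assms(1) by (subst negligible_iff_emeasure0) auto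
  ultimately show False by simp
qed

text \<open>\<open>dens \<rho>\<close> is the density of the smoothed measure, \<open>adj\<close>
  the adjoint of smoothing (convolution with the reflected kernel), and \<open>tv\<close> the
  \<open>L\<^sup>1\<close> distance of densities.\<close>

locale smoothing =
  fixes k :: "'a::ordered_euclidean_space \<Rightarrow> real" and M r :: real
  assumes k_cont: "continuous_on UNIV k" and k_nonneg: "\<And>x. 0 \<le> k x" and k_le: "\<And>x. k x \<le> M"
    and k_zero: "\<And>x. x \<notin> ball 0 r \<Longrightarrow> k x = 0" and k_int: "(LINT x|lborel. k x) = 1"
begin

definition "\<eta> = density lborel (\<lambda>x. ennreal (k x))"
definition smooth :: "'a measure \<Rightarrow> 'a measure" where "smooth \<rho> = (\<rho> \<star> \<eta>)"
definition dens :: "'a measure \<Rightarrow> 'a \<Rightarrow> real" where "dens \<rho> y = (LINT x|\<rho>. k (y - x))"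
definition adj :: "('a \<Rightarrow> real) \<Rightarrow> 'a \<Rightarrow> real" where "adj F x = (LINT y|lborel. F y * k (y - x))"
definition tv :: "'a measure \<Rightarrow> 'a measure \<Rightarrow> real" where "tv \<rho> \<rho>' = (LINT y|lborel. \<bar>dens \<rho> y - dens \<rho>' y\<bar>)"

lemma k_measurable [measurable]: "k \<in> borel_measurable borel"
  using k_cont by (rule borel_measurable_continuous_onI)

lemma M_nonneg: "0 \<le> M" using k_nonneg k_le order_trans by blast

lemma k_integrable: "integrable lborel k"
  using k_int not_integrable_integral_eq by fastforce

lemma \<eta>_prob: "prob_space \<eta>"
proof
  have "(\<integral>\<^sup>+ x. ennreal (k x) \<partial>lborel) = ennreal (LINT x|lborel. k x)"
    by (rule nn_integral_eq_integral[OF k_integrable]) (simp add: k_nonneg)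
  then show "emeasure \<eta> (space \<eta>) = 1" by (simp add: \<eta>_def emeasure_density k_int)
qed

lemma \<eta>_sets [measurable_cong, simp]: "sets \<eta> = sets borel" by (simp add: \<eta>_def)

lemma smooth_sets [measurable_cong, simp]: "sets (smooth \<rho>) = sets borel" by (simp add: smooth_def)

lemma shifted_kernel:
  fixes F :: "'a \<Rightarrow> real"
  assumes [measurable]: "F \<in> borel_measurable borel" and F: "\<And>x. \<bar>F x\<bar> \<le> B"
  shows "integrable lborel (\<lambda>y. F y * k (y - x))" "(LINT y|lborel. k (y - x)) = 1" "integrable lborel (\<lambda>y. k (y - x))"
    and "\<bar>adj F x\<bar> \<le> B" and "adj F x = (LINT z|\<eta>. F (x + z))"
    and "integrable lborel (\<lambda>y. \<bar>F y\<bar> * k (y - x))"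
proof -
  show k: "integrable lborel (\<lambda>y. k (y - x))" "(LINT y|lborel. k (y - x)) = 1"
    using lborel_integral_translation[of k "- x"] k_integrable k_int by simp_all
  have B: "0 \<le> B" using F abs_ge_zero order_trans by blast
  show i: "integrable lborel (\<lambda>y. F y * k (y - x))"
  proof (rule Bochner_Integration.integrable_bound)
    show "integrable lborel (\<lambda>y. B * k (y - x))" using k by simp
    show "AE y in lborel. norm (F y * k (y - x)) \<le> norm (B * k (y - x))"
      using F B k_nonneg by (auto simp: abs_mult intro!: mult_right_mono)
  qed simp
  show ia: "integrable lborel (\<lambda>y. \<bar>F y\<bar> * k (y - x))"
    using integrable_norm[OF i] k_nonneg by (simp add: abs_mult)
  have "\<bar>adj F x\<bar> \<le> (LINT y|lborel. \<bar>F y * k (y - x)\<bar>)" unfolding adj_def by (rule integral_abs_bound)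
  also have "\<dots> \<le> (LINT y|lborel. B * k (y - x))"
    using ia k F k_nonneg by (intro integral_mono) (auto simp: abs_mult intro!: mult_right_mono)
  also have "\<dots> = B" using k by simp
  finally show "\<bar>adj F x\<bar> \<le> B" .
  have "(LINT z|\<eta>. F (x + z)) = (LINT z|lborel. k z * F (x + z))"
    unfolding \<eta>_def using k_nonneg by (subst integral_density) auto
  also have "\<dots> = (LINT z|lborel. (\<lambda>y. F y * k (y - x)) (x + z))" by (simp add: mult.commute)
  also have "\<dots> = adj F x" unfolding adj_def by (rule lborel_integral_translation) simp
  finally show "adj F x = (LINT z|\<eta>. F (x + z))" by simp
qed

lemma adj_measurable [measurable]:
  assumes [measurable]: "F \<in> borel_measurable borel"
  shows "adj F \<in> borel_measurable borel"
  unfolding adj_def[abs_def] by measurable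

text \<open>\<open>adj F\<close> is an average of translates of \<open>F\<close>.\<close>

lemma adj_lipschitz:
  assumes F: "L-lipschitz_on UNIV F" and b: "\<And>x. \<bar>F x\<bar> \<le> B"
  shows "L-lipschitz_on UNIV (adj F)"
proof (rule lipschitz_onI)
  show "0 \<le> L" using F lipschitz_on_nonneg by blast
  interpret \<eta>: prob_space \<eta> by (rule \<eta>_prob)
  have m [measurable]: "F \<in> borel_measurable borel" using F by (rule lipschitz_measurable)
  fix x x' :: 'a
  have i: "integrable \<eta> (\<lambda>z. F (x + z))" for x
    by (rule \<eta>.integrable_const_bound[where B=B]) (use b in auto)
  have "\<bar>adj F x - adj F x'\<bar> = \<bar>LINT z|\<eta>. F (x + z) - F (x' + z)\<bar>"
    using shifted_kernel(5)[OF m b] i by simp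
  also have "\<dots> \<le> (LINT z|\<eta>. \<bar>F (x + z) - F (x' + z)\<bar>)" by (rule integral_abs_bound)
  also have "\<dots> \<le> L * dist x x'"
  proof (rule \<eta>.integral_le_const)
    have "\<bar>F (x + z) - F (x' + z)\<bar> \<le> L * dist x x'" for z
      using lipschitz_onD[OF F, of "x + z" "x' + z"] by (simp add: dist_real_def)
    then show "AE z in \<eta>. \<bar>F (x + z) - F (x' + z)\<bar> \<le> L * dist x x'" by simp
  qed (use i in auto)
  finally show "dist (adj F x) (adj F x') \<le> L * dist x x'" by (simp add: dist_real_def)
qed

context
  fixes \<rho> :: "'a measure"
  assumes \<rho>: "prob_space \<rho>" and \<rho>s [measurable_cong]: "sets \<rho> = sets borel"
begin

interpretation \<rho>: prob_space \<rho> by (rule \<rho>)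
interpretation \<eta>: prob_space \<eta> by (rule \<eta>_prob)
interpretation pair_prob_space \<rho> \<eta> ..
interpretation L: pair_sigma_finite \<rho> "lborel :: 'a measure" ..

lemma smooth_prob: "prob_space (smooth \<rho>)"
  unfolding smooth_def convolution_def by (rule P.prob_space_distr) measurable

lemma smooth_nn_integral:
  assumes [measurable]: "F \<in> borel_measurable borel"
  shows "(\<integral>\<^sup>+ z. F z \<partial>smooth \<rho>) = (\<integral>\<^sup>+ x. \<integral>\<^sup>+ z. F (x + z) \<partial>\<eta> \<partial>\<rho>)"
  unfolding smooth_def by (rule nn_integral_convolution) (auto simp: \<rho>.finite_measure_axioms \<eta>.finite_measure_axioms \<rho>s)

lemma smooth_integral:
  fixes F :: "'a \<Rightarrow> real"
  assumes [measurable]: "F \<in> borel_measurable borel" and F: "\<And>x. \<bar>F x\<bar> \<le> B"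
  shows "(LINT z|smooth \<rho>. F z) = (LINT x|\<rho>. adj F x)"
proof -
  have "(LINT z|smooth \<rho>. F z) = (LINT w|(\<rho> \<Otimes>\<^sub>M \<eta>). F (fst w + snd w))"
    unfolding smooth_def convolution_def by (subst integral_distr) (auto simp: split_beta')
  also have "\<dots> = (LINT x|\<rho>. LINT z|\<eta>. F (x + z))"
  proof -
    have "integrable (\<rho> \<Otimes>\<^sub>M \<eta>) (\<lambda>w. F (fst w + snd w))"
      by (rule P.integrable_const_bound[where B=B]) (use F in auto)
    from integral_fst'[OF this] show ?thesis by simp
  qed
  finally show ?thesis by (simp add: shifted_kernel(5)[OF assms])
qed

lemma dens_integral:
  fixes F :: "'a \<Rightarrow> real"
  assumes [measurable]: "F \<in> borel_measurable borel" and F: "\<And>x. \<bar>F x\<bar> \<le> B"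
  shows "(LINT x|\<rho>. adj F x) = (LINT y|lborel. F y * dens \<rho> y)" "integrable lborel (\<lambda>y. F y * dens \<rho> y)"
proof -
  have B: "0 \<le> B" using F abs_ge_zero order_trans by blast
  have i: "integrable (\<rho> \<Otimes>\<^sub>M lborel) (\<lambda>(x, y). F y * k (y - x))"
  proof (rule L.Fubini_integrable)
    show "integrable \<rho> (\<lambda>x. LINT y|lborel. norm (case (x, y) of (x, y) \<Rightarrow> F y * k (y - x)))"
    proof (rule \<rho>.integrable_const_bound[where B=B])
      have "norm (LINT y|lborel. norm (F y * k (y - x))) \<le> B" for x
      proof -
        have "norm (LINT y|lborel. norm (F y * k (y - x))) = (LINT y|lborel. norm (F y * k (y - x)))"
          by (simp add: Bochner_Integration.integral_nonneg)
        also have "\<dots> \<le> (LINT y|lborel. B * k (y - x))"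
          using shifted_kernel[OF assms, of x] F k_nonneg
          by (intro integral_mono) (auto simp: abs_mult intro!: mult_right_mono)
        also have "\<dots> = B" using shifted_kernel(2)[OF assms] by simp
        finally show ?thesis .
      qed
      then show "AE x in \<rho>. norm (LINT y|lborel. norm (case (x, y) of (x, y) \<Rightarrow> F y * k (y - x))) \<le> B" by simp
    qed measurable
    show "AE x in \<rho>. integrable lborel (\<lambda>y. case (x, y) of (x, y) \<Rightarrow> F y * k (y - x))"
      using shifted_kernel(1)[OF assms] by simp
  qed measurable
  have eq: "(LINT x|\<rho>. F y * k (y - x)) = F y * dens \<rho> y" for y
    by (simp add: dens_def)
  show "(LINT x|\<rho>. adj F x) = (LINT y|lborel. F y * dens \<rho> y)"
    unfolding adj_def eq[symmetric] using L.Fubini_integral[OF i] by simp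
  show "integrable lborel (\<lambda>y. F y * dens \<rho> y)"
    unfolding eq[symmetric] using L.integrable_snd[OF i] by simp
qed

lemma dens_integrable: "integrable lborel (dens \<rho>)"
  using dens_integral(2)[of "\<lambda>_. 1" 1] by simp

lemma dens_measurable [measurable]: "dens \<rho> \<in> borel_measurable borel"
  using borel_measurable_integrable[OF dens_integrable] by simp

end

lemma tv_nonneg: "0 \<le> tv \<rho> \<rho>'" by (simp add: tv_def Bochner_Integration.integral_nonneg)

text \<open>Integrals against a smoothed measure are integrals against its density.\<close>

lemma variation_close_smooth:
  assumes \<rho>: "prob_space \<rho>" "sets \<rho> = sets borel" and \<rho>': "prob_space \<rho>'" "sets \<rho>' = sets borel"
  shows "variation_close (tv \<rho> \<rho>') (smooth \<rho>) (smooth \<rho>')"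
  unfolding variation_close_def
proof (intro allI impI)
  fix F :: "'a \<Rightarrow> real" assume F [measurable]: "F \<in> borel_measurable borel" and "\<forall>x. \<bar>F x\<bar> \<le> 1"
  then have b: "\<And>x. \<bar>F x\<bar> \<le> 1" by blast
  have i: "integrable lborel (\<lambda>y. F y * (dens \<rho> y - dens \<rho>' y))"
    using dens_integral(2)[OF \<rho> F b] dens_integral(2)[OF \<rho>' F b] by (simp add: right_diff_distrib)
  have "(LINT x|smooth \<rho>. F x) - (LINT x|smooth \<rho>'. F x) = (LINT y|lborel. F y * (dens \<rho> y - dens \<rho>' y))"
    unfolding smooth_integral[OF \<rho> F b] smooth_integral[OF \<rho>' F b] dens_integral(1)[OF \<rho> F b] dens_integral(1)[OF \<rho>' F b]
    using dens_integral(2)[OF \<rho> F b] dens_integral(2)[OF \<rho>' F b] by (simp add: right_diff_distrib)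
  then have "\<bar>(LINT x|smooth \<rho>. F x) - (LINT x|smooth \<rho>'. F x)\<bar> \<le> (LINT y|lborel. \<bar>F y * (dens \<rho> y - dens \<rho>' y)\<bar>)"
    using integral_abs_bound by simp
  also have "\<dots> \<le> tv \<rho> \<rho>'"
    unfolding tv_def
  proof (rule integral_mono)
    show "\<bar>F y * (dens \<rho> y - dens \<rho>' y)\<bar> \<le> \<bar>dens \<rho> y - dens \<rho>' y\<bar>" for y
      using b[of y] by (simp add: abs_mult mult_left_le_one_le)
  qed (use i dens_integrable[OF \<rho>] dens_integrable[OF \<rho>'] in auto)
  finally show "\<bar>(LINT x|smooth \<rho>. F x) - (LINT x|smooth \<rho>'. F x)\<bar> \<le> tv \<rho> \<rho>'" .
qed

lemma tv_triangle:
  assumes "prob_space \<rho>" "sets \<rho> = sets borel" "prob_space \<rho>'" "sets \<rho>' = sets borel" "prob_space \<rho>''" "sets \<rho>'' = sets borel"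
  shows "tv \<rho> \<rho>'' \<le> tv \<rho> \<rho>' + tv \<rho>' \<rho>''"
proof -
  note i = dens_integrable[OF assms(1,2)] dens_integrable[OF assms(3,4)] dens_integrable[OF assms(5,6)]
  have "tv \<rho> \<rho>'' \<le> (LINT y|lborel. \<bar>dens \<rho> y - dens \<rho>' y\<bar> + \<bar>dens \<rho>' y - dens \<rho>'' y\<bar>)"
    unfolding tv_def using i by (intro integral_mono) auto
  also have "\<dots> = tv \<rho> \<rho>' + tv \<rho>' \<rho>''" unfolding tv_def using i by (intro Bochner_Integration.integral_add) auto
  finally show ?thesis .
qed

text \<open>The points at which smoothing a measure with the same support as \<open>\<mu>\<close>
  puts positive density. The support of the smoothed measure is the closure of this open set,
  hence depends on the support of \<open>\<mu>\<close> only and is the closure of its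
  interior.\<close>

definition charged :: "'a measure \<Rightarrow> 'a set" where
  "charged \<mu> = (\<Union>x\<in>msupport \<mu>. (\<lambda>y. y - x) -` {z. 0 < k z})"

lemma open_charged: "open (charged \<mu>)"
proof -
  have "open {z. 0 < k z}" using open_Collect_less[OF continuous_on_const k_cont] .
  then have "open ((\<lambda>y. y - x) -` {z. 0 < k z})" for x :: 'a
    by (intro open_vimage continuous_intros)
  then show ?thesis unfolding charged_def by auto
qed

lemma shifted_mass_zero_iff:
  assumes V: "open V"
  shows "emeasure \<eta> {z. x + z \<in> V} = 0 \<longleftrightarrow> (\<forall>z. 0 < k z \<longrightarrow> x + z \<notin> V)"
proof
  have Vo: "open {z. x + z \<in> V}" using open_vimage[OF V, of "\<lambda>z. x + z"] by (simp add: vimage_def continuous_intros)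
  then have Vm [measurable]: "{z. x + z \<in> V} \<in> sets borel" by simp
  {
    assume "emeasure \<eta> {z. x + z \<in> V} = 0"
    then have "AE z in lborel. ennreal (k z) * indicator {z. x + z \<in> V} z = 0"
      unfolding \<eta>_def by (simp add: emeasure_density nn_integral_0_iff_AE)
    then have "AE z in lborel. z \<notin> {z. 0 < k z} \<inter> {z. x + z \<in> V}"
      by eventually_elim (auto simp: ennreal_eq_0_iff split: split_indicator_asm)
    moreover have "open ({z. 0 < k z} \<inter> {z. x + z \<in> V})"
      using open_Collect_less[OF continuous_on_const k_cont] Vo by auto
    ultimately have "{z. 0 < k z} \<inter> {z. x + z \<in> V} = {}" by (intro open_null_lborel)
    then show "\<forall>z. 0 < k z \<longrightarrow> x + z \<notin> V" by auto
  }
  {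
    assume *: "\<forall>z. 0 < k z \<longrightarrow> x + z \<notin> V"
    have "AE z in lborel. ennreal (k z) * indicator {z. x + z \<in> V} z = 0"
      using * k_nonneg by (intro AE_I2) (auto simp: ennreal_eq_0_iff not_less split: split_indicator)
    then show "emeasure \<eta> {z. x + z \<in> V} = 0"
      unfolding \<eta>_def by (simp add: emeasure_density nn_integral_0_iff_AE)
  }
qed

lemma smooth_emeasure:
  assumes \<rho>: "prob_space \<rho>" "sets \<rho> = sets borel" and V: "open V"
  shows "emeasure (smooth \<rho>) V = (\<integral>\<^sup>+ x. emeasure \<eta> {z. x + z \<in> V} \<partial>\<rho>)"
    and "(\<lambda>x. emeasure \<eta> {z. x + z \<in> V}) \<in> borel_measurable \<rho>"
proof -
  have [measurable]: "V \<in> sets borel" using V by simp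
  note [measurable_cong] = \<rho>(2)
  interpret \<eta>: prob_space \<eta> by (rule \<eta>_prob)
  have "(\<integral>\<^sup>+ z. indicator V (x + z) \<partial>\<eta>) = emeasure \<eta> {z. x + z \<in> V}" for x
  proof -
    have "{z. x + z \<in> V} \<in> sets \<eta>" using open_vimage[OF V, of "\<lambda>z. x + z"] by (simp add: vimage_def continuous_intros)
    then have "emeasure \<eta> {z. x + z \<in> V} = (\<integral>\<^sup>+ z. indicator {z. x + z \<in> V} z \<partial>\<eta>)" by simp
    also have "\<dots> = (\<integral>\<^sup>+ z. indicator V (x + z) \<partial>\<eta>)" by (rule nn_integral_cong) (auto split: split_indicator)
    finally show ?thesis by simp
  qed
  then have eq: "(\<lambda>x. emeasure \<eta> {z. x + z \<in> V}) = (\<lambda>x. \<integral>\<^sup>+ z. indicator V (x + z) \<partial>\<eta>)" by auto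
  show "(\<lambda>x. emeasure \<eta> {z. x + z \<in> V}) \<in> borel_measurable \<rho>" unfolding eq by measurable
  show "emeasure (smooth \<rho>) V = (\<integral>\<^sup>+ x. emeasure \<eta> {z. x + z \<in> V} \<partial>\<rho>)"
    unfolding eq using smooth_nn_integral[OF \<rho>, of "indicator V"] by simp
qed

lemma msupport_smooth:
  assumes \<mu>: "prob_space \<mu>" "sets \<mu> = sets borel"
  shows "msupport (smooth \<mu>) = closure (charged \<mu>)"
proof -
  have pos: "0 < emeasure (smooth \<mu>) V \<longleftrightarrow> V \<inter> charged \<mu> \<noteq> {}" if V: "open V" for V
  proof -
    have "emeasure (smooth \<mu>) V = 0 \<longleftrightarrow> (AE x in \<mu>. emeasure \<eta> {z. x + z \<in> V} = 0)"
      unfolding smooth_emeasure(1)[OF \<mu> V] by (rule nn_integral_0_iff_AE[OF smooth_emeasure(2)[OF \<mu> V]])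
    also have "\<dots> \<longleftrightarrow> (AE x in \<mu>. \<forall>z. 0 < k z \<longrightarrow> x + z \<notin> V)"
      by (simp only: shifted_mass_zero_iff[OF V])
    also have "\<dots> \<longleftrightarrow> V \<inter> charged \<mu> = {}"
    proof
      assume ae: "AE x in \<mu>. \<forall>z. 0 < k z \<longrightarrow> x + z \<notin> V"
      define Q where "Q = (\<Union>z\<in>{z. 0 < k z}. (\<lambda>x. x + z) -` V)"
      have Qo: "open Q" unfolding Q_def by (intro open_UN ballI open_vimage[OF V] continuous_intros)
      have "AE x in \<mu>. x \<notin> Q" using ae by eventually_elim (auto simp: Q_def)
      then have "emeasure \<mu> Q = 0"
        using Qo \<mu>(2) by (subst (asm) AE_iff_measurable[of Q]) (auto simp: sets_eq_imp_space_eq[OF \<mu>(2)])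
      then have "x \<notin> msupport \<mu>" if "x \<in> Q" for x using that Qo by (auto simp: msupport_def)
      then show "V \<inter> charged \<mu> = {}" by (force simp: charged_def Q_def)
    next
      assume *: "V \<inter> charged \<mu> = {}"
      show "AE x in \<mu>. \<forall>z. 0 < k z \<longrightarrow> x + z \<notin> V"
        using AE_msupport[OF \<mu>(2)]
      proof eventually_elim
        case (elim x)
        show ?case
        proof (intro allI impI notI)
          fix z assume z: "0 < k z" "x + z \<in> V"
          then have "x + z \<in> charged \<mu>" using elim by (auto simp: charged_def intro!: bexI[of _ x])
          then show False using * z by auto
        qed
      qed
    qed
    finally show ?thesis by (simp add: zero_less_iff_neq_zero)
  qed
  have "x \<in> msupport (smooth \<mu>) \<longleftrightarrow> x \<in> closure (charged \<mu>)" for x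
  proof -
    have "x \<in> msupport (smooth \<mu>) \<longleftrightarrow> (\<forall>V. open V \<longrightarrow> x \<in> V \<longrightarrow> V \<inter> charged \<mu> \<noteq> {})"
      unfolding msupport_def using pos by auto
    also have "\<dots> \<longleftrightarrow> x \<in> closure (charged \<mu>)" unfolding closure_iff_nhds_not_empty
      by (metis Int_commute Int_mono subset_empty subset_refl)
    finally show ?thesis .
  qed
  then show ?thesis by blast
qed

lemma charged_subset_msupport:
  assumes \<mu>: "prob_space \<mu>" "sets \<mu> = sets borel" shows "charged \<mu> \<subseteq> msupport (smooth \<mu>)"
  unfolding msupport_smooth[OF assms] by (rule closure_subset)

lemma msupport_smooth_regular:
  assumes \<mu>: "prob_space \<mu>" "sets \<mu> = sets borel"
  shows "msupport (smooth \<mu>) \<subseteq> closure (interior (msupport (smooth \<mu>)))"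
proof -
  have "charged \<mu> \<subseteq> interior (msupport (smooth \<mu>))"
    by (rule interior_maximal[OF charged_subset_msupport[OF \<mu>] open_charged])
  then show ?thesis unfolding msupport_smooth[OF \<mu>] by (rule closure_mono)
qed

text \<open>Empirical measures are supported in the support of the sampled law, and smoothing
  preserves this relation. Thus all perturbations that occur are admissible for the
  differentiability theorem.\<close>

lemma smooth_concentrated:
  assumes \<mu>: "prob_space \<mu>" "sets \<mu> = sets borel" and \<rho>: "prob_space \<rho>" "sets \<rho> = sets borel"
    and conc: "AE x in \<rho>. x \<in> msupport \<mu>"
  shows "AE y in smooth \<rho>. y \<in> msupport (smooth \<mu>)"
proof -
  let ?V = "- msupport (smooth \<mu>)"
  have V: "open ?V" using closed_msupport by auto
  have "AE x in \<rho>. emeasure \<eta> {z. x + z \<in> ?V} = 0"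
    using conc
  proof eventually_elim
    case (elim x)
    have "x + z \<in> charged \<mu>" if "0 < k z" for z using that elim by (auto simp: charged_def intro!: bexI[of _ x])
    then show ?case unfolding shifted_mass_zero_iff[OF V] using charged_subset_msupport[OF \<mu>] by auto
  qed
  then have "emeasure (smooth \<rho>) ?V = 0"
    unfolding smooth_emeasure(1)[OF \<rho> V] using nn_integral_0_iff_AE[OF smooth_emeasure(2)[OF \<rho> V]] by blast
  then show ?thesis using V
    by (subst AE_iff_measurable[of ?V]) (auto simp: sets_eq_imp_space_eq[OF smooth_sets])
qed

lemma smooth_concentrated_ball:
  assumes \<rho>: "prob_space \<rho>" "sets \<rho> = sets borel" and conc: "AE x in \<rho>. norm x \<le> s"
  shows "AE y in smooth \<rho>. y \<in> cball 0 (s + r)"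
proof -
  let ?V = "- cball (0::'a) (s + r)"
  have V: "open ?V" by auto
  have "AE x in \<rho>. emeasure \<eta> {z. x + z \<in> ?V} = 0"
    using conc
  proof eventually_elim
    case (elim x)
    have "x + z \<in> cball 0 (s + r)" if "0 < k z" for z
    proof -
      have "z \<in> ball 0 r" using k_zero[of z] that by fastforce
      then show ?thesis using elim norm_triangle_ineq[of x z] by simp
    qed
    then show ?case unfolding shifted_mass_zero_iff[OF V] by auto
  qed
  then have "emeasure (smooth \<rho>) ?V = 0"
    unfolding smooth_emeasure(1)[OF \<rho> V] using nn_integral_0_iff_AE[OF smooth_emeasure(2)[OF \<rho> V]] by blast
  then show ?thesis using V
    by (subst AE_iff_measurable[of ?V]) (auto simp: sets_eq_imp_space_eq[OF smooth_sets])
qed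

text \<open>For \<open>x\<close> in the support of \<open>\<mu>\<close> the kernel centred at
  \<open>x\<close> lives on the support of the smoothed measure, so the values of a potential
  elsewhere are irrelevant for the variance.\<close>

lemma adj_msupport_cong:
  assumes \<mu>: "prob_space \<mu>" "sets \<mu> = sets borel" and x: "x \<in> msupport \<mu>"
    and eq: "\<And>y. y \<in> msupport (smooth \<mu>) \<Longrightarrow> F y = G y"
  shows "adj F x = adj G x"
  unfolding adj_def
proof (rule Bochner_Integration.integral_cong[OF refl])
  fix y
  show "F y * k (y - x) = G y * k (y - x)"
  proof (cases "k (y - x) = 0")
    case False
    then have "0 < k (y - x)" using k_nonneg[of "y - x"] by simp
    then have "y \<in> charged \<mu>" using x by (auto simp: charged_def)
    then show ?thesis using eq charged_subset_msupport[OF \<mu>] by auto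
  qed simp
qed

end

section \<open>Empirical measures\<close>

lemma sets_empirical [simp]: "sets (empirical n x) = sets borel"
  by (simp add: empirical_def)

lemma measurable_uniform_count: "f \<in> measurable (uniform_count_measure A) borel"
  by (simp add: measurable_def sets_uniform_count_measure space_uniform_count_measure)

lemma prob_space_empirical: "0 < n \<Longrightarrow> prob_space (empirical n x)"
  unfolding empirical_def
  by (intro prob_space.prob_space_distr prob_space_uniform_count_measure measurable_uniform_count) auto

lemma integral_empirical:
  fixes f :: "'a::topological_space \<Rightarrow> real"
  assumes "f \<in> borel_measurable borel"
  shows "(LINT z|empirical n x. f z) = (\<Sum>i<n. f (x i)) / real n"
  unfolding empirical_def using assms
  by (subst integral_distr) (auto simp: integral_uniform_count_measure measurable_uniform_count)

lemma AE_empirical: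
  assumes "0 < n" "S \<in> sets borel" "\<And>i. i < n \<Longrightarrow> x i \<in> S"
  shows "AE z in empirical n x. z \<in> S"
proof -
  interpret prob_space "empirical n x" using prob_space_empirical assms(1) .
  have "emeasure (empirical n x) S = ennreal ((\<Sum>i<n. indicator S (x i)) / real n)"
    using assms(1,2) by (rule emeasure_empirical)
  also have "(\<Sum>i<n. indicator S (x i)) = real n" using assms(3) by simp
  finally have "prob S = 1" using assms(1) by (simp add: emeasure_eq_measure)
  then show ?thesis by (rule AE_prob_1)
qed

text \<open>Centred independent variables are orthogonal.\<close>

lemma PiM_second_moment:
  fixes g :: "'a \<Rightarrow> real"
  assumes \<rho>: "prob_space \<rho>" and [measurable]: "g \<in> borel_measurable \<rho>" and b: "\<And>x. \<bar>g x\<bar> \<le> B"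
    and mean: "(LINT x|\<rho>. g x) = 0"
  shows "(LINT x|PiM {..<n} (\<lambda>_. \<rho>). (\<Sum>i<n. g (x i))\<^sup>2) = real n * (LINT x|\<rho>. (g x)\<^sup>2)"
proof -
  interpret \<rho>: prob_space \<rho> by fact
  interpret product_prob_space "\<lambda>_::nat. \<rho>" "{..<n}" ..
  let ?P = "PiM {..<n} (\<lambda>_. \<rho>)"
  have ig: "integrable \<rho> g" by (rule \<rho>.integrable_const_bound[where B=B]) (use b in auto)
  have B: "0 \<le> B" using b abs_ge_zero order_trans by blast
  have ig2: "integrable \<rho> (\<lambda>x. (g x)\<^sup>2)"
  proof (rule \<rho>.integrable_const_bound[where B="B\<^sup>2"])
    have "(g x)\<^sup>2 \<le> B\<^sup>2" for x using power_mono[OF b[of x], of 2] by simp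
    then show "AE x in \<rho>. norm ((g x)\<^sup>2) \<le> B\<^sup>2" by simp
  qed simp
  have pr: "(LINT x|?P. g (x i) * g (x j)) = (if i = j then (LINT x|\<rho>. (g x)\<^sup>2) else 0)" (is ?A)
    and int: "integrable ?P (\<lambda>x. g (x i) * g (x j))" (is ?B) if ij: "i < n" "j < n" for i j
  proof -
    define h where "h l = (if i = j then (if l = i then (\<lambda>x. (g x)\<^sup>2) else (\<lambda>_. 1)) else (if l = i \<or> l = j then g else (\<lambda>_. 1)))" for l
    have hi: "integrable \<rho> (h l)" for l using ig ig2 by (auto simp: h_def)
    have eq: "(\<Prod>l<n. h l (x l)) = g (x i) * g (x j)" for x
    proof (cases "i = j")
      case True
      then have "(\<Prod>l<n. h l (x l)) = (\<Prod>l<n. if l = i then (g (x i))\<^sup>2 else 1)" by (intro prod.cong) (auto simp: h_def)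
      then show ?thesis using True ij by (simp add: prod.delta power2_eq_square)
    next
      case False
      have "(\<Prod>l<n. h l (x l)) = (\<Prod>l\<in>{i, j}. h l (x l))"
        by (rule prod.mono_neutral_right) (use ij False in \<open>auto simp: h_def\<close>)
      then show ?thesis using False by (simp add: h_def)
    qed
    have "(LINT x|?P. (\<Prod>l<n. h l (x l))) = (\<Prod>l<n. integral\<^sup>L \<rho> (h l))"
      by (rule product_integral_prod) (use hi in auto)
    also have "\<dots> = (if i = j then (LINT x|\<rho>. (g x)\<^sup>2) else 0)"
    proof (cases "i = j")
      case True
      then have "(\<Prod>l<n. integral\<^sup>L \<rho> (h l)) = (\<Prod>l<n. if l = i then (LINT x|\<rho>. (g x)\<^sup>2) else 1)"
        by (intro prod.cong) (auto simp: h_def \<rho>.prob_space)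
      then show ?thesis using True ij by (simp add: prod.delta)
    next
      case False
      have "integral\<^sup>L \<rho> (h i) = 0" using False mean by (simp add: h_def)
      then show ?thesis using False ij by (auto intro!: prod_zero)
    qed
    finally show ?A by (simp add: eq)
    have "integrable ?P (\<lambda>x. (\<Prod>l<n. h l (x l)))"
      by (rule product_integrable_prod) (use hi in auto)
    then show ?B by (simp add: eq)
  qed
  have "(LINT x|?P. (\<Sum>i<n. g (x i))\<^sup>2) = (LINT x|?P. (\<Sum>i<n. \<Sum>j<n. g (x i) * g (x j)))"
    by (simp add: power2_eq_square sum_product)
  also have "\<dots> = (\<Sum>i<n. \<Sum>j<n. LINT x|?P. g (x i) * g (x j))"
    by (subst Bochner_Integration.integral_sum; (intro Bochner_Integration.integrable_sum int sum.cong refl Bochner_Integration.integral_sum)?; simp)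
  also have "\<dots> = (\<Sum>i<n. \<Sum>j<n. if i = j then (LINT x|\<rho>. (g x)\<^sup>2) else 0)"
    by (intro sum.cong refl pr) auto
  also have "\<dots> = real n * (LINT x|\<rho>. (g x)\<^sup>2)" by (simp add: sum.delta)
  finally show ?thesis .
qed

lemma (in prob_space) expectation_abs_le_sqrt:
  assumes [measurable]: "f \<in> borel_measurable M" and b: "\<And>x. \<bar>f x\<bar> \<le> B"
  shows "expectation (\<lambda>x. \<bar>f x\<bar>) \<le> sqrt (expectation (\<lambda>x. (f x)\<^sup>2))"
proof -
  have i: "integrable M (\<lambda>x. \<bar>f x\<bar>)" by (rule integrable_const_bound[where B=B]) (use b in auto)
  have "(f x)\<^sup>2 \<le> B\<^sup>2" for x using power_mono[OF b[of x], of 2] by simp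
  then have i2: "integrable M (\<lambda>x. \<bar>f x\<bar>\<^sup>2)" by (intro integrable_const_bound[where B="B\<^sup>2"]) auto
  have "0 \<le> variance (\<lambda>x. \<bar>f x\<bar>)" by (rule variance_positive)
  also have "\<dots> = expectation (\<lambda>x. \<bar>f x\<bar>\<^sup>2) - (expectation (\<lambda>x. \<bar>f x\<bar>))\<^sup>2" by (rule variance_eq[OF i i2])
  finally have "(expectation (\<lambda>x. \<bar>f x\<bar>))\<^sup>2 \<le> expectation (\<lambda>x. (f x)\<^sup>2)" by simp
  then show ?thesis by (rule real_le_rsqrt)
qed

context smoothing begin

lemma dens_bounds:
  assumes "prob_space \<rho>" "sets \<rho> = sets borel"
  shows "0 \<le> dens \<rho> y" "dens \<rho> y \<le> M" "integrable \<rho> (\<lambda>x. k (y - x))"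
proof -
  interpret prob_space \<rho> by fact
  note [measurable_cong] = assms(2)
  show i: "integrable \<rho> (\<lambda>x. k (y - x))"
  proof (rule integrable_const_bound[where B=M])
    show "AE x in \<rho>. norm (k (y - x)) \<le> M" using k_le k_nonneg by (intro AE_I2) simp
  qed measurable
  show "0 \<le> dens \<rho> y" unfolding dens_def by (simp add: Bochner_Integration.integral_nonneg k_nonneg)
  show "dens \<rho> y \<le> M" unfolding dens_def by (rule integral_le_const[OF i]) (simp add: k_le)
qed

lemma dens_empirical: "dens (empirical n x) y = (\<Sum>i<n. k (y - x i)) / real n"
  unfolding dens_def by (rule integral_empirical) simp

lemma tv_empirical_measurable:
  assumes \<rho>: "prob_space \<rho>" "sets \<rho> = sets borel"
  shows "(\<lambda>x. tv (empirical n x) \<rho>) \<in> borel_measurable (PiM {..<n} (\<lambda>_. borel))"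
proof -
  note [measurable] = dens_measurable[OF \<rho>]
  have "(\<lambda>x. LINT y|lborel. \<bar>(\<Sum>i<n. k (y - x i)) / real n - dens \<rho> y\<bar>) \<in> borel_measurable (PiM {..<n} (\<lambda>_. borel))"
    by measurable
  then show ?thesis by (simp add: tv_def dens_empirical)
qed

definition "tv_const s = M * measure lborel (cball (0::'a) (s + r))"

lemma tv_const_nonneg: "0 \<le> tv_const s" using M_nonneg by (simp add: tv_const_def)

text \<open>This is where smoothing beats the curse of dimension. For fixed \<open>y\<close> the
  difference of the densities at \<open>y\<close> is an average of \<open>n\<close> centred
  independent variables bounded by \<open>M\<close>, so its mean absolute value is at most
  \<open>M / sqrt n\<close>; it vanishes outside a ball that depends on the support and on
  \<open>r\<close> only, and integrating over that ball keeps the rate. The bound is uniform in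
  \<open>\<rho>\<close>, as the bootstrap requires.\<close>

lemma tv_sampling:
  assumes \<rho>: "prob_space \<rho>" "sets \<rho> = sets borel" and conc: "AE x in \<rho>. norm x \<le> s" and n: "0 < n"
  shows "(\<integral>\<^sup>+ x. ennreal (tv (empirical n x) \<rho>) \<partial>PiM {..<n} (\<lambda>_. \<rho>)) \<le> ennreal (tv_const s / sqrt (real n))"
proof -
  interpret \<rho>: prob_space \<rho> by fact
  interpret product_prob_space "\<lambda>_::nat. \<rho>" "{..<n}" ..
  let ?P = "PiM {..<n} (\<lambda>_. \<rho>)"
  interpret P: prob_space ?P by (rule prob_space_PiM) (rule \<rho>)
  interpret PL: pair_sigma_finite ?P "lborel :: 'a measure" ..
  note [measurable_cong] = \<rho>(2)
  note [measurable] = dens_measurable[OF \<rho>]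
  define g where "g y x = k (y - x) - dens \<rho> y" for y x
  define h where "h y x = (\<Sum>i<n. g y (x i)) / real n" for y and x :: "nat \<Rightarrow> 'a"
  have h_eq: "dens (empirical n x) y - dens \<rho> y = h y x" for x y
    using n by (simp add: dens_empirical h_def g_def sum_subtractf field_simps)
  have [measurable]: "(\<lambda>(x, y). h y x) \<in> borel_measurable (?P \<Otimes>\<^sub>M lborel)"
    unfolding h_def g_def by measurable
  have gb: "\<bar>g y x\<bar> \<le> M" for y x
    using dens_bounds[OF \<rho>, of y] k_nonneg[of "y - x"] k_le[of "y - x"] by (simp add: g_def)
  have hb: "\<bar>h y x\<bar> \<le> M" for y x
  proof -
    have "\<bar>\<Sum>i<n. g y (x i)\<bar> \<le> (\<Sum>i<n. \<bar>g y (x i)\<bar>)" by (rule sum_abs)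
    also have "\<dots> \<le> (\<Sum>i<n. M)" by (rule sum_mono) (rule gb)
    finally show ?thesis using n by (simp add: h_def abs_divide divide_le_eq mult.commute)
  qed
  have inner: "(\<integral>\<^sup>+ x. ennreal \<bar>h y x\<bar> \<partial>?P) \<le> ennreal (M / sqrt (real n)) * indicator (cball 0 (s + r)) y" for y
  proof (cases "y \<in> cball 0 (s + r)")
    case True
    have [measurable]: "h y \<in> borel_measurable ?P" unfolding h_def g_def by measurable
    have "(LINT x|?P. (h y x)\<^sup>2) = (LINT x|?P. (\<Sum>i<n. g y (x i))\<^sup>2) / (real n)\<^sup>2"
      by (simp add: h_def power_divide)
    also have "(LINT x|?P. (\<Sum>i<n. g y (x i))\<^sup>2) = real n * (LINT x|\<rho>. (g y x)\<^sup>2)"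
    proof (rule PiM_second_moment[OF \<rho>(1) _ gb])
      show "(LINT x|\<rho>. g y x) = 0" using dens_bounds(3)[OF \<rho>] by (simp add: g_def \<rho>.prob_space dens_def)
    qed (simp add: g_def)
    also have "(LINT x|\<rho>. (g y x)\<^sup>2) \<le> M\<^sup>2"
    proof -
      have sq: "(g y x)\<^sup>2 \<le> M\<^sup>2" for x using power_mono[OF gb[of y x], of 2] by simp
      have "integrable \<rho> (\<lambda>x. (g y x)\<^sup>2)"
        by (rule \<rho>.integrable_const_bound[where B="M\<^sup>2"]) (use sq in \<open>auto simp: g_def\<close>)
      then show ?thesis using sq by (intro \<rho>.integral_le_const) auto
    qed
    finally have "(LINT x|?P. (h y x)\<^sup>2) \<le> real n * M\<^sup>2 / (real n)\<^sup>2" by (simp add: divide_right_mono mult_left_mono)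
    also have "\<dots> = M\<^sup>2 / real n" using n by (simp add: power2_eq_square)
    finally have "sqrt (LINT x|?P. (h y x)\<^sup>2) \<le> sqrt (M\<^sup>2 / real n)" by (rule real_sqrt_le_mono)
    also have "\<dots> = M / sqrt (real n)" using M_nonneg by (simp add: real_sqrt_divide)
    finally have "(LINT x|?P. \<bar>h y x\<bar>) \<le> M / sqrt (real n)"
      using P.expectation_abs_le_sqrt[of "h y" M] hb by simp
    moreover have "(\<integral>\<^sup>+ x. ennreal \<bar>h y x\<bar> \<partial>?P) = ennreal (LINT x|?P. \<bar>h y x\<bar>)"
      by (rule nn_integral_eq_integral) (use hb in \<open>auto intro!: P.integrable_const_bound[where B=M]\<close>)
    ultimately show ?thesis using True by (simp add: ennreal_leI)
  next
    case False
    have out: "k (y - x) = 0" if "norm x \<le> s" for x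
    proof (rule k_zero)
      show "y - x \<notin> ball 0 r" using False that norm_triangle_ineq2[of y x] by simp
    qed
    have d0: "dens \<rho> y = 0"
    proof -
      have "dens \<rho> y = (LINT x|\<rho>. 0)" unfolding dens_def
        by (rule integral_cong_AE) (use conc out in auto)
      then show ?thesis by simp
    qed
    have "AE x in ?P. \<forall>i\<in>{..<n}. norm (x i) \<le> s"
    proof (rule AE_finite_allI)
      show "AE x in ?P. norm (x i) \<le> s" if "i \<in> {..<n}" for i
        using AE_PiM_component[of "{..<n}" "\<lambda>_. \<rho>" i "\<lambda>x. norm x \<le> s"] that conc \<rho> by auto
    qed simp
    then have "AE x in ?P. ennreal \<bar>h y x\<bar> = 0"
      by eventually_elim (simp add: h_def g_def d0 out)
    then have "(\<integral>\<^sup>+ x. ennreal \<bar>h y x\<bar> \<partial>?P) = (\<integral>\<^sup>+ x. 0 \<partial>?P)" by (rule nn_integral_cong_AE)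
    then show ?thesis by simp
  qed
  have "(\<integral>\<^sup>+ x. ennreal (tv (empirical n x) \<rho>) \<partial>?P) = (\<integral>\<^sup>+ x. \<integral>\<^sup>+ y. ennreal \<bar>h y x\<bar> \<partial>lborel \<partial>?P)"
  proof (rule nn_integral_cong)
    fix x
    have "integrable lborel (\<lambda>y. \<bar>h y x\<bar>)"
      unfolding h_eq[symmetric] using dens_integrable[OF \<rho>] dens_integrable[OF prob_space_empirical[OF n] sets_empirical, of x] by auto
    then show "ennreal (tv (empirical n x) \<rho>) = (\<integral>\<^sup>+ y. ennreal \<bar>h y x\<bar> \<partial>lborel)"
      unfolding tv_def h_eq by (subst nn_integral_eq_integral) auto
  qed
  also have "\<dots> = (\<integral>\<^sup>+ y. \<integral>\<^sup>+ x. ennreal \<bar>h y x\<bar> \<partial>?P \<partial>lborel)"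
    by (rule PL.Fubini'[symmetric]) measurable
  also have "\<dots> \<le> (\<integral>\<^sup>+ y. ennreal (M / sqrt (real n)) * indicator (cball (0::'a) (s + r)) y \<partial>lborel)"
    by (intro nn_integral_mono inner)
  also have "(\<integral>\<^sup>+ y. ennreal (M / sqrt (real n)) * indicator (cball (0::'a) (s + r)) y \<partial>lborel)
      = ennreal (M / sqrt (real n)) * emeasure lborel (cball (0::'a) (s + r))"
    by (rule nn_integral_cmult_indicator) simp
  also have "\<dots> = ennreal (M / sqrt (real n) * measure lborel (cball (0::'a) (s + r)))"
    using M_nonneg emeasure_lborel_cball_finite[of "0::'a" "s + r"]
    by (subst ennreal_mult) (auto simp: emeasure_eq_ennreal_measure less_top)
  also have "\<dots> = ennreal (tv_const s / sqrt (real n))" by (simp add: tv_const_def)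
  finally show ?thesis .
qed

lemma tv_tail:
  assumes \<rho>: "prob_space \<rho>" "sets \<rho> = sets borel" and conc: "AE x in \<rho>. norm x \<le> s" and n: "0 < n" and t: "0 < t"
  shows "measure (PiM {..<n} (\<lambda>_. \<rho>)) {x \<in> space (PiM {..<n} (\<lambda>_. \<rho>)). t < sqrt (real n) * tv (empirical n x) \<rho>} \<le> tv_const s / t"
proof -
  let ?P = "PiM {..<n} (\<lambda>_. \<rho>)"
  interpret P: prob_space ?P by (rule prob_space_PiM) (rule \<rho>)
  have sP: "sets ?P = sets (PiM {..<n} (\<lambda>_. borel))" by (rule sets_PiM_cong) (auto simp: \<rho>)
  have [measurable]: "(\<lambda>x. tv (empirical n x) \<rho>) \<in> borel_measurable ?P"
    using tv_empirical_measurable[OF \<rho>] by (simp cong: measurable_cong_sets[OF sP refl])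
  define c where "c = t / sqrt (real n)"
  have c: "0 < c" using t n by (simp add: c_def)
  have "emeasure ?P {x \<in> space ?P. t < sqrt (real n) * tv (empirical n x) \<rho>} \<le> emeasure ?P {x \<in> space ?P. 1 \<le> ennreal (1 / c) * ennreal (tv (empirical n x) \<rho>)}"
  proof (rule emeasure_mono)
    show "{x \<in> space ?P. t < sqrt (real n) * tv (empirical n x) \<rho>} \<subseteq> {x \<in> space ?P. 1 \<le> ennreal (1 / c) * ennreal (tv (empirical n x) \<rho>)}"
    proof safe
      fix x assume "t < sqrt (real n) * tv (empirical n x) \<rho>"
      then have "1 \<le> 1 / c * tv (empirical n x) \<rho>" using t n by (simp add: c_def field_simps)
      then show "1 \<le> ennreal (1 / c) * ennreal (tv (empirical n x) \<rho>)"
        using c tv_nonneg by (subst ennreal_mult[symmetric]) (auto simp del: ennreal_1 simp flip: ennreal_1 intro!: ennreal_leI)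
    qed
  qed measurable
  also have "\<dots> \<le> ennreal (1 / c) * (\<integral>\<^sup>+ x. ennreal (tv (empirical n x) \<rho>) * indicator (space ?P) x \<partial>?P)"
    by (rule nn_integral_Markov_inequality) auto
  also have "\<dots> = ennreal (1 / c) * (\<integral>\<^sup>+ x. ennreal (tv (empirical n x) \<rho>) \<partial>?P)"
    by (intro arg_cong2[where f="(*)"] refl nn_integral_cong) simp
  also have "\<dots> \<le> ennreal (1 / c) * ennreal (tv_const s / sqrt (real n))"
    by (rule mult_left_mono[OF tv_sampling[OF \<rho> conc n]]) simp
  also have "\<dots> = ennreal (tv_const s / t)"
    using c tv_const_nonneg n t by (subst ennreal_mult[symmetric]) (auto simp: c_def)
  finally show ?thesis using tv_const_nonneg t by (simp add: P.emeasure_eq_measure)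
qed

end

section \<open>Characteristic functions and weak convergence\<close>

lemma real_distributionI: "prob_space M \<Longrightarrow> sets M = sets borel \<Longrightarrow> real_distribution M"
  by (simp add: real_distribution_def real_distribution_axioms_def)

lemma centered_normal_std:
  assumes "0 < v"
  shows "centered_normal v = distr std_normal_distribution borel (\<lambda>x. sqrt v * x)"
proof -
  interpret prob_space std_normal_distribution by (rule prob_space_normal_density) simp
  have "distributed std_normal_distribution lborel (\<lambda>x. x) std_normal_density"
    unfolding distributed_def by (auto simp: distr_id2)
  from normal_density_affine[OF this, of "sqrt v" 0]
  have "distributed std_normal_distribution lborel (\<lambda>x. sqrt v * x) (normal_density 0 (sqrt v))" using assms by simp
  then have "distr std_normal_distribution lborel (\<lambda>x. sqrt v * x) = density lborel (normal_density 0 (sqrt v))"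
    by (simp add: distributed_def)
  moreover have "distr std_normal_distribution lborel (\<lambda>x. sqrt v * x) = distr std_normal_distribution borel (\<lambda>x. sqrt v * x)"
    by (rule distr_cong) auto
  ultimately show ?thesis using assms by (simp add: centered_normal_def)
qed

lemma centered_normal_real_distribution: "0 \<le> v \<Longrightarrow> real_distribution (centered_normal v)"
proof (cases "v = 0")
  case True
  then show ?thesis by (auto simp: centered_normal_def intro!: real_distributionI prob_space_return)
next
  case False
  assume "0 \<le> v"
  with False have "0 < v" by simp
  then have "prob_space (centered_normal v)"
    unfolding centered_normal_def using False by (simp add: prob_space_normal_density)
  then show ?thesis by (rule real_distributionI) (simp add: centered_normal_def)
qed

lemma char_centered_normal:
  assumes "0 \<le> v" shows "char (centered_normal v) t = exp (- v * t\<^sup>2 / 2)"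
proof (cases "v = 0")
  case True
  then show ?thesis by (simp add: centered_normal_def char_def integral_return)
next
  case False
  with assms have v: "0 < v" by simp
  have "char (centered_normal v) t = char std_normal_distribution (t * sqrt v)"
    unfolding centered_normal_std[OF v] char_def by (subst integral_distr) (auto simp: mult.assoc)
  also have "\<dots> = exp (- v * t\<^sup>2 / 2)"
    using v by (simp add: char_std_normal_distribution power_mult_distrib mult.commute exp_of_real)
  finally show ?thesis .
qed

lemma isCont_cdf_centered_normal:
  assumes "0 < v" shows "isCont (cdf (centered_normal v)) x"
proof -
  interpret real_distribution "centered_normal v" using centered_normal_real_distribution assms by simp
  interpret finite_borel_measure "centered_normal v" by (rule finite_borel_measure_M)
  have "emeasure (centered_normal v) {x} = 0"
    using assms AE_lborel_singleton[of x]
    by (auto simp: centered_normal_def emeasure_density nn_integral_0_iff_AE elim!: eventually_mono split: split_indicator)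
  then show ?thesis by (simp add: isCont_cdf measure_def)
qed

lemma cdf_attains_values:
  assumes "real_distribution M" "\<And>x. isCont (cdf M) x" "0 < c" "c < 1"
  obtains x where "cdf M x = c"
proof -
  interpret real_distribution M by fact
  interpret finite_borel_measure M by (rule finite_borel_measure_M)
  have "eventually (\<lambda>x. cdf M x < c) at_bot" using order_tendstoD(2)[OF cdf_lim_at_bot assms(3)] .
  then obtain a where a: "cdf M a < c" by (auto simp: eventually_at_bot_linorder)
  have "eventually (\<lambda>x. c < cdf M x) at_top" using order_tendstoD(1)[OF cdf_lim_at_top_prob assms(4)] .
  then obtain b where b: "c < cdf M b" by (auto simp: eventually_at_top_linorder)
  have "a \<le> b" using a b cdf_nondecreasing[of b a] by linarith
  then obtain x where "cdf M x = c"
    using IVT[of "cdf M" a c b] a b assms(2) by (auto intro: less_imp_le)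
  then show ?thesis by (rule that)
qed

text \<open>Polya's theorem: convergence at finitely many quantiles of the continuous limit
  controls monotone functions between them.\<close>

theorem weak_conv_uniform:
  fixes M :: "nat \<Rightarrow> real measure"
  assumes M: "\<And>n. real_distribution (M n)" and N: "real_distribution N" "\<And>x. isCont (cdf N) x"
    and conv: "weak_conv_m M N" and e: "0 < e"
  shows "eventually (\<lambda>n. \<forall>t. \<bar>cdf (M n) t - cdf N t\<bar> \<le> e) sequentially"
proof -
  interpret N: real_distribution N by fact
  interpret N: finite_borel_measure N by (rule N.finite_borel_measure_M)
  obtain m where m: "2 / e < real m" using reals_Archimedean2 by blast
  have "0 < 2 / e" using e by simp
  then have m0: "0 < real m" using m by linarith
  have me: "1 / real m < e / 2" using m m0 e by (simp add: field_simps)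
  have "\<exists>x. cdf N x = real j / real m" if "j \<in> {1..<m}" for j
  proof -
    have "0 < real j / real m" "real j / real m < 1" using that m0 by auto
    from cdf_attains_values[OF N this] show ?thesis by blast
  qed
  then obtain X where X: "\<And>j. j \<in> {1..<m} \<Longrightarrow> cdf N (X j) = real j / real m" by metis
  have "eventually (\<lambda>n. \<forall>j\<in>{1..<m}. \<bar>cdf (M n) (X j) - cdf N (X j)\<bar> < e / 2) sequentially"
  proof (intro eventually_ball_finite ballI)
    fix j
    have "(\<lambda>n. cdf (M n) (X j)) \<longlonglongrightarrow> cdf N (X j)"
      using conv N(2) by (auto simp: weak_conv_m_def weak_conv_def)
    from tendstoD[OF this, of "e / 2"] e
    show "eventually (\<lambda>n. \<bar>cdf (M n) (X j) - cdf N (X j)\<bar> < e / 2) sequentially" by (simp add: dist_real_def)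
  qed simp
  then show ?thesis
  proof eventually_elim
    case (elim n)
    interpret Mn: real_distribution "M n" by fact
    interpret Mn: finite_borel_measure "M n" by (rule Mn.finite_borel_measure_M)
    show ?case
    proof
      fix t
      define F where "F = cdf N t"
      have F: "0 \<le> F" "F \<le> 1" by (auto simp: F_def N.cdf_nonneg N.cdf_bounded_prob)
      have Fn: "0 \<le> cdf (M n) t" "cdf (M n) t \<le> 1" by (auto simp: Mn.cdf_nonneg Mn.cdf_bounded_prob)
      have lower: "F - e \<le> cdf (M n) t"
      proof (cases "real m * F \<le> 1")
        case True
        then have "F \<le> 1 / real m" using m0 by (simp add: field_simps)
        then show ?thesis using me Fn e by linarith
      next
        case False
        define j where "j = nat (ceiling (real m * F)) - 1"
        have c: "1 < ceiling (real m * F)" using False by linarith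
        then have j: "real j = of_int (ceiling (real m * F)) - 1" proof -
          have "int j = ceiling (real m * F) - 1" unfolding j_def using c by linarith
          then show ?thesis by (metis of_int_1 of_int_diff of_int_of_nat_eq)
        qed
        have jl: "real j < real m * F" "real m * F \<le> real j + 1" using j by linarith+
        have "real m * F \<le> real m" using F m0 by (simp add: mult_left_le)
        then have "j < m" using jl by linarith
        moreover have "1 \<le> j" using c unfolding j_def by linarith
        ultimately have jm: "j \<in> {1..<m}" by simp
        have "cdf N (X j) < F" unfolding X[OF jm] using jl m0 by (simp add: divide_less_eq mult.commute)
        then have "X j \<le> t" unfolding F_def using N.cdf_nondecreasing[of t "X j"] by linarith
        then have "cdf (M n) (X j) \<le> cdf (M n) t" by (rule Mn.cdf_nondecreasing)
        moreover have "real j / real m - e / 2 < cdf (M n) (X j)" using bspec[OF elim jm] unfolding X[OF jm] abs_less_iff by linarith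
        moreover have "F \<le> real j / real m + 1 / real m" using jl m0 by (simp add: field_simps)
        ultimately show ?thesis using me by linarith
      qed
      have upper: "cdf (M n) t \<le> F + e"
      proof (cases "real m - 1 \<le> real m * F")
        case True
        then have "1 - 1 / real m \<le> F" using m0 by (simp add: field_simps)
        then show ?thesis using me Fn e by linarith
      next
        case False
        define j where "j = nat (floor (real m * F)) + 1"
        have f0: "0 \<le> real m * F" using F m0 by simp
        then have j: "real j = of_int (floor (real m * F)) + 1" unfolding j_def by simp
        have jl: "real m * F < real j" "real j \<le> real m * F + 1" using j by linarith+
        then have jm: "j \<in> {1..<m}" using False f0 by auto
        have "F < cdf N (X j)" unfolding X[OF jm] using jl m0 by (simp add: less_divide_eq mult.commute)
        then have "t \<le> X j" unfolding F_def using N.cdf_nondecreasing[of "X j" t] by linarith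
        then have "cdf (M n) t \<le> cdf (M n) (X j)" by (rule Mn.cdf_nondecreasing)
        moreover have "cdf (M n) (X j) < real j / real m + e / 2" using bspec[OF elim jm] unfolding X[OF jm] abs_less_iff by linarith
        moreover have "real j / real m \<le> F + 1 / real m" using jl m0 by (simp add: field_simps)
        ultimately show ?thesis using me by linarith
      qed
      show "\<bar>cdf (M n) t - cdf N t\<bar> \<le> e" using lower upper by (simp add: F_def abs_le_iff)
    qed
  qed
qed

lemma iexp_diff_le: "cmod (iexp a - iexp b) \<le> \<bar>a - b\<bar>"
proof -
  have "iexp a - iexp b = iexp b * (iexp (a - b) - 1)" by (simp add: right_diff_distrib mult_exp_exp algebra_simps of_real_diff)
  then have "cmod (iexp a - iexp b) = cmod (iexp (a - b) - 1)" by (simp add: norm_mult)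
  also have "\<dots> \<le> \<bar>a - b\<bar>" using iexp_approx1[of "a - b" 0] by simp
  finally show ?thesis .
qed

lemma (in prob_space) iexp_integrable:
  assumes [measurable]: "f \<in> borel_measurable M" shows "integrable M (\<lambda>x. iexp (f x))"
  by (rule integrable_const_bound[where B=1]) auto

text \<open>Characteristic functions see a difference of at most \<open>e\<close>, except on a set
  of small probability where they still differ by at most \<open>2\<close>.\<close>

lemma (in prob_space) char_perturbation:
  assumes [measurable]: "W \<in> borel_measurable M" "Z \<in> borel_measurable M" and e: "0 \<le> e"
    and d: "prob {x \<in> space M. e < \<bar>W x - Z x\<bar>} \<le> d"
  shows "cmod ((LINT x|M. iexp (s * W x)) - (LINT x|M. iexp (s * Z x))) \<le> \<bar>s\<bar> * e + 2 * d"
proof -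
  let ?E = "{x \<in> space M. e < \<bar>W x - Z x\<bar>}"
  have i: "integrable M (\<lambda>x. iexp (s * W x))" "integrable M (\<lambda>x. iexp (s * Z x))" by (rule iexp_integrable; measurable)+
  have iE: "integrable M (\<lambda>x. \<bar>s\<bar> * e + 2 * indicator ?E x)"
    by (intro Bochner_Integration.integrable_add integrable_mult_right integrable_real_indicator) (auto simp: emeasure_eq_measure)
  have "cmod ((LINT x|M. iexp (s * W x)) - (LINT x|M. iexp (s * Z x))) = cmod (LINT x|M. iexp (s * W x) - iexp (s * Z x))"
    using i by simp
  also have "\<dots> \<le> (LINT x|M. cmod (iexp (s * W x) - iexp (s * Z x)))" by (rule integral_norm_bound)
  also have "\<dots> \<le> (LINT x|M. \<bar>s\<bar> * e + 2 * indicator ?E x)"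
  proof (rule integral_mono[OF _ iE])
    show "integrable M (\<lambda>x. cmod (iexp (s * W x) - iexp (s * Z x)))" using i by auto
    fix x assume x: "x \<in> space M"
    show "cmod (iexp (s * W x) - iexp (s * Z x)) \<le> \<bar>s\<bar> * e + 2 * indicator ?E x"
    proof (cases "x \<in> ?E")
      case True
      have "cmod (iexp (s * W x) - iexp (s * Z x)) \<le> 1 + 1"
        using norm_triangle_ineq4[of "iexp (s * W x)" "iexp (s * Z x)"] by simp
      also have "\<dots> \<le> \<bar>s\<bar> * e + 2 * indicator ?E x" using True e by simp
      finally show ?thesis .
    next
      case False
      have "cmod (iexp (s * W x) - iexp (s * Z x)) \<le> \<bar>s * W x - s * Z x\<bar>" by (rule iexp_diff_le)
      also have "\<dots> = \<bar>s\<bar> * \<bar>W x - Z x\<bar>" by (simp add: abs_mult flip: right_diff_distrib)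
      also have "\<dots> \<le> \<bar>s\<bar> * e" using False x by (intro mult_left_mono) auto
      finally show ?thesis using False by simp
    qed
  qed
  also have "\<dots> = \<bar>s\<bar> * e + 2 * prob ?E"
    by (subst Bochner_Integration.integral_add) (auto simp: prob_space emeasure_eq_measure intro!: integrable_mult_right integrable_real_indicator)
  also have "\<dots> \<le> \<bar>s\<bar> * e + 2 * d" using d by simp
  finally show ?thesis .
qed

definition "clt_error B s n = \<bar>s\<bar> ^ 3 * B ^ 3 / (6 * sqrt (real n)) + s ^ 4 * B ^ 4 / (8 * real n)"

lemma clt_error_tendsto: "(\<lambda>n. clt_error B s n) \<longlonglongrightarrow> 0"
  unfolding clt_error_def[abs_def] by real_asymp

lemma exp_minus_quadratic: "0 \<le> a \<Longrightarrow> \<bar>exp (- a) - (1 - a)\<bar> \<le> a\<^sup>2 / 2" for a :: real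
proof -
  assume a: "0 \<le> a"
  have "1 - a \<le> exp (- a)" using exp_ge_add_one_self[of "- a"] by simp
  moreover have "exp (- a) \<le> 1 - a + a\<^sup>2 / 2"
  proof -
    define f where "f x = 1 - x + x\<^sup>2 / 2 - exp (- x)" for x :: real
    have "f 0 \<le> f a"
    proof (rule DERIV_nonneg_imp_nondecreasing[OF a])
      fix x :: real
      have "(f has_real_derivative (- 1 + x + exp (- x))) (at x)"
        unfolding f_def by (auto intro!: derivative_eq_intros)
      moreover have "0 \<le> - 1 + x + exp (- x)" using exp_ge_add_one_self[of "- x"] by simp
      ultimately show "\<exists>y. (f has_real_derivative y) (at x) \<and> 0 \<le> y" by blast
    qed
    then show ?thesis by (simp add: f_def)
  qed
  ultimately show ?thesis by (simp add: abs_le_iff)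
qed

text \<open>The classical computation behind the central limit theorem, with an explicit error.
  For bounded variables the error depends on the bound alone and not on the law, so the statement
  applies to triangular arrays.\<close>

lemma char_iid_power:
  fixes f :: "'a \<Rightarrow> real"
  assumes \<rho>: "prob_space \<rho>" and [measurable]: "f \<in> borel_measurable \<rho>" and b: "\<And>x. \<bar>f x\<bar> \<le> B"
    and mean: "(LINT x|\<rho>. f x) = 0" and n: "0 < n"
  shows "cmod ((LINT x|\<rho>. iexp (s * (f x / sqrt (real n)))) ^ n - exp (- (LINT x|\<rho>. (f x)\<^sup>2) * s\<^sup>2 / 2)) \<le> clt_error B s n"
proof -
  interpret prob_space \<rho> by fact
  define v where "v = (LINT x|\<rho>. (f x)\<^sup>2)"
  define a where "a = v * s\<^sup>2 / (2 * real n)"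
  define h where "h x = s * (f x / sqrt (real n))" for x
  have [measurable]: "h \<in> borel_measurable \<rho>" unfolding h_def by measurable
  have B: "0 \<le> B" using b abs_ge_zero order_trans by blast
  have sq: "(f x)\<^sup>2 \<le> B\<^sup>2" for x using power_mono[OF b[of x], of 2] by simp
  have i1: "integrable \<rho> f" by (rule integrable_const_bound[where B=B]) (use b in auto)
  have i2: "integrable \<rho> (\<lambda>x. (f x)\<^sup>2)" by (rule integrable_const_bound[where B="B\<^sup>2"]) (use sq in auto)
  have v: "0 \<le> v" "v \<le> B\<^sup>2" using sq i2 by (auto simp: v_def Bochner_Integration.integral_nonneg intro!: integral_le_const)
  have a0: "0 \<le> a" using v by (simp add: a_def)
  have h2: "(h x)\<^sup>2 = s\<^sup>2 / real n * (f x)\<^sup>2" for x using n by (simp add: h_def power_mult_distrib power_divide)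
  have "integrable \<rho> h" unfolding h_def[abs_def] using i1 by simp
  moreover have "integrable \<rho> (\<lambda>x. (h x)\<^sup>2)" unfolding h2 using i2 by simp
  ultimately have ihc: "integrable \<rho> (\<lambda>x. complex_of_real (h x))" "integrable \<rho> (\<lambda>x. complex_of_real ((h x)\<^sup>2))"
    by (auto intro: integrable_of_real simp del: of_real_power)
  have iq: "integrable \<rho> (\<lambda>x. 1 + \<i> * complex_of_real (h x) - complex_of_real ((h x)\<^sup>2) / 2)"
    using ihc by (auto simp del: of_real_power)
  have q: "(LINT x|\<rho>. 1 + \<i> * complex_of_real (h x) - complex_of_real ((h x)\<^sup>2) / 2) = complex_of_real (1 - a)"
  proof -
    have "(LINT x|\<rho>. 1 + \<i> * complex_of_real (h x) - complex_of_real ((h x)\<^sup>2) / 2) =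
        1 + \<i> * complex_of_real (LINT x|\<rho>. h x) - complex_of_real (LINT x|\<rho>. (h x)\<^sup>2) / 2"
      using ihc by (simp add: prob_space del: of_real_power)
    also have "(LINT x|\<rho>. h x) = 0" using mean by (simp add: h_def)
    also have "(LINT x|\<rho>. (h x)\<^sup>2) = 2 * a" using n by (simp add: h2 a_def v_def)
    finally show ?thesis by simp
  qed
  have hb: "\<bar>h x\<bar> \<le> \<bar>s\<bar> * B / sqrt (real n)" for x
    using b[of x] by (simp add: h_def abs_mult abs_divide divide_right_mono mult_left_mono)
  define c where "c = (\<bar>s\<bar> * B / sqrt (real n)) ^ 3 / 6"
  have "cmod ((LINT x|\<rho>. iexp (h x)) - complex_of_real (1 - a)) \<le> c"
  proof -
    have ih: "integrable \<rho> (\<lambda>x. iexp (h x))" by (rule iexp_integrable) simp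
    have "(LINT x|\<rho>. iexp (h x)) - complex_of_real (1 - a) =
      (LINT x|\<rho>. iexp (h x) - (1 + \<i> * complex_of_real (h x) - complex_of_real ((h x)\<^sup>2) / 2))"
      unfolding q[symmetric] by (rule Bochner_Integration.integral_diff[symmetric, OF ih iq])
    also have "cmod \<dots> \<le> (LINT x|\<rho>. cmod (iexp (h x) - (1 + \<i> * complex_of_real (h x) - complex_of_real ((h x)\<^sup>2) / 2)))"
      by (rule integral_norm_bound)
    also have "\<dots> \<le> c"
    proof (rule integral_le_const)
      show "integrable \<rho> (\<lambda>x. cmod (iexp (h x) - (1 + \<i> * complex_of_real (h x) - complex_of_real ((h x)\<^sup>2) / 2)))"
        by (rule integrable_norm[OF Bochner_Integration.integrable_diff[OF ih iq]])
      have "cmod (iexp (h x) - (1 + \<i> * complex_of_real (h x) - complex_of_real ((h x)\<^sup>2) / 2)) \<le> c" for x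
      proof -
        have "(\<Sum>k\<le>2. (\<i> * complex_of_real (h x)) ^ k / fact k) = 1 + \<i> * complex_of_real (h x) - complex_of_real ((h x)\<^sup>2) / 2"
          by (simp add: numeral_2_eq_2 power_mult_distrib)
        then have "cmod (iexp (h x) - (1 + \<i> * complex_of_real (h x) - complex_of_real ((h x)\<^sup>2) / 2)) \<le> \<bar>h x\<bar> ^ 3 / 6"
          using iexp_approx1[of "h x" 2] by (simp add: eval_nat_numeral)
        also have "\<dots> \<le> c" unfolding c_def by (intro divide_right_mono power_mono hb) auto
        finally show ?thesis .
      qed
      then show "AE x in \<rho>. cmod (iexp (h x) - (1 + \<i> * complex_of_real (h x) - complex_of_real ((h x)\<^sup>2) / 2)) \<le> c" by simp
    qed
    finally show ?thesis .
  qed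
  moreover have "cmod (complex_of_real (1 - a) - complex_of_real (exp (- a))) \<le> a\<^sup>2 / 2"
    using exp_minus_quadratic[OF a0] unfolding of_real_diff[symmetric] norm_of_real by (simp add: abs_minus_commute)
  ultimately have diff: "cmod ((LINT x|\<rho>. iexp (h x)) - complex_of_real (exp (- a))) \<le> c + a\<^sup>2 / 2"
    using norm_triangle_ineq[of "(LINT x|\<rho>. iexp (h x)) - complex_of_real (1 - a)" "complex_of_real (1 - a) - complex_of_real (exp (- a))"] by simp
  have "cmod (LINT x|\<rho>. iexp (h x)) \<le> (LINT x|\<rho>. cmod (iexp (h x)))" by (rule integral_norm_bound)
  then have n1: "cmod (LINT x|\<rho>. iexp (h x)) \<le> 1" by (simp add: prob_space)
  have "cmod ((LINT x|\<rho>. iexp (h x)) ^ n - complex_of_real (exp (- a)) ^ n) \<le> n * cmod ((LINT x|\<rho>. iexp (h x)) - complex_of_real (exp (- a)))"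
    by (rule norm_power_diff[OF n1]) (use a0 in simp)
  also have "\<dots> \<le> real n * (c + a\<^sup>2 / 2)" using diff by (intro mult_left_mono) auto
  also have "\<dots> \<le> clt_error B s n"
  proof -
    have "real n * c = \<bar>s\<bar> ^ 3 * B ^ 3 / (6 * sqrt (real n))"
    proof -
      have "sqrt (real n) ^ 3 = real n * sqrt (real n)" by (simp add: power3_eq_cube)
      then show ?thesis using n by (simp add: c_def power_divide power_mult_distrib)
    qed
    moreover have "real n * (a\<^sup>2 / 2) \<le> s ^ 4 * B ^ 4 / (8 * real n)"
    proof -
      have "v\<^sup>2 \<le> (B\<^sup>2)\<^sup>2" using v by (intro power_mono)
      then have "v\<^sup>2 * s ^ 4 \<le> B ^ 4 * s ^ 4" by (intro mult_right_mono) auto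
      moreover have "real n * (a\<^sup>2 / 2) = v\<^sup>2 * s ^ 4 / (8 * real n)"
        using n by (simp add: a_def power_divide power_mult_distrib power2_eq_square field_simps eval_nat_numeral)
      ultimately show ?thesis using n by (simp add: divide_right_mono mult.commute)
    qed
    ultimately show ?thesis by (simp add: clt_error_def distrib_left)
  qed
  also have "complex_of_real (exp (- a)) ^ n = complex_of_real (exp (- v * s\<^sup>2 / 2))"
    using n by (simp add: a_def exp_of_nat_mult[symmetric] flip: of_real_power)
  finally show ?thesis by (simp add: h_def v_def)
qed

lemma char_iid_sum:
  fixes f :: "'a \<Rightarrow> real"
  assumes \<rho>: "prob_space \<rho>" and [measurable]: "f \<in> borel_measurable \<rho>"
  shows "(LINT x|PiM {..<n} (\<lambda>_. \<rho>). iexp (s * ((\<Sum>i<n. f (x i)) / c))) = (LINT x|\<rho>. iexp (s * (f x / c))) ^ n"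
proof -
  interpret \<rho>: prob_space \<rho> by fact
  interpret product_prob_space "\<lambda>_::nat. \<rho>" "{..<n}" ..
  have "iexp (s * ((\<Sum>i<n. f (x i)) / c)) = (\<Prod>i<n. iexp (s * (f (x i) / c)))" for x
    by (subst exp_sum[symmetric]) (auto simp: sum_divide_distrib sum_distrib_left)
  then have "(LINT x|PiM {..<n} (\<lambda>_. \<rho>). iexp (s * ((\<Sum>i<n. f (x i)) / c))) = (\<Prod>i<n. LINT x|\<rho>. iexp (s * (f x / c)))"
    using product_integral_prod[of "{..<n}" "\<lambda>i x. iexp (s * (f x / c))"] \<rho>.iexp_integrable[of "\<lambda>x. s * (f x / c)"] by simp
  then show ?thesis by simp
qed

section \<open>Asymptotics of differentiable functionals of smoothed empirical measures\<close>

definition concentrated :: "'a::topological_space measure \<Rightarrow> 'a measure \<Rightarrow> bool" where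
  "concentrated \<rho> \<mu> \<longleftrightarrow> prob_space \<rho> \<and> sets \<rho> = sets borel \<and> (AE x in \<rho>. x \<in> msupport \<mu>)"

definition var :: "'a measure \<Rightarrow> ('a \<Rightarrow> real) \<Rightarrow> real" where
  "var \<rho> g = (LINT x|\<rho>. (g x - (LINT x|\<rho>. g x))\<^sup>2)"

lemma var_nonneg: "0 \<le> var \<rho> g" by (simp add: var_def Bochner_Integration.integral_nonneg)

lemma var_eq:
  assumes "prob_space \<rho>" "g \<in> borel_measurable \<rho>" "\<And>x. \<bar>g x\<bar> \<le> B"
  shows "var \<rho> g = (LINT x|\<rho>. (g x)\<^sup>2) - (LINT x|\<rho>. g x)\<^sup>2"
proof -
  interpret prob_space \<rho> by fact
  have "(g x)\<^sup>2 \<le> B\<^sup>2" for x using power_mono[OF assms(3)[of x], of 2] by simp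
  then have "integrable \<rho> (\<lambda>x. (g x)\<^sup>2)" by (intro integrable_const_bound[where B="B\<^sup>2"]) (use assms in auto)
  moreover have "integrable \<rho> g" by (rule integrable_const_bound[where B=B]) (use assms in auto)
  ultimately show ?thesis unfolding var_def by (intro variance_eq)
qed

lemma concentrated_refl: "prob_space \<mu> \<Longrightarrow> sets \<mu> = sets borel \<Longrightarrow> concentrated (\<mu> :: 'a::second_countable_topology measure) \<mu>"
  by (simp add: concentrated_def AE_msupport)

lemma concentrated_empirical:
  assumes "0 < n" "\<And>i. i < n \<Longrightarrow> x i \<in> msupport \<mu>"
  shows "concentrated (empirical n x) \<mu>"
  unfolding concentrated_def
  using assms closed_msupport by (auto intro!: AE_empirical prob_space_empirical borel_closed)

lemma empirical_cong: "(\<And>i. i < n \<Longrightarrow> x i = y i) \<Longrightarrow> empirical n x = empirical n y"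
  unfolding empirical_def by (rule distr_cong) (auto simp: space_uniform_count_measure)

lemma cmod_mult_diff_le:
  assumes "cmod b \<le> 1" "cmod a' \<le> 1"
  shows "cmod (a * b - a' * b') \<le> cmod (a - a') + cmod (b - b')"
proof -
  have "a * b - a' * b' = (a - a') * b + a' * (b - b')" by (simp add: algebra_simps)
  then have "cmod (a * b - a' * b') \<le> cmod (a - a') * cmod b + cmod a' * cmod (b - b')"
    by (metis norm_mult norm_triangle_ineq)
  also have "\<dots> \<le> cmod (a - a') * 1 + 1 * cmod (b - b')" using assms by (intro add_mono mult_mono) auto
  finally show ?thesis by simp
qed

lemma AE_pair_fst:
  assumes N: "sigma_finite_measure N" and ae: "AE x in M. P x"
  shows "AE z in M \<Otimes>\<^sub>M N. P (fst z)"
proof -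
  interpret N: sigma_finite_measure N by fact
  obtain Z where Z: "{x \<in> space M. \<not> P x} \<subseteq> Z" "emeasure M Z = 0" "Z \<in> sets M" using AE_E[OF ae] .
  show ?thesis
  proof (rule AE_I)
    show "{z \<in> space (M \<Otimes>\<^sub>M N). \<not> P (fst z)} \<subseteq> Z \<times> space N" using Z(1) by (auto simp: space_pair_measure)
    show "emeasure (M \<Otimes>\<^sub>M N) (Z \<times> space N) = 0" using Z by (simp add: N.emeasure_pair_measure_Times)
  qed (use Z in auto)
qed

lemma AE_pair_snd:
  assumes N: "sigma_finite_measure N" and ae: "AE y in N. P y"
  shows "AE z in M \<Otimes>\<^sub>M N. P (snd z)"
proof -
  interpret N: sigma_finite_measure N by fact
  obtain Z where Z: "{x \<in> space N. \<not> P x} \<subseteq> Z" "emeasure N Z = 0" "Z \<in> sets N" using AE_E[OF ae] .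
  show ?thesis
  proof (rule AE_I)
    show "{z \<in> space (M \<Otimes>\<^sub>M N). \<not> P (snd z)} \<subseteq> space M \<times> Z" using Z(1) by (auto simp: space_pair_measure)
    show "emeasure (M \<Otimes>\<^sub>M N) (space M \<times> Z) = 0" using Z by (simp add: N.emeasure_pair_measure_Times)
  qed (use Z in auto)
qed

text \<open>A functional of two measures that is differentiable at \<open>(\<mu>, \<nu>)\<close>
  for the distance \<open>tv\<close>, along measures carried by the supports, with derivative
  given by bounded functions \<open>g1\<close> and \<open>g2\<close>. The limit theorems and the
  efficiency bounds are consequences of this expansion.\<close>

locale smooth_functional = smoothing +
  fixes \<kappa> :: "'a measure \<Rightarrow> 'a measure \<Rightarrow> real" and \<mu> \<nu> :: "'a measure" and g1 g2 :: "'a \<Rightarrow> real" and s B :: real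
  assumes \<mu>: "prob_space \<mu>" "sets \<mu> = sets borel" and \<nu>: "prob_space \<nu>" "sets \<nu> = sets borel"
    and supp_bdd: "\<And>x. x \<in> msupport \<mu> \<Longrightarrow> norm x \<le> s" "\<And>x. x \<in> msupport \<nu> \<Longrightarrow> norm x \<le> s"
    and g_meas [measurable]: "g1 \<in> borel_measurable borel" "g2 \<in> borel_measurable borel"
    and g_bdd: "\<And>x. \<bar>g1 x\<bar> \<le> B" "\<And>x. \<bar>g2 x\<bar> \<le> B"
    and differentiable: "\<And>\<epsilon>. 0 < \<epsilon> \<Longrightarrow> \<exists>\<delta>>0. \<forall>\<rho> \<tau>. concentrated \<rho> \<mu> \<longrightarrow> concentrated \<tau> \<nu> \<longrightarrow> tv \<rho> \<mu> \<le> \<delta> \<longrightarrow> tv \<tau> \<nu> \<le> \<delta> \<longrightarrow>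
        \<bar>\<kappa> \<rho> \<tau> - \<kappa> \<mu> \<nu> - ((LINT x|\<rho>. g1 x) - (LINT x|\<mu>. g1 x)) - ((LINT x|\<tau>. g2 x) - (LINT x|\<nu>. g2 x))\<bar> \<le> \<epsilon> * (tv \<rho> \<mu> + tv \<tau> \<nu>)"
    and \<kappa>_measurable: "\<And>n. 0 < n \<Longrightarrow> (\<lambda>(x, y). \<kappa> (empirical n x) (empirical n y)) \<in>
        borel_measurable (PiM {..<n} (\<lambda>_. borel) \<Otimes>\<^sub>M PiM {..<n} (\<lambda>_. borel))"
begin

definition "sample_measure n \<rho> \<tau> = PiM {..<n} (\<lambda>_. \<rho>) \<Otimes>\<^sub>M PiM {..<n} (\<lambda>_. \<tau>)"
definition "statistic n \<rho> \<tau> z = sqrt (real n) * (\<kappa> (empirical n (fst z)) (empirical n (snd z)) - \<kappa> \<rho> \<tau>)"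
definition "linear_part n \<rho> \<tau> z =
  (\<Sum>i<n. g1 (fst z i) - (LINT x|\<rho>. g1 x)) / sqrt (real n) + (\<Sum>i<n. g2 (snd z i) - (LINT x|\<tau>. g2 x)) / sqrt (real n)"

lemma sets_sample_measure:
  assumes "sets \<rho> = sets borel" "sets \<tau> = sets borel"
  shows "sets (sample_measure n \<rho> \<tau>) = sets (PiM {..<n} (\<lambda>_. borel) \<Otimes>\<^sub>M PiM {..<n} (\<lambda>_. borel))"
  unfolding sample_measure_def by (intro sets_pair_measure_cong sets_PiM_cong) (auto simp: assms)

lemma prob_space_sample_measure:
  assumes "prob_space \<rho>" "prob_space \<tau>" shows "prob_space (sample_measure n \<rho> \<tau>)"
  unfolding sample_measure_def by (intro prob_space_pair prob_space_PiM assms)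

lemma statistic_measurable:
  assumes "0 < n" shows "statistic n \<rho> \<tau> \<in> borel_measurable (PiM {..<n} (\<lambda>_. borel) \<Otimes>\<^sub>M PiM {..<n} (\<lambda>_. borel))"
  using \<kappa>_measurable[OF assms] unfolding statistic_def[abs_def] by (simp add: split_beta')

lemma linear_part_measurable:
  "linear_part n \<rho> \<tau> \<in> borel_measurable (PiM {..<n} (\<lambda>_. borel) \<Otimes>\<^sub>M PiM {..<n} (\<lambda>_. borel))"
  unfolding linear_part_def[abs_def] by measurable

lemma expectation_bdd:
  assumes "prob_space \<rho>" "sets \<rho> = sets borel" "g \<in> borel_measurable borel" "\<And>x. \<bar>g x\<bar> \<le> (b::real)"
  shows "integrable \<rho> g" "\<bar>LINT x|\<rho>. g x\<bar> \<le> b"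
proof -
  interpret prob_space \<rho> by fact
  show i: "integrable \<rho> g" by (rule integrable_const_bound[where B=b]) (use assms in \<open>auto cong: measurable_cong_sets\<close>)
  have "\<bar>LINT x|\<rho>. g x\<bar> \<le> (LINT x|\<rho>. \<bar>g x\<bar>)" by (rule integral_abs_bound)
  also have "\<dots> \<le> b" using i assms by (intro integral_le_const) auto
  finally show "\<bar>LINT x|\<rho>. g x\<bar> \<le> b" .
qed

text \<open>Independence of the two samples factorizes the characteristic function.\<close>

lemma linear_part_char:
  assumes \<rho>: "prob_space \<rho>" "sets \<rho> = sets borel" and \<tau>: "prob_space \<tau>" "sets \<tau> = sets borel" and n: "0 < n"
  shows "cmod ((LINT z|sample_measure n \<rho> \<tau>. iexp (a * linear_part n \<rho> \<tau> z)) - exp (- (var \<rho> g1 + var \<tau> g2) * a\<^sup>2 / 2))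
     \<le> 2 * clt_error (2 * B) a n"
proof -
  interpret \<rho>: prob_space \<rho> by fact
  interpret \<tau>: prob_space \<tau> by fact
  let ?P = "PiM {..<n} (\<lambda>_. \<rho>)" and ?Q = "PiM {..<n} (\<lambda>_. \<tau>)"
  interpret P: prob_space ?P by (rule prob_space_PiM) (rule \<rho>)
  interpret Q: prob_space ?Q by (rule prob_space_PiM) (rule \<tau>)
  interpret PQ: pair_prob_space ?P ?Q ..
  define f1 where "f1 x = g1 x - (LINT x|\<rho>. g1 x)" for x
  define f2 where "f2 x = g2 x - (LINT x|\<tau>. g2 x)" for x
  note e1 = expectation_bdd[OF \<rho> g_meas(1) g_bdd(1)] and e2 = expectation_bdd[OF \<tau> g_meas(2) g_bdd(2)]
  have m [measurable]: "f1 \<in> borel_measurable \<rho>" "f2 \<in> borel_measurable \<tau>"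
    unfolding f1_def f2_def using g_meas by (auto cong: measurable_cong_sets simp: \<rho>(2) \<tau>(2))
  have b: "\<bar>f1 x\<bar> \<le> 2 * B" "\<bar>f2 x\<bar> \<le> 2 * B" for x
    using g_bdd(1)[of x] g_bdd(2)[of x] e1(2) e2(2) unfolding f1_def f2_def abs_le_iff by linarith+
  have mean: "(LINT x|\<rho>. f1 x) = 0" "(LINT x|\<tau>. f2 x) = 0"
    using e1(1) e2(1) by (simp_all add: f1_def f2_def \<rho>.prob_space \<tau>.prob_space)
  define c1 where "c1 = (LINT x|\<rho>. iexp (a * (f1 x / sqrt (real n)))) ^ n"
  define c2 where "c2 = (LINT x|\<tau>. iexp (a * (f2 x / sqrt (real n)))) ^ n"
  define h1 where "h1 x = iexp (a * ((\<Sum>i<n. f1 (x i)) / sqrt (real n)))" for x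
  define h2 where "h2 x = iexp (a * ((\<Sum>i<n. f2 (x i)) / sqrt (real n)))" for x
  have [measurable]: "h1 \<in> borel_measurable ?P" "h2 \<in> borel_measurable ?Q" unfolding h1_def h2_def by measurable
  have "iexp (a * linear_part n \<rho> \<tau> z) = h1 (fst z) * h2 (snd z)" for z
    by (simp add: linear_part_def h1_def h2_def f1_def f2_def mult_exp_exp distrib_left)
  then have "(LINT z|sample_measure n \<rho> \<tau>. iexp (a * linear_part n \<rho> \<tau> z)) = (LINT z|(?P \<Otimes>\<^sub>M ?Q). h1 (fst z) * h2 (snd z))"
    by (simp add: sample_measure_def)
  also have "\<dots> = (LINT x|?P. LINT y|?Q. h1 x * h2 y)"
  proof -
    have "integrable (?P \<Otimes>\<^sub>M ?Q) (\<lambda>z. h1 (fst z) * h2 (snd z))"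
      by (rule PQ.P.integrable_const_bound[where B=1]) (auto simp: h1_def h2_def norm_mult)
    from PQ.integral_fst'[OF this] show ?thesis by simp
  qed
  also have "\<dots> = (LINT x|?P. h1 x) * (LINT y|?Q. h2 y)"
    by simp
  also have "\<dots> = c1 * c2"
    unfolding h1_def h2_def c1_def c2_def by (simp only: char_iid_sum[OF \<rho>(1) m(1)] char_iid_sum[OF \<tau>(1) m(2)])
  finally have eq: "(LINT z|sample_measure n \<rho> \<tau>. iexp (a * linear_part n \<rho> \<tau> z)) = c1 * c2" .
  have n1: "cmod (LINT x|\<tau>. iexp (a * (f2 x / sqrt (real n)))) \<le> 1"
  proof -
    have "cmod (LINT x|\<tau>. iexp (a * (f2 x / sqrt (real n)))) \<le> (LINT x|\<tau>. cmod (iexp (a * (f2 x / sqrt (real n)))))"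
      by (rule integral_norm_bound)
    then show ?thesis by (simp add: \<tau>.prob_space)
  qed
  have v: "(LINT x|\<rho>. (f1 x)\<^sup>2) = var \<rho> g1" "(LINT x|\<tau>. (f2 x)\<^sup>2) = var \<tau> g2"
    by (simp_all add: var_def f1_def f2_def)
  have "complex_of_real (exp (- (var \<rho> g1 + var \<tau> g2) * a\<^sup>2 / 2)) = complex_of_real (exp (- var \<rho> g1 * a\<^sup>2 / 2)) * complex_of_real (exp (- var \<tau> g2 * a\<^sup>2 / 2))"
  proof -
    have "- (var \<rho> g1 + var \<tau> g2) * a\<^sup>2 / 2 = - var \<rho> g1 * a\<^sup>2 / 2 + - var \<tau> g2 * a\<^sup>2 / 2" by (simp add: field_simps)
    then show ?thesis by (simp only: exp_add of_real_mult)
  qed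
  then have "cmod ((LINT z|sample_measure n \<rho> \<tau>. iexp (a * linear_part n \<rho> \<tau> z)) - exp (- (var \<rho> g1 + var \<tau> g2) * a\<^sup>2 / 2)) =
      cmod (c1 * c2 - complex_of_real (exp (- var \<rho> g1 * a\<^sup>2 / 2)) * complex_of_real (exp (- var \<tau> g2 * a\<^sup>2 / 2)))"
    unfolding eq by simp
  also have "\<dots> \<le> cmod (c1 - complex_of_real (exp (- var \<rho> g1 * a\<^sup>2 / 2))) + cmod (c2 - complex_of_real (exp (- var \<tau> g2 * a\<^sup>2 / 2)))"
  proof (rule cmod_mult_diff_le)
    show "cmod c2 \<le> 1" unfolding c2_def norm_power using n1 by (intro power_le_one) auto
    show "cmod (complex_of_real (exp (- var \<rho> g1 * a\<^sup>2 / 2))) \<le> 1" using var_nonneg[of \<rho> g1] by simp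
  qed
  also have "\<dots> \<le> clt_error (2 * B) a n + clt_error (2 * B) a n"
    using char_iid_power[OF \<rho>(1) m(1) b(1) mean(1) n, of a] char_iid_power[OF \<tau>(1) m(2) b(2) mean(2) n, of a]
    unfolding c1_def c2_def v by (intro add_mono) auto
  finally show ?thesis by simp
qed

lemma concentrated_norm: "concentrated \<rho> \<mu> \<Longrightarrow> AE x in \<rho>. norm x \<le> s" "concentrated \<tau> \<nu> \<Longrightarrow> AE x in \<tau>. norm x \<le> s"
  unfolding concentrated_def using supp_bdd by (auto elim: eventually_mono)

text \<open>The error of sampling from \<open>(\<rho>, \<tau>)\<close> is compared with its linear
  part. Differentiability is available at \<open>(\<mu>, \<nu>)\<close> only, so the expansion is
  used twice, at the empirical measures of the sample and at \<open>(\<rho>, \<tau>)\<close>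
  itself; the linear terms subtract to the linear part for \<open>(\<rho>, \<tau>)\<close>. Both
  remainders are \<open>\<epsilon>\<close> times a distance of order \<open>1 / sqrt n\<close>: by
  assumption for \<open>(\<rho>, \<tau>)\<close>, and off an event of probability at most
  \<open>2 * tv_const s / t\<close> for the sample.\<close>

lemma statistic_linearization:
  assumes C: "0 \<le> C" and t: "0 < t" and \<epsilon>: "0 < \<epsilon>"
  shows "eventually (\<lambda>n. \<forall>\<rho> \<tau>. concentrated \<rho> \<mu> \<longrightarrow> concentrated \<tau> \<nu> \<longrightarrow> sqrt (real n) * tv \<rho> \<mu> \<le> C \<longrightarrow> sqrt (real n) * tv \<tau> \<nu> \<le> C \<longrightarrow>
      measure (sample_measure n \<rho> \<tau>) {z \<in> space (sample_measure n \<rho> \<tau>). \<epsilon> * (2 * t + 4 * C) < \<bar>statistic n \<rho> \<tau> z - linear_part n \<rho> \<tau> z\<bar>}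
        \<le> 2 * tv_const s / t) sequentially"
proof -
  obtain \<delta> where \<delta>: "0 < \<delta>" and D: "\<And>\<rho> \<tau>. concentrated \<rho> \<mu> \<Longrightarrow> concentrated \<tau> \<nu> \<Longrightarrow> tv \<rho> \<mu> \<le> \<delta> \<Longrightarrow> tv \<tau> \<nu> \<le> \<delta> \<Longrightarrow>
      \<bar>\<kappa> \<rho> \<tau> - \<kappa> \<mu> \<nu> - ((LINT x|\<rho>. g1 x) - (LINT x|\<mu>. g1 x)) - ((LINT x|\<tau>. g2 x) - (LINT x|\<nu>. g2 x))\<bar> \<le> \<epsilon> * (tv \<rho> \<mu> + tv \<tau> \<nu>)"
    using differentiable[OF \<epsilon>] by blast
  have "(\<lambda>n. (t + C) / sqrt (real n)) \<longlonglongrightarrow> 0" by real_asymp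
  from order_tendstoD(2)[OF this \<delta>] have "eventually (\<lambda>n. (t + C) / sqrt (real n) < \<delta>) sequentially" .
  then show ?thesis
    using eventually_gt_at_top[of 0]
  proof eventually_elim
    case (elim n)
    show ?case
    proof (intro allI impI)
      fix \<rho> \<tau> assume \<rho>: "concentrated \<rho> \<mu>" and \<tau>: "concentrated \<tau> \<nu>"
        and tvs: "sqrt (real n) * tv \<rho> \<mu> \<le> C" "sqrt (real n) * tv \<tau> \<nu> \<le> C"
      have \<rho>p: "prob_space \<rho>" "sets \<rho> = sets borel" and \<tau>p: "prob_space \<tau>" "sets \<tau> = sets borel"
        using \<rho> \<tau> by (auto simp: concentrated_def)
      let ?P = "PiM {..<n} (\<lambda>_. \<rho>)" and ?Q = "PiM {..<n} (\<lambda>_. \<tau>)" and ?S = "sample_measure n \<rho> \<tau>"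
      interpret P: prob_space ?P by (rule prob_space_PiM) (rule \<rho>p)
      interpret Q: prob_space ?Q by (rule prob_space_PiM) (rule \<tau>p)
      interpret PQ: pair_prob_space ?P ?Q ..
      interpret S: prob_space ?S by (rule prob_space_sample_measure[OF \<rho>p(1) \<tau>p(1)])
      have sP: "sets ?P = sets (PiM {..<n} (\<lambda>_. borel))" by (rule sets_PiM_cong) (auto simp: \<rho>p)
      have sQ: "sets ?Q = sets (PiM {..<n} (\<lambda>_. borel))" by (rule sets_PiM_cong) (auto simp: \<tau>p)
      define n' where "n' = sqrt (real n)"
      have n': "0 < n'" using elim by (simp add: n'_def)
      have nn: "n' * n' = real n" by (simp add: n'_def)
      have small: "(t + C) / n' < \<delta>" using elim by (simp add: n'_def)
      have "C / n' \<le> (t + C) / n'" using t n' by (intro divide_right_mono) auto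
      moreover have tv\<rho>: "tv \<rho> \<mu> \<le> C / n'" "tv \<tau> \<nu> \<le> C / n'" using tvs n' by (simp_all add: n'_def field_simps)
      ultimately have "tv \<rho> \<mu> \<le> \<delta>" "tv \<tau> \<nu> \<le> \<delta>" using small by linarith+
      note D0 = D[OF \<rho> \<tau> this]
      define E1 where "E1 = {x \<in> space ?P. t < n' * tv (empirical n x) \<rho>}"
      define E2 where "E2 = {x \<in> space ?Q. t < n' * tv (empirical n x) \<tau>}"
      have [measurable]: "(\<lambda>x. tv (empirical n x) \<rho>) \<in> borel_measurable ?P"
        unfolding measurable_cong_sets[OF sP refl] by (rule tv_empirical_measurable[OF \<rho>p])
      have [measurable]: "(\<lambda>x. tv (empirical n x) \<tau>) \<in> borel_measurable ?Q"
        unfolding measurable_cong_sets[OF sQ refl] by (rule tv_empirical_measurable[OF \<tau>p])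
      have E1m: "E1 \<in> sets ?P" unfolding E1_def by measurable
      have E2m: "E2 \<in> sets ?Q" unfolding E2_def by measurable
      have E1: "P.prob E1 \<le> tv_const s / t"
        unfolding E1_def n'_def using tv_tail[OF \<rho>p concentrated_norm(1)[OF \<rho>] _ t] elim by simp
      have E2: "Q.prob E2 \<le> tv_const s / t"
        unfolding E2_def n'_def using tv_tail[OF \<tau>p concentrated_norm(2)[OF \<tau>] _ t] elim by simp
      let ?bad = "{z \<in> space ?S. \<epsilon> * (2 * t + 4 * C) < \<bar>statistic n \<rho> \<tau> z - linear_part n \<rho> \<tau> z\<bar>}"
      have aeP: "AE x in ?P. \<forall>i\<in>{..<n}. x i \<in> msupport \<mu>"
        using \<rho> closed_msupport by (intro AE_finite_allI AE_PiM_component) (auto simp: concentrated_def)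
      have aeQ: "AE x in ?Q. \<forall>i\<in>{..<n}. x i \<in> msupport \<nu>"
        using \<tau> closed_msupport by (intro AE_finite_allI AE_PiM_component) (auto simp: concentrated_def)
      have in\<mu>: "AE z in ?S. \<forall>i\<in>{..<n}. fst z i \<in> msupport \<mu>"
        unfolding sample_measure_def by (rule AE_pair_fst[OF Q.sigma_finite_measure_axioms aeP])
      have in\<nu>: "AE z in ?S. \<forall>i\<in>{..<n}. snd z i \<in> msupport \<nu>"
        unfolding sample_measure_def by (rule AE_pair_snd[OF Q.sigma_finite_measure_axioms aeQ])
      have key: "AE z in ?S. z \<in> ?bad \<longrightarrow> z \<in> E1 \<times> space ?Q \<union> space ?P \<times> E2"
        using in\<mu> in\<nu> AE_space
      proof eventually_elim
        case (elim z)
        show ?case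
        proof (rule impI, rule ccontr)
          assume bad: "z \<in> ?bad" and nE: "z \<notin> E1 \<times> space ?Q \<union> space ?P \<times> E2"
          have zs: "fst z \<in> space ?P" "snd z \<in> space ?Q" using elim(3) by (auto simp: sample_measure_def space_pair_measure)
          with nE have small1: "n' * tv (empirical n (fst z)) \<rho> \<le> t" "n' * tv (empirical n (snd z)) \<tau> \<le> t"
            by (auto simp: E1_def E2_def mem_Times_iff)
          have c: "concentrated (empirical n (fst z)) \<mu>" "concentrated (empirical n (snd z)) \<nu>"
            using elim(1,2) \<open>0 < n\<close> by (auto intro!: concentrated_empirical)
          have p: "prob_space (empirical n (fst z))" "prob_space (empirical n (snd z))" using c by (auto simp: concentrated_def)
          have "tv (empirical n (fst z)) \<mu> \<le> tv (empirical n (fst z)) \<rho> + tv \<rho> \<mu>"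
            by (rule tv_triangle[OF p(1) sets_empirical \<rho>p \<mu>])
          also have "\<dots> \<le> t / n' + C / n'" using small1 tv\<rho> n' by (intro add_mono) (auto simp: field_simps)
          finally have b1: "tv (empirical n (fst z)) \<mu> \<le> (t + C) / n'" by (simp add: add_divide_distrib)
          have "tv (empirical n (snd z)) \<nu> \<le> tv (empirical n (snd z)) \<tau> + tv \<tau> \<nu>"
            by (rule tv_triangle[OF p(2) sets_empirical \<tau>p \<nu>])
          also have "\<dots> \<le> t / n' + C / n'" using small1 tv\<rho> n' by (intro add_mono) (auto simp: field_simps)
          finally have b2: "tv (empirical n (snd z)) \<nu> \<le> (t + C) / n'" by (simp add: add_divide_distrib)
          \<comment> \<open>The remainders of the expansion at \<open>(\<mu>, \<nu>)\<close>,
            evaluated at the empirical measures and at \<open>(\<rho>, \<tau>)\<close>.\<close>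
          define Ra where "Ra = \<kappa> (empirical n (fst z)) (empirical n (snd z)) - \<kappa> \<mu> \<nu> -
             ((LINT x|empirical n (fst z). g1 x) - (LINT x|\<mu>. g1 x)) - ((LINT x|empirical n (snd z). g2 x) - (LINT x|\<nu>. g2 x))"
          define Rb where "Rb = \<kappa> \<rho> \<tau> - \<kappa> \<mu> \<nu> - ((LINT x|\<rho>. g1 x) - (LINT x|\<mu>. g1 x)) - ((LINT x|\<tau>. g2 x) - (LINT x|\<nu>. g2 x))"
          have "tv (empirical n (fst z)) \<mu> \<le> \<delta>" "tv (empirical n (snd z)) \<nu> \<le> \<delta>" using b1 b2 small by linarith+
          then have "\<bar>Ra\<bar> \<le> \<epsilon> * (tv (empirical n (fst z)) \<mu> + tv (empirical n (snd z)) \<nu>)"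
            unfolding Ra_def by (rule D[OF c])
          also have "\<dots> \<le> \<epsilon> * ((t + C) / n' + (t + C) / n')"
            by (rule mult_left_mono[OF add_mono[OF b1 b2] less_imp_le[OF \<epsilon>]])
          finally have Ra: "\<bar>Ra\<bar> \<le> \<epsilon> * (2 * (t + C) / n')" by (simp only: mult_2 add_divide_distrib)
          have "\<bar>Rb\<bar> \<le> \<epsilon> * (C / n' + C / n')" unfolding Rb_def
            by (rule order_trans[OF D0 mult_left_mono[OF add_mono[OF tv\<rho>] less_imp_le[OF \<epsilon>]]])
          then have Rb: "\<bar>Rb\<bar> \<le> \<epsilon> * (2 * C / n')" by (simp only: mult_2 add_divide_distrib)
          have lin: "(\<Sum>i<n. h (w i) - m) / n' = n' * ((LINT x|empirical n w. h x) - m)"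
            if "h \<in> borel_measurable borel" for h :: "'a \<Rightarrow> real" and w m
          proof -
            have "(\<Sum>i<n. h (w i) - m) = n' * n' * ((LINT x|empirical n w. h x) - m)"
              unfolding nn using \<open>0 < n\<close> by (simp add: integral_empirical[OF that] sum_subtractf right_diff_distrib)
            then show ?thesis using n' by simp
          qed
          have "statistic n \<rho> \<tau> z - linear_part n \<rho> \<tau> z = n' * (Ra - Rb)"
            unfolding statistic_def linear_part_def n'_def[symmetric] lin[OF g_meas(1)] lin[OF g_meas(2)] Ra_def Rb_def
            by (simp add: algebra_simps)
          then have "\<bar>statistic n \<rho> \<tau> z - linear_part n \<rho> \<tau> z\<bar> = n' * \<bar>Ra - Rb\<bar>" using n' by (simp add: abs_mult)
          also have "\<dots> \<le> n' * (\<epsilon> * (2 * (t + C) / n') + \<epsilon> * (2 * C / n'))"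
            using Ra Rb n' by (intro mult_left_mono) auto
          also have "\<dots> = \<epsilon> * (2 * t + 4 * C)" using n' by (simp add: field_simps)
          finally show False using bad by simp
        qed
      qed
      have "S.prob ?bad \<le> S.prob (E1 \<times> space ?Q \<union> space ?P \<times> E2)"
        using key E1m E2m by (intro S.finite_measure_mono_AE) (auto simp: sample_measure_def)
      also have "\<dots> \<le> S.prob (E1 \<times> space ?Q) + S.prob (space ?P \<times> E2)"
        using E1m E2m by (intro measure_Un_le) (auto simp: sample_measure_def)
      also have "S.prob (E1 \<times> space ?Q) = P.prob E1"
        using E1m unfolding sample_measure_def by (simp add: measure_def Q.emeasure_pair_measure_Times Q.emeasure_space_1)
      also have "S.prob (space ?P \<times> E2) = Q.prob E2"
        using E2m unfolding sample_measure_def by (simp add: measure_def Q.emeasure_pair_measure_Times P.emeasure_space_1)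
      also have "P.prob E1 + Q.prob E2 \<le> 2 * tv_const s / t" using E1 E2 by simp
      finally show "S.prob ?bad \<le> 2 * tv_const s / t" .
    qed
  qed
qed

text \<open>First \<open>t\<close> is chosen large to make the exceptional event rare, then
  \<open>\<epsilon>\<close> small compared with \<open>1 / t\<close>.\<close>

lemma statistic_char:
  assumes C: "0 \<le> C" and e: "0 < e"
  shows "eventually (\<lambda>n. \<forall>\<rho> \<tau>. concentrated \<rho> \<mu> \<longrightarrow> concentrated \<tau> \<nu> \<longrightarrow> sqrt (real n) * tv \<rho> \<mu> \<le> C \<longrightarrow> sqrt (real n) * tv \<tau> \<nu> \<le> C \<longrightarrow>
     cmod ((LINT z|sample_measure n \<rho> \<tau>. iexp (a * statistic n \<rho> \<tau> z)) - exp (- (var \<rho> g1 + var \<tau> g2) * a\<^sup>2 / 2)) \<le> e) sequentially"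
proof -
  define t where "t = 16 * tv_const s / e + 1"
  have t0: "0 < t" unfolding t_def using tv_const_nonneg[of s] e by (simp add: add_nonneg_pos)
  have tt: "2 * (2 * tv_const s / t) \<le> e / 4"
  proof -
    have "16 * tv_const s \<le> e * t" using e by (simp add: t_def distrib_left)
    then show ?thesis using t0 by (simp add: field_simps)
  qed
  define A where "A = \<bar>a\<bar> + 1"
  define T where "T = 2 * t + 4 * C + 1"
  define \<epsilon> where "\<epsilon> = e / (4 * A * T)"
  have d: "0 < A" "0 < T" using t0 C by (auto simp: A_def T_def)
  have \<epsilon>: "0 < \<epsilon>" unfolding \<epsilon>_def using e d by simp
  have at: "\<bar>a\<bar> * (\<epsilon> * (2 * t + 4 * C)) \<le> e / 4"
  proof -
    have "\<bar>a\<bar> * (\<epsilon> * (2 * t + 4 * C)) \<le> A * (\<epsilon> * T)"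
      using \<epsilon> t0 C d by (intro mult_mono mult_left_mono) (auto simp: A_def T_def)
    also have "\<dots> = e / 4" using d by (simp add: \<epsilon>_def)
    finally show ?thesis .
  qed
  have "eventually (\<lambda>n. clt_error (2 * B) a n < e / 4) sequentially"
    using order_tendstoD(2)[OF clt_error_tendsto, of "e / 4"] e by simp
  then show ?thesis
    using statistic_linearization[OF C t0 \<epsilon>] eventually_gt_at_top[of 0]
  proof eventually_elim
    case (elim n)
    show ?case
    proof (intro allI impI)
      fix \<rho> \<tau> assume \<rho>: "concentrated \<rho> \<mu>" and \<tau>: "concentrated \<tau> \<nu>"
        and tvs: "sqrt (real n) * tv \<rho> \<mu> \<le> C" "sqrt (real n) * tv \<tau> \<nu> \<le> C"
      have \<rho>p: "prob_space \<rho>" "sets \<rho> = sets borel" and \<tau>p: "prob_space \<tau>" "sets \<tau> = sets borel"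
        using \<rho> \<tau> by (auto simp: concentrated_def)
      let ?S = "sample_measure n \<rho> \<tau>"
      interpret S: prob_space ?S by (rule prob_space_sample_measure[OF \<rho>p(1) \<tau>p(1)])
      have bad: "S.prob {z \<in> space ?S. \<epsilon> * (2 * t + 4 * C) < \<bar>statistic n \<rho> \<tau> z - linear_part n \<rho> \<tau> z\<bar>} \<le> 2 * tv_const s / t"
        using elim(2) \<rho> \<tau> tvs by blast
      note sc = measurable_cong_sets[OF sets_sample_measure[OF \<rho>p(2) \<tau>p(2)] refl]
      have mW: "statistic n \<rho> \<tau> \<in> borel_measurable ?S" using statistic_measurable[OF elim(3)] unfolding sc .
      have mZ: "linear_part n \<rho> \<tau> \<in> borel_measurable ?S" using linear_part_measurable unfolding sc .
      have "0 \<le> \<epsilon> * (2 * t + 4 * C)" using \<epsilon> t0 C by simp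
      from S.char_perturbation[OF mW mZ this bad, of a]
      have 1: "cmod ((LINT z|?S. iexp (a * statistic n \<rho> \<tau> z)) - (LINT z|?S. iexp (a * linear_part n \<rho> \<tau> z))) \<le> e / 4 + e / 4"
        using at tt by linarith
      have 2: "cmod ((LINT z|?S. iexp (a * linear_part n \<rho> \<tau> z)) - exp (- (var \<rho> g1 + var \<tau> g2) * a\<^sup>2 / 2)) \<le> 2 * (e / 4)"
        using linear_part_char[OF \<rho>p \<tau>p elim(3), of a] elim(1) by linarith
      show "cmod ((LINT z|?S. iexp (a * statistic n \<rho> \<tau> z)) - exp (- (var \<rho> g1 + var \<tau> g2) * a\<^sup>2 / 2)) \<le> e"
        using norm_triangle_le[OF add_mono[OF 1 2]] by simp
    qed
  qed
qed

text \<open>Convergence of characteristic functions and Levy's theorem. The row laws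
  \<open>\<rho> k\<close>, \<open>\<tau> k\<close> may vary with the sample size
  \<open>N k\<close>: constant rows give the central limit theorem, rows of empirical measures the
  bootstrap.\<close>

theorem statistic_weak_convergence:
  fixes N :: "nat \<Rightarrow> nat"
  assumes N: "filterlim N at_top sequentially" "\<And>k. 0 < N k"
    and conc: "\<And>k. concentrated (\<rho> k) \<mu>" "\<And>k. concentrated (\<tau> k) \<nu>"
    and tvs: "\<And>k. sqrt (real (N k)) * tv (\<rho> k) \<mu> \<le> C" "\<And>k. sqrt (real (N k)) * tv (\<tau> k) \<nu> \<le> C"
    and vars: "(\<lambda>k. var (\<rho> k) g1) \<longlonglongrightarrow> v" "(\<lambda>k. var (\<tau> k) g2) \<longlonglongrightarrow> w"
  shows "weak_conv_m (\<lambda>k. distr (sample_measure (N k) (\<rho> k) (\<tau> k)) borel (statistic (N k) (\<rho> k) (\<tau> k))) (centered_normal (v + w))"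
proof (rule levy_continuity)
  have p: "prob_space (\<rho> k)" "sets (\<rho> k) = sets borel" "prob_space (\<tau> k)" "sets (\<tau> k) = sets borel" for k
    using conc[of k] by (auto simp: concentrated_def)
  have m: "statistic (N k) (\<rho> k) (\<tau> k) \<in> borel_measurable (sample_measure (N k) (\<rho> k) (\<tau> k))" for k
    using statistic_measurable[OF N(2)] unfolding measurable_cong_sets[OF sets_sample_measure[OF p(2) p(4)] refl] .
  have vw: "0 \<le> v" "0 \<le> w"
    using vars by (auto intro!: LIMSEQ_le_const[where x=v] LIMSEQ_le_const[where x=w] simp: var_nonneg)
  have "0 \<le> sqrt (real (N 0)) * tv (\<rho> 0) \<mu>" using tv_nonneg by simp
  with tvs(1)[of 0] have C: "0 \<le> C" by linarith
  show "real_distribution (distr (sample_measure (N k) (\<rho> k) (\<tau> k)) borel (statistic (N k) (\<rho> k) (\<tau> k)))" for k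
    using m by (intro real_distributionI prob_space.prob_space_distr prob_space_sample_measure p) auto
  show "real_distribution (centered_normal (v + w))" using vw by (intro centered_normal_real_distribution) auto
  fix a
  have "(\<lambda>k. exp (- (var (\<rho> k) g1 + var (\<tau> k) g2) * a\<^sup>2 / 2)) \<longlonglongrightarrow> exp (- (v + w) * a\<^sup>2 / 2)"
    using vars by (intro tendsto_intros) auto
  then have lim: "(\<lambda>k. complex_of_real (exp (- (var (\<rho> k) g1 + var (\<tau> k) g2) * a\<^sup>2 / 2))) \<longlonglongrightarrow> complex_of_real (exp (- (v + w) * a\<^sup>2 / 2))"
    by (rule tendsto_of_real)
  have "(\<lambda>k. (LINT z|sample_measure (N k) (\<rho> k) (\<tau> k). iexp (a * statistic (N k) (\<rho> k) (\<tau> k) z)) -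
      complex_of_real (exp (- (var (\<rho> k) g1 + var (\<tau> k) g2) * a\<^sup>2 / 2))) \<longlonglongrightarrow> 0"
  proof (rule tendstoI)
    fix e :: real assume "0 < e"
    then have "eventually (\<lambda>k. cmod ((LINT z|sample_measure (N k) (\<rho> k) (\<tau> k). iexp (a * statistic (N k) (\<rho> k) (\<tau> k) z)) -
      complex_of_real (exp (- (var (\<rho> k) g1 + var (\<tau> k) g2) * a\<^sup>2 / 2))) \<le> e / 2) sequentially"
      using filterlim_iff[THEN iffD1, OF N(1), rule_format, OF statistic_char[OF C, of "e / 2" a]] conc tvs
      by (auto elim!: eventually_mono)
    then show "eventually (\<lambda>k. dist ((LINT z|sample_measure (N k) (\<rho> k) (\<tau> k). iexp (a * statistic (N k) (\<rho> k) (\<tau> k) z)) -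
      complex_of_real (exp (- (var (\<rho> k) g1 + var (\<tau> k) g2) * a\<^sup>2 / 2))) 0 < e) sequentially"
      by eventually_elim (use \<open>0 < e\<close> in \<open>simp add: dist_norm\<close>)
  qed
  from tendsto_add[OF this lim]
  have "(\<lambda>k. LINT z|sample_measure (N k) (\<rho> k) (\<tau> k). iexp (a * statistic (N k) (\<rho> k) (\<tau> k) z)) \<longlonglongrightarrow> complex_of_real (exp (- (v + w) * a\<^sup>2 / 2))"
    by simp
  moreover have "char (distr (sample_measure (N k) (\<rho> k) (\<tau> k)) borel (statistic (N k) (\<rho> k) (\<tau> k))) a =
      (LINT z|sample_measure (N k) (\<rho> k) (\<tau> k). iexp (a * statistic (N k) (\<rho> k) (\<tau> k) z))" for k
    unfolding char_def using m by (subst integral_distr) auto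
  ultimately show "(\<lambda>k. char (distr (sample_measure (N k) (\<rho> k) (\<tau> k)) borel (statistic (N k) (\<rho> k) (\<tau> k))) a) \<longlonglongrightarrow> char (centered_normal (v + w)) a"
    using vw by (simp add: char_centered_normal)
qed

end

section \<open>Sampling, resampling and the bootstrap\<close>

lemma (in prob_space) iid_law:
  fixes Z :: "'i \<Rightarrow> 'a \<Rightarrow> 'b::topological_space" and e :: "nat \<Rightarrow> 'i"
  assumes ind: "indep_vars (\<lambda>_. borel) Z UNIV" and e: "inj e" and law: "\<And>i. distr M borel (Z (e i)) = \<mu>" and n: "0 < n"
  shows "distr M (PiM {..<n} (\<lambda>_. borel)) (\<lambda>\<omega>. \<lambda>i\<in>{..<n}. Z (e i) \<omega>) = PiM {..<n} (\<lambda>_. \<mu>)"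
proof -
  have rv [measurable]: "Z j \<in> measurable M borel" for j using ind by (auto simp: indep_vars_def)
  have \<mu>: "prob_space \<mu>" "sets \<mu> = sets borel"
    using prob_space_distr[OF rv[of "e 0"]] law[of 0] by auto
  note indD = indep_varsD[OF ind] and em = emeasure_eq_measure
  interpret \<mu>: prob_space \<mu> by fact
  interpret product_prob_space "\<lambda>_::nat. \<mu>" "{..<n}" ..
  show ?thesis
  proof (rule PiM_eqI)
    show "sets (distr M (PiM {..<n} (\<lambda>_. borel)) (\<lambda>\<omega>. \<lambda>i\<in>{..<n}. Z (e i) \<omega>)) = sets (PiM {..<n} (\<lambda>_. \<mu>))"
      unfolding sets_distr by (rule sets_PiM_cong) (auto simp: \<mu>)
    fix A :: "nat \<Rightarrow> 'b set" assume A: "\<And>i. i \<in> {..<n} \<Longrightarrow> A i \<in> sets \<mu>"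
    then have Ab: "\<And>i. i \<in> {..<n} \<Longrightarrow> A i \<in> sets borel" by (simp add: \<mu>)
    have m: "(\<lambda>\<omega>. \<lambda>i\<in>{..<n}. Z (e i) \<omega>) \<in> measurable M (PiM {..<n} (\<lambda>_. borel))" by measurable
    have eq: "(\<lambda>\<omega>. \<lambda>i\<in>{..<n}. Z (e i) \<omega>) -` (Pi\<^sub>E {..<n} A) \<inter> space M = (\<Inter>j\<in>e ` {..<n}. Z j -` A (inv e j) \<inter> space M)"
      using n e by (auto simp: PiE_iff inv_f_f)
    have "emeasure (distr M (PiM {..<n} (\<lambda>_. borel)) (\<lambda>\<omega>. \<lambda>i\<in>{..<n}. Z (e i) \<omega>)) (Pi\<^sub>E {..<n} A) =
       emeasure M (\<Inter>j\<in>e ` {..<n}. Z j -` A (inv e j) \<inter> space M)"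
      using Ab m by (subst emeasure_distr) (auto simp: eq)
    also have "\<dots> = ennreal (\<Prod>j\<in>e ` {..<n}. measure M (Z j -` A (inv e j) \<inter> space M))"
      unfolding em using n Ab e by (subst indD) (auto simp: inv_f_f)
    also have "(\<Prod>j\<in>e ` {..<n}. measure M (Z j -` A (inv e j) \<inter> space M)) = (\<Prod>i<n. measure M (Z (e i) -` A i \<inter> space M))"
      using e by (subst prod.reindex) (auto simp: inv_f_f intro: inj_on_subset)
    also have "\<dots> = (\<Prod>i<n. measure \<mu> (A i))"
    proof (rule prod.cong[OF refl])
      fix i assume "i \<in> {..<n}"
      then have "measure (distr M borel (Z (e i))) (A i) = measure M (Z (e i) -` A i \<inter> space M)"
        using Ab by (intro measure_distr) auto
      then show "measure M (Z (e i) -` A i \<inter> space M) = measure \<mu> (A i)" by (simp add: law)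
    qed
    also have "ennreal \<dots> = (\<Prod>i<n. emeasure \<mu> (A i))"
      by (simp add: \<mu>.emeasure_eq_measure prod_ennreal)
    finally show "emeasure (distr M (PiM {..<n} (\<lambda>_. borel)) (\<lambda>\<omega>. \<lambda>i\<in>{..<n}. Z (e i) \<omega>)) (Pi\<^sub>E {..<n} A) = (\<Prod>i<n. emeasure \<mu> (A i))" .
  qed simp
qed

definition two_samples :: "nat \<Rightarrow> (nat \<Rightarrow> 'w \<Rightarrow> 'a) \<Rightarrow> (nat \<Rightarrow> 'w \<Rightarrow> 'a) \<Rightarrow> 'w \<Rightarrow> (nat \<Rightarrow> 'a) \<times> (nat \<Rightarrow> 'a)" where
  "two_samples n X Y \<omega> = (\<lambda>i\<in>{..<n}. X i \<omega>, \<lambda>i\<in>{..<n}. Y i \<omega>)"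

lemma two_samples_measurable:
  fixes X Y :: "nat \<Rightarrow> 'w \<Rightarrow> 'a::topological_space"
  assumes [measurable]: "\<And>i. X i \<in> measurable \<Omega> borel" "\<And>i. Y i \<in> measurable \<Omega> borel"
  shows "two_samples n X Y \<in> measurable \<Omega> (PiM {..<n} (\<lambda>_. borel) \<Otimes>\<^sub>M PiM {..<n} (\<lambda>_. borel))"
  unfolding two_samples_def[abs_def] by measurable

lemma (in prob_space) two_samples_law:
  fixes X Y :: "nat \<Rightarrow> 'a \<Rightarrow> 'b::topological_space"
  assumes ind: "indep_vars (\<lambda>_. borel) (case_sum X Y) UNIV"
    and X: "\<And>i. distr M borel (X i) = \<mu>" and Y: "\<And>i. distr M borel (Y i) = \<nu>" and n: "0 < n"
  shows "distr M (PiM {..<n} (\<lambda>_. borel) \<Otimes>\<^sub>M PiM {..<n} (\<lambda>_. borel)) (two_samples n X Y) = PiM {..<n} (\<lambda>_. \<mu>) \<Otimes>\<^sub>M PiM {..<n} (\<lambda>_. \<nu>)"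
proof -
  let ?Z = "case_sum X Y" and ?A = "Inl ` {..<n}" and ?B = "Inr ` {..<n}"
  have "indep_var (PiM ?A (\<lambda>_. borel)) (\<lambda>\<omega>. restrict (\<lambda>i. ?Z i \<omega>) ?A) (PiM ?B (\<lambda>_. borel)) (\<lambda>\<omega>. restrict (\<lambda>i. ?Z i \<omega>) ?B)"
    by (rule indep_var_restrict[OF ind]) auto
  moreover have "(\<lambda>f. \<lambda>i\<in>{..<n}. f (Inl i)) \<in> measurable (PiM ?A (\<lambda>_. borel)) (PiM {..<n} (\<lambda>_. borel :: 'b measure))"
    by (intro measurable_restrict measurable_component_singleton) auto
  moreover have "(\<lambda>f. \<lambda>i\<in>{..<n}. f (Inr i)) \<in> measurable (PiM ?B (\<lambda>_. borel)) (PiM {..<n} (\<lambda>_. borel :: 'b measure))"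
    by (intro measurable_restrict measurable_component_singleton) auto
  ultimately have "indep_var (PiM {..<n} (\<lambda>_. borel)) ((\<lambda>f. \<lambda>i\<in>{..<n}. f (Inl i)) \<circ> (\<lambda>\<omega>. restrict (\<lambda>i. ?Z i \<omega>) ?A))
     (PiM {..<n} (\<lambda>_. borel)) ((\<lambda>f. \<lambda>i\<in>{..<n}. f (Inr i)) \<circ> (\<lambda>\<omega>. restrict (\<lambda>i. ?Z i \<omega>) ?B))"
    by (rule indep_var_compose)
  moreover have "(\<lambda>f. \<lambda>i\<in>{..<n}. f (Inl i)) \<circ> (\<lambda>\<omega>. restrict (\<lambda>i. ?Z i \<omega>) ?A) = (\<lambda>\<omega>. \<lambda>i\<in>{..<n}. X i \<omega>)"
    "(\<lambda>f. \<lambda>i\<in>{..<n}. f (Inr i)) \<circ> (\<lambda>\<omega>. restrict (\<lambda>i. ?Z i \<omega>) ?B) = (\<lambda>\<omega>. \<lambda>i\<in>{..<n}. Y i \<omega>)"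
    by (auto simp: fun_eq_iff)
  ultimately have "distr M (PiM {..<n} (\<lambda>_. borel)) (\<lambda>\<omega>. \<lambda>i\<in>{..<n}. X i \<omega>) \<Otimes>\<^sub>M distr M (PiM {..<n} (\<lambda>_. borel)) (\<lambda>\<omega>. \<lambda>i\<in>{..<n}. Y i \<omega>)
     = distr M (PiM {..<n} (\<lambda>_. borel) \<Otimes>\<^sub>M PiM {..<n} (\<lambda>_. borel)) (\<lambda>\<omega>. (\<lambda>i\<in>{..<n}. X i \<omega>, \<lambda>i\<in>{..<n}. Y i \<omega>))"
    by (simp add: indep_var_distribution_eq)
  moreover have "distr M (PiM {..<n} (\<lambda>_. borel)) (\<lambda>\<omega>. \<lambda>i\<in>{..<n}. X i \<omega>) = PiM {..<n} (\<lambda>_. \<mu>)"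
    using iid_law[OF ind, of Inl \<mu> n] X n by simp
  moreover have "distr M (PiM {..<n} (\<lambda>_. borel)) (\<lambda>\<omega>. \<lambda>i\<in>{..<n}. Y i \<omega>) = PiM {..<n} (\<lambda>_. \<nu>)"
    using iid_law[OF ind, of Inr \<nu> n] Y n by simp
  ultimately show ?thesis by (simp add: two_samples_def[abs_def])
qed

lemma empirical_restrict [simp]: "empirical n (\<lambda>i\<in>{..<n}. x i) = empirical n x"
  by (rule empirical_cong) simp

definition resamplings :: "nat \<Rightarrow> (nat \<Rightarrow> nat) set" where
  "resamplings n = Pi\<^sub>E {..<n} (\<lambda>_. {..<n})"

lemma finite_resamplings: "finite (resamplings n)" by (simp add: resamplings_def finite_PiE)

lemma card_resamplings: "card (resamplings n) = n ^ n" by (simp add: resamplings_def card_PiE)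

text \<open>A bootstrap sample is a uniformly chosen function from positions to positions.\<close>

lemma PiM_empirical:
  fixes x :: "nat \<Rightarrow> 'a::topological_space"
  assumes n: "0 < n"
  shows "PiM {..<n} (\<lambda>_. empirical n x) = distr (uniform_count_measure (resamplings n)) (PiM {..<n} (\<lambda>_. borel)) (\<lambda>j. \<lambda>i\<in>{..<n}. x (j i))"
proof -
  interpret E: prob_space "empirical n x" by (rule prob_space_empirical[OF n])
  interpret product_prob_space "\<lambda>_::nat. empirical n x" "{..<n}" ..
  let ?U = "uniform_count_measure (resamplings n)"
  show ?thesis
  proof (rule PiM_eqI[symmetric])
    show "sets (distr ?U (PiM {..<n} (\<lambda>_. borel)) (\<lambda>j. \<lambda>i\<in>{..<n}. x (j i))) = sets (PiM {..<n} (\<lambda>_. empirical n x))"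
      unfolding sets_distr by (rule sets_PiM_cong) auto
    fix A :: "nat \<Rightarrow> 'a set" assume A: "\<And>i. i \<in> {..<n} \<Longrightarrow> A i \<in> sets (empirical n x)"
    have m: "(\<lambda>j. \<lambda>i\<in>{..<n}. x (j i)) \<in> measurable ?U (PiM {..<n} (\<lambda>_. borel))"
      by (auto simp: measurable_def sets_uniform_count_measure space_uniform_count_measure space_PiM)
    have eq: "(\<lambda>j. \<lambda>i\<in>{..<n}. x (j i)) -` (Pi\<^sub>E {..<n} A) \<inter> space ?U = Pi\<^sub>E {..<n} (\<lambda>i. {l \<in> {..<n}. x l \<in> A i})"
    proof (intro set_eqI iffI)
      fix j assume "j \<in> Pi\<^sub>E {..<n} (\<lambda>i. {l \<in> {..<n}. x l \<in> A i})"
      then have "j \<in> Pi\<^sub>E {..<n} (\<lambda>_. {..<n})" "\<And>i. i \<in> {..<n} \<Longrightarrow> x (j i) \<in> A i" by (simp_all add: PiE_iff)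
      then show "j \<in> (\<lambda>j. \<lambda>i\<in>{..<n}. x (j i)) -` (Pi\<^sub>E {..<n} A) \<inter> space ?U"
        by (simp add: space_uniform_count_measure resamplings_def)
    next
      fix j assume j: "j \<in> (\<lambda>j. \<lambda>i\<in>{..<n}. x (j i)) -` (Pi\<^sub>E {..<n} A) \<inter> space ?U"
      then have "j \<in> Pi\<^sub>E {..<n} (\<lambda>_. {..<n})" by (simp add: space_uniform_count_measure resamplings_def)
      moreover have "(\<lambda>i\<in>{..<n}. x (j i)) \<in> Pi\<^sub>E {..<n} A" using j by simp
      then have "\<And>i. i \<in> {..<n} \<Longrightarrow> x (j i) \<in> A i" by (simp only: restrict_PiE_iff)
      ultimately show "j \<in> Pi\<^sub>E {..<n} (\<lambda>i. {l \<in> {..<n}. x l \<in> A i})" by (simp add: PiE_iff)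
    qed
    have "emeasure (distr ?U (PiM {..<n} (\<lambda>_. borel)) (\<lambda>j. \<lambda>i\<in>{..<n}. x (j i))) (Pi\<^sub>E {..<n} A) =
        emeasure ?U (Pi\<^sub>E {..<n} (\<lambda>i. {l \<in> {..<n}. x l \<in> A i}))"
      using A m by (subst emeasure_distr) (auto simp: eq)
    also have "\<dots> = ennreal (real (card (Pi\<^sub>E {..<n} (\<lambda>i. {l \<in> {..<n}. x l \<in> A i}))) / real (card (resamplings n)))"
      by (rule emeasure_uniform_count_measure[OF finite_resamplings]) (auto simp: resamplings_def PiE_iff)
    also have "real (card (Pi\<^sub>E {..<n} (\<lambda>i. {l \<in> {..<n}. x l \<in> A i}))) / real (card (resamplings n)) =
        (\<Prod>i<n. real (card {l \<in> {..<n}. x l \<in> A i}) / real n)"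
      by (simp add: card_resamplings card_PiE prod_dividef)
    also have "\<dots> = (\<Prod>i<n. (\<Sum>l<n. indicator (A i) (x l)) / real n)"
      by (intro prod.cong refl) (simp add: indicator_def sum.If_cases Int_def)
    also have "ennreal \<dots> = (\<Prod>i<n. ennreal ((\<Sum>l<n. indicator (A i) (x l)) / real n))"
      by (intro prod_ennreal[symmetric]) (auto intro!: divide_nonneg_nonneg sum_nonneg)
    also have "\<dots> = (\<Prod>i<n. emeasure (empirical n x) (A i))"
      using A n by (intro prod.cong refl) (simp add: emeasure_empirical)
    finally show "emeasure (distr ?U (PiM {..<n} (\<lambda>_. borel)) (\<lambda>j. \<lambda>i\<in>{..<n}. x (j i))) (Pi\<^sub>E {..<n} A) = (\<Prod>i<n. emeasure (empirical n x) (A i))" .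
  qed simp
qed

lemma integral_PiM_empirical:
  fixes f :: "(nat \<Rightarrow> 'a::topological_space) \<Rightarrow> real"
  assumes n: "0 < n" and f: "f \<in> borel_measurable (PiM {..<n} (\<lambda>_. borel))"
  shows "(LINT z|PiM {..<n} (\<lambda>_. empirical n x). f z) = (\<Sum>j\<in>resamplings n. f (\<lambda>i\<in>{..<n}. x (j i))) / real (n ^ n)"
proof -
  have m: "(\<lambda>j. \<lambda>i\<in>{..<n}. x (j i)) \<in> measurable (uniform_count_measure (resamplings n)) (PiM {..<n} (\<lambda>_. borel))"
    by (auto simp: measurable_def sets_uniform_count_measure space_uniform_count_measure space_PiM)
  show ?thesis unfolding PiM_empirical[OF n]
    by (subst integral_distr[OF m f]) (simp add: integral_uniform_count_measure finite_resamplings card_resamplings)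
qed

lemma measure_resampling:
  fixes x y :: "nat \<Rightarrow> 'a::topological_space"
  assumes n: "0 < n" and Q: "Q \<in> sets (PiM {..<n} (\<lambda>_. borel) \<Otimes>\<^sub>M PiM {..<n} (\<lambda>_. borel))"
  shows "measure (PiM {..<n} (\<lambda>_. empirical n x) \<Otimes>\<^sub>M PiM {..<n} (\<lambda>_. empirical n y)) Q =
    (\<Sum>j\<in>resamplings n. \<Sum>l\<in>resamplings n. indicator Q (\<lambda>i\<in>{..<n}. x (j i), \<lambda>i\<in>{..<n}. y (l i))) / (real (n ^ n))\<^sup>2"
proof -
  let ?P = "PiM {..<n} (\<lambda>_. empirical n x)" and ?Q = "PiM {..<n} (\<lambda>_. empirical n y)"
  interpret P: prob_space ?P by (intro prob_space_PiM prob_space_empirical n)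
  interpret R: prob_space ?Q by (intro prob_space_PiM prob_space_empirical n)
  interpret PQ: pair_prob_space ?P ?Q ..
  have sP: "sets ?P = sets (PiM {..<n} (\<lambda>_. borel))" "sets ?Q = sets (PiM {..<n} (\<lambda>_. borel))"
    by (rule sets_PiM_cong; simp)+
  have Q': "Q \<in> sets (?P \<Otimes>\<^sub>M ?Q)" using Q sets_pair_measure_cong[OF sP] by simp
  note [measurable] = Q
  have i: "integrable (?P \<Otimes>\<^sub>M ?Q) (indicator Q :: _ \<Rightarrow> real)"
    using Q' by (intro integrable_real_indicator) (auto simp: PQ.P.emeasure_eq_measure)
  have m1: "(\<lambda>b. indicator Q (a, b) :: real) \<in> borel_measurable (PiM {..<n} (\<lambda>_. borel))" if "a \<in> space (PiM {..<n} (\<lambda>_. borel))" for a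
    using that by measurable
  have "measure (?P \<Otimes>\<^sub>M ?Q) Q = (LINT z|(?P \<Otimes>\<^sub>M ?Q). indicator Q z)" using Q' by simp
  also have "\<dots> = (LINT a|?P. LINT b|?Q. indicator Q (a, b))" using PQ.integral_fst'[OF i] by simp
  also have "\<dots> = (LINT a|?P. (\<Sum>l\<in>resamplings n. indicator Q (a, \<lambda>i\<in>{..<n}. y (l i))) / real (n ^ n))"
    using m1 sets_eq_imp_space_eq[OF sP(1)] by (intro Bochner_Integration.integral_cong refl integral_PiM_empirical[OF n]) auto
  also have "\<dots> = (\<Sum>j\<in>resamplings n. (\<Sum>l\<in>resamplings n. indicator Q (\<lambda>i\<in>{..<n}. x (j i), \<lambda>i\<in>{..<n}. y (l i))) / real (n ^ n)) / real (n ^ n)"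
  proof (rule integral_PiM_empirical[OF n])
    have "(\<lambda>i\<in>{..<n}. y (l i)) \<in> space (PiM {..<n} (\<lambda>_. borel))" for l by (simp add: space_PiM)
    then show "(\<lambda>a. (\<Sum>l\<in>resamplings n. indicator Q (a, \<lambda>i\<in>{..<n}. y (l i))) / real (n ^ n)) \<in> borel_measurable (PiM {..<n} (\<lambda>_. borel))"
      by measurable
  qed
  finally show ?thesis by (simp add: sum_divide_distrib power2_eq_square)
qed

text \<open>Distribution functions are right continuous, so the supremum over all \<open>t\<close>
  is one over a countable set; this makes the bootstrap error measurable.\<close>

lemma SUP_rational:
  fixes h :: "real \<Rightarrow> real"
  assumes bdd: "bdd_above (range h)" and cont: "\<And>t. continuous (at_right t) h"
  shows "(SUP t. h t) = (SUP q\<in>\<rat>. h q)"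
proof (rule antisym)
  have bddQ: "bdd_above (h ` \<rat>)" using bdd by (rule bdd_above_mono) auto
  show "(SUP t. h t) \<le> (SUP q\<in>\<rat>. h q)"
  proof (rule cSUP_least)
    fix t
    show "h t \<le> (SUP q\<in>\<rat>. h q)"
    proof (rule ccontr)
      assume "\<not> ?thesis"
      then have less: "(SUP q\<in>\<rat>. h q) < h t" by simp
      have "(h \<longlongrightarrow> h t) (at_right t)" using cont[of t] by (simp add: continuous_within)
      from order_tendstoD(1)[OF this less] obtain b where b: "t < b" "\<And>u. t < u \<Longrightarrow> u < b \<Longrightarrow> (SUP q\<in>\<rat>. h q) < h u"
        by (auto simp: eventually_at_right_field)
      obtain q where q: "q \<in> \<rat>" "t < q" "q < b" using Rats_dense_in_real[OF b(1)] by blast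
      have "h q \<le> (SUP q\<in>\<rat>. h q)" using q(1) bddQ by (rule cSUP_upper)
      then show False using b(2)[OF q(2,3)] by simp
    qed
  qed simp
  show "(SUP q\<in>\<rat>. h q) \<le> (SUP t. h t)"
    by (rule cSUP_subset_mono) (use bdd in \<open>auto intro: Rats_0\<close>)
qed

context smooth_functional begin

lemma bootstrap_cdf2_eq:
  assumes n: "0 < n"
  shows "bootstrap_cdf2 \<kappa> n x y t = cdf (distr (sample_measure n (empirical n x) (empirical n y)) borel (statistic n (empirical n x) (empirical n y))) t"
    and "real_distribution (distr (sample_measure n (empirical n x) (empirical n y)) borel (statistic n (empirical n x) (empirical n y)))"
proof -
  let ?S = "sample_measure n (empirical n x) (empirical n y)" and ?W = "statistic n (empirical n x) (empirical n y)"
  have m: "?W \<in> borel_measurable ?S"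
    using statistic_measurable[OF n] unfolding measurable_cong_sets[OF sets_sample_measure[OF sets_empirical sets_empirical] refl] .
  show "real_distribution (distr ?S borel ?W)"
    using m by (intro real_distributionI prob_space.prob_space_distr prob_space_sample_measure prob_space_empirical n) auto
  have "cdf (distr ?S borel ?W) t = measure ?S (?W -` {..t} \<inter> space ?S)"
    unfolding cdf_def using m by (intro measure_distr) auto
  also have "?W -` {..t} \<inter> space ?S = {z \<in> space ?S. ?W z \<le> t}" by auto
  finally show "bootstrap_cdf2 \<kappa> n x y t = cdf (distr ?S borel ?W) t"
    unfolding bootstrap_cdf2_def Let_def sample_measure_def statistic_def by (simp add: split_beta')
qed

text \<open>The conditional distribution function is a finite average over resamplings of
  functions of the data.\<close>

lemma bootstrap_cdf2_measurable:
  assumes n: "0 < n"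
  shows "(\<lambda>z. bootstrap_cdf2 \<kappa> n (fst z) (snd z) t) \<in> borel_measurable (PiM {..<n} (\<lambda>_. borel) \<Otimes>\<^sub>M PiM {..<n} (\<lambda>_. borel))"
proof -
  let ?B = "PiM {..<n} (\<lambda>_. borel) \<Otimes>\<^sub>M PiM {..<n} (\<lambda>_. borel) :: ((nat \<Rightarrow> 'a) \<times> (nat \<Rightarrow> 'a)) measure"
  define k2 where "k2 z = \<kappa> (empirical n (fst z)) (empirical n (snd z))" for z
  have k2 [measurable]: "k2 \<in> borel_measurable ?B" unfolding k2_def[abs_def] using \<kappa>_measurable[OF n] by (simp add: split_beta')
  define re where "re j l z = (\<lambda>i\<in>{..<n}. fst z (j i), \<lambda>i\<in>{..<n}. snd z (l i))" for j l :: "nat \<Rightarrow> nat" and z :: "(nat \<Rightarrow> 'a) \<times> (nat \<Rightarrow> 'a)"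
  have re: "re j l \<in> measurable ?B ?B" if "j \<in> resamplings n" "l \<in> resamplings n" for j l
  proof -
    have "j i \<in> {..<n}" "l i \<in> {..<n}" if "i \<in> {..<n}" for i
      using that \<open>j \<in> resamplings n\<close> \<open>l \<in> resamplings n\<close> by (auto simp: resamplings_def PiE_iff)
    then show ?thesis unfolding re_def[abs_def]
      by (intro measurable_Pair measurable_restrict measurable_compose[OF measurable_fst measurable_component_singleton]
          measurable_compose[OF measurable_snd measurable_component_singleton]) auto
  qed
  have eq: "bootstrap_cdf2 \<kappa> n (fst z) (snd z) t = (\<Sum>j\<in>resamplings n. \<Sum>l\<in>resamplings n. indicator {..t} (sqrt (real n) * (k2 (re j l z) - k2 z))) / (real (n ^ n))\<^sup>2" for z
  proof -
    define Q where "Q = {w \<in> space ?B. sqrt (real n) * (k2 w - k2 z) \<le> t}"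
    have Qm: "Q \<in> sets ?B" unfolding Q_def by measurable
    have sp: "space (PiM {..<n} (\<lambda>_. empirical n (fst z)) \<Otimes>\<^sub>M PiM {..<n} (\<lambda>_. empirical n (snd z))) = space ?B"
      by (rule sets_eq_imp_space_eq, intro sets_pair_measure_cong sets_PiM_cong) auto
    have "bootstrap_cdf2 \<kappa> n (fst z) (snd z) t = measure (PiM {..<n} (\<lambda>_. empirical n (fst z)) \<Otimes>\<^sub>M PiM {..<n} (\<lambda>_. empirical n (snd z))) Q"
      unfolding bootstrap_cdf2_def Let_def Q_def sp k2_def by (simp add: split_beta')
    also have "\<dots> = (\<Sum>j\<in>resamplings n. \<Sum>l\<in>resamplings n. indicator Q (re j l z)) / (real (n ^ n))\<^sup>2"
      unfolding re_def by (rule measure_resampling[OF n Qm])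
    also have "(\<Sum>j\<in>resamplings n. \<Sum>l\<in>resamplings n. indicator Q (re j l z) :: real) = (\<Sum>j\<in>resamplings n. \<Sum>l\<in>resamplings n. indicator {..t} (sqrt (real n) * (k2 (re j l z) - k2 z)))"
      by (intro sum.cong refl) (auto simp: Q_def re_def space_pair_measure space_PiM split: split_indicator)
    finally show ?thesis .
  qed
  have "(\<lambda>z. (\<Sum>j\<in>resamplings n. \<Sum>l\<in>resamplings n. indicator {..t} (sqrt (real n) * (k2 (re j l z) - k2 z))) / (real (n ^ n))\<^sup>2) \<in> borel_measurable ?B"
  proof (intro borel_measurable_divide borel_measurable_sum borel_measurable_const)
    fix j l assume "j \<in> resamplings n" "l \<in> resamplings n"
    note [measurable] = re[OF this]
    show "(\<lambda>z. indicator {..t} (sqrt (real n) * (k2 (re j l z) - k2 z)) :: real) \<in> borel_measurable ?B" by measurable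
  qed
  then show ?thesis unfolding eq .
qed

definition "limit_variance = var \<mu> g1 + var \<nu> g2"
definition "bootstrap_error n x y = (SUP t. \<bar>bootstrap_cdf2 \<kappa> n x y t - cdf (centered_normal limit_variance) t\<bar>)"

lemma limit_variance_nonneg: "0 \<le> limit_variance" by (simp add: limit_variance_def var_nonneg)

lemma bootstrap_error_measurable:
  assumes n: "0 < n" and v: "0 < limit_variance"
  shows "(\<lambda>z. bootstrap_error n (fst z) (snd z)) \<in> borel_measurable (PiM {..<n} (\<lambda>_. borel) \<Otimes>\<^sub>M PiM {..<n} (\<lambda>_. borel))"
proof -
  let ?N = "centered_normal limit_variance"
  interpret N: real_distribution ?N by (rule centered_normal_real_distribution[OF limit_variance_nonneg])
  interpret N: finite_borel_measure ?N by (rule N.finite_borel_measure_M)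
  define h where "h z t = \<bar>bootstrap_cdf2 \<kappa> n (fst z) (snd z) t - cdf ?N t\<bar>" for z t
  have h: "bdd_above (range (h z))" "continuous (at_right t) (h z)" for z t
  proof -
    let ?M = "distr (sample_measure n (empirical n (fst z)) (empirical n (snd z))) borel (statistic n (empirical n (fst z)) (empirical n (snd z)))"
    interpret M: real_distribution ?M by (rule bootstrap_cdf2_eq(2)[OF n])
    interpret M: finite_borel_measure ?M by (rule M.finite_borel_measure_M)
    have heq: "h z = (\<lambda>t. \<bar>cdf ?M t - cdf ?N t\<bar>)" by (simp add: h_def bootstrap_cdf2_eq(1)[OF n] fun_eq_iff)
    have "h z t \<le> 1" for t
      unfolding heq using M.cdf_nonneg[of t] M.cdf_bounded_prob[of t] N.cdf_nonneg[of t] N.cdf_bounded_prob[of t] by linarith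
    then show "bdd_above (range (h z))" by (auto intro!: bdd_aboveI)
    have "continuous (at_right t) (cdf ?N)" by (rule N.cdf_is_right_cont)
    moreover have "continuous (at_right t) (cdf ?M)" by (rule M.cdf_is_right_cont)
    ultimately show "continuous (at_right t) (h z)" unfolding heq by (intro continuous_intros)
  qed
  have eq: "bootstrap_error n (fst z) (snd z) = (SUP q\<in>\<rat>. h z q)" for z
    unfolding bootstrap_error_def h_def[symmetric] by (rule SUP_rational[OF h])
  show ?thesis unfolding eq
  proof (rule borel_measurable_cSUP)
    show "countable (\<rat> :: real set)" by (rule countable_rat)
    show "(\<lambda>z. h z q) \<in> borel_measurable (PiM {..<n} (\<lambda>_. borel) \<Otimes>\<^sub>M PiM {..<n} (\<lambda>_. borel))" for q
      unfolding h_def using bootstrap_cdf2_measurable[OF n, of q] by measurable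
    show "bdd_above ((\<lambda>q. h z q) ` \<rat>)" for z using h(1)[of z] by (rule bdd_above_mono) auto
  qed
qed

text \<open>A bound for the bootstrap error on a set of good data, with no probability involved.
  If it failed, there would be a sequence of good samples of increasing size with large error; for
  the empirical measures of these samples the limit theorem for triangular arrays applies and
  yields a contradiction.\<close>

lemma bootstrap_error_deterministic:
  assumes e: "0 < e" and v: "0 < limit_variance"
  obtains \<delta> n0 where "0 < \<delta>" "\<And>n x y. n0 \<le> n \<Longrightarrow> 0 < n \<Longrightarrow> (\<And>i. i < n \<Longrightarrow> x i \<in> msupport \<mu>) \<Longrightarrow> (\<And>i. i < n \<Longrightarrow> y i \<in> msupport \<nu>) \<Longrightarrow>
     sqrt (real n) * tv (empirical n x) \<mu> \<le> C \<Longrightarrow> sqrt (real n) * tv (empirical n y) \<nu> \<le> C \<Longrightarrow>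
     \<bar>var (empirical n x) g1 - var \<mu> g1\<bar> \<le> \<delta> \<Longrightarrow> \<bar>var (empirical n y) g2 - var \<nu> g2\<bar> \<le> \<delta> \<Longrightarrow> bootstrap_error n x y \<le> e"
proof (rule ccontr)
  assume neg: "\<not> thesis"
  let ?good = "\<lambda>\<delta> n x y. 0 < n \<and> (\<forall>i<n. x i \<in> msupport \<mu>) \<and> (\<forall>i<n. y i \<in> msupport \<nu>) \<and>
     sqrt (real n) * tv (empirical n x) \<mu> \<le> C \<and> sqrt (real n) * tv (empirical n y) \<nu> \<le> C \<and>
     \<bar>var (empirical n x) g1 - var \<mu> g1\<bar> \<le> \<delta> \<and> \<bar>var (empirical n y) g2 - var \<nu> g2\<bar> \<le> \<delta>"
  have "\<exists>n x y. m \<le> n \<and> ?good (1 / real (Suc m)) n x y \<and> e < bootstrap_error n x y" for m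
  proof (rule ccontr)
    assume none: "\<not> ?thesis"
    have thesis
    proof (rule that[of "1 / real (Suc m)" m])
      fix n x y
      assume "m \<le> n" "0 < n" "\<And>i. i < n \<Longrightarrow> x i \<in> msupport \<mu>" "\<And>i. i < n \<Longrightarrow> y i \<in> msupport \<nu>"
        "sqrt (real n) * tv (empirical n x) \<mu> \<le> C" "sqrt (real n) * tv (empirical n y) \<nu> \<le> C"
        "\<bar>var (empirical n x) g1 - var \<mu> g1\<bar> \<le> 1 / real (Suc m)" "\<bar>var (empirical n y) g2 - var \<nu> g2\<bar> \<le> 1 / real (Suc m)"
      then have "\<not> e < bootstrap_error n x y" using none by blast
      then show "bootstrap_error n x y \<le> e" by simp
    qed simp
    then show False using neg by blast
  qed
  then obtain N x y where N: "\<And>m. m \<le> N m" and good: "\<And>m. ?good (1 / real (Suc m)) (N m) (x m) (y m)"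
    and bad: "\<And>m. e < bootstrap_error (N m) (x m) (y m)" by metis
  let ?\<rho> = "\<lambda>m. empirical (N m) (x m)" and ?\<tau> = "\<lambda>m. empirical (N m) (y m)"
  have lim: "(\<lambda>m. 1 / real (Suc m)) \<longlonglongrightarrow> 0" by (rule LIMSEQ_Suc[OF lim_1_over_n])
  have conv: "f \<longlonglongrightarrow> l" if "\<And>m. \<bar>f m - l\<bar> \<le> 1 / real (Suc m)" for f :: "nat \<Rightarrow> real" and l
  proof -
    have "(\<lambda>m. f m - l) \<longlonglongrightarrow> 0" by (rule Lim_null_comparison[OF _ lim]) (use that in auto)
    then show ?thesis by (simp add: LIM_zero_iff)
  qed
  have "weak_conv_m (\<lambda>m. distr (sample_measure (N m) (?\<rho> m) (?\<tau> m)) borel (statistic (N m) (?\<rho> m) (?\<tau> m))) (centered_normal (var \<mu> g1 + var \<nu> g2))"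
  proof (rule statistic_weak_convergence)
    show "filterlim N at_top sequentially" using N by (intro filterlim_at_top_mono[OF filterlim_ident]) auto
    show "concentrated (?\<rho> m) \<mu>" "concentrated (?\<tau> m) \<nu>" for m using good[of m] by (auto intro!: concentrated_empirical)
    show "(\<lambda>m. var (?\<rho> m) g1) \<longlonglongrightarrow> var \<mu> g1" by (rule conv) (use good in blast)
    show "(\<lambda>m. var (?\<tau> m) g2) \<longlonglongrightarrow> var \<nu> g2" by (rule conv) (use good in blast)
  qed (use good in auto)
  then have wc: "weak_conv_m (\<lambda>m. distr (sample_measure (N m) (?\<rho> m) (?\<tau> m)) borel (statistic (N m) (?\<rho> m) (?\<tau> m))) (centered_normal limit_variance)"
    by (simp add: limit_variance_def)
  have Npos: "0 < N m" for m using good by blast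
  have "eventually (\<lambda>m. \<forall>t. \<bar>cdf (distr (sample_measure (N m) (?\<rho> m) (?\<tau> m)) borel (statistic (N m) (?\<rho> m) (?\<tau> m))) t - cdf (centered_normal limit_variance) t\<bar> \<le> e) sequentially"
    by (rule weak_conv_uniform[OF _ centered_normal_real_distribution[OF limit_variance_nonneg] isCont_cdf_centered_normal[OF v] wc e])
      (rule bootstrap_cdf2_eq(2)[OF Npos])
  then obtain m where m: "\<And>t. \<bar>bootstrap_cdf2 \<kappa> (N m) (x m) (y m) t - cdf (centered_normal limit_variance) t\<bar> \<le> e"
    unfolding bootstrap_cdf2_eq(1)[OF Npos] by (auto simp: eventually_sequentially)
  have "bootstrap_error (N m) (x m) (y m) \<le> e" unfolding bootstrap_error_def by (rule cSUP_least) (use m in auto)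
  then show False using bad[of m] by simp
qed

lemma empirical_mean_deviation:
  assumes \<rho>: "prob_space \<rho>" "sets \<rho> = sets borel" and h [measurable]: "h \<in> borel_measurable borel" and b: "\<And>x. \<bar>h x\<bar> \<le> b" and n: "0 < n"
  shows "(LINT x|PiM {..<n} (\<lambda>_. \<rho>). \<bar>(LINT z|empirical n x. h z) - (LINT z|\<rho>. h z)\<bar>) \<le> 2 * b / sqrt (real n)"
    and "integrable (PiM {..<n} (\<lambda>_. \<rho>)) (\<lambda>x. \<bar>(LINT z|empirical n x. h z) - (LINT z|\<rho>. h z)\<bar>)"
proof -
  interpret \<rho>: prob_space \<rho> by fact
  note [measurable_cong] = \<rho>(2)
  let ?P = "PiM {..<n} (\<lambda>_. \<rho>)"
  interpret P: prob_space ?P by (rule prob_space_PiM) (rule \<rho>)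
  note eb = expectation_bdd[OF \<rho> h b]
  define f where "f x = h x - (LINT z|\<rho>. h z)" for x
  have fb: "\<bar>f x\<bar> \<le> 2 * b" for x using b[of x] eb(2) unfolding f_def abs_le_iff by linarith
  have fm [measurable]: "f \<in> borel_measurable borel" unfolding f_def by measurable
  have b0: "0 \<le> b" using b abs_ge_zero order_trans by blast
  have eq: "(LINT z|empirical n x. h z) - (LINT z|\<rho>. h z) = (\<Sum>i<n. f (x i)) / real n" for x
    using n by (simp add: integral_empirical f_def sum_subtractf field_simps)
  have sb: "\<bar>(\<Sum>i<n. f (x i)) / real n\<bar> \<le> 2 * b" for x
  proof -
    have "\<bar>\<Sum>i<n. f (x i)\<bar> \<le> (\<Sum>i<n. \<bar>f (x i)\<bar>)" by (rule sum_abs)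
    also have "\<dots> \<le> (\<Sum>i<n. 2 * b)" by (rule sum_mono) (rule fb)
    finally show ?thesis using n by (simp add: abs_divide divide_le_eq mult.commute)
  qed
  have [measurable]: "(\<lambda>x. (\<Sum>i<n. f (x i)) / real n) \<in> borel_measurable ?P" by measurable
  show "integrable ?P (\<lambda>x. \<bar>(LINT z|empirical n x. h z) - (LINT z|\<rho>. h z)\<bar>)"
    unfolding eq by (rule P.integrable_const_bound[where B="2 * b"]) (use sb in auto)
  have "(LINT x|?P. \<bar>(\<Sum>i<n. f (x i)) / real n\<bar>) \<le> sqrt (LINT x|?P. ((\<Sum>i<n. f (x i)) / real n)\<^sup>2)"
    by (rule P.expectation_abs_le_sqrt[OF _ sb]) simp
  also have "(LINT x|?P. ((\<Sum>i<n. f (x i)) / real n)\<^sup>2) = (LINT x|?P. (\<Sum>i<n. f (x i))\<^sup>2) / (real n)\<^sup>2"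
    by (simp add: power_divide)
  also have "(LINT x|?P. (\<Sum>i<n. f (x i))\<^sup>2) = real n * (LINT x|\<rho>. (f x)\<^sup>2)"
  proof (rule PiM_second_moment[OF \<rho>(1) _ fb])
    show "(LINT x|\<rho>. f x) = 0" using eb(1) by (simp add: f_def \<rho>.prob_space)
  qed simp
  also have "sqrt (real n * (LINT x|\<rho>. (f x)\<^sup>2) / (real n)\<^sup>2) \<le> sqrt ((2 * b)\<^sup>2 / real n)"
  proof (rule real_sqrt_le_mono)
    have sq: "(f x)\<^sup>2 \<le> (2 * b)\<^sup>2" for x using power_mono[OF fb[of x], of 2] by simp
    have "integrable \<rho> (\<lambda>x. (f x)\<^sup>2)" by (rule \<rho>.integrable_const_bound[where B="(2 * b)\<^sup>2"]) (use sq in auto)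
    then have "(LINT x|\<rho>. (f x)\<^sup>2) \<le> (2 * b)\<^sup>2" using sq by (intro \<rho>.integral_le_const) auto
    then show "real n * (LINT x|\<rho>. (f x)\<^sup>2) / (real n)\<^sup>2 \<le> (2 * b)\<^sup>2 / real n"
      using n by (simp add: power2_eq_square divide_right_mono)
  qed
  also have "\<dots> = 2 * b / sqrt (real n)" using b0 by (simp add: real_sqrt_divide real_sqrt_mult power_mult_distrib)
  finally show "(LINT x|?P. \<bar>(LINT z|empirical n x. h z) - (LINT z|\<rho>. h z)\<bar>) \<le> 2 * b / sqrt (real n)" by (simp add: eq)
qed

text \<open>Good data are typical: besides \<open>tv\<close>, the empirical variances must be
  close to the true ones.\<close>

lemma empirical_variance_consistent:
  assumes \<rho>: "prob_space \<rho>" "sets \<rho> = sets borel" and h [measurable]: "h \<in> borel_measurable borel" and b: "\<And>x. \<bar>h x\<bar> \<le> b"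
    and n: "0 < n" and \<delta>: "0 < \<delta>"
  shows "measure (PiM {..<n} (\<lambda>_. \<rho>)) {x \<in> space (PiM {..<n} (\<lambda>_. \<rho>)). \<delta> \<le> \<bar>var (empirical n x) h - var \<rho> h\<bar>} \<le> 6 * b\<^sup>2 / (\<delta> * sqrt (real n))"
    and "(\<lambda>x. var (empirical n x) h) \<in> borel_measurable (PiM {..<n} (\<lambda>_. borel))"
proof -
  let ?P = "PiM {..<n} (\<lambda>_. \<rho>)"
  interpret P: prob_space ?P by (rule prob_space_PiM) (rule \<rho>)
  note [measurable_cong] = \<rho>(2)
  have b0: "0 \<le> b" using b abs_ge_zero order_trans by blast
  have sq: "\<bar>(h x)\<^sup>2\<bar> \<le> b\<^sup>2" for x using power_mono[OF b[of x], of 2] by simp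
  have m2: "(\<lambda>x. (h x)\<^sup>2) \<in> borel_measurable borel" by measurable
  let ?d1 = "\<lambda>x. \<bar>(LINT z|empirical n x. h z) - (LINT z|\<rho>. h z)\<bar>" and ?d2 = "\<lambda>x. \<bar>(LINT z|empirical n x. (h z)\<^sup>2) - (LINT z|\<rho>. (h z)\<^sup>2)\<bar>"
  note D1 = empirical_mean_deviation[OF \<rho> h b n] and D2 = empirical_mean_deviation[OF \<rho> m2 sq n]
  have ve: "var (empirical n x) h = (LINT z|empirical n x. (h z)\<^sup>2) - (LINT z|empirical n x. h z)\<^sup>2" for x
    by (rule var_eq[OF prob_space_empirical[OF n] _ b]) (simp cong: measurable_cong_sets)
  have vr: "var \<rho> h = (LINT z|\<rho>. (h z)\<^sup>2) - (LINT z|\<rho>. h z)\<^sup>2"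
    by (rule var_eq[OF \<rho>(1) _ b]) measurable
  have le: "\<bar>var (empirical n x) h - var \<rho> h\<bar> \<le> ?d2 x + 2 * b * ?d1 x" for x
  proof -
    let ?a = "LINT z|empirical n x. h z" and ?c = "LINT z|\<rho>. h z"
    have "\<bar>?a\<bar> \<le> b" by (rule expectation_bdd(2)[OF prob_space_empirical[OF n] sets_empirical h b])
    moreover have "\<bar>?c\<bar> \<le> b" by (rule expectation_bdd(2)[OF \<rho> h b])
    ultimately have "\<bar>?a + ?c\<bar> \<le> 2 * b" by linarith
    then have "\<bar>?a + ?c\<bar> * \<bar>?a - ?c\<bar> \<le> 2 * b * \<bar>?a - ?c\<bar>" by (rule mult_right_mono) simp
    moreover have "?a\<^sup>2 - ?c\<^sup>2 = (?a + ?c) * (?a - ?c)" by (simp add: power2_eq_square algebra_simps)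
    ultimately have "\<bar>?a\<^sup>2 - ?c\<^sup>2\<bar> \<le> 2 * b * \<bar>?a - ?c\<bar>" by (simp add: abs_mult)
    then show ?thesis unfolding ve vr by linarith
  qed
  let ?u = "\<lambda>x. ?d2 x + 2 * b * ?d1 x"
  have iu: "integrable ?P ?u" using D1(2) D2(2) by auto
  have "(LINT x|?P. ?u x) = (LINT x|?P. ?d2 x) + 2 * b * (LINT x|?P. ?d1 x)" using D1(2) D2(2) by simp
  also have "\<dots> \<le> 2 * b\<^sup>2 / sqrt (real n) + 2 * b * (2 * b / sqrt (real n))"
    using D1(1) D2(1) b0 by (intro add_mono mult_left_mono) auto
  also have "\<dots> = 6 * b\<^sup>2 / sqrt (real n)" by (simp add: power2_eq_square add_divide_distrib[symmetric])
  finally have Eu: "(LINT x|?P. ?u x) \<le> 6 * b\<^sup>2 / sqrt (real n)" .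
  show vm: "(\<lambda>x. var (empirical n x) h) \<in> borel_measurable (PiM {..<n} (\<lambda>_. borel))"
    unfolding ve by (simp add: integral_empirical)
  have um: "{x \<in> space ?P. \<delta> \<le> ?u x} \<in> sets ?P" using borel_measurable_integrable[OF iu] by measurable
  have "measure ?P {x \<in> space ?P. \<delta> \<le> \<bar>var (empirical n x) h - var \<rho> h\<bar>} \<le> measure ?P {x \<in> space ?P. \<delta> \<le> ?u x}"
  proof (rule P.finite_measure_mono[OF _ um], rule subsetI)
    fix x assume "x \<in> {x \<in> space ?P. \<delta> \<le> \<bar>var (empirical n x) h - var \<rho> h\<bar>}"
    then show "x \<in> {x \<in> space ?P. \<delta> \<le> ?u x}" using le[of x] unfolding mem_Collect_eq by linarith
  qed
  also have "\<dots> \<le> (LINT x|?P. ?u x) / \<delta>"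
    by (rule integral_Markov_inequality_measure[OF iu _ _ \<delta>, of "space ?P"]) (use b0 in auto)
  also have "\<dots> \<le> 6 * b\<^sup>2 / sqrt (real n) / \<delta>" using Eu \<delta> by (intro divide_right_mono) auto
  finally show "measure ?P {x \<in> space ?P. \<delta> \<le> \<bar>var (empirical n x) h - var \<rho> h\<bar>} \<le> 6 * b\<^sup>2 / (\<delta> * sqrt (real n))"
    by (simp add: mult.commute)
qed

end

locale sampled_functional = smooth_functional + \<Omega>: prob_space \<Omega>
  for \<Omega> :: "'w measure" +
  fixes X Y :: "nat \<Rightarrow> 'w \<Rightarrow> 'a"
  assumes indep: "prob_space.indep_vars \<Omega> (\<lambda>_. borel) (case_sum X Y) UNIV"
    and X_law: "\<And>i. distr \<Omega> borel (X i) = \<mu>" and Y_law: "\<And>i. distr \<Omega> borel (Y i) = \<nu>"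
begin

lemma XY_measurable [measurable]: "X i \<in> measurable \<Omega> borel" "Y i \<in> measurable \<Omega> borel"
proof -
  have "case_sum X Y j \<in> measurable \<Omega> borel" for j using indep by (auto simp: \<Omega>.indep_vars_def)
  from this[of "Inl i"] this[of "Inr i"] show "X i \<in> measurable \<Omega> borel" "Y i \<in> measurable \<Omega> borel" by auto
qed

lemmas samples_measurable = two_samples_measurable[OF XY_measurable]

lemma samples_law:
  assumes "0 < n"
  shows "distr \<Omega> (PiM {..<n} (\<lambda>_. borel) \<Otimes>\<^sub>M PiM {..<n} (\<lambda>_. borel)) (two_samples n X Y) = sample_measure n \<mu> \<nu>"
  unfolding sample_measure_def by (rule \<Omega>.two_samples_law[OF indep X_law Y_law assms])

definition "error n \<omega> = sqrt (real n) * (\<kappa> (empirical n (\<lambda>i. X i \<omega>)) (empirical n (\<lambda>i. Y i \<omega>)) - \<kappa> \<mu> \<nu>)"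

lemma error_statistic: "error n \<omega> = statistic n \<mu> \<nu> (two_samples n X Y \<omega>)"
  by (simp add: error_def statistic_def two_samples_def)

lemma error_measurable: "error n \<in> borel_measurable \<Omega>"
proof (cases "n = 0")
  case True
  then show ?thesis by (simp add: error_def[abs_def])
next
  case False
  then show ?thesis
    unfolding error_statistic[abs_def] using measurable_compose[OF samples_measurable statistic_measurable] by simp
qed

text \<open>The constant triangular array. The sample size \<open>k + 1\<close> avoids the empty
  sample, whose empirical measure is not a probability measure.\<close>

theorem central_limit: "converges_in_distribution \<Omega> error (centered_normal limit_variance)"
  unfolding converges_in_distribution_def
proof (intro conjI allI error_measurable)
  have "weak_conv_m (\<lambda>k. distr (sample_measure (Suc k) \<mu> \<nu>) borel (statistic (Suc k) \<mu> \<nu>)) (centered_normal (var \<mu> g1 + var \<nu> g2))"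
  proof (rule statistic_weak_convergence)
    show "filterlim Suc at_top sequentially" by (rule filterlim_Suc)
    have "tv \<mu> \<mu> = 0" "tv \<nu> \<nu> = 0" by (simp_all add: tv_def)
    then show "sqrt (real (Suc k)) * tv \<mu> \<mu> \<le> 0" "sqrt (real (Suc k)) * tv \<nu> \<nu> \<le> 0" for k by simp_all
  qed (rule concentrated_refl[OF \<mu>] concentrated_refl[OF \<nu>] tendsto_const zero_less_Suc)+
  moreover have "distr (sample_measure (Suc k) \<mu> \<nu>) borel (statistic (Suc k) \<mu> \<nu>) = distr \<Omega> borel (error (Suc k))" for k
    unfolding samples_law[OF zero_less_Suc, symmetric]
    by (subst distr_distr[OF statistic_measurable samples_measurable]) (auto simp: o_def error_statistic[abs_def])
  ultimately have "weak_conv_m (\<lambda>k. distr \<Omega> borel (error (Suc k))) (centered_normal limit_variance)"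
    by (simp add: limit_variance_def)
  then show "weak_conv_m (\<lambda>n. distr \<Omega> borel (error n)) (centered_normal limit_variance)"
    unfolding weak_conv_m_def weak_conv_def by (auto intro: LIMSEQ_imp_Suc)
qed

lemma bootstrap_error_samples:
  "bootstrap_error n (\<lambda>i. X i \<omega>) (\<lambda>i. Y i \<omega>) = bootstrap_error n (fst (two_samples n X Y \<omega>)) (snd (two_samples n X Y \<omega>))"
  by (simp add: bootstrap_error_def bootstrap_cdf2_def two_samples_def)

text \<open>By the deterministic bound, the bootstrap error exceeds \<open>\<epsilon>\<close> only
  for data with a large \<open>tv\<close> distance or a wrong empirical variance, and both have
  small probability.\<close>

theorem bootstrap_consistent:
  assumes v: "0 < limit_variance"
  shows "converges_in_probability \<Omega> (\<lambda>n \<omega>. bootstrap_error n (\<lambda>i. X i \<omega>) (\<lambda>i. Y i \<omega>)) 0"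
  unfolding converges_in_probability_def
proof (intro conjI allI impI)
  fix n
  show "(\<lambda>\<omega>. bootstrap_error n (\<lambda>i. X i \<omega>) (\<lambda>i. Y i \<omega>)) \<in> borel_measurable \<Omega>"
  proof (cases "n = 0")
    case True
    \<comment> \<open>For \<open>n = 0\<close> nothing depends on the data.\<close>
    have "bootstrap_error 0 x y = bootstrap_error 0 (\<lambda>_. 0) (\<lambda>_. 0)" for x y
      using empirical_cong[of 0 x "\<lambda>_. 0"] empirical_cong[of 0 y "\<lambda>_. 0"] by (simp add: bootstrap_error_def bootstrap_cdf2_def)
    then have "(\<lambda>\<omega>. bootstrap_error n (\<lambda>i. X i \<omega>) (\<lambda>i. Y i \<omega>)) = (\<lambda>\<omega>. bootstrap_error 0 (\<lambda>_. 0) (\<lambda>_. 0))"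
      unfolding True by blast
    then show ?thesis by simp
  next
    case False
    then show ?thesis unfolding bootstrap_error_samples
      using measurable_compose[OF samples_measurable bootstrap_error_measurable[OF _ v]] by simp
  qed
next
  fix \<epsilon> :: real assume \<epsilon>: "0 < \<epsilon>"
  show "(\<lambda>n. measure \<Omega> {\<omega> \<in> space \<Omega>. \<epsilon> < \<bar>bootstrap_error n (\<lambda>i. X i \<omega>) (\<lambda>i. Y i \<omega>) - 0\<bar>}) \<longlonglongrightarrow> 0"
  proof (rule tendstoI)
    fix e :: real assume e: "0 < e"
    \<comment> \<open>\<open>C\<close> makes the two events of a large \<open>tv\<close> distance
      cost less than \<open>e / 2\<close> in total.\<close>
    define C where "C = 4 * tv_const s / e + 1"
    have C: "0 < C" unfolding C_def using tv_const_nonneg[of s] e by (simp add: add_nonneg_pos)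
    have Ce: "2 * (tv_const s / C) < e / 2 + e / 4"
    proof -
      have "4 * tv_const s < e * C" using e by (simp add: C_def distrib_left)
      then have "2 * (tv_const s / C) < e / 2" using C by (simp add: field_simps)
      then show ?thesis using e by linarith
    qed
    obtain \<delta> n0 where \<delta>: "0 < \<delta>" and det: "\<And>n x y. n0 \<le> n \<Longrightarrow> 0 < n \<Longrightarrow> (\<And>i. i < n \<Longrightarrow> x i \<in> msupport \<mu>) \<Longrightarrow> (\<And>i. i < n \<Longrightarrow> y i \<in> msupport \<nu>) \<Longrightarrow>
     sqrt (real n) * tv (empirical n x) \<mu> \<le> C \<Longrightarrow> sqrt (real n) * tv (empirical n y) \<nu> \<le> C \<Longrightarrow>
     \<bar>var (empirical n x) g1 - var \<mu> g1\<bar> \<le> \<delta> \<Longrightarrow> \<bar>var (empirical n y) g2 - var \<nu> g2\<bar> \<le> \<delta> \<Longrightarrow> bootstrap_error n x y \<le> \<epsilon>"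
      using bootstrap_error_deterministic[OF \<epsilon> v, of C thesis] by blast
    have "(\<lambda>n. 2 * (6 * B\<^sup>2 / (\<delta> * sqrt (real n)))) \<longlonglongrightarrow> 0" using \<delta> by real_asymp
    from order_tendstoD(2)[OF this, of "e / 4"] e
    have "eventually (\<lambda>n. 2 * (6 * B\<^sup>2 / (\<delta> * sqrt (real n))) < e / 4) sequentially" by simp
    then show "eventually (\<lambda>n. dist (measure \<Omega> {\<omega> \<in> space \<Omega>. \<epsilon> < \<bar>bootstrap_error n (\<lambda>i. X i \<omega>) (\<lambda>i. Y i \<omega>) - 0\<bar>}) 0 < e) sequentially"
      using eventually_ge_at_top[of n0] eventually_gt_at_top[of 0]
    proof eventually_elim
      case (elim n)
      let ?P = "PiM {..<n} (\<lambda>_. \<mu>)" and ?Q = "PiM {..<n} (\<lambda>_. \<nu>)" and ?S = "sample_measure n \<mu> \<nu>"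
      let ?B = "PiM {..<n} (\<lambda>_. borel) \<Otimes>\<^sub>M PiM {..<n} (\<lambda>_. borel) :: ((nat \<Rightarrow> 'a) \<times> (nat \<Rightarrow> 'a)) measure"
      interpret P: prob_space ?P by (rule prob_space_PiM) (rule \<mu>)
      interpret Q: prob_space ?Q by (rule prob_space_PiM) (rule \<nu>)
      interpret S: prob_space ?S by (rule prob_space_sample_measure[OF \<mu>(1) \<nu>(1)])
      have sP: "sets ?P = sets (PiM {..<n} (\<lambda>_. borel))" by (rule sets_PiM_cong) (auto simp: \<mu>)
      have sQ: "sets ?Q = sets (PiM {..<n} (\<lambda>_. borel))" by (rule sets_PiM_cong) (auto simp: \<nu>)
      define E1 where "E1 = {x \<in> space ?P. C < sqrt (real n) * tv (empirical n x) \<mu>}"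
      define E2 where "E2 = {x \<in> space ?Q. C < sqrt (real n) * tv (empirical n x) \<nu>}"
      define V1 where "V1 = {x \<in> space ?P. \<delta> \<le> \<bar>var (empirical n x) g1 - var \<mu> g1\<bar>}"
      define V2 where "V2 = {x \<in> space ?Q. \<delta> \<le> \<bar>var (empirical n x) g2 - var \<nu> g2\<bar>}"
      have [measurable]: "(\<lambda>x. tv (empirical n x) \<mu>) \<in> borel_measurable ?P" "(\<lambda>x. var (empirical n x) g1) \<in> borel_measurable ?P"
        unfolding measurable_cong_sets[OF sP refl]
        by (rule tv_empirical_measurable[OF \<mu>] empirical_variance_consistent(2)[OF \<mu> g_meas(1) g_bdd(1) elim(3) \<delta>])+
      have [measurable]: "(\<lambda>x. tv (empirical n x) \<nu>) \<in> borel_measurable ?Q" "(\<lambda>x. var (empirical n x) g2) \<in> borel_measurable ?Q"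
        unfolding measurable_cong_sets[OF sQ refl]
        by (rule tv_empirical_measurable[OF \<nu>] empirical_variance_consistent(2)[OF \<nu> g_meas(2) g_bdd(2) elim(3) \<delta>])+
      have m: "E1 \<in> sets ?P" "V1 \<in> sets ?P" "E2 \<in> sets ?Q" "V2 \<in> sets ?Q"
        unfolding E1_def E2_def V1_def V2_def by measurable
      have pE: "P.prob E1 \<le> tv_const s / C" "Q.prob E2 \<le> tv_const s / C"
        unfolding E1_def E2_def
        using tv_tail[OF \<mu> concentrated_norm(1)[OF concentrated_refl[OF \<mu>]] elim(3) C] tv_tail[OF \<nu> concentrated_norm(2)[OF concentrated_refl[OF \<nu>]] elim(3) C]
        by auto
      have pV: "P.prob V1 \<le> 6 * B\<^sup>2 / (\<delta> * sqrt (real n))" "Q.prob V2 \<le> 6 * B\<^sup>2 / (\<delta> * sqrt (real n))"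
        unfolding V1_def V2_def
        by (rule empirical_variance_consistent(1)[OF \<mu> g_meas(1) g_bdd(1) elim(3) \<delta>] empirical_variance_consistent(1)[OF \<nu> g_meas(2) g_bdd(2) elim(3) \<delta>])+
      have aeP: "AE x in ?P. \<forall>i\<in>{..<n}. x i \<in> msupport \<mu>"
        using AE_msupport[OF \<mu>(2)] \<mu> by (intro AE_finite_allI AE_PiM_component) auto
      have aeQ: "AE x in ?Q. \<forall>i\<in>{..<n}. x i \<in> msupport \<nu>"
        using AE_msupport[OF \<nu>(2)] \<nu> by (intro AE_finite_allI AE_PiM_component) auto
      have in\<mu>: "AE z in ?S. \<forall>i\<in>{..<n}. fst z i \<in> msupport \<mu>"
        unfolding sample_measure_def by (rule AE_pair_fst[OF Q.sigma_finite_measure_axioms aeP])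
      have in\<nu>: "AE z in ?S. \<forall>i\<in>{..<n}. snd z i \<in> msupport \<nu>"
        unfolding sample_measure_def by (rule AE_pair_snd[OF Q.sigma_finite_measure_axioms aeQ])
      let ?H = "\<lambda>z. bootstrap_error n (fst z) (snd z)"
      have Hm: "?H \<in> borel_measurable ?B" by (rule bootstrap_error_measurable[OF elim(3) v])
      have nn: "0 \<le> ?H z" for z
      proof -
        interpret N: real_distribution "centered_normal limit_variance" by (rule centered_normal_real_distribution[OF limit_variance_nonneg])
        interpret N: finite_borel_measure "centered_normal limit_variance" by (rule N.finite_borel_measure_M)
        let ?M = "distr (sample_measure n (empirical n (fst z)) (empirical n (snd z))) borel (statistic n (empirical n (fst z)) (empirical n (snd z)))"
        interpret M: real_distribution ?M by (rule bootstrap_cdf2_eq(2)[OF elim(3)])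
        interpret M: finite_borel_measure ?M by (rule M.finite_borel_measure_M)
        have "\<bar>bootstrap_cdf2 \<kappa> n (fst z) (snd z) t - cdf (centered_normal limit_variance) t\<bar> \<le> 1" for t
          unfolding bootstrap_cdf2_eq(1)[OF elim(3)] using M.cdf_nonneg[of t] M.cdf_bounded_prob[of t] N.cdf_nonneg[of t] N.cdf_bounded_prob[of t] by linarith
        then have "bdd_above (range (\<lambda>t. \<bar>bootstrap_cdf2 \<kappa> n (fst z) (snd z) t - cdf (centered_normal limit_variance) t\<bar>))" by (auto intro!: bdd_aboveI)
        from cSUP_upper2[OF this, of 0 0] show ?thesis by (simp add: bootstrap_error_def)
      qed
      define bad where "bad = {z \<in> space ?B. \<epsilon> < ?H z}"
      have badm: "bad \<in> sets ?B" unfolding bad_def using Hm by measurable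
      have key: "AE z in ?S. z \<in> bad \<longrightarrow> z \<in> (E1 \<union> V1) \<times> space ?Q \<union> space ?P \<times> (E2 \<union> V2)"
        using in\<mu> in\<nu> AE_space
      proof eventually_elim
        case (elim z)
        have zs: "fst z \<in> space ?P" "snd z \<in> space ?Q" using elim(3) by (auto simp: sample_measure_def space_pair_measure)
        show ?case
        proof (rule impI, rule ccontr)
          assume b: "z \<in> bad" and nE: "z \<notin> (E1 \<union> V1) \<times> space ?Q \<union> space ?P \<times> (E2 \<union> V2)"
          with zs have nE': "fst z \<notin> E1" "fst z \<notin> V1" "snd z \<notin> E2" "snd z \<notin> V2" by (auto simp: mem_Times_iff)
          have "?H z \<le> \<epsilon>"
          proof (rule det[OF \<open>n0 \<le> n\<close> \<open>0 < n\<close>])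
            show "fst z i \<in> msupport \<mu>" "snd z i \<in> msupport \<nu>" if "i < n" for i using elim(1,2) that by auto
          qed (use nE' zs in \<open>auto simp: E1_def E2_def V1_def V2_def not_less not_le less_imp_le\<close>)
          then show False using b by (simp add: bad_def)
        qed
      qed
      have "measure \<Omega> {\<omega> \<in> space \<Omega>. \<epsilon> < \<bar>bootstrap_error n (\<lambda>i. X i \<omega>) (\<lambda>i. Y i \<omega>) - 0\<bar>} = measure \<Omega> (two_samples n X Y -` bad \<inter> space \<Omega>)"
      proof (rule arg_cong[where f="measure \<Omega>"])
        show "{\<omega> \<in> space \<Omega>. \<epsilon> < \<bar>bootstrap_error n (\<lambda>i. X i \<omega>) (\<lambda>i. Y i \<omega>) - 0\<bar>} = two_samples n X Y -` bad \<inter> space \<Omega>"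
          using nn measurable_space[OF samples_measurable[of n]] by (auto simp: bad_def bootstrap_error_samples)
      qed
      also have "\<dots> = measure (distr \<Omega> ?B (two_samples n X Y)) bad"
        by (rule measure_distr[symmetric, OF samples_measurable badm])
      also have "\<dots> = S.prob bad" by (simp only: samples_law[OF elim(3)])
      also have "\<dots> \<le> S.prob ((E1 \<union> V1) \<times> space ?Q \<union> space ?P \<times> (E2 \<union> V2))"
        using key m by (intro S.finite_measure_mono_AE) (auto simp: sample_measure_def)
      also have "\<dots> \<le> S.prob ((E1 \<union> V1) \<times> space ?Q) + S.prob (space ?P \<times> (E2 \<union> V2))"
        using m by (intro measure_Un_le) (auto simp: sample_measure_def)
      also have "S.prob ((E1 \<union> V1) \<times> space ?Q) = P.prob (E1 \<union> V1)"
        using m unfolding sample_measure_def by (simp add: measure_def Q.emeasure_pair_measure_Times Q.emeasure_space_1)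
      also have "S.prob (space ?P \<times> (E2 \<union> V2)) = Q.prob (E2 \<union> V2)"
        using m unfolding sample_measure_def by (simp add: measure_def Q.emeasure_pair_measure_Times P.emeasure_space_1)
      also have "P.prob (E1 \<union> V1) + Q.prob (E2 \<union> V2) \<le> (P.prob E1 + P.prob V1) + (Q.prob E2 + Q.prob V2)"
        using m by (intro add_mono measure_Un_le) auto
      also have "\<dots> < e" using pE pV Ce elim(1) by linarith
      finally show ?case by simp
    qed
  qed
qed

end

section \<open>Semiparametric efficiency bounds\<close>

lemma L2_bounded_mult:
  assumes "prob_space M" and f: "f \<in> L2_functions M" and [measurable]: "G \<in> borel_measurable M" and b: "\<And>x. \<bar>G x\<bar> \<le> b"
  shows "integrable M f" "integrable M (\<lambda>x. G x * f x)" "\<bar>LINT x|M. G x * f x\<bar> \<le> b * L2_norm M f"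
proof -
  interpret prob_space M by fact
  have [measurable]: "f \<in> borel_measurable M" and i2: "integrable M (\<lambda>x. (f x)\<^sup>2)" using f by (auto simp: L2_functions_def)
  show i: "integrable M f" by (rule square_integrable_imp_integrable[OF _ i2]) simp
  have b0: "0 \<le> b" using b abs_ge_zero order_trans by blast
  have le: "\<bar>G x * f x\<bar> \<le> b * \<bar>f x\<bar>" for x using b[of x] by (simp add: abs_mult mult_right_mono)
  show iG: "integrable M (\<lambda>x. G x * f x)"
    by (rule Bochner_Integration.integrable_bound[where f="\<lambda>x. b * \<bar>f x\<bar>"]) (use i le b0 in auto)
  have i2': "integrable M (\<lambda>x. \<bar>f x\<bar>\<^sup>2)" using i2 by simp
  have "0 \<le> variance (\<lambda>x. \<bar>f x\<bar>)" by (rule variance_positive)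
  also have "\<dots> = expectation (\<lambda>x. \<bar>f x\<bar>\<^sup>2) - (expectation (\<lambda>x. \<bar>f x\<bar>))\<^sup>2"
    by (rule variance_eq[OF _ i2']) (use i in auto)
  finally have "(expectation (\<lambda>x. \<bar>f x\<bar>))\<^sup>2 \<le> expectation (\<lambda>x. (f x)\<^sup>2)" by simp
  then have "expectation (\<lambda>x. \<bar>f x\<bar>) \<le> L2_norm M f" unfolding L2_norm_def by (rule real_le_rsqrt)
  then have *: "b * expectation (\<lambda>x. \<bar>f x\<bar>) \<le> b * L2_norm M f" using b0 by (rule mult_left_mono)
  have "\<bar>LINT x|M. G x * f x\<bar> \<le> (LINT x|M. \<bar>G x * f x\<bar>)" by (rule integral_abs_bound)
  also have "\<dots> \<le> (LINT x|M. b * \<bar>f x\<bar>)" using iG i le by (intro integral_mono) auto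
  also have "\<dots> \<le> b * L2_norm M f" using * by simp
  finally show "\<bar>LINT x|M. G x * f x\<bar> \<le> b * L2_norm M f" .
qed

lemma bounded_in_L2:
  assumes "prob_space M" "f \<in> borel_measurable M" "\<And>x. \<bar>f x\<bar> \<le> (b::real)"
  shows "f \<in> L2_functions M"
proof -
  interpret prob_space M by fact
  have "(f x)\<^sup>2 \<le> b\<^sup>2" for x using power_mono[OF assms(3)[of x], of 2] by simp
  then have "integrable M (\<lambda>x. (f x)\<^sup>2)" by (intro integrable_const_bound[where B="b\<^sup>2"]) (use assms in auto)
  then show ?thesis using assms by (simp add: L2_functions_def)
qed

lemma L2_continuous_linear_representer:
  assumes M: "prob_space M" and G: "G \<in> borel_measurable M" "\<And>x. \<bar>G x\<bar> \<le> b"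
  shows "L2_continuous_linear M (\<lambda>f. LINT x|M. G x * f x)"
  unfolding L2_continuous_linear_def
proof (intro conjI ballI allI exI)
  fix f g assume "f \<in> L2_functions M" "g \<in> L2_functions M"
  then show "(LINT x|M. G x * (f x + g x)) = (LINT x|M. G x * f x) + (LINT x|M. G x * g x)"
    using L2_bounded_mult(2)[OF M _ G] by (simp add: distrib_left)
next
  fix c :: real and f assume "f \<in> L2_functions M"
  show "(LINT x|M. G x * (c * f x)) = c * (LINT x|M. G x * f x)"
    by (simp add: mult.left_commute)
next
  fix f assume "f \<in> L2_functions M"
  then show "\<bar>LINT x|M. G x * f x\<bar> \<le> b * L2_norm M f" by (rule L2_bounded_mult(3)[OF M _ G])
qed

text \<open>Cauchy--Schwarz, with equality at the representing function, which lies in the tangent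
  space. If the representer vanishes in \<open>L\<^sup>2\<close> every quotient is
  \<open>0\<close>, so the degenerate cases agree.\<close>

lemma sup_quotient_representer:
  assumes M: "prob_space M" and G: "G \<in> borel_measurable M" "\<And>x. \<bar>G x\<bar> \<le> b" "G \<in> H"
    and H: "\<And>h. h \<in> H \<Longrightarrow> h \<in> L2_functions M"
  shows "sup_quotient M (\<lambda>f. LINT x|M. G x * f x) H = (LINT x|M. (G x)\<^sup>2)"
proof -
  interpret prob_space M by fact
  define D where "D f = (LINT x|M. G x * f x)" for f
  define V where "V = (LINT x|M. (G x)\<^sup>2)"
  define H' where "H' = {h \<in> H. L2_norm M h \<noteq> 0}"
  have V0: "0 \<le> V" by (simp add: V_def Bochner_Integration.integral_nonneg)
  have norm2: "(L2_norm M h)\<^sup>2 = (LINT x|M. (h x)\<^sup>2)" for h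
    by (simp add: L2_norm_def Bochner_Integration.integral_nonneg)
  have iG: "integrable M (\<lambda>x. (G x)\<^sup>2)" using bounded_in_L2[OF M G(1,2)] by (simp add: L2_functions_def)
  have cs: "(D h)\<^sup>2 / (L2_norm M h)\<^sup>2 \<le> V" if h: "h \<in> H'" for h
  proof -
    have hL: "h \<in> L2_functions M" using h H by (simp add: H'_def)
    then have ih: "integrable M (\<lambda>x. (h x)\<^sup>2)" by (simp add: L2_functions_def)
    note iGh = L2_bounded_mult(2)[OF M hL G(1,2)]
    define a where "a = (LINT x|M. (h x)\<^sup>2)"
    have "(L2_norm M h)\<^sup>2 \<noteq> 0" using h by (simp add: H'_def)
    then have a: "0 < a" unfolding norm2 a_def[symmetric] using Bochner_Integration.integral_nonneg[of M "\<lambda>x. (h x)\<^sup>2"]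
      by (simp add: a_def less_le)
    have "0 \<le> (LINT x|M. (a * G x - D h * h x)\<^sup>2)" by (simp add: Bochner_Integration.integral_nonneg)
    also have "\<dots> = (LINT x|M. a\<^sup>2 * (G x)\<^sup>2 - 2 * a * D h * (G x * h x) + (D h)\<^sup>2 * (h x)\<^sup>2)"
      by (intro Bochner_Integration.integral_cong refl) (simp add: power2_eq_square algebra_simps)
    also have "\<dots> = a\<^sup>2 * V - 2 * a * D h * D h + (D h)\<^sup>2 * a"
      using iG ih iGh by (simp add: V_def a_def D_def)
    also have "\<dots> = a * (a * V - (D h)\<^sup>2)" by (simp add: power2_eq_square algebra_simps)
    finally have "0 \<le> a * V - (D h)\<^sup>2" using a by (simp add: zero_le_mult_iff)
    then show ?thesis unfolding norm2 a_def[symmetric] using a by (simp add: divide_le_eq mult.commute)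
  qed
  have DG: "D G = V" by (simp add: D_def V_def power2_eq_square)
  show ?thesis
  proof (cases "H' = {}")
    case True
    then have "L2_norm M G = 0" using G(3) by (auto simp: H'_def)
    then have "V = 0" using norm2[of G] by (simp add: V_def)
    then show ?thesis using True by (simp add: sup_quotient_def H'_def V_def Let_def)
  next
    case False
    have "(SUP h\<in>H'. (D h)\<^sup>2 / (L2_norm M h)\<^sup>2) = V"
    proof (rule antisym)
      show "(SUP h\<in>H'. (D h)\<^sup>2 / (L2_norm M h)\<^sup>2) \<le> V" using False cs by (intro cSUP_least)
      have bdd: "bdd_above ((\<lambda>h. (D h)\<^sup>2 / (L2_norm M h)\<^sup>2) ` H')" using cs by (auto intro!: bdd_aboveI)
      obtain h where h: "h \<in> H'" "V \<le> (D h)\<^sup>2 / (L2_norm M h)\<^sup>2"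
      proof (cases "V = 0")
        case True
        then show ?thesis using False that by (metis divide_nonneg_nonneg ex_in_conv zero_le_power2)
      next
        case nz: False
        then have "G \<in> H'" using G(3) norm2[of G] by (auto simp: H'_def V_def)
        then show ?thesis using nz by (intro that[of G]) (simp_all add: norm2 DG flip: V_def, simp add: power2_eq_square)
      qed
      then show "V \<le> (SUP h\<in>H'. (D h)\<^sup>2 / (L2_norm M h)\<^sup>2)" using bdd by (intro cSUP_upper2)
    qed
    then show ?thesis using False unfolding sup_quotient_def Let_def H'_def[symmetric] D_def V_def by simp
  qed
qed

lemma tangent_setD:
  assumes "h \<in> tangent_set \<mu>"
  obtains b where "0 < b" "\<And>x. \<bar>h x\<bar> \<le> b" "h \<in> borel_measurable borel" "(LINT x|\<mu>. h x) = 0"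
proof -
  obtain b where b: "0 < b" "\<And>x. norm (h x) \<le> b"
    using assms by (auto simp: tangent_set_def bounded_pos)
  then show ?thesis using assms that[of b] by (auto simp: tangent_set_def)
qed

lemma tilt_zero: "tilt M (\<lambda>_. 0) t = M"
  by (simp add: tilt_def density_1)

context smoothing begin

context
  fixes \<mu> :: "'a measure" and h :: "'a \<Rightarrow> real" and b t :: real
  assumes \<mu>: "prob_space \<mu>" and \<mu>s [measurable_cong]: "sets \<mu> = sets borel"
    and h: "\<And>x. \<bar>h x\<bar> \<le> b" and hm [measurable]: "h \<in> borel_measurable borel" and mean: "(LINT x|\<mu>. h x) = 0"
    and t: "0 \<le> t" "t * b \<le> 1"
begin

interpretation prob_space \<mu> by (rule \<mu>)

lemma tilt_density_nonneg: "0 \<le> 1 + t * h x"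
proof -
  have "t * \<bar>h x\<bar> \<le> t * b" using t(1) h by (intro mult_left_mono)
  then have "\<bar>t * h x\<bar> \<le> 1" using t by (simp add: abs_mult)
  then show ?thesis by linarith
qed

lemma tilt_integral:
  fixes f :: "'a \<Rightarrow> real"
  assumes [measurable]: "f \<in> borel_measurable borel" and f: "\<And>x. \<bar>f x\<bar> \<le> c"
  shows "(LINT x|tilt \<mu> h t. f x) = (LINT x|\<mu>. f x) + t * (LINT x|\<mu>. f x * h x)"
proof -
  have i: "integrable \<mu> f" by (rule integrable_const_bound[where B=c]) (use f in auto)
  have ih: "integrable \<mu> (\<lambda>x. f x * h x)"
    by (rule L2_bounded_mult(2)[OF \<mu> bounded_in_L2[OF \<mu> _ h] _ f]) measurable
  have "(LINT x|tilt \<mu> h t. f x) = (LINT x|\<mu>. (1 + t * h x) * f x)"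
    unfolding tilt_def using tilt_density_nonneg by (subst integral_density) auto
  also have "\<dots> = (LINT x|\<mu>. f x + t * (f x * h x))" by (simp add: algebra_simps)
  also have "\<dots> = (LINT x|\<mu>. f x) + t * (LINT x|\<mu>. f x * h x)" using i ih by simp
  finally show ?thesis .
qed

lemma concentrated_tilt: "concentrated (tilt \<mu> h t) \<mu>"
  unfolding concentrated_def
proof (intro conjI)
  have ih: "integrable \<mu> h" by (rule integrable_const_bound[where B=b]) (use h in auto)
  have "emeasure (tilt \<mu> h t) (space (tilt \<mu> h t)) = (\<integral>\<^sup>+ x. ennreal (1 + t * h x) \<partial>\<mu>)"
    unfolding tilt_def by (simp add: emeasure_density cong: nn_integral_cong)
  also have "\<dots> = ennreal (LINT x|\<mu>. 1 + t * h x)"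
    using ih tilt_density_nonneg by (intro nn_integral_eq_integral) auto
  also have "(LINT x|\<mu>. 1 + t * h x) = 1" using ih mean by (simp add: prob_space)
  finally show "prob_space (tilt \<mu> h t)" by (intro prob_spaceI) simp
  show "sets (tilt \<mu> h t) = sets borel" by (simp add: tilt_def \<mu>s)
  show "AE x in tilt \<mu> h t. x \<in> msupport \<mu>"
    unfolding tilt_def using AE_msupport[OF \<mu>s] by (subst AE_density) (auto elim: eventually_mono)
qed

lemma tv_tilt: "tv (tilt \<mu> h t) \<mu> \<le> t * b"
proof -
  have km: "(\<lambda>x. k (y - x)) \<in> borel_measurable borel" for y by measurable
  have kb: "\<bar>k (y - x)\<bar> \<le> M" for x y using k_nonneg k_le by (simp add: abs_of_nonneg)
  have d: "\<bar>dens (tilt \<mu> h t) y - dens \<mu> y\<bar> \<le> t * b * dens \<mu> y" for y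
  proof -
    have i1: "integrable \<mu> (\<lambda>x. k (y - x) * h x)"
      by (rule L2_bounded_mult(2)[OF \<mu> bounded_in_L2[OF \<mu> _ h] _ kb]) measurable
    have "dens (tilt \<mu> h t) y - dens \<mu> y = t * (LINT x|\<mu>. k (y - x) * h x)"
      unfolding dens_def tilt_integral[OF km kb] by simp
    then have "\<bar>dens (tilt \<mu> h t) y - dens \<mu> y\<bar> = t * \<bar>LINT x|\<mu>. k (y - x) * h x\<bar>" using t by (simp add: abs_mult)
    also have "\<bar>LINT x|\<mu>. k (y - x) * h x\<bar> \<le> (LINT x|\<mu>. \<bar>k (y - x) * h x\<bar>)" by (rule integral_abs_bound)
    also have "\<dots> \<le> (LINT x|\<mu>. b * k (y - x))"
    proof (rule integral_mono)
      show "\<bar>k (y - x) * h x\<bar> \<le> b * k (y - x)" for x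
        using mult_left_mono[OF h[of x] k_nonneg[of "y - x"]] k_nonneg[of "y - x"] by (simp add: abs_mult mult.commute)
    qed (use i1 dens_bounds(3)[OF \<mu> \<mu>s] in auto)
    also have "\<dots> = b * dens \<mu> y" by (simp add: dens_def)
    finally show ?thesis using t by (simp add: mult_left_mono mult.assoc)
  qed
  have p: "prob_space (tilt \<mu> h t)" "sets (tilt \<mu> h t) = sets borel" using concentrated_tilt by (auto simp: concentrated_def)
  have one: "(LINT y|lborel. dens \<mu> y) = 1"
  proof -
    have "adj (\<lambda>_. 1) x = 1" for x using shifted_kernel(2)[of "\<lambda>_. 1" 1 x] by (simp add: adj_def)
    then show ?thesis using dens_integral(1)[OF \<mu> \<mu>s, of "\<lambda>_. 1" 1] by (simp add: prob_space)
  qed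
  have "tv (tilt \<mu> h t) \<mu> \<le> (LINT y|lborel. t * b * dens \<mu> y)"
    unfolding tv_def using d dens_integrable[OF p] dens_integrable[OF \<mu> \<mu>s] by (intro integral_mono) auto
  also have "\<dots> = t * b" using one by simp
  finally show ?thesis .
qed

end

end

context smooth_functional begin

text \<open>A tilt by \<open>h\<close> is within \<open>t sup \<bar>h\<bar>\<close> of the
  original measure and is carried by the same support, so differentiability applies; integrals are
  affine in \<open>t\<close>. For small \<open>t\<close> the tilted density is
  nonnegative.\<close>

lemma directional_derivative:
  assumes h: "h \<in> tangent_set \<mu>" and l: "l \<in> tangent_set \<nu>"
  shows "((\<lambda>t. (\<kappa> (tilt \<mu> h t) (tilt \<nu> l t) - \<kappa> \<mu> \<nu>) / t) \<longlongrightarrow> (LINT x|\<mu>. g1 x * h x) + (LINT x|\<nu>. g2 x * l x)) (at_right 0)"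
proof (rule tendstoI)
  fix e :: real assume e: "0 < e"
  obtain b1 where b1: "0 < b1" "\<And>x. \<bar>h x\<bar> \<le> b1" "h \<in> borel_measurable borel" "(LINT x|\<mu>. h x) = 0" by (rule tangent_setD[OF h]) blast
  obtain b2 where b2: "0 < b2" "\<And>x. \<bar>l x\<bar> \<le> b2" "l \<in> borel_measurable borel" "(LINT x|\<nu>. l x) = 0" by (rule tangent_setD[OF l]) blast
  define b where "b = max b1 b2"
  have b: "0 < b" "\<And>x. \<bar>h x\<bar> \<le> b" "\<And>x. \<bar>l x\<bar> \<le> b" using b1(1,2) b2(1,2) by (auto simp: b_def intro: le_max_iff_disj[THEN iffD2])
  define \<epsilon> where "\<epsilon> = e / (4 * b)"
  have \<epsilon>: "0 < \<epsilon>" using e b by (simp add: \<epsilon>_def)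
  obtain \<delta> where \<delta>: "0 < \<delta>" and D: "\<And>\<rho> \<tau>. concentrated \<rho> \<mu> \<Longrightarrow> concentrated \<tau> \<nu> \<Longrightarrow> tv \<rho> \<mu> \<le> \<delta> \<Longrightarrow> tv \<tau> \<nu> \<le> \<delta> \<Longrightarrow>
      \<bar>\<kappa> \<rho> \<tau> - \<kappa> \<mu> \<nu> - ((LINT x|\<rho>. g1 x) - (LINT x|\<mu>. g1 x)) - ((LINT x|\<tau>. g2 x) - (LINT x|\<nu>. g2 x))\<bar> \<le> \<epsilon> * (tv \<rho> \<mu> + tv \<tau> \<nu>)"
    using differentiable[OF \<epsilon>] by blast
  have "eventually (\<lambda>t. t < min 1 \<delta> / b) (at_right 0)"
    using b \<delta> by (intro eventually_at_right_less order_tendstoD(2)[OF tendsto_ident_at]) auto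
  then show "eventually (\<lambda>t. dist ((\<kappa> (tilt \<mu> h t) (tilt \<nu> l t) - \<kappa> \<mu> \<nu>) / t) ((LINT x|\<mu>. g1 x * h x) + (LINT x|\<nu>. g2 x * l x)) < e) (at_right 0)"
    using eventually_at_right_less[of 0]
  proof eventually_elim
    case (elim t)
    have tb: "t * b < min 1 \<delta>" using elim b by (simp add: less_divide_eq)
    then have t: "0 \<le> t" "t * b \<le> 1" using elim by auto
    note c = concentrated_tilt[OF \<mu> b(2) b1(3,4) t] concentrated_tilt[OF \<nu> b(3) b2(3,4) t]
    note v = tv_tilt[OF \<mu> b(2) b1(3,4) t] tv_tilt[OF \<nu> b(3) b2(3,4) t]
    have "tv (tilt \<mu> h t) \<mu> \<le> \<delta>" "tv (tilt \<nu> l t) \<nu> \<le> \<delta>" using v tb by auto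
    note D' = D[OF c this]
    have "\<bar>\<kappa> (tilt \<mu> h t) (tilt \<nu> l t) - \<kappa> \<mu> \<nu> - t * (LINT x|\<mu>. g1 x * h x) - t * (LINT x|\<nu>. g2 x * l x)\<bar> \<le> \<epsilon> * (tv (tilt \<mu> h t) \<mu> + tv (tilt \<nu> l t) \<nu>)"
      using D' unfolding tilt_integral[OF \<mu> b(2) b1(3,4) t g_meas(1) g_bdd(1)] tilt_integral[OF \<nu> b(3) b2(3,4) t g_meas(2) g_bdd(2)] by simp
    also have "\<dots> \<le> \<epsilon> * (t * b + t * b)" using v \<epsilon> by (intro mult_left_mono add_mono) auto
    also have "\<dots> = t * (e / 2)" using b by (simp add: \<epsilon>_def)
    finally have *: "\<bar>\<kappa> (tilt \<mu> h t) (tilt \<nu> l t) - \<kappa> \<mu> \<nu> - t * (LINT x|\<mu>. g1 x * h x) - t * (LINT x|\<nu>. g2 x * l x)\<bar> \<le> t * (e / 2)" .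
    have "(\<kappa> (tilt \<mu> h t) (tilt \<nu> l t) - \<kappa> \<mu> \<nu>) / t - ((LINT x|\<mu>. g1 x * h x) + (LINT x|\<nu>. g2 x * l x)) =
       (\<kappa> (tilt \<mu> h t) (tilt \<nu> l t) - \<kappa> \<mu> \<nu> - t * (LINT x|\<mu>. g1 x * h x) - t * (LINT x|\<nu>. g2 x * l x)) / t"
      using elim by (simp add: field_simps)
    then have "\<bar>(\<kappa> (tilt \<mu> h t) (tilt \<nu> l t) - \<kappa> \<mu> \<nu>) / t - ((LINT x|\<mu>. g1 x * h x) + (LINT x|\<nu>. g2 x * l x))\<bar> \<le> t * (e / 2) / t"
      using divide_right_mono[OF *, of t] elim by (simp add: abs_divide del: times_divide_eq_right)
    also have "\<dots> < e" using elim e by simp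
    finally show ?case by (simp add: dist_real_def)
  qed
qed

definition "centered1 x = g1 x - (LINT z|\<mu>. g1 z)"
definition "centered2 x = g2 x - (LINT z|\<nu>. g2 z)"

lemma centered_tangent: "centered1 \<in> tangent_set \<mu>" "centered2 \<in> tangent_set \<nu>"
  and centered_bdd: "\<bar>centered1 x\<bar> \<le> 2 * B" "\<bar>centered2 x\<bar> \<le> 2 * B"
  and centered_square: "(LINT x|\<mu>. (centered1 x)\<^sup>2) = var \<mu> g1" "(LINT x|\<nu>. (centered2 x)\<^sup>2) = var \<nu> g2"
proof -
  interpret m: prob_space \<mu> by (rule \<mu>)
  interpret n: prob_space \<nu> by (rule \<nu>)
  note e1 = expectation_bdd[OF \<mu> g_meas(1) g_bdd(1)] and e2 = expectation_bdd[OF \<nu> g_meas(2) g_bdd(2)]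
  show b: "\<bar>centered1 x\<bar> \<le> 2 * B" "\<bar>centered2 x\<bar> \<le> 2 * B" for x
    using g_bdd(1)[of x] g_bdd(2)[of x] e1(2) e2(2) unfolding centered1_def centered2_def abs_le_iff by linarith+
  then have "bounded (range centered1)" "bounded (range centered2)" by (auto intro!: boundedI)
  moreover have "centered1 \<in> borel_measurable borel" "centered2 \<in> borel_measurable borel"
    unfolding centered1_def[abs_def] centered2_def[abs_def] by measurable
  moreover have "(LINT x|\<mu>. centered1 x) = 0" "(LINT x|\<nu>. centered2 x) = 0"
    using e1(1) e2(1) by (simp_all add: centered1_def centered2_def m.prob_space n.prob_space)
  ultimately show "centered1 \<in> tangent_set \<mu>" "centered2 \<in> tangent_set \<nu>" by (auto simp: tangent_set_def)
  show "(LINT x|\<mu>. (centered1 x)\<^sup>2) = var \<mu> g1" "(LINT x|\<nu>. (centered2 x)\<^sup>2) = var \<nu> g2"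
    by (simp_all add: centered1_def centered2_def var_def)
qed

lemma centered_mult:
  "h \<in> tangent_set \<mu> \<Longrightarrow> (LINT x|\<mu>. centered1 x * h x) = (LINT x|\<mu>. g1 x * h x)"
  "l \<in> tangent_set \<nu> \<Longrightarrow> (LINT x|\<nu>. centered2 x * l x) = (LINT x|\<nu>. g2 x * l x)"
proof -
  have gen: "(LINT x|\<rho>. (g x - c) * h x) = (LINT x|\<rho>. g x * h x)"
    if \<rho>: "prob_space \<rho>" "sets \<rho> = sets borel" and h: "h \<in> tangent_set \<rho>" and g: "g \<in> borel_measurable borel" "\<And>x. \<bar>g x\<bar> \<le> B"
    for \<rho> :: "'a measure" and g h c
  proof -
    obtain b where b: "\<And>x. \<bar>h x\<bar> \<le> b" "h \<in> borel_measurable borel" "(LINT x|\<rho>. h x) = 0" by (rule tangent_setD[OF h]) blast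
    have m: "h \<in> borel_measurable \<rho>" "g \<in> borel_measurable \<rho>" using b(2) g(1) by (simp_all cong: measurable_cong_sets add: \<rho>(2))
    note i = L2_bounded_mult(1,2)[OF \<rho>(1) bounded_in_L2[OF \<rho>(1) m(1) b(1)] m(2) g(2)]
    have "(LINT x|\<rho>. (g x - c) * h x) = (LINT x|\<rho>. g x * h x - c * h x)" by (simp add: left_diff_distrib)
    also have "\<dots> = (LINT x|\<rho>. g x * h x) - c * (LINT x|\<rho>. h x)" using i by simp
    finally show ?thesis by (simp add: b(3))
  qed
  show "h \<in> tangent_set \<mu> \<Longrightarrow> (LINT x|\<mu>. centered1 x * h x) = (LINT x|\<mu>. g1 x * h x)"
    unfolding centered1_def by (rule gen[OF \<mu> _ g_meas(1) g_bdd(1)])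
  show "l \<in> tangent_set \<nu> \<Longrightarrow> (LINT x|\<nu>. centered2 x * l x) = (LINT x|\<nu>. g2 x * l x)"
    unfolding centered2_def by (rule gen[OF \<nu> _ g_meas(2) g_bdd(2)])
qed

lemma tangent_L2:
  assumes "prob_space \<rho>" "sets \<rho> = sets borel" "h \<in> tangent_set \<rho>" shows "h \<in> L2_functions \<rho>"
proof -
  obtain b where b: "\<And>x. \<bar>h x\<bar> \<le> b" "h \<in> borel_measurable borel" by (rule tangent_setD[OF assms(3)]) blast
  then show ?thesis using assms(2) by (intro bounded_in_L2[OF assms(1) _ b(1)]) (simp cong: measurable_cong_sets)
qed

lemma zero_tangent: "(\<lambda>_. 0) \<in> tangent_set \<rho>" by (auto simp: tangent_set_def intro: bounded_subset[of "{0}"])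

text \<open>Keeping \<open>\<nu>\<close> fixed is tilting it by the zero function. The representer
  has to be centred in order to lie in the tangent space; tangent functions have mean zero, so
  centring does not change the derivative.\<close>

theorem efficiency_one_sample: "efficiency_bound (\<lambda>\<rho>. \<kappa> \<rho> \<nu>) \<mu> (var \<mu> g1)"
  unfolding efficiency_bound_def
proof (intro exI conjI ballI)
  have m: "centered1 \<in> borel_measurable \<mu>" using centered_tangent(1) \<mu>(2) by (simp add: tangent_set_def cong: measurable_cong_sets)
  show "L2_continuous_linear \<mu> (\<lambda>f. LINT x|\<mu>. centered1 x * f x)"
    by (rule L2_continuous_linear_representer[OF \<mu>(1) m centered_bdd(1)])
  show "var \<mu> g1 = sup_quotient \<mu> (\<lambda>f. LINT x|\<mu>. centered1 x * f x) (tangent_set \<mu>)"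
    using sup_quotient_representer[OF \<mu>(1) m centered_bdd(1) centered_tangent(1) tangent_L2[OF \<mu>]] centered_square by simp
  fix h assume h: "h \<in> tangent_set \<mu>"
  show "((\<lambda>t. (\<kappa> (tilt \<mu> h t) \<nu> - \<kappa> \<mu> \<nu>) / t) \<longlongrightarrow> (LINT x|\<mu>. centered1 x * h x)) (at_right 0)"
    using directional_derivative[OF h zero_tangent] by (simp add: tilt_zero centered_mult(1)[OF h])
qed

lemma integral_osum_mult:
  assumes h: "h \<in> tangent_set \<mu>" and l: "l \<in> tangent_set \<nu>"
  shows "(LINT z|(\<mu> \<Otimes>\<^sub>M \<nu>). (centered1 \<oplus>\<^sub>o centered2) z * (h \<oplus>\<^sub>o l) z) = (LINT x|\<mu>. centered1 x * h x) + (LINT x|\<nu>. centered2 x * l x)"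
proof -
  interpret m: prob_space \<mu> by (rule \<mu>)
  interpret n: prob_space \<nu> by (rule \<nu>)
  interpret mn: pair_prob_space \<mu> \<nu> ..
  note [measurable_cong] = \<mu>(2) \<nu>(2)
  obtain b1 where b1: "\<And>x. \<bar>h x\<bar> \<le> b1" "h \<in> borel_measurable borel" "(LINT x|\<mu>. h x) = 0" by (rule tangent_setD[OF h]) blast
  obtain b2 where b2: "\<And>x. \<bar>l x\<bar> \<le> b2" "l \<in> borel_measurable borel" "(LINT x|\<nu>. l x) = 0" by (rule tangent_setD[OF l]) blast
  have cm: "centered1 \<in> borel_measurable borel" "centered2 \<in> borel_measurable borel" and c0: "(LINT x|\<mu>. centered1 x) = 0" "(LINT x|\<nu>. centered2 x) = 0"
    using centered_tangent by (auto simp: tangent_set_def)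
  have prod: "(LINT z|(\<mu> \<Otimes>\<^sub>M \<nu>). f (fst z) * g (snd z)) = (LINT x|\<mu>. f x) * (LINT y|\<nu>. g y) \<and> integrable (\<mu> \<Otimes>\<^sub>M \<nu>) (\<lambda>z. f (fst z) * g (snd z))"
    if [measurable]: "f \<in> borel_measurable borel" "g \<in> borel_measurable borel" and bb: "\<And>x. \<bar>f x\<bar> \<le> (c::real)" "\<And>x. \<bar>g x\<bar> \<le> (d::real)" for f g c d
  proof -
    have "0 \<le> c" using bb(1) abs_ge_zero order_trans by blast
    then have "integrable (\<mu> \<Otimes>\<^sub>M \<nu>) (\<lambda>z. f (fst z) * g (snd z))"
      using bb by (intro mn.P.integrable_const_bound[where B="c * d"]) (auto simp: abs_mult intro!: mult_mono AE_I2)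
    from mn.integral_fst'[OF this] this show ?thesis by simp
  qed
  have prodb: "\<bar>f x * g x\<bar> \<le> c * d" if "\<And>x. \<bar>f x\<bar> \<le> (c::real)" "\<And>x. \<bar>g x\<bar> \<le> (d::real)" for f g :: "'a \<Rightarrow> real" and c d x
  proof -
    have "0 \<le> c" using that(1) abs_ge_zero order_trans by blast
    then show ?thesis using that by (auto simp: abs_mult intro!: mult_mono)
  qed
  note p1 = prod[of "\<lambda>x. centered1 x * h x" "\<lambda>_. 1" "2 * B * b1" 1] and p2 = prod[of centered1 l "2 * B" b2]
    and p3 = prod[of h centered2 b1 "2 * B"] and p4 = prod[of "\<lambda>_. 1" "\<lambda>x. centered2 x * l x" 1 "2 * B * b2"]
  have P1: "(LINT z|(\<mu> \<Otimes>\<^sub>M \<nu>). centered1 (fst z) * h (fst z)) = (LINT x|\<mu>. centered1 x * h x) \<and> integrable (\<mu> \<Otimes>\<^sub>M \<nu>) (\<lambda>z. centered1 (fst z) * h (fst z))"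
    using p1 cm b1 prodb[of centered1 "2 * B" h b1] centered_bdd by (simp add: n.prob_space)
  have P2: "(LINT z|(\<mu> \<Otimes>\<^sub>M \<nu>). centered1 (fst z) * l (snd z)) = 0 \<and> integrable (\<mu> \<Otimes>\<^sub>M \<nu>) (\<lambda>z. centered1 (fst z) * l (snd z))"
    using p2 cm b2 c0 centered_bdd by simp
  have P3: "(LINT z|(\<mu> \<Otimes>\<^sub>M \<nu>). h (fst z) * centered2 (snd z)) = 0 \<and> integrable (\<mu> \<Otimes>\<^sub>M \<nu>) (\<lambda>z. h (fst z) * centered2 (snd z))"
    using p3 cm b1 c0 centered_bdd by simp
  have P4: "(LINT z|(\<mu> \<Otimes>\<^sub>M \<nu>). centered2 (snd z) * l (snd z)) = (LINT x|\<nu>. centered2 x * l x) \<and> integrable (\<mu> \<Otimes>\<^sub>M \<nu>) (\<lambda>z. centered2 (snd z) * l (snd z))"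
    using p4 cm b2 prodb[of centered2 "2 * B" l b2] centered_bdd by (simp add: m.prob_space)
  have "(centered1 \<oplus>\<^sub>o centered2) z * (h \<oplus>\<^sub>o l) z = centered1 (fst z) * h (fst z) + centered1 (fst z) * l (snd z) + h (fst z) * centered2 (snd z) + centered2 (snd z) * l (snd z)" for z
    by (simp add: osum_def split_beta' algebra_simps)
  then show ?thesis using P1 P2 P3 P4 by simp
qed

text \<open>The representer is the sum of the two centred functions, which are orthogonal in
  \<open>L\<^sup>2 (\<mu> \<otimes> \<nu>)\<close>; hence the variances add.\<close>

theorem efficiency_two_samples: "efficiency_bound2 \<kappa> \<mu> \<nu> limit_variance"
  unfolding efficiency_bound2_def
proof (intro exI conjI ballI)
  interpret m: prob_space \<mu> by (rule \<mu>)
  interpret n: prob_space \<nu> by (rule \<nu>)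
  interpret mn: pair_prob_space \<mu> \<nu> ..
  let ?G = "centered1 \<oplus>\<^sub>o centered2" and ?H = "{h \<oplus>\<^sub>o k |h k. h \<in> tangent_set \<mu> \<and> k \<in> tangent_set \<nu>}"
  have osum_m: "(h \<oplus>\<^sub>o l) \<in> borel_measurable (\<mu> \<Otimes>\<^sub>M \<nu>)" if "h \<in> tangent_set \<mu>" "l \<in> tangent_set \<nu>" for h l
  proof -
    have [measurable]: "h \<in> borel_measurable \<mu>" "l \<in> borel_measurable \<nu>"
      using that \<mu>(2) \<nu>(2) by (simp_all add: tangent_set_def cong: measurable_cong_sets)
    show ?thesis unfolding osum_def by measurable
  qed
  have G: "?G \<in> borel_measurable (\<mu> \<Otimes>\<^sub>M \<nu>)" by (rule osum_m[OF centered_tangent])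
  have Gb: "\<bar>?G z\<bar> \<le> 4 * B" for z
    using centered_bdd(1)[of "fst z"] centered_bdd(2)[of "snd z"] unfolding osum_def split_beta' abs_le_iff by linarith
  show "L2_continuous_linear (\<mu> \<Otimes>\<^sub>M \<nu>) (\<lambda>f. LINT z|(\<mu> \<Otimes>\<^sub>M \<nu>). ?G z * f z)"
    by (rule L2_continuous_linear_representer[OF mn.P.prob_space_axioms G Gb])
  have L2: "f \<in> L2_functions (\<mu> \<Otimes>\<^sub>M \<nu>)" if f: "f \<in> ?H" for f
  proof -
    obtain h l where hl: "f = h \<oplus>\<^sub>o l" "h \<in> tangent_set \<mu>" "l \<in> tangent_set \<nu>" using f by blast
    obtain b1 where b1: "\<And>x. \<bar>h x\<bar> \<le> b1" by (rule tangent_setD[OF hl(2)]) blast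
    obtain b2 where b2: "\<And>x. \<bar>l x\<bar> \<le> b2" by (rule tangent_setD[OF hl(3)]) blast
    have "\<bar>f z\<bar> \<le> b1 + b2" for z
      using b1[of "fst z"] b2[of "snd z"] unfolding hl(1) osum_def split_beta' by linarith
    then show ?thesis unfolding hl(1) by (intro bounded_in_L2[OF mn.P.prob_space_axioms osum_m[OF hl(2,3)]])
  qed
  have "?G \<in> ?H" using centered_tangent by blast
  from sup_quotient_representer[OF mn.P.prob_space_axioms G Gb this L2]
  have "sup_quotient (\<mu> \<Otimes>\<^sub>M \<nu>) (\<lambda>f. LINT z|(\<mu> \<Otimes>\<^sub>M \<nu>). ?G z * f z) ?H = (LINT z|(\<mu> \<Otimes>\<^sub>M \<nu>). (?G z)\<^sup>2)" by simp
  also have "\<dots> = limit_variance"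
    using integral_osum_mult[OF centered_tangent] centered_square by (simp add: power2_eq_square limit_variance_def)
  finally show "limit_variance = sup_quotient (\<mu> \<Otimes>\<^sub>M \<nu>) (\<lambda>f. LINT z|(\<mu> \<Otimes>\<^sub>M \<nu>). ?G z * f z) ?H" by simp
  fix h l assume hl: "h \<in> tangent_set \<mu>" "l \<in> tangent_set \<nu>"
  show "((\<lambda>t. (\<kappa> (tilt \<mu> h t) (tilt \<nu> l t) - \<kappa> \<mu> \<nu>) / t) \<longlongrightarrow> (LINT z|(\<mu> \<Otimes>\<^sub>M \<nu>). ?G z * (h \<oplus>\<^sub>o l) z)) (at_right 0)"
    using directional_derivative[OF hl] by (simp add: integral_osum_mult[OF hl] centered_mult hl)
qed

end

section \<open>The smoothed transport cost as a differentiable functional\<close>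

text \<open>A local form of continuity of a family of measures: bounded supports and small
  differences of integrals of Lipschitz functions. The family is indexed by a topological space so
  that empirical measures, as functions of the sample points, and constant families are covered
  alike.\<close>

definition controlled :: "('z \<Rightarrow> 'a::euclidean_space measure) \<Rightarrow> 'z \<Rightarrow> real \<Rightarrow> real \<Rightarrow> real \<Rightarrow> 'z \<Rightarrow> bool" where
  "controlled \<tau> z0 m L e z \<longleftrightarrow> prob_space (\<tau> z) \<and> sets (\<tau> z) = sets borel \<and> (AE x in \<tau> z. norm x \<le> m) \<and>
     (\<forall>f b. L-lipschitz_on UNIV f \<longrightarrow> (\<forall>x. \<bar>f x\<bar> \<le> b) \<longrightarrow> \<bar>(LINT x|\<tau> z. f x) - (LINT x|\<tau> z0. f x)\<bar> \<le> e)"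

definition weakly_stable :: "('z::topological_space \<Rightarrow> 'a::euclidean_space measure) \<Rightarrow> bool" where
  "weakly_stable \<tau> \<longleftrightarrow> (\<forall>z0. \<exists>m\<ge>0. \<forall>L\<ge>0. \<forall>e>0. eventually (controlled \<tau> z0 m L e) (nhds z0))"

lemma weakly_stable_const:
  assumes "prob_space \<rho>" "sets \<rho> = sets borel" "AE x in \<rho>. norm x \<le> m" "0 \<le> m"
  shows "weakly_stable (\<lambda>_. \<rho>)"
  unfolding weakly_stable_def by (intro allI exI[of _ m] conjI impI assms(4), rule always_eventually) (use assms in \<open>auto simp: controlled_def\<close>)

lemma weakly_stable_empirical:
  assumes n: "0 < n"
  shows "weakly_stable (\<lambda>x. empirical n x :: 'a::euclidean_space measure)"
  unfolding weakly_stable_def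
proof (intro allI exI[of _ "1 + (\<Sum>i<n. norm (x0 i))" for x0] conjI impI)
  fix x0 :: "nat \<Rightarrow> 'a"
  show "0 \<le> 1 + (\<Sum>i<n. norm (x0 i))" by (simp add: add_nonneg_nonneg sum_nonneg)
  fix L e :: real assume L: "0 \<le> L" and e: "0 < e"
  define d where "d = min 1 (e / (L + 1))"
  have d: "0 < d" "d \<le> 1" using L e by (auto simp: d_def)
  have "L * d \<le> L * (e / (L + 1))" using L by (intro mult_left_mono) (auto simp: d_def)
  also have "\<dots> \<le> e" using L e by (simp add: field_simps)
  finally have Ld: "L * d \<le> e" .
  have "eventually (\<lambda>x. \<forall>i\<in>{..<n}. dist (x i) (x0 i) < d) (nhds x0)"
  proof (rule eventually_ball_finite, simp, rule ballI)
    fix i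
    have "((\<lambda>x::nat \<Rightarrow> 'a. x i) \<longlongrightarrow> x0 i) (at x0)"
      using continuous_on_product_coordinates[of i] unfolding continuous_on_def by blast
    then have "((\<lambda>x. x i) \<longlongrightarrow> x0 i) (nhds x0)" by (rule tendsto_at_iff_tendsto_nhds[of "\<lambda>x. x i" x0, THEN iffD1])
    then show "eventually (\<lambda>x. dist (x i) (x0 i) < d) (nhds x0)" using d by (simp add: tendsto_iff)
  qed
  then show "eventually (controlled (empirical n) x0 (1 + (\<Sum>i<n. norm (x0 i))) L e) (nhds x0)"
  proof eventually_elim
    case (elim x)
    have "norm (x i) \<le> 1 + (\<Sum>i<n. norm (x0 i))" if i: "i < n" for i
    proof -
      have "norm (x i) \<le> norm (x0 i) + dist (x i) (x0 i)" using norm_triangle_ineq[of "x0 i" "x i - x0 i"] by (simp add: dist_norm)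
      moreover have "norm (x0 i) \<le> (\<Sum>i<n. norm (x0 i))" using i by (intro member_le_sum) auto
      ultimately show ?thesis using elim i d by force
    qed
    then have "AE z in empirical n x. z \<in> cball 0 (1 + (\<Sum>i<n. norm (x0 i)))" using n by (intro AE_empirical) auto
    moreover have "\<bar>(LINT z|empirical n x. f z) - (LINT z|empirical n x0. f z)\<bar> \<le> e" if f: "L-lipschitz_on UNIV f" for f :: "'a \<Rightarrow> real"
    proof -
      have "\<bar>(LINT z|empirical n x. f z) - (LINT z|empirical n x0. f z)\<bar> = \<bar>\<Sum>i<n. f (x i) - f (x0 i)\<bar> / real n"
        using lipschitz_measurable[OF f] by (simp add: integral_empirical sum_subtractf abs_divide diff_divide_distrib[symmetric])
      also have "\<dots> \<le> (\<Sum>i<n. e) / real n"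
      proof (intro divide_right_mono order_trans[OF sum_abs] sum_mono)
        fix i assume i: "i \<in> {..<n}"
        have "\<bar>f (x i) - f (x0 i)\<bar> \<le> L * dist (x i) (x0 i)" using lipschitz_onD[OF f, of "x i" "x0 i"] by (simp add: dist_real_def)
        also have "\<dots> \<le> L * d" using elim i L by (intro mult_left_mono) (auto intro: less_imp_le)
        finally show "\<bar>f (x i) - f (x0 i)\<bar> \<le> e" using Ld by simp
      qed simp
      finally show ?thesis using n by simp
    qed
    ultimately show ?case using n prob_space_empirical by (simp add: controlled_def)
  qed
qed

context smoothing begin

definition "cost p \<rho> \<tau> = transport_cost p (smooth \<rho>) (smooth \<tau>)"

lemma smooth_power_transport:
  assumes p: "1 < p" and m: "0 \<le> m + r"
    and \<rho>: "prob_space \<rho>" "sets \<rho> = sets borel" "AE x in \<rho>. norm x \<le> m"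
    and \<tau>: "prob_space \<tau>" "sets \<tau> = sets borel" "AE x in \<tau>. norm x \<le> m"
  shows "power_transport p (2 * (m + r)) (smooth \<rho>) (smooth \<tau>) (cball 0 (m + r)) (cball 0 (m + r))"
proof (rule power_transport.intro)
  show "norm (x - y) \<le> 2 * (m + r)" if "x \<in> cball 0 (m + r)" "y \<in> cball 0 (m + r)" for x y :: 'a
    using norm_triangle_ineq4[of x y] that by simp
  show "AE x in smooth \<rho>. x \<in> cball 0 (m + r)" by (rule smooth_concentrated_ball[OF \<rho>])
  show "AE x in smooth \<tau>. x \<in> cball 0 (m + r)" by (rule smooth_concentrated_ball[OF \<tau>])
qed (use p m smooth_prob[OF \<rho>(1,2)] smooth_prob[OF \<tau>(1,2)] in simp_all)

lemma cost_perturbation: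
  assumes p: "1 < p" and m: "0 \<le> m + r"
    and \<rho>: "prob_space \<rho>" "sets \<rho> = sets borel" "AE x in \<rho>. norm x \<le> m"
    and \<tau>: "prob_space \<tau>" "sets \<tau> = sets borel" "AE x in \<tau>. norm x \<le> m"
    and \<rho>': "prob_space \<rho>'" "sets \<rho>' = sets borel" "AE x in \<rho>'. norm x \<le> m"
    and \<tau>': "prob_space \<tau>'" "sets \<tau>' = sets borel" "AE x in \<tau>'. norm x \<le> m"
    and d1: "\<And>f b. (p * (2 * (m + r)) powr (p - 1))-lipschitz_on UNIV f \<Longrightarrow> (\<And>x. \<bar>f x\<bar> \<le> b) \<Longrightarrow> \<bar>(LINT x|\<rho>'. f x) - (LINT x|\<rho>. f x)\<bar> \<le> d1"
    and d2: "\<And>f b. (p * (2 * (m + r)) powr (p - 1))-lipschitz_on UNIV f \<Longrightarrow> (\<And>x. \<bar>f x\<bar> \<le> b) \<Longrightarrow> \<bar>(LINT x|\<tau>'. f x) - (LINT x|\<tau>. f x)\<bar> \<le> d2"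
  shows "\<bar>cost p \<rho>' \<tau>' - cost p \<rho> \<tau>\<bar> \<le> d1 + d2"
proof -
  interpret P: power_transport p "2 * (m + r)" "smooth \<rho>" "smooth \<tau>" "cball 0 (m + r)" "cball 0 (m + r)"
    by (rule smooth_power_transport[OF p m \<rho> \<tau>])
  have red: "\<bar>(LINT x|smooth a. f x) - (LINT x|smooth b. f x)\<bar> = \<bar>(LINT x|a. adj f x) - (LINT x|b. adj f x)\<bar>"
    if f: "(p * (2 * (m + r)) powr (p - 1))-lipschitz_on UNIV f" "\<And>x. \<bar>f x\<bar> \<le> c" and ab: "prob_space a" "sets a = sets borel" "prob_space b" "sets b = sets borel"
    for f :: "'a \<Rightarrow> real" and c a b
    using smooth_integral[OF ab(1,2) lipschitz_measurable[OF f(1)] f(2)] smooth_integral[OF ab(3,4) lipschitz_measurable[OF f(1)] f(2)] by simp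
  show ?thesis unfolding cost_def
  proof (rule P.transport_cost_lipschitz_perturbation[OF smooth_power_transport[OF p m \<rho>' \<tau>']])
    fix f :: "'a \<Rightarrow> real" and b assume f: "(p * (2 * (m + r)) powr (p - 1))-lipschitz_on UNIV f" "\<And>x. \<bar>f x\<bar> \<le> b"
    note a = adj_lipschitz[OF f] shifted_kernel(4)[OF lipschitz_measurable[OF f(1)] f(2)]
    show "\<bar>(LINT x|smooth \<rho>'. f x) - (LINT x|smooth \<rho>. f x)\<bar> \<le> d1" unfolding red[OF f \<rho>'(1,2) \<rho>(1,2)] by (rule d1[OF a])
    show "\<bar>(LINT x|smooth \<tau>'. f x) - (LINT x|smooth \<tau>. f x)\<bar> \<le> d2" unfolding red[OF f \<tau>'(1,2) \<tau>(1,2)] by (rule d2[OF a])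
  qed
qed

lemma cost_continuous:
  fixes \<rho> :: "'b::t2_space \<Rightarrow> 'a measure" and \<tau> :: "'c::t2_space \<Rightarrow> 'a measure"
  assumes p: "1 < p" and r: "0 \<le> r" and stab: "weakly_stable \<rho>" "weakly_stable \<tau>"
  shows "continuous_on UNIV (\<lambda>(x, y). cost p (\<rho> x) (\<tau> y))"
  unfolding continuous_on_eq_continuous_at[OF open_UNIV]
proof (intro ballI)
  fix z0 :: "'b \<times> 'c"
  obtain x0 y0 where z0: "z0 = (x0, y0)" by force
  obtain m1 where m1: "0 \<le> m1" "\<And>L e. 0 \<le> L \<Longrightarrow> 0 < e \<Longrightarrow> eventually (controlled \<rho> x0 m1 L e) (nhds x0)"
    using stab(1) unfolding weakly_stable_def by metis
  obtain m2 where m2: "0 \<le> m2" "\<And>L e. 0 \<le> L \<Longrightarrow> 0 < e \<Longrightarrow> eventually (controlled \<tau> y0 m2 L e) (nhds y0)"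
    using stab(2) unfolding weakly_stable_def by metis
  define m where "m = max m1 m2"
  define L where "L = p * (2 * (m + r)) powr (p - 1)"
  have m: "0 \<le> m + r" "m1 \<le> m" "m2 \<le> m" using m1(1) r by (auto simp: m_def)
  have L: "0 \<le> L" using p by (simp add: L_def)
  have "((\<lambda>(x, y). cost p (\<rho> x) (\<tau> y)) \<longlongrightarrow> cost p (\<rho> x0) (\<tau> y0)) (nhds (x0, y0))"
  proof (rule tendstoI)
    fix e :: real assume e: "0 < e"
    have ev: "eventually (controlled \<rho> x0 m1 L (e / 3)) (nhds x0)" "eventually (controlled \<tau> y0 m2 L (e / 3)) (nhds y0)"
      using m1(2) m2(2) L e by simp_all
    have at0: "controlled \<rho> x0 m1 L (e / 3) x0" "controlled \<tau> y0 m2 L (e / 3) y0"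
      using ev by (auto dest: eventually_nhds_x_imp_x)
    have "eventually (\<lambda>z. controlled \<rho> x0 m1 L (e / 3) (fst z)) (nhds (x0, y0))"
      by (rule eventually_compose_filterlim[OF ev(1)]) (simp add: nhds_prod filterlim_fst)
    moreover have "eventually (\<lambda>z. controlled \<tau> y0 m2 L (e / 3) (snd z)) (nhds (x0, y0))"
      by (rule eventually_compose_filterlim[OF ev(2)]) (simp add: nhds_prod filterlim_snd)
    ultimately show "eventually (\<lambda>z. dist (case z of (x, y) \<Rightarrow> cost p (\<rho> x) (\<tau> y)) (cost p (\<rho> x0) (\<tau> y0)) < e) (nhds (x0, y0))"
    proof eventually_elim
      case (elim z)
      have w: "AE x in \<sigma>. norm x \<le> m" if "AE x in \<sigma>. norm x \<le> m'" "m' \<le> m" for \<sigma> :: "'a measure" and m'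
        using that by (auto elim: eventually_mono)
      have "\<bar>cost p (\<rho> (fst z)) (\<tau> (snd z)) - cost p (\<rho> x0) (\<tau> y0)\<bar> \<le> e / 3 + e / 3"
      proof (rule cost_perturbation[OF p m(1)])
        show "AE x in \<rho> x0. norm x \<le> m" "AE x in \<rho> (fst z). norm x \<le> m" "AE x in \<tau> y0. norm x \<le> m" "AE x in \<tau> (snd z). norm x \<le> m"
          using at0 elim w m(2,3) unfolding controlled_def by blast+
        fix f :: "'a \<Rightarrow> real" and b
        assume f: "(p * (2 * (m + r)) powr (p - 1))-lipschitz_on UNIV f" "\<And>x. \<bar>f x\<bar> \<le> b"
        show "\<bar>(LINT x|\<rho> (fst z). f x) - (LINT x|\<rho> x0. f x)\<bar> \<le> e / 3" "\<bar>(LINT x|\<tau> (snd z). f x) - (LINT x|\<tau> y0. f x)\<bar> \<le> e / 3"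
          using elim f unfolding controlled_def L_def by blast+
      qed (use at0 elim in \<open>auto simp: controlled_def\<close>)
      then show ?case using e by (simp add: dist_real_def split_beta)
    qed
  qed
  then show "isCont (\<lambda>(x, y). cost p (\<rho> x) (\<tau> y)) z0"
    unfolding z0 isCont_def using tendsto_at_iff_tendsto_nhds[of "\<lambda>(x, y). cost p (\<rho> x) (\<tau> y)" "(x0, y0)"] by simp
qed

text \<open>The cost is continuous in the sample points, seen as infinite sequences with the
  product topology, whose Borel sets are the product sigma algebra. A finite sample is padded by
  zeros; the cost does not see the padding.\<close>

lemma cost_measurable:
  fixes \<rho> \<tau> :: "(nat \<Rightarrow> 'a) \<Rightarrow> 'a measure"
  assumes p: "1 < p" and r: "0 \<le> r" and stab: "weakly_stable \<rho>" "weakly_stable \<tau>"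
    and local: "\<And>x x'. (\<And>i. i < n \<Longrightarrow> x i = x' i) \<Longrightarrow> \<rho> x = \<rho> x'" "\<And>x x'. (\<And>i. i < n \<Longrightarrow> x i = x' i) \<Longrightarrow> \<tau> x = \<tau> x'"
  shows "(\<lambda>(x, y). cost p (\<rho> x) (\<tau> y)) \<in> borel_measurable (PiM {..<n} (\<lambda>_. borel) \<Otimes>\<^sub>M PiM {..<n} (\<lambda>_. borel))"
proof -
  define ext where "ext x = (\<lambda>i. if i < n then x i else 0)" for x :: "nat \<Rightarrow> 'a"
  have c: "(\<lambda>(x, y). cost p (\<rho> x) (\<tau> y)) \<in> borel_measurable (borel \<Otimes>\<^sub>M borel)"
    unfolding borel_prod by (rule borel_measurable_continuous_onI[OF cost_continuous[OF p r stab]])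
  have [measurable]: "ext \<in> measurable (PiM {..<n} (\<lambda>_. borel)) borel"
  proof -
    have "ext \<in> measurable (PiM {..<n} (\<lambda>_. borel)) (PiM UNIV (\<lambda>_. borel))"
      unfolding ext_def
    proof (rule measurable_PiM_single')
      show "(\<lambda>x. if i < n then x i else 0) \<in> borel_measurable (PiM {..<n} (\<lambda>_. borel))" for i
        by (cases "i < n") simp_all
    qed (auto simp: space_PiM)
    then show ?thesis using measurable_cong_sets[OF refl sets_PiM_equal_borel] by blast
  qed
  have "(\<lambda>z. (ext (fst z), ext (snd z))) \<in> measurable (PiM {..<n} (\<lambda>_. borel) \<Otimes>\<^sub>M PiM {..<n} (\<lambda>_. borel)) (borel \<Otimes>\<^sub>M borel)"
    by measurable
  note measurable_compose[OF this c]
  moreover have "\<rho> (ext x) = \<rho> x" "\<tau> (ext x) = \<tau> x" for x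
    by (rule local; simp add: ext_def)+
  ultimately show ?thesis by (simp add: split_beta')
qed

end

text \<open>The transport problem between two smoothed measures, with its optimal potentials. The
  supports of \<open>\<mu>\<close> and \<open>\<nu>\<close> lie in the ball of radius
  \<open>s\<close>, those of the smoothed measures in the ball of radius
  \<open>s + r\<close>.\<close>

locale smoothed_transport = smoothing +
  fixes p s :: real and \<mu> \<nu> :: "'a measure" and \<phi> :: "'a \<Rightarrow> ereal"
  assumes p: "1 < p" and r: "0 \<le> r" and s: "0 \<le> s"
    and \<mu>: "prob_space \<mu>" "sets \<mu> = sets borel" and \<nu>: "prob_space \<nu>" "sets \<nu> = sets borel"
    and supp_bdd: "\<And>x. x \<in> msupport \<mu> \<Longrightarrow> norm x \<le> s" "\<And>x. x \<in> msupport \<nu> \<Longrightarrow> norm x \<le> s"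
    and conn: "connected (interior (msupport (smooth \<mu>)))"
    and \<phi>: "OT_potential p (smooth \<mu>) (smooth \<nu>) \<phi>"
begin

abbreviation "A \<equiv> msupport (smooth \<mu>)"
abbreviation "B \<equiv> msupport (smooth \<nu>)"

lemma supports_subset: "A \<subseteq> cball 0 (s + r)" "B \<subseteq> cball 0 (s + r)"
proof -
  have ae: "AE x in \<mu>. norm x \<le> s" "AE x in \<nu>. norm x \<le> s"
    using AE_msupport[OF \<mu>(2)] AE_msupport[OF \<nu>(2)] supp_bdd by (auto elim: eventually_mono)
  show "A \<subseteq> cball 0 (s + r)" by (rule msupport_subset_closed[OF smooth_sets closed_cball smooth_concentrated_ball[OF \<mu> ae(1)]])
  show "B \<subseteq> cball 0 (s + r)" by (rule msupport_subset_closed[OF smooth_sets closed_cball smooth_concentrated_ball[OF \<nu> ae(2)]])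
qed

sublocale P: power_transport p "2 * (s + r)" "smooth \<mu>" "smooth \<nu>" A B
proof (rule power_transport.intro)
  show "norm (x - y) \<le> 2 * (s + r)" if "x \<in> A" "y \<in> B" for x y
  proof -
    have "norm x \<le> s + r" "norm y \<le> s + r" using that supports_subset by auto
    then show ?thesis using norm_triangle_ineq4[of x y] by simp
  qed
  have "compact (cball (0::'a) (s + r) \<inter> A)" "compact (cball (0::'a) (s + r) \<inter> B)"
    by (intro compact_Int_closed compact_cball closed_msupport)+
  then show "compact A" "compact B" using supports_subset by (simp_all add: Int_absorb1)
qed (use p r s smooth_prob[OF \<mu>] smooth_prob[OF \<nu>] in \<open>simp_all add: AE_msupport\<close>)

sublocale P: unique_transport p "2 * (s + r)" "smooth \<mu>" "smooth \<nu>" A B \<phi> "c_transform p \<phi>"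
  by unfold_locales (use conn msupport_smooth_regular[OF \<mu>] P.OT_potential_dual_optimal[OF \<phi>] in simp_all)

lemma potential_unique:
  assumes "OT_potential p (smooth \<mu>) (smooth \<nu>) \<psi>"
  shows "\<exists>c::real. \<forall>x\<in>interior A. \<psi> x = \<phi> x + ereal c"
proof -
  obtain c :: real where "\<And>x. x \<in> A \<Longrightarrow> \<psi> x = \<phi> x + ereal c"
    by (rule P.dual_optimal_unique[OF P.uv P.OT_potential_dual_optimal[OF assms] refl refl P.conn]) blast
  then show ?thesis using interior_subset by blast
qed

definition "g1 = adj P.fst_potential"
definition "g2 = adj P.snd_potential"

text \<open>The chain rule: smoothing maps \<open>tv\<close> to total variation, and its adjoint
  maps the potentials to the derivatives \<open>g1\<close> and \<open>g2\<close>.\<close>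

lemma cost_differentiable:
  assumes \<epsilon>: "0 < \<epsilon>"
  shows "\<exists>\<delta>>0. \<forall>\<rho> \<tau>. concentrated \<rho> \<mu> \<longrightarrow> concentrated \<tau> \<nu> \<longrightarrow> tv \<rho> \<mu> \<le> \<delta> \<longrightarrow> tv \<tau> \<nu> \<le> \<delta> \<longrightarrow>
        \<bar>cost p \<rho> \<tau> - cost p \<mu> \<nu> - ((LINT x|\<rho>. g1 x) - (LINT x|\<mu>. g1 x)) - ((LINT x|\<tau>. g2 x) - (LINT x|\<nu>. g2 x))\<bar> \<le> \<epsilon> * (tv \<rho> \<mu> + tv \<tau> \<nu>)"
proof -
  obtain \<delta> where \<delta>: "0 < \<delta>" and rem: "\<And>\<alpha>' \<beta>' \<delta>1 \<delta>2. P.admissible \<alpha>' \<beta>' \<Longrightarrow> variation_close \<delta>1 \<alpha>' (smooth \<mu>) \<Longrightarrow> variation_close \<delta>2 \<beta>' (smooth \<nu>) \<Longrightarrow>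
     \<delta>1 \<le> \<delta> \<Longrightarrow> \<delta>2 \<le> \<delta> \<Longrightarrow> \<bar>P.remainder \<alpha>' \<beta>'\<bar> \<le> \<epsilon> * (\<delta>1 + \<delta>2)"
    by (rule P.transport_cost_differentiable[OF \<epsilon>]) blast
  obtain K where K: "\<And>x. \<bar>P.fst_potential x\<bar> \<le> K" "\<And>y. \<bar>P.snd_potential y\<bar> \<le> K" by (rule P.potentials_bounded) blast
  have int: "(LINT z|smooth \<rho>. P.fst_potential z) = (LINT x|\<rho>. g1 x)" "(LINT z|smooth \<rho>. P.snd_potential z) = (LINT x|\<rho>. g2 x)"
    if "prob_space \<rho>" "sets \<rho> = sets borel" for \<rho>
    unfolding g1_def g2_def by (rule smooth_integral[OF that P.potentials_measurable(1) K(1)] smooth_integral[OF that P.potentials_measurable(2) K(2)])+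
  show ?thesis
  proof (intro exI[of _ \<delta>] conjI allI impI \<delta>)
    fix \<rho> \<tau> assume c: "concentrated \<rho> \<mu>" "concentrated \<tau> \<nu>" and t: "tv \<rho> \<mu> \<le> \<delta>" "tv \<tau> \<nu> \<le> \<delta>"
    have \<rho>: "prob_space \<rho>" "sets \<rho> = sets borel" "AE x in \<rho>. x \<in> msupport \<mu>"
      and \<tau>: "prob_space \<tau>" "sets \<tau> = sets borel" "AE x in \<tau>. x \<in> msupport \<nu>" using c by (auto simp: concentrated_def)
    have "P.admissible (smooth \<rho>) (smooth \<tau>)"
      unfolding P.admissible_def using smooth_prob[OF \<rho>(1,2)] smooth_prob[OF \<tau>(1,2)]
        smooth_concentrated[OF \<mu> \<rho>] smooth_concentrated[OF \<nu> \<tau>] by simp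
    from rem[OF this variation_close_smooth[OF \<rho>(1,2) \<mu>] variation_close_smooth[OF \<tau>(1,2) \<nu>] t]
    show "\<bar>cost p \<rho> \<tau> - cost p \<mu> \<nu> - ((LINT x|\<rho>. g1 x) - (LINT x|\<mu>. g1 x)) - ((LINT x|\<tau>. g2 x) - (LINT x|\<nu>. g2 x))\<bar> \<le> \<epsilon> * (tv \<rho> \<mu> + tv \<tau> \<nu>)"
      unfolding P.remainder_def P.potentials_value[folded cost_def] int[OF \<rho>(1,2)] int[OF \<tau>(1,2)] int[OF \<mu>] int[OF \<nu>] cost_def
      by (simp add: algebra_simps)
  qed
qed

text \<open>The same cost seen as a functional of both measures and of the first one only. In the
  second case the derivative in the second argument is \<open>0\<close>, and the expansion is the
  two-sample one at \<open>\<tau> = \<nu>\<close>.\<close>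

lemma cost_functionals:
  obtains C where "smooth_functional k M r (cost p) \<mu> \<nu> g1 g2 s C"
    "smooth_functional k M r (\<lambda>\<rho> \<tau>. cost p \<rho> \<nu>) \<mu> \<nu> g1 (\<lambda>_. 0) s C"
proof -
  obtain K where K0: "0 \<le> K" and K: "\<And>x. \<bar>P.fst_potential x\<bar> \<le> K" "\<And>y. \<bar>P.snd_potential y\<bar> \<le> K" by (rule P.potentials_bounded) blast
  have bdd: "\<bar>g1 x\<bar> \<le> K" "\<bar>g2 x\<bar> \<le> K" for x
    unfolding g1_def g2_def by (rule shifted_kernel(4)[OF P.potentials_measurable(1) K(1)] shifted_kernel(4)[OF P.potentials_measurable(2) K(2)])+
  have meas: "g1 \<in> borel_measurable borel" "g2 \<in> borel_measurable borel" unfolding g1_def g2_def by measurable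
  have \<nu>s: "AE x in \<nu>. norm x \<le> s" using AE_msupport[OF \<nu>(2)] supp_bdd by (auto elim: eventually_mono)
  have tv0: "tv \<nu> \<nu> = 0" by (simp add: tv_def)
  have m2: "(\<lambda>(x, y). cost p (empirical n x) (empirical n y)) \<in> borel_measurable (PiM {..<n} (\<lambda>_. borel) \<Otimes>\<^sub>M PiM {..<n} (\<lambda>_. borel))" if "0 < n" for n
    by (rule cost_measurable[OF p r weakly_stable_empirical[OF that] weakly_stable_empirical[OF that]]; rule empirical_cong)
  have m1: "(\<lambda>(x, y::nat \<Rightarrow> 'a). cost p (empirical n x) \<nu>) \<in> borel_measurable (PiM {..<n} (\<lambda>_. borel) \<Otimes>\<^sub>M PiM {..<n} (\<lambda>_. borel))" if "0 < n" for n
  proof (rule cost_measurable[where \<tau>="\<lambda>_. \<nu>", OF p r weakly_stable_empirical[OF that] weakly_stable_const[OF \<nu> \<nu>s s]])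
    show "empirical n x = empirical n x'" if "\<And>i. i < n \<Longrightarrow> x i = x' i" for x x' :: "nat \<Rightarrow> 'a"
      using that by (rule empirical_cong)
  qed (rule refl)
  have d1: "\<exists>\<delta>>0. \<forall>\<rho> \<tau>. concentrated \<rho> \<mu> \<longrightarrow> concentrated \<tau> \<nu> \<longrightarrow> tv \<rho> \<mu> \<le> \<delta> \<longrightarrow> tv \<tau> \<nu> \<le> \<delta> \<longrightarrow>
        \<bar>cost p \<rho> \<nu> - cost p \<mu> \<nu> - ((LINT x|\<rho>. g1 x) - (LINT x|\<mu>. g1 x)) - ((LINT x|\<tau>. 0) - (LINT x|\<nu>. 0))\<bar> \<le> \<epsilon> * (tv \<rho> \<mu> + tv \<tau> \<nu>)"
    if \<epsilon>: "0 < \<epsilon>" for \<epsilon>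
  proof -
    obtain \<delta> where \<delta>: "0 < \<delta>" and D: "\<And>\<rho> \<tau>. concentrated \<rho> \<mu> \<Longrightarrow> concentrated \<tau> \<nu> \<Longrightarrow> tv \<rho> \<mu> \<le> \<delta> \<Longrightarrow> tv \<tau> \<nu> \<le> \<delta> \<Longrightarrow>
        \<bar>cost p \<rho> \<tau> - cost p \<mu> \<nu> - ((LINT x|\<rho>. g1 x) - (LINT x|\<mu>. g1 x)) - ((LINT x|\<tau>. g2 x) - (LINT x|\<nu>. g2 x))\<bar> \<le> \<epsilon> * (tv \<rho> \<mu> + tv \<tau> \<nu>)"
      using cost_differentiable[OF \<epsilon>] by blast
    show ?thesis
    proof (intro exI[of _ \<delta>] conjI allI impI \<delta>)
      fix \<rho> \<tau> assume "concentrated \<rho> \<mu>" "tv \<rho> \<mu> \<le> \<delta>"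
      then have "\<bar>cost p \<rho> \<nu> - cost p \<mu> \<nu> - ((LINT x|\<rho>. g1 x) - (LINT x|\<mu>. g1 x))\<bar> \<le> \<epsilon> * tv \<rho> \<mu>"
        using D[OF _ concentrated_refl[OF \<nu>], of \<rho>] tv0 \<delta> by simp
      also have "\<dots> \<le> \<epsilon> * (tv \<rho> \<mu> + tv \<tau> \<nu>)" using \<epsilon> tv_nonneg by (intro mult_left_mono) auto
      finally show "\<bar>cost p \<rho> \<nu> - cost p \<mu> \<nu> - ((LINT x|\<rho>. g1 x) - (LINT x|\<mu>. g1 x)) - ((LINT x|\<tau>. 0) - (LINT x|\<nu>. 0))\<bar> \<le> \<epsilon> * (tv \<rho> \<mu> + tv \<tau> \<nu>)" by simp
    qed
  qed
  show thesis
  proof (rule that[of K])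
    show "smooth_functional k M r (cost p) \<mu> \<nu> g1 g2 s K"
      by (intro smooth_functional.intro smooth_functional_axioms.intro smoothing_axioms \<mu> \<nu> supp_bdd meas bdd cost_differentiable m2)
    show "smooth_functional k M r (\<lambda>\<rho> \<tau>. cost p \<rho> \<nu>) \<mu> \<nu> g1 (\<lambda>_. 0) s K"
      by (intro smooth_functional.intro smooth_functional_axioms.intro smoothing_axioms \<mu> \<nu> supp_bdd meas(1) bdd(1) d1 m1) (use K0 in simp_all)
  qed
qed

text \<open>The potentials agree with their truncated real versions on the supports, which is all
  that the adjoint of smoothing sees at points of the supports of \<open>\<mu>\<close> and
  \<open>\<nu>\<close>.\<close>

lemma potential_variances:
  shows "(LINT x|\<mu>. (adj (\<lambda>y. real_of_ereal (\<phi> y)) x - (LINT z|\<mu>. adj (\<lambda>y. real_of_ereal (\<phi> y)) z))\<^sup>2) = var \<mu> g1"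
    and "(LINT x|\<nu>. (adj (\<lambda>y. real_of_ereal (c_transform p \<phi> y)) x - (LINT z|\<nu>. adj (\<lambda>y. real_of_ereal (c_transform p \<phi> y)) z))\<^sup>2) = var \<nu> g2"
proof -
  have meas: "g1 \<in> borel_measurable borel" "g2 \<in> borel_measurable borel" unfolding g1_def g2_def by measurable
  have [measurable]: "\<phi> \<in> borel_measurable borel" "c_transform p \<phi> \<in> borel_measurable borel"
    using P.uv upper_semicontinuous_measurable by (auto simp: P.dual_optimal_def)
  have m: "adj (\<lambda>y. real_of_ereal (\<phi> y)) \<in> borel_measurable borel" "adj (\<lambda>y. real_of_ereal (c_transform p \<phi> y)) \<in> borel_measurable borel"
    by measurable
  have gen: "(LINT x|\<rho>. (f x - (LINT z|\<rho>. f z))\<^sup>2) = var \<rho> g"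
    if ae: "AE x in \<rho>. f x = g x" and b: "f \<in> borel_measurable borel" "g \<in> borel_measurable borel" and \<rho>: "sets \<rho> = sets borel" for \<rho> :: "'a measure" and f g
  proof -
    have [measurable]: "f \<in> borel_measurable \<rho>" "g \<in> borel_measurable \<rho>" using b \<rho> by (simp_all cong: measurable_cong_sets)
    have "(LINT z|\<rho>. f z) = (LINT z|\<rho>. g z)" by (rule integral_cong_AE) (use ae in auto)
    then show ?thesis unfolding var_def by (intro integral_cong_AE) (use ae in \<open>auto elim: eventually_mono\<close>)
  qed
  have e1: "adj (\<lambda>y. real_of_ereal (\<phi> y)) x = g1 x" if "x \<in> msupport \<mu>" for x
    unfolding g1_def by (rule adj_msupport_cong[OF \<mu> that]) (simp add: P.fst_potential_def)
  have e2: "adj (\<lambda>y. real_of_ereal (c_transform p \<phi> y)) x = g2 x" if "x \<in> msupport \<nu>" for x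
    unfolding g2_def by (rule adj_msupport_cong[OF \<nu> that]) (simp add: P.snd_potential_def)
  show "(LINT x|\<mu>. (adj (\<lambda>y. real_of_ereal (\<phi> y)) x - (LINT z|\<mu>. adj (\<lambda>y. real_of_ereal (\<phi> y)) z))\<^sup>2) = var \<mu> g1"
    by (rule gen[OF _ m(1) meas(1) \<mu>(2)]) (use AE_msupport[OF \<mu>(2)] e1 in \<open>auto elim: eventually_mono\<close>)
  show "(LINT x|\<nu>. (adj (\<lambda>y. real_of_ereal (c_transform p \<phi> y)) x - (LINT z|\<nu>. adj (\<lambda>y. real_of_ereal (c_transform p \<phi> y)) z))\<^sup>2) = var \<nu> g2"
    by (rule gen[OF _ m(2) meas(2) \<nu>(2)]) (use AE_msupport[OF \<nu>(2)] e2 in \<open>auto elim: eventually_mono\<close>)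
qed

end

section \<open>Limit theorems for the smoothed transport cost\<close>

lemma smoothing_scaled_kernel:
  fixes K :: "'a::ordered_euclidean_space \<Rightarrow> real"
  assumes \<sigma>: "0 < \<sigma>" and K: "smoothing_kernel K" and supp: "\<forall>x. x \<notin> ball 0 \<sigma> \<longrightarrow> scaled_kernel K \<sigma> x = 0"
  obtains M where "smoothing (scaled_kernel K \<sigma>) M \<sigma>"
proof -
  have K0: "\<And>x. 0 \<le> K x" and Kint: "(LINT x|lborel. K x) = 1" and KC: "C_infinity K" using K by (auto simp: smoothing_kernel_def)
  have "C_k 0 K" using KC by (simp add: C_infinity_def del: C_k.simps)
  then have "continuous_on UNIV K" by simp
  then have cont: "continuous_on UNIV (scaled_kernel K \<sigma>)"
    unfolding scaled_kernel_def[abs_def] divide_inverse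
    by (intro continuous_on_mult_right continuous_on_compose2[of UNIV K UNIV "\<lambda>x. x /\<^sub>R \<sigma>"] continuous_on_scaleR continuous_on_const continuous_on_id) simp_all
  have "bounded (scaled_kernel K \<sigma> ` cball 0 \<sigma>)"
    by (intro compact_imp_bounded compact_continuous_image continuous_on_subset[OF cont]) auto
  then obtain M where M: "\<forall>z\<in>scaled_kernel K \<sigma> ` cball 0 \<sigma>. norm z \<le> M" unfolding bounded_iff ..
  have nonneg: "0 \<le> scaled_kernel K \<sigma> x" for x using K0 \<sigma> by (simp add: scaled_kernel_def)
  have le: "scaled_kernel K \<sigma> x \<le> M" for x
  proof (cases "x \<in> ball 0 \<sigma>")
    case True
    then have "norm (scaled_kernel K \<sigma> x) \<le> M" by (intro bspec[OF M] imageI) simp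
    then show ?thesis by simp
  next
    case False
    have "norm (scaled_kernel K \<sigma> 0) \<le> M" using \<sigma> by (intro bspec[OF M] imageI) simp
    then have "0 \<le> M" using norm_ge_zero order_trans by blast
    then show ?thesis using False supp by simp
  qed
  have int1: "(LINT x|lborel. scaled_kernel K \<sigma> x) = 1"
  proof -
    have Km [measurable]: "scaled_kernel K \<sigma> \<in> borel_measurable borel" using cont by (rule borel_measurable_continuous_onI)
    have "(LINT x|lborel. scaled_kernel K \<sigma> x) =
        (LINT x|density (distr lborel borel (\<lambda>x. 0 + \<sigma> *\<^sub>R x)) (\<lambda>_. ennreal (\<bar>\<sigma>\<bar> ^ DIM('a))). scaled_kernel K \<sigma> x)"
      using lborel_affine[of \<sigma> "0::'a"] \<sigma> by simp
    also have "\<dots> = (LINT x|lborel. \<bar>\<sigma>\<bar> ^ DIM('a) * scaled_kernel K \<sigma> (\<sigma> *\<^sub>R x))"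
      by (subst integral_density) (simp_all add: integral_distr)
    also have "\<dots> = (LINT x|lborel. K x)"
      using \<sigma> by (intro Bochner_Integration.integral_cong refl) (simp add: scaled_kernel_def)
    finally show ?thesis using Kint by simp
  qed
  show thesis
    by (rule that[of M], rule smoothing.intro) (use cont nonneg le supp int1 in auto)
qed

text \<open>A statistic that ignores the second sample: integrate that sample out.\<close>

lemma bootstrap_cdf_eq:
  assumes n: "0 < n" and m: "(\<lambda>x. \<kappa> (empirical n x)) \<in> borel_measurable (PiM {..<n} (\<lambda>_. borel))"
  shows "bootstrap_cdf \<kappa> n x t = bootstrap_cdf2 (\<lambda>\<rho> \<tau>. \<kappa> \<rho>) n x y t"
proof -
  let ?P = "PiM {..<n} (\<lambda>_. empirical n x)" and ?Q = "PiM {..<n} (\<lambda>_. empirical n y)"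
  interpret P: prob_space ?P by (intro prob_space_PiM prob_space_empirical n)
  interpret Q: prob_space ?Q by (intro prob_space_PiM prob_space_empirical n)
  interpret PQ: pair_prob_space ?P ?Q ..
  define E where "E = {xB \<in> space ?P. sqrt (real n) * (\<kappa> (empirical n xB) - \<kappa> (empirical n x)) \<le> t}"
  have "sets ?P = sets (PiM {..<n} (\<lambda>_. borel))" by (intro sets_PiM_cong) auto
  from measurable_cong_sets[OF this refl] have [measurable]: "(\<lambda>x. \<kappa> (empirical n x)) \<in> borel_measurable ?P" using m by blast
  have E: "E \<in> sets ?P" unfolding E_def by measurable
  have "{(xB, yB) \<in> space (?P \<Otimes>\<^sub>M ?Q). sqrt (real n) * (\<kappa> (empirical n xB) - \<kappa> (empirical n x)) \<le> t} = E \<times> space ?Q"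
    by (auto simp: E_def space_pair_measure)
  moreover have "measure (?P \<Otimes>\<^sub>M ?Q) (E \<times> space ?Q) = measure ?P E"
    using Q.emeasure_pair_measure_Times[OF E sets.top] by (simp add: measure_def Q.emeasure_space_1)
  ultimately show ?thesis by (simp add: bootstrap_cdf_def bootstrap_cdf2_def Let_def E_def)
qed

lemma converges_in_probability_cong:
  assumes "converges_in_probability \<Omega> Z c" "\<And>n. 0 < n \<Longrightarrow> Z' n = Z n" "Z' 0 \<in> borel_measurable \<Omega>"
  shows "converges_in_probability \<Omega> Z' c"
  unfolding converges_in_probability_def
proof (intro conjI allI impI)
  show "Z' n \<in> borel_measurable \<Omega>" for n
    using assms by (cases "n = 0") (auto simp: converges_in_probability_def)
  fix e :: real assume "0 < e"
  then have "(\<lambda>n. measure \<Omega> {\<omega> \<in> space \<Omega>. \<bar>Z n \<omega> - c\<bar> > e}) \<longlonglongrightarrow> 0"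
    using assms(1) by (simp add: converges_in_probability_def)
  then show "(\<lambda>n. measure \<Omega> {\<omega> \<in> space \<Omega>. \<bar>Z' n \<omega> - c\<bar> > e}) \<longlonglongrightarrow> 0"
    by (rule Lim_transform_eventually) (rule eventually_mono[OF eventually_gt_at_top[of 0]], simp add: assms(2))
qed

text \<open>It remains to instantiate: the scaled kernel is a smoothing kernel in the sense of the
  locale, the smoothed cost is \<open>cost p\<close>, and both functionals from
  \<open>cost_functionals\<close> are sampled along the same data.\<close>

theorem theorem4:
  fixes K :: "real^'d \<Rightarrow> real" and \<sigma> p :: real and \<X> :: "(real^'d) set"
    and \<mu> \<nu> :: "(real^'d) measure" and \<phi> :: "real^'d \<Rightarrow> ereal"
    and \<Omega> :: "'w measure" and X Y :: "nat \<Rightarrow> 'w \<Rightarrow> real^'d"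
  assumes p: "1 < p" and \<sigma>: "0 < \<sigma>"
    and K: "smoothing_kernel K" "\<forall>x. x \<notin> ball 0 \<sigma> \<longrightarrow> scaled_kernel K \<sigma> x = 0"
    and \<X>: "compact \<X>" and \<mu>: "\<mu> \<in> prob_measures_on \<X>" and \<nu>: "\<nu> \<in> prob_measures_on \<X>"
    and conn: "connected (interior (msupport (\<mu> \<star> kernel_measure K \<sigma>)))"
    and \<phi>: "OT_potential p (\<mu> \<star> kernel_measure K \<sigma>) (\<nu> \<star> kernel_measure K \<sigma>) \<phi>"
    and \<Omega>: "prob_space \<Omega>"
    and indep: "prob_space.indep_vars \<Omega> (\<lambda>_. borel) (case_sum X Y) UNIV"
    and X: "\<forall>i. distr \<Omega> borel (X i) = \<mu>" and Y: "\<forall>i. distr \<Omega> borel (Y i) = \<nu>"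
  shows
    "let S = smooth_cost K \<sigma> p;
         v = smoothed_variance K \<sigma> \<mu> \<phi>;
         w = smoothed_variance K \<sigma> \<nu> (c_transform p \<phi>);
         \<mu>h = (\<lambda>n \<omega>. empirical n (\<lambda>i. X i \<omega>));
         \<nu>h = (\<lambda>n \<omega>. empirical n (\<lambda>i. Y i \<omega>))
     in
       (\<forall>\<psi>. OT_potential p (\<mu> \<star> kernel_measure K \<sigma>) (\<nu> \<star> kernel_measure K \<sigma>) \<psi> \<longrightarrow>
          (\<exists>c::real. \<forall>x\<in>interior (msupport (\<mu> \<star> kernel_measure K \<sigma>)). \<psi> x = \<phi> x + ereal c)) \<and>
       (converges_in_distribution \<Omega> (\<lambda>n \<omega>. sqrt (real n) * (S (\<mu>h n \<omega>) \<nu> - S \<mu> \<nu>)) (centered_normal v) \<and>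
        efficiency_bound (\<lambda>\<rho>. S \<rho> \<nu>) \<mu> v \<and>
        (0 < v \<longrightarrow>
          converges_in_probability \<Omega>
            (\<lambda>n \<omega>. SUP t. \<bar>bootstrap_cdf (\<lambda>\<rho>. S \<rho> \<nu>) n (\<lambda>i. X i \<omega>) t - cdf (centered_normal v) t\<bar>) 0)) \<and>
       (connected (msupport (\<nu> \<star> kernel_measure K \<sigma>)) \<longrightarrow>
          converges_in_distribution \<Omega>
            (\<lambda>n \<omega>. sqrt (real n) * (S (\<mu>h n \<omega>) (\<nu>h n \<omega>) - S \<mu> \<nu>)) (centered_normal (v + w)) \<and>
          efficiency_bound2 S \<mu> \<nu> (v + w) \<and>
          (0 < v + w \<longrightarrow>
            converges_in_probability \<Omega>
              (\<lambda>n \<omega>. SUP t. \<bar>bootstrap_cdf2 S n (\<lambda>i. X i \<omega>) (\<lambda>i. Y i \<omega>) t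
                              - cdf (centered_normal (v + w)) t\<bar>) 0))"
proof -
  obtain M where "smoothing (scaled_kernel K \<sigma>) M \<sigma>" by (rule smoothing_scaled_kernel[OF \<sigma> K])
  then interpret smoothing "scaled_kernel K \<sigma>" M \<sigma> .
  have smooth_eq: "\<rho> \<star> kernel_measure K \<sigma> = smooth \<rho>" for \<rho> by (simp add: smooth_def \<eta>_def kernel_measure_def)
  have S_eq: "smooth_cost K \<sigma> p = cost p"
    by (simp add: fun_eq_iff smooth_cost_def smooth_wasserstein_def cost_def transport_cost_def smooth_eq)
  have \<mu>': "prob_space \<mu>" "sets \<mu> = sets borel" "msupport \<mu> \<subseteq> \<X>" and \<nu>': "prob_space \<nu>" "sets \<nu> = sets borel" "msupport \<nu> \<subseteq> \<X>"
    using \<mu> \<nu> by (auto simp: prob_measures_on_def)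
  obtain s where s: "0 < s" "\<forall>x\<in>\<X>. norm x \<le> s"
    using compact_imp_bounded[OF \<X>] unfolding bounded_pos by (elim exE conjE)
  interpret T: smoothed_transport "scaled_kernel K \<sigma>" M \<sigma> p s \<mu> \<nu> \<phi>
  proof (intro smoothed_transport.intro smoothed_transport_axioms.intro smoothing_axioms)
    show "norm x \<le> s" if "x \<in> msupport \<mu>" for x using that \<mu>'(3) s(2) by blast
    show "norm x \<le> s" if "x \<in> msupport \<nu>" for x using that \<nu>'(3) s(2) by blast
  qed (use p \<sigma> s(1) \<mu>'(1,2) \<nu>'(1,2) conn \<phi> in \<open>simp_all add: smooth_eq\<close>)
  obtain C where C: "smooth_functional (scaled_kernel K \<sigma>) M \<sigma> (cost p) \<mu> \<nu> T.g1 T.g2 s C"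
    "smooth_functional (scaled_kernel K \<sigma>) M \<sigma> (\<lambda>\<rho> \<tau>. cost p \<rho> \<nu>) \<mu> \<nu> T.g1 (\<lambda>_. 0) s C"
    by (rule T.cost_functionals)
  have samp: "sampled_functional_axioms \<mu> \<nu> \<Omega> X Y"
    using indep X Y by (simp add: sampled_functional_axioms_def)
  interpret S2: sampled_functional "scaled_kernel K \<sigma>" M \<sigma> "cost p" \<mu> \<nu> T.g1 T.g2 s C \<Omega> X Y
    by (intro sampled_functional.intro C \<Omega> samp)
  interpret S1: sampled_functional "scaled_kernel K \<sigma>" M \<sigma> "\<lambda>\<rho> \<tau>. cost p \<rho> \<nu>" \<mu> \<nu> T.g1 "\<lambda>_. 0" s C \<Omega> X Y
    by (intro sampled_functional.intro C \<Omega> samp)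
  have conv: "fun_convolution f (reflect (scaled_kernel K \<sigma>)) = adj f" for f
    by (simp add: fun_eq_iff fun_convolution_def reflect_def adj_def)
  have v: "smoothed_variance K \<sigma> \<mu> \<phi> = var \<mu> T.g1" and w: "smoothed_variance K \<sigma> \<nu> (c_transform p \<phi>) = var \<nu> T.g2"
    using T.potential_variances by (simp_all add: smoothed_variance_def conv)
  have var1: "S1.limit_variance = var \<mu> T.g1" by (simp add: S1.limit_variance_def) (simp add: var_def)
  have var2: "S2.limit_variance = var \<mu> T.g1 + var \<nu> T.g2" by (simp add: S2.limit_variance_def)
  have boot1: "converges_in_probability \<Omega>
      (\<lambda>n \<omega>. SUP t. \<bar>bootstrap_cdf (\<lambda>\<rho>. cost p \<rho> \<nu>) n (\<lambda>i. X i \<omega>) t - cdf (centered_normal (var \<mu> T.g1)) t\<bar>) 0"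
    if pos: "0 < var \<mu> T.g1"
  proof (rule converges_in_probability_cong[OF S1.bootstrap_consistent[unfolded var1, OF pos]])
    fix n :: nat assume n: "0 < n"
    have "(\<lambda>x. (x, \<lambda>i\<in>{..<n}. 0)) \<in> measurable (PiM {..<n} (\<lambda>_. borel)) (PiM {..<n} (\<lambda>_. borel) \<Otimes>\<^sub>M PiM {..<n} (\<lambda>_. borel))"
      by (intro measurable_Pair measurable_ident measurable_const) (auto simp: space_PiM)
    from measurable_compose[OF this S1.\<kappa>_measurable[OF n]]
    have "(\<lambda>x. cost p (empirical n x) \<nu>) \<in> borel_measurable (PiM {..<n} (\<lambda>_. borel))" by simp
    note eq = bootstrap_cdf_eq[OF n this]
    show "(\<lambda>\<omega>. SUP t. \<bar>bootstrap_cdf (\<lambda>\<rho>. cost p \<rho> \<nu>) n (\<lambda>i. X i \<omega>) t - cdf (centered_normal (var \<mu> T.g1)) t\<bar>) =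
        (\<lambda>\<omega>. S1.bootstrap_error n (\<lambda>i. X i \<omega>) (\<lambda>i. Y i \<omega>))"
      unfolding S1.bootstrap_error_def var1 proof
      fix \<omega>
      show "(SUP t. \<bar>bootstrap_cdf (\<lambda>\<rho>. cost p \<rho> \<nu>) n (\<lambda>i. X i \<omega>) t - cdf (centered_normal (var \<mu> T.g1)) t\<bar>) =
        (SUP t. \<bar>bootstrap_cdf2 (\<lambda>\<rho> \<tau>. cost p \<rho> \<nu>) n (\<lambda>i. X i \<omega>) (\<lambda>i. Y i \<omega>) t - cdf (centered_normal (var \<mu> T.g1)) t\<bar>)"
        by (subst eq[where y="\<lambda>i. Y i \<omega>"]) (rule refl)
    qed
  next
    have e: "empirical 0 x = empirical 0 (\<lambda>_. 0)" for x :: "nat \<Rightarrow> real^'d" by (rule empirical_cong) simp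
    have b: "bootstrap_cdf (\<lambda>\<rho>. cost p \<rho> \<nu>) 0 x t = bootstrap_cdf (\<lambda>\<rho>. cost p \<rho> \<nu>) 0 (\<lambda>_. 0) t" for x t
      unfolding bootstrap_cdf_def by (simp only: e[of x])
    have "(\<lambda>\<omega>. SUP t. \<bar>bootstrap_cdf (\<lambda>\<rho>. cost p \<rho> \<nu>) 0 (\<lambda>i. X i \<omega>) t - cdf (centered_normal (var \<mu> T.g1)) t\<bar>) =
        (\<lambda>\<omega>. SUP t. \<bar>bootstrap_cdf (\<lambda>\<rho>. cost p \<rho> \<nu>) 0 (\<lambda>_. 0) t - cdf (centered_normal (var \<mu> T.g1)) t\<bar>)"
      by (rule ext, subst b, rule refl)
    then show "(\<lambda>\<omega>. SUP t. \<bar>bootstrap_cdf (\<lambda>\<rho>. cost p \<rho> \<nu>) 0 (\<lambda>i. X i \<omega>) t - cdf (centered_normal (var \<mu> T.g1)) t\<bar>) \<in> borel_measurable \<Omega>"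
      by simp
  qed
  have clt1: "converges_in_distribution \<Omega> (\<lambda>n \<omega>. sqrt (real n) * (cost p (empirical n (\<lambda>i. X i \<omega>)) \<nu> - cost p \<mu> \<nu>)) (centered_normal (var \<mu> T.g1))"
    using S1.central_limit unfolding var1 S1.error_def[abs_def] .
  have clt2: "converges_in_distribution \<Omega> (\<lambda>n \<omega>. sqrt (real n) * (cost p (empirical n (\<lambda>i. X i \<omega>)) (empirical n (\<lambda>i. Y i \<omega>)) - cost p \<mu> \<nu>))
      (centered_normal (var \<mu> T.g1 + var \<nu> T.g2))"
    using S2.central_limit unfolding var2 S2.error_def[abs_def] .
  have boot2: "converges_in_probability \<Omega> (\<lambda>n \<omega>. SUP t. \<bar>bootstrap_cdf2 (cost p) n (\<lambda>i. X i \<omega>) (\<lambda>i. Y i \<omega>) t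
      - cdf (centered_normal (var \<mu> T.g1 + var \<nu> T.g2)) t\<bar>) 0" if "0 < var \<mu> T.g1 + var \<nu> T.g2"
    using S2.bootstrap_consistent that unfolding var2 S2.bootstrap_error_def .
  show ?thesis
    unfolding Let_def v w S_eq smooth_eq
    by (intro conjI impI allI clt1 clt2 boot1 boot2 T.potential_unique S2.efficiency_one_sample S2.efficiency_two_samples[unfolded var2])
qed

end
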